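(* Suppose the preference $\succsim$ on $\Delta(X)$ has an SMEU representation. Then: (a) $\succsim$ has a FATE representation if and only if $i\rightharpoonup j$ for all $i,j\in I$. (b) $\succsim$ has a FETA representation if and only if, for all $i,j\in I$, $i\rightharpoonup j\iff i=j$. (c) $\succsim$ has a recursive representation if and only if $\rightharpoonup$ is a linear order on $I$ (complete, transitive, and antisymmetric).
   Context: **Setup.** $N>1$ is an integer and $I=\{1,\dots,N\}$. For each $i\in I$, $X_i=[\underline x_i,\overline x_i]\subseteq\mathbb R$ is a nondegenerate compact interval. For $A\subseteq I$: $X_A=\prod_{i\in A}X_i$, $X=X_I$, $A^{\mathsf c}=I\setminus A$; $X_\emptyset$ is trivial and arguments in it are ignored. $\Delta(Z)$ is the set of finitely supported probability measures on $Z$; $\delta_x$ is the point mass at $x$, identified with $x$. $p_A$ is the marginal of $p$ on the coordinates in $A$, $x_A$ the restriction of $x$ to $A$; $p_{A|x}$ is the conditional distribution of the coordinates in $A$ given that the coordinates in $B$ (disjoint from $A$) equal $x\in X_B$ ($p_{A|x}=p_A$ if $B=\emptyset$), and $\mathbb E^p_{A|x}$ is expectation under $p_{A|x}$. For disjoint index sets, $(p_1,\dots,p_n)$ is the product measure. Vectors are ordered coordinatewise; $g$ is strictly increasing if $y\geqslant y'$, $y\ne y'$ imply $g(y)>g(y')$. $\succsim$ is a binary relation on $\Delta(X)$. For nonempty $A\subseteq I$ and $x\in X_{A^{\mathsf c}}$, the conditional preference $\succsim_x$ on $\Delta(X_A)$ is: $p\succsim_x q\iff(p,x)\succsim(q,x)$.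 **RCT.** A rooted clustered tree (RCT) is a pair $\mathcal T=(\mathcal P,E)$, where $\mathcal P$ is a partition of $I$ and $E$ is the set of directed edges of an out-tree (underlying undirected graph connected and acyclic, with a unique directed path from the root to every other vertex) on $\mathcal P_o=\mathcal P\cup\{o\}$, with $o$ an additional vertex, the root. $c(A)$, $a(A)$, $d(A)$ are the sets of children, ancestors (including $o$ if $A\neq o$), and descendants of $A\in\mathcal P_o$; $\bar a(A)=\bigcup_{B\in a(A)\setminus\{o\}}B$, $\bar d(A)=\bigcup_{B\in d(A)}B$. The root carries no dimensions: $\bar a(o)=\emptyset$, and "$o\cup\bar d(o)$" means $I$ (with complement $\emptyset$). **SMEU representation.** $\succsim$ has an SMEU representation $(\mathcal T,(u^A)_{A\in\mathcal P_o})$ if there are an RCT $\mathcal T=(\mathcal P,E)$ and functions $u^o:\mathbb R^{c(o)}\to\mathbb R$ and $u^A:X_{\bar a(A)}\times X_A\times\mathbb R^{c(A)}\to\mathbb R$ ($A\in\mathcal P$; the factor $\mathbb R^{c(A)}$ is dropped if $c(A)=\emptyset$) such that, defining recursively for $A\in\mathcal P$, $x\in X_{\bar a(A)}$, $p\in\Delta(X)$ $$U^A_x(p)=\mathbb E^p_{A|x}\,u^A\big(x,y,(U^B_{(x,y)}(p))_{B\in c(A)}\big)$$ ($y\in X_A$ is the integration variable; the value is $0$ if $x\notin\operatorname{supp}(p_{\bar a(A)})$) and $U^o(p)=u^o((U^B(p))_{B\in c(o)})$, the following hold for all $A\in\mathcal P_o$, $x\in X_{\bar a(A)}$, and $z\in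 X_{(A\cup\bar d(A))^{\mathsf c}}$ with $z_{\bar a(A)}=x$: (1) $p\succsim_z q\iff U^A_x(\delta_z,p)\geqslant U^A_x(\delta_z,q)$ for all $p,q\in\Delta(X_{A\cup\bar d(A)})$; (2) $U^A_x(\delta_{(z,y)})$ is continuous and strictly increasing in $y\in X_{A\cup\bar d(A)}$. $\mathbb T(\succsim)$ is the set of RCTs $\mathcal T$ such that $(\mathcal T,(u^A)_{A\in\mathcal P_o})$ is an SMEU representation of $\succsim$ for some $(u^A)_{A\in\mathcal P_o}$. The preference has an SMEU representation with a *unique* RCT if $\mathbb T(\succsim)$ is a singleton. **Special cases.** $\succsim$ has - a FATE representation if it has an SMEU representation with an RCT such that $c(o)=\{I\}$; - a FETA representation if it has an SMEU representation with a unique RCT, and this RCT satisfies $c(o)=\{\{1\},\dots,\{N\}\}$; - a recursive representation if it has an SMEU representation with a unique RCT, and this RCT satisfies $|c(A)|\leqslant1$ for all $A\in\mathcal P_o$. **Relation $\rightharpoonup$ on $I$.** $i\rightharpoonup j$ ($i=j$ allowed) if: whenever $x^k,y^k\in X$ and $\pi^k\in[0,1)$, $k=1,\dots,n$, satisfy $\sum_k\pi^k=1$, $(x^k_i)_{k}$ pairwise distinct, $(y^k_i)_{k}$ pairwise distinct, and for all $k$, $x^k_{\{i,j\}^{\mathsf c}}=y^k_{\{i,j\}^{\mathsf c}}$ and $\delta_{x^k}\succsim\delta_{y^k}$, then $\sum_k\pi^k\delta_{x^k}\succsim\sum_k\pi^k\delta_{y^k}$. *)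

theory Defs
  imports "HOL-Probability.Probability"
begin

text \<open>An outcome on the coordinates in A is an extensional function (value \<^term>\<open>undefined\<close> outside A).
  The product over the empty set is the singleton \<^term>\<open>{\<lambda>_. undefined}\<close>.\<close>

type_synonym outcome = "nat \<Rightarrow> real"

definition outcomes :: "(nat \<Rightarrow> real set) \<Rightarrow> nat set \<Rightarrow> outcome set" where
  "outcomes X A = (\<Pi>\<^sub>E i\<in>A. X i)"

definition lotteries :: "(nat \<Rightarrow> real set) \<Rightarrow> nat set \<Rightarrow> outcome pmf set" where
  "lotteries X A = {p. finite (set_pmf p) \<and> set_pmf p \<subseteq> outcomes X A}"

definition marginal :: "outcome pmf \<Rightarrow> nat set \<Rightarrow> outcome pmf" where
  "marginal p A = map_pmf (\<lambda>x. restrict x A) p"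

text \<open>Distribution of the coordinates in A given that those in B equal x; it is meaningful only
  for x in the support of \<^term>\<open>marginal p B\<close>.\<close>

definition conditional :: "outcome pmf \<Rightarrow> nat set \<Rightarrow> nat set \<Rightarrow> outcome \<Rightarrow> outcome pmf" where
  "conditional p A B x = marginal (cond_pmf p {y. restrict y B = x}) A"

definition prod_lottery :: "nat set \<Rightarrow> nat set \<Rightarrow> outcome pmf \<Rightarrow> outcome pmf \<Rightarrow> outcome pmf" where
  "prod_lottery A B p q = map_pmf (merge A B) (pair_pmf p q)"

definition cond_pref ::
  "nat set \<Rightarrow> (outcome pmf \<Rightarrow> outcome pmf \<Rightarrow> bool) \<Rightarrow> nat set \<Rightarrow> outcome \<Rightarrow> outcome pmf \<Rightarrow> outcome pmf \<Rightarrow> bool"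
  where
  "cond_pref I R A x p q \<longleftrightarrow>
     R (prod_lottery A (I - A) p (return_pmf x)) (prod_lottery A (I - A) q (return_pmf x))"

text \<open>The vertices are \<^term>\<open>Some A\<close> for the blocks A of the partition, and \<^term>\<open>None\<close> for the root.\<close>

type_synonym vertex = "nat set option"
type_synonym rct = "nat set set \<times> (vertex \<times> vertex) set"

definition vertices :: "nat set set \<Rightarrow> vertex set" where
  "vertices P = insert None (Some ` P)"

definition directed_path :: "'v rel \<Rightarrow> 'v \<Rightarrow> 'v \<Rightarrow> 'v list \<Rightarrow> bool" where
  "directed_path E u v xs \<longleftrightarrow>
     xs \<noteq> [] \<and> hd xs = u \<and> last xs = v \<and> distinct xs \<and> successively (\<lambda>a b. (a, b) \<in> E) xs"

text \<open>Acyclicity of the underlying undirected graph: loops and pairs of antiparallel edges (which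
  are cycles of length one and two) are excluded by asymmetry, longer cycles by the second conjunct.\<close>

definition undirected_acyclic :: "'v rel \<Rightarrow> bool" where
  "undirected_acyclic E \<longleftrightarrow> asym E \<and>
     \<not> (\<exists>xs. 3 \<le> length xs \<and> distinct xs \<and>
          successively (\<lambda>a b. (a, b) \<in> E \<union> E\<inverse>) xs \<and> (last xs, hd xs) \<in> E \<union> E\<inverse>)"

definition out_tree :: "'v set \<Rightarrow> 'v \<Rightarrow> 'v rel \<Rightarrow> bool" where
  "out_tree V r E \<longleftrightarrow> r \<in> V \<and> E \<subseteq> V \<times> V \<and>
     (\<forall>u\<in>V. \<forall>v\<in>V. (u, v) \<in> (E \<union> E\<inverse>)\<^sup>*) \<and>
     undirected_acyclic E \<and>
     (\<forall>v\<in>V - {r}. \<exists>!xs. directed_path E r v xs)"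

definition is_rct :: "nat set \<Rightarrow> rct \<Rightarrow> bool" where
  "is_rct I T \<longleftrightarrow> (case T of (P, E) \<Rightarrow> partition_on I P \<and> out_tree (vertices P) None E)"

definition children :: "vertex rel \<Rightarrow> vertex \<Rightarrow> nat set set" where
  "children E A = {B. (A, Some B) \<in> E}"

definition anc_coords :: "vertex rel \<Rightarrow> vertex \<Rightarrow> nat set" where
  "anc_coords E A = \<Union>{B. (Some B, A) \<in> E\<^sup>+}"

definition desc_coords :: "vertex rel \<Rightarrow> vertex \<Rightarrow> nat set" where
  "desc_coords E A = \<Union>{B. (A, Some B) \<in> E\<^sup>+}"

text \<open>The root carries no coordinates of its own, so its subtree has all the coordinates in
  \<open>\<Union>P\<close>.\<close>

definition own_coords :: "vertex \<Rightarrow> nat set" where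
  "own_coords A = (case A of None \<Rightarrow> {} | Some B \<Rightarrow> B)"

definition subtree_coords :: "vertex rel \<Rightarrow> vertex \<Rightarrow> nat set" where
  "subtree_coords E A = own_coords A \<union> desc_coords E A"

text \<open>Vectors indexed by the children of a vertex are extensional functions on clusters.\<close>

type_synonym root_fun = "(nat set \<Rightarrow> real) \<Rightarrow> real"
type_synonym cluster_fun = "nat set \<Rightarrow> outcome \<Rightarrow> outcome \<Rightarrow> (nat set \<Rightarrow> real) \<Rightarrow> real"

text \<open>The recursion runs from a cluster to its children, which is well founded on a rooted
  clustered tree; the resulting recursive equation is \<open>cluster_utility_eq\<close> below.\<close>

definition cluster_utility ::
  "vertex rel \<Rightarrow> cluster_fun \<Rightarrow> nat set \<Rightarrow> outcome \<Rightarrow> outcome pmf \<Rightarrow> real" where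
  "cluster_utility E u = wfrec {(B, A). (Some A, Some B) \<in> E}
     (\<lambda>U A x p. let C = anc_coords E (Some A) in
        if x \<in> set_pmf (marginal p C)
        then measure_pmf.expectation (conditional p A C x)
               (\<lambda>y. u A x y (\<lambda>B\<in>children E (Some A). U B (merge C A (x, y)) p))
        else 0)"

definition utility ::
  "vertex rel \<Rightarrow> root_fun \<Rightarrow> cluster_fun \<Rightarrow> vertex \<Rightarrow> outcome \<Rightarrow> outcome pmf \<Rightarrow> real" where
  "utility E uo u A x p =
     (case A of
        None \<Rightarrow> uo (\<lambda>B\<in>children E None. cluster_utility E u B (\<lambda>_. undefined) p)
      | Some A' \<Rightarrow> cluster_utility E u A' x p)"

lemma rct_acyclic:
  assumes "is_rct I (P, E)"
  shows "acyclic E"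
proof -
  from assms have tree: "out_tree (vertices P) None E"
    by (simp add: is_rct_def)
  then have sub: "E \<subseteq> vertices P \<times> vertices P" and asym: "asym E"
    and uniq: "\<And>v. v \<in> vertices P \<Longrightarrow> v \<noteq> None \<Longrightarrow> \<exists>!xs. directed_path E None v xs"
    and no_cycle: "\<And>xs. 3 \<le> length xs \<Longrightarrow> distinct xs \<Longrightarrow>
          successively (\<lambda>a b. (a, b) \<in> E \<union> E\<inverse>) xs \<Longrightarrow> (last xs, hd xs) \<notin> E \<union> E\<inverse>"
    by (auto simp: out_tree_def undirected_acyclic_def)
  have no_back: False
    if xs: "directed_path E u v xs" and e: "(v, u) \<in> E" for u v xs
  proof (cases "3 \<le> length xs")
    case True
    have "successively (\<lambda>a b. (a, b) \<in> E \<union> E\<inverse>) xs"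
      by (rule successively_mono[of "\<lambda>a b. (a, b) \<in> E"]) (use xs in \<open>auto simp: directed_path_def\<close>)
    with no_cycle[OF True] xs e show False
      by (auto simp: directed_path_def)
  next
    case False
    then consider a where "xs = [a]" | a b where "xs = [a, b]"
      using xs by (cases xs; cases "tl xs"; cases "tl (tl xs)")
        (auto simp: directed_path_def)
    then show False
      using xs e asym by cases (auto simp: directed_path_def dest: asymD)
  qed
  have trivial: "xs = [None]" if "directed_path E None None xs" for xs
    using that by (cases xs) (auto simp: directed_path_def dest: last_in_set split: if_splits)
  define path where "path v = (THE xs. directed_path E None v xs)" for v
  have path: "directed_path E None v (path v)" and path_eq: "directed_path E None v xs \<Longrightarrow> path v = xs"
    if "v \<in> vertices P" for v xs
  proof -
    have ex1: "\<exists>!xs. directed_path E None v xs"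
    proof (cases "v = None")
      case True
      moreover have "directed_path E None None [None]"
        by (simp add: directed_path_def)
      ultimately show ?thesis using trivial by blast
    qed (use uniq that in blast)
    show "directed_path E None v (path v)"
      unfolding path_def by (rule theI'[OF ex1])
    show "directed_path E None v xs \<Longrightarrow> path v = xs"
      unfolding path_def by (rule the1_equality[OF ex1])
  qed
  have "E \<subseteq> inv_image less_than (\<lambda>v. length (path v))"
  proof clarify
    fix u v assume e: "(u, v) \<in> E"
    with sub have uv: "u \<in> vertices P" "v \<in> vertices P" by auto
    have pu: "directed_path E None u (path u)" using path uv by blast
    have "v \<notin> set (path u)"
    proof
      assume "v \<in> set (path u)"
      then obtain ys zs where "path u = ys @ v # zs" by (meson split_list)
      with pu have "directed_path E v u (v # zs)"
        by (auto simp: directed_path_def successively_append_iff)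
      with no_back e show False by blast
    qed
    with pu e have "directed_path E None v (path u @ [v])"
      by (auto simp: directed_path_def successively_append_iff)
    with path_eq uv have "path v = path u @ [v]" by blast
    then show "(u, v) \<in> inv_image less_than (\<lambda>v. length (path v))" by simp
  qed
  then have "wf E"
    by (rule wf_subset[OF wf_inv_image[OF wf_less_than]])
  then show ?thesis by (rule wf_acyclic)
qed

lemma cluster_utility_eq:
  assumes "is_rct I (P, E)" "finite I"
  shows "cluster_utility E u A x p =
    (if x \<in> set_pmf (marginal p (anc_coords E (Some A)))
     then measure_pmf.expectation (conditional p A (anc_coords E (Some A)) x)
            (\<lambda>y. u A x y (\<lambda>B\<in>children E (Some A).
                cluster_utility E u B (merge (anc_coords E (Some A)) A (x, y)) p))
     else 0)"
proof -
  have "finite P"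
    using assms by (auto simp: is_rct_def intro: finite_elements)
  moreover have "E \<subseteq> vertices P \<times> vertices P"
    using assms by (simp add: is_rct_def out_tree_def)
  ultimately have "finite E"
    by (auto simp: vertices_def intro: finite_subset)
  with rct_acyclic[OF assms(1)] have "wf (E\<inverse>)"
    by (simp add: finite_acyclic_wf_converse)
  then have "wf (inv_image (E\<inverse>) Some)"
    by (rule wf_inv_image)
  also have "inv_image (E\<inverse>) Some = {(B, A). (Some A, Some B) \<in> E}"
    by (auto simp: inv_image_def)
  finally have wf: "wf {(B, A). (Some A, Some B) \<in> E}" .
  show ?thesis
    unfolding cluster_utility_def
    by (subst wfrec[OF wf])
      (auto simp: Let_def cut_apply children_def cong: restrict_cong)
qed

text \<open>At the root, x and z range over the singleton \<^term>\<open>{\<lambda>_. undefined}\<close>. Continuity refers to the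
  product topology on functions and strict monotonicity to the pointwise order; on extensional
  functions these are the topology and the order of the finite product.\<close>

definition smeu_representation ::
  "nat set \<Rightarrow> (nat \<Rightarrow> real set) \<Rightarrow> (outcome pmf \<Rightarrow> outcome pmf \<Rightarrow> bool)
     \<Rightarrow> rct \<Rightarrow> root_fun \<Rightarrow> cluster_fun \<Rightarrow> bool" where
  "smeu_representation I X R T uo u \<longleftrightarrow> is_rct I T \<and>
     (case T of (P, E) \<Rightarrow>
       \<forall>A\<in>vertices P. \<forall>x\<in>outcomes X (anc_coords E A).
         let D = subtree_coords E A in
         \<forall>z\<in>outcomes X (I - D). restrict z (anc_coords E A) = x \<longrightarrow>
           (\<forall>p\<in>lotteries X D. \<forall>q\<in>lotteries X D.
              cond_pref I R D z p q \<longleftrightarrow>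
                utility E uo u A x (prod_lottery (I - D) D (return_pmf z) p)
                  \<ge> utility E uo u A x (prod_lottery (I - D) D (return_pmf z) q)) \<and>
           continuous_on (outcomes X D)
             (\<lambda>y. utility E uo u A x (return_pmf (merge (I - D) D (z, y)))) \<and>
           strict_mono_on (outcomes X D)
             (\<lambda>y. utility E uo u A x (return_pmf (merge (I - D) D (z, y)))))"

definition smeu_rcts ::
  "nat set \<Rightarrow> (nat \<Rightarrow> real set) \<Rightarrow> (outcome pmf \<Rightarrow> outcome pmf \<Rightarrow> bool) \<Rightarrow> rct set" where
  "smeu_rcts I X R = {T. \<exists>uo u. smeu_representation I X R T uo u}"

definition has_smeu where
  "has_smeu I X R \<longleftrightarrow> (\<exists>T uo u. smeu_representation I X R T uo u)"

definition has_fate where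
  "has_fate I X R \<longleftrightarrow> (\<exists>P E. (P, E) \<in> smeu_rcts I X R \<and> children E None = {I})"

definition has_feta where
  "has_feta I X R \<longleftrightarrow>
     (\<exists>P E. smeu_rcts I X R = {(P, E)} \<and> children E None = (\<lambda>i. {i}) ` I)"

definition has_recursive where
  "has_recursive I X R \<longleftrightarrow>
     (\<exists>P E. smeu_rcts I X R = {(P, E)} \<and> (\<forall>A\<in>vertices P. card (children E A) \<le> 1))"

definition mixture :: "nat \<Rightarrow> (nat \<Rightarrow> real) \<Rightarrow> (nat \<Rightarrow> outcome) \<Rightarrow> outcome pmf" where
  "mixture n \<pi> x = pmf_of_list (map (\<lambda>k. (x k, \<pi> k)) [1..<Suc n])"

lemma pmf_mixture:
  assumes "\<And>k. k \<in> {1..n} \<Longrightarrow> \<pi> k \<ge> 0" "(\<Sum>k=1..n. \<pi> k) = 1"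
  shows "pmf (mixture n \<pi> x) z = (\<Sum>k=1..n. \<pi> k * pmf (return_pmf (x k)) z)"
proof -
  have set_upt: "set [1..<Suc n] = {1..n}" by auto
  have wf: "pmf_of_list_wf (map (\<lambda>k. (x k, \<pi> k)) [1..<Suc n])"
    using assms by (intro pmf_of_list_wfI)
      (auto simp: o_def interv_sum_list_conv_sum_set_nat simp del: upt_Suc
         simp flip: atLeastLessThanSuc_atLeastAtMost)
  have "pmf (mixture n \<pi> x) z = sum_list (map \<pi> (filter (\<lambda>k. x k = z) [1..<Suc n]))"
    unfolding mixture_def pmf_pmf_of_list[OF wf] by (simp add: filter_map o_def del: upt_Suc)
  also have "\<dots> = (\<Sum>k=1..n. if x k = z then \<pi> k else 0)"
    by (simp only: sum_list_map_filter' interv_sum_list_conv_sum_set_nat set_upt)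
  also have "\<dots> = (\<Sum>k=1..n. \<pi> k * pmf (return_pmf (x k)) z)"
    by (intro sum.cong) (auto simp: indicator_def)
  finally show ?thesis .
qed

definition dim_rel ::
  "nat set \<Rightarrow> (nat \<Rightarrow> real set) \<Rightarrow> (outcome pmf \<Rightarrow> outcome pmf \<Rightarrow> bool) \<Rightarrow> nat \<Rightarrow> nat \<Rightarrow> bool" where
  "dim_rel I X R i j \<longleftrightarrow>
     (\<forall>n \<pi> x y.
        (\<forall>k\<in>{1..n}. x k \<in> outcomes X I \<and> y k \<in> outcomes X I \<and> 0 \<le> \<pi> k \<and> \<pi> k < 1) \<and>
        (\<Sum>k=1..n. \<pi> k) = 1 \<and>
        inj_on (\<lambda>k. x k i) {1..n} \<and> inj_on (\<lambda>k. y k i) {1..n} \<and>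
        (\<forall>k\<in>{1..n}. restrict (x k) (I - {i, j}) = restrict (y k) (I - {i, j}) \<and>
           R (return_pmf (x k)) (return_pmf (y k)))
        \<longrightarrow> R (mixture n \<pi> x) (mixture n \<pi> y))"

end

(* A lottery is the image of a finitely supported distribution of indices, which turns the node
   utilities into conditional averages. Everything then rests on the behaviour of the aggregators.

   If j lies in the cluster of i or below it, then, the values of i being pairwise distinct, each
   value of i is followed by a degenerate continuation. So a comparison outcome by outcome passes
   to the mixture, and i is related to j. Conversely, mixing indifferent pairs of outcomes shows
   what a relation costs: if some dimension below A is related to a dimension of A, then the utility
   of A is affine in the values of its children; if a relation holds between siblings, then the two
   values enter through a linear trade-off. An affine aggregator can be absorbed into an
   expectation, and so can a linear trade-off at the root of a star, so the clusters involved can be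
   merged; in the other direction, every cluster with at least two dimensions can be split into a
   parent and a child.

   Hence if all dimensions are related, every tree can be flattened to a star and the star merged
   into a single cluster. A relation between two leaves of a star produces a second tree, and so does
   a relation against the direction of a chain. If the relation is trivial, the tree must be the star.
   If it is a linear order, two lowest siblings would be leaves related in both directions, so the
   tree is a chain of singletons in the given order. *)
theory Submission imports Defs begin

section \<open>Local description of rooted clustered trees: acyclic edges and unique parents\<close>

section \<open>Rooted clustered trees\<close>

text \<open>An aggregator is constrained only at vectors of child utilities that can occur. These
  form a box, and moving each child subtree along its diagonal realizes every point of the box by a
  deterministic outcome. Continuity and strict monotonicity in outcomes thus carry over to the
  aggregators, but only on that box. The obstacle is that the relation tests only mixtures with
  pairwise distinct values in its first dimension. Tests therefore give identities at generic points
  only, which must be extended by perturbation and continuity. The basic test replaces one outcome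
  of a mixture by an indifferent one: a coordinate is moved slightly and another compensates. The
  change may shift the vertex at which uncertainty is resolved, which compares an aggregator of
  averages with an average of aggregator values; or it shifts child utilities in a fixed direction,
  along which the aggregator must then be constant. For a linear order, uniqueness of the tree holds
  because its edges are the covering pairs of reachability, and reachability is determined by the
  relation.\<close>

lemma rct_parent_characterization_forward:
  assumes "is_rct I (P, E)"
  shows "partition_on I P" "E \<subseteq> vertices P \<times> vertices P" "acyclic E"
    "\<And>u. (u, None) \<notin> E" "\<And>A. A \<in> P \<Longrightarrow> \<exists>!u. (u, Some A) \<in> E"
proof -
  show part: "partition_on I P" and sub: "E \<subseteq> vertices P \<times> vertices P"
    using assms by (auto simp: is_rct_def out_tree_def)
  show acyc: "acyclic E" by (rule rct_acyclic[OF assms])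
  have uniq: "\<exists>!xs. directed_path E None v xs" if "v \<in> vertices P" "v \<noteq> None" for v
    using assms that by (auto simp: is_rct_def out_tree_def)
  have path_rtrancl: "(y, last xs) \<in> E\<^sup>*"
    if "successively (\<lambda>a b. (a, b) \<in> E) xs" "y \<in> set xs" for xs y
    using that
  proof (induction xs arbitrary: y)
    case (Cons a zs)
    show ?case
    proof (cases zs)
      case Nil
      with Cons.prems show ?thesis by simp
    next
      case (Cons b bs)
      then have e: "(a, b) \<in> E" and s: "successively (\<lambda>a b. (a, b) \<in> E) zs"
        using Cons.prems by auto
      have "(b, last zs) \<in> E\<^sup>*" by (rule Cons.IH[OF s]) (simp add: Cons)
      with e have "(a, last zs) \<in> E\<^sup>*" by (rule converse_rtrancl_into_rtrancl)
      moreover have "(y, last zs) \<in> E\<^sup>*" if "y \<in> set zs" using Cons.IH[OF s that] .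
      ultimately show ?thesis using Cons.prems Cons by auto
    qed
  qed simp
  have ex_path: "\<exists>xs. directed_path E None v xs" if "v \<in> vertices P" for v
  proof (cases "v = None")
    case True
    have "directed_path E None None [None]" by (simp add: directed_path_def)
    with True show ?thesis by blast
  qed (use uniq that in blast)
  \<comment> \<open>Acyclicity keeps the extended path simple, so two parents of a vertex would give
    two simple paths from the root to it.\<close>
  have extend: "directed_path E None v (xs @ [v])"
    if e: "(u, v) \<in> E" and xs: "directed_path E None u xs" for u v xs
  proof -
    have "v \<notin> set xs"
    proof
      assume "v \<in> set xs"
      with path_rtrancl[of xs v] xs have "(v, u) \<in> E\<^sup>*" by (auto simp: directed_path_def)
      with e have "(v, v) \<in> E\<^sup>+" by (meson rtrancl_into_trancl1)
      with acyc show False by (auto simp: acyclic_def)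
    qed
    with e xs show ?thesis by (auto simp: directed_path_def successively_append_iff)
  qed
  show no_root: "(u, None) \<notin> E" for u
  proof
    assume e: "(u, None) \<in> E"
    with sub ex_path obtain xs where xs: "directed_path E None u xs" by blast
    then have "None \<in> set xs" by (metis directed_path_def hd_in_set)
    with path_rtrancl[of xs None] xs have "(None, u) \<in> E\<^sup>*" by (auto simp: directed_path_def)
    with e have "(None, None) \<in> E\<^sup>+" by (meson rtrancl_into_trancl1)
    with acyc show False by (auto simp: acyclic_def)
  qed
  fix A assume A: "A \<in> P"
  then have V: "Some A \<in> vertices P" by (simp add: vertices_def)
  obtain xs where xs: "directed_path E None (Some A) xs" using ex_path[OF V] by blast
  show "\<exists>!u. (u, Some A) \<in> E"
  proof (rule ex_ex1I)
    from xs have ne: "xs \<noteq> []" and l: "last xs = Some A" and h: "hd xs = None"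
      and s: "successively (\<lambda>a b. (a, b) \<in> E) xs" by (auto simp: directed_path_def)
    have eq: "xs = butlast xs @ [Some A]" using ne l by (metis append_butlast_last_id)
    with h have "butlast xs \<noteq> []" by (metis append_Nil list.sel(1) option.distinct(1))
    with s eq have "(last (butlast xs), Some A) \<in> E"
      by (metis successively_append_iff list.sel(1) not_Cons_self2)
    then show "\<exists>u. (u, Some A) \<in> E" ..
  next
    fix u u' assume e: "(u, Some A) \<in> E" "(u', Some A) \<in> E"
    with sub ex_path obtain ys zs where p: "directed_path E None u ys" "directed_path E None u' zs"
      by blast
    have "ys @ [Some A] = zs @ [Some A]"
      using uniq[OF V] extend[OF e(1) p(1)] extend[OF e(2) p(2)] by blast
    with p show "u = u'" by (auto simp: directed_path_def)
  qed
qed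

lemma rtrancl_from_root:
  assumes wf: "wf E" and par: "\<And>A. A \<in> P \<Longrightarrow> \<exists>u. (u, Some A) \<in> E"
    and sub: "E \<subseteq> vertices P \<times> vertices P" and v: "v \<in> vertices P"
  shows "(None, v) \<in> E\<^sup>*"
  using wf v
proof (induction v rule: wf_induct_rule)
  case (less v)
  show ?case
  proof (cases v)
    case (Some A)
    with less.prems have "A \<in> P" by (auto simp: vertices_def)
    with par obtain u where e: "(u, v) \<in> E" using Some by blast
    with sub have "u \<in> vertices P" by blast
    with less.IH[OF e] e show ?thesis by (auto intro: rtrancl_into_rtrancl)
  qed auto
qed

text \<open>The path and cycle conditions of \<open>out_tree\<close> follow from conditions that can
  be checked edge by edge. Together with \<open>rct_parent_characterization_forward\<close> this
  lets trees be built and modified without handling paths.\<close>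

lemma is_rctI:
  assumes part: "partition_on I P" and fin: "finite P"
    and sub: "E \<subseteq> vertices P \<times> vertices P" and acyc: "acyclic E"
    and root: "\<And>u. (u, None) \<notin> E" and par: "\<And>A. A \<in> P \<Longrightarrow> \<exists>!u. (u, Some A) \<in> E"
  shows "is_rct I (P, E)"
proof -
  have "finite (vertices P)" using fin by (simp add: vertices_def)
  with sub have finE: "finite E" by (meson finite_SigmaI finite_subset)
  have wfE: "wf E" using finE acyc by (rule finite_acyclic_wf)
  have par_uniq: "u = u'" if "(u, v) \<in> E" "(u', v) \<in> E" for u u' v
  proof (cases v)
    case None then show ?thesis using root that by blast
  next
    case (Some A)
    with that sub have "A \<in> P" by (auto simp: vertices_def)
    with par that Some show ?thesis by blast
  qed
  have reach: "(None, v) \<in> E\<^sup>*" if "v \<in> vertices P" for v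
    by (rule rtrancl_from_root[OF wfE _ sub that]) (use par in blast)
  have conn: "(u, v) \<in> (E \<union> E\<inverse>)\<^sup>*" if "u \<in> vertices P" "v \<in> vertices P" for u v
  proof -
    have "(u, None) \<in> (E\<inverse>)\<^sup>*" using reach[OF that(1)] by (simp add: rtrancl_converse)
    then have "(u, None) \<in> (E \<union> E\<inverse>)\<^sup>*" by (meson in_rtrancl_UnI)
    moreover have "(None, v) \<in> (E \<union> E\<inverse>)\<^sup>*" using reach[OF that(2)] by (meson in_rtrancl_UnI)
    ultimately show ?thesis by (rule rtrancl_trans)
  qed
  have asymE: "asym E"
    by (rule asymI) (use acyc in \<open>auto simp: acyclic_def dest: trancl_into_trancl r_into_trancl\<close>)
  have no_cycle: False
    if len: "3 \<le> length xs" and dist: "distinct xs"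
      and succ: "successively (\<lambda>a b. (a, b) \<in> E \<union> E\<inverse>) xs"
      and close: "(last xs, hd xs) \<in> E \<union> E\<inverse>" for xs
  proof -
    \<comment> \<open>Some vertex of the cycle has no successor on the cycle; both of its neighbours
      there must then be its parents.\<close>
    have "wf (E\<inverse>)" using finE acyc by (rule finite_acyclic_wf_converse)
    moreover have "hd xs \<in> set xs" using len by (metis hd_in_set list.size(3) not_numeral_le_zero)
    ultimately obtain v where v: "v \<in> set xs" and maxv: "\<And>w. (w, v) \<in> E\<inverse> \<Longrightarrow> w \<notin> set xs"
      by (rule wfE_min) blast
    have down: "(w, v) \<in> E" if "(w, v) \<in> E \<union> E\<inverse>" "w \<in> set xs" for w
      using that maxv by blast
    have step: "(xs ! m, xs ! Suc m) \<in> E \<union> E\<inverse>" if "Suc m < length xs" for m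
      using succ that by (auto simp: successively_conv_nth)
    have lasth: "(xs ! (length xs - 1), xs ! 0) \<in> E \<union> E\<inverse>"
      using close len by (metis hd_conv_nth last_conv_nth list.size(3) not_numeral_le_zero)
    obtain m where m: "m < length xs" "v = xs ! m" using v by (auto simp: in_set_conv_nth)
    \<comment> \<open>Positions before and after \<open>m\<close> on the cycle, with wrap-around;
      they differ because the cycle has at least three vertices.\<close>
    define a where "a = (if m = 0 then length xs - 1 else m - 1)"
    define b where "b = (if m = length xs - 1 then 0 else m + 1)"
    have ab: "a < length xs" "b < length xs" "a \<noteq> b" using m len by (auto simp: a_def b_def)
    have "(xs ! a, v) \<in> E \<union> E\<inverse>"
      using step[of "m - 1"] lasth m by (auto simp: a_def)
    moreover have "(xs ! b, v) \<in> E \<union> E\<inverse>"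
    proof (cases "m = length xs - 1")
      case True then show ?thesis using lasth m by (auto simp: b_def)
    next
      case False then show ?thesis using step[of m] m by (auto simp: b_def)
    qed
    ultimately have "xs ! a = xs ! b" using down ab par_uniq by (meson nth_mem)
    with ab dist show False by (simp add: nth_eq_iff_index_eq)
  qed
  have acyclic_un: "undirected_acyclic E"
    unfolding undirected_acyclic_def using asymE no_cycle by blast
  have ex: "\<exists>xs. directed_path E None v xs \<and> (\<forall>w\<in>set xs. (w, v) \<in> E\<^sup>*)" if "v \<in> vertices P" for v
    using reach[OF that]
  proof (induction rule: rtrancl_induct)
    case base
    have "directed_path E None None [None] \<and> (\<forall>w\<in>set [None]. (w, None) \<in> E\<^sup>*)"
      by (simp add: directed_path_def)
    then show ?case by blast
  next
    case (step u v)
    then obtain xs where xs: "directed_path E None u xs" "\<forall>w\<in>set xs. (w, u) \<in> E\<^sup>*" by blast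
    have "v \<notin> set xs"
    proof
      assume "v \<in> set xs"
      with xs step have "(v, v) \<in> E\<^sup>+" by (meson rtrancl_into_trancl1)
      with acyc show False by (auto simp: acyclic_def)
    qed
    with xs step have "directed_path E None v (xs @ [v])"
      by (auto simp: directed_path_def successively_append_iff)
    moreover have "\<forall>w\<in>set (xs @ [v]). (w, v) \<in> E\<^sup>*"
      using xs step by (auto intro: rtrancl_into_rtrancl)
    ultimately show ?case by blast
  qed
  have un: "xs = ys" if "directed_path E None v xs" "directed_path E None v ys" for v xs ys
    using that
  proof (induction xs arbitrary: v ys rule: rev_induct)
    case Nil then show ?case by (simp add: directed_path_def)
  next
    case (snoc x xs)
    then have x: "x = v" by (simp add: directed_path_def)
    obtain ys' where ys: "ys = ys' @ [v]"
      using snoc.prems(2) by (metis append_butlast_last_id directed_path_def)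
    show ?case
    proof (cases "v = None")
      case True
      have "xs = []" using snoc.prems(1) x True by (cases xs) (auto simp: directed_path_def)
      moreover have "ys' = []" using snoc.prems(2) ys True by (cases ys') (auto simp: directed_path_def)
      ultimately show ?thesis using x ys by simp
    next
      case False
      have ne: "xs \<noteq> []" "ys' \<noteq> []" using snoc.prems x ys False by (auto simp: directed_path_def)
      have e: "(last xs, v) \<in> E" "(last ys', v) \<in> E"
        using snoc.prems x ys ne by (auto simp: directed_path_def successively_append_iff)
      then have "last xs = last ys'" by (rule par_uniq)
      then have "directed_path E None (last xs) xs" "directed_path E None (last xs) ys'"
        using snoc.prems x ys ne by (auto simp: directed_path_def successively_append_iff)
      then have "xs = ys'" by (rule snoc.IH)
      then show ?thesis using x ys by simp
    qed
  qed
  have "\<forall>v\<in>vertices P - {None}. \<exists>!xs. directed_path E None v xs"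
    using ex un by blast
  then show ?thesis
    using part sub conn acyclic_un by (auto simp: is_rct_def out_tree_def vertices_def)
qed

locale rct =
  fixes I :: "nat set" and P :: "nat set set" and E :: "vertex rel"
  assumes fin: "finite I" and is_rct: "is_rct I (P, E)"
begin

abbreviation "V \<equiv> vertices P"
abbreviation "anc \<equiv> anc_coords E"
abbreviation "sub \<equiv> subtree_coords E"
abbreviation "ch \<equiv> children E"

lemmas part = rct_parent_characterization_forward(1)[OF is_rct]
lemmas E_sub = rct_parent_characterization_forward(2)[OF is_rct]
lemmas acyc = rct_parent_characterization_forward(3)[OF is_rct]
lemmas no_root_parent [simp] = rct_parent_characterization_forward(4)[OF is_rct]
lemmas parent_ex1 = rct_parent_characterization_forward(5)[OF is_rct]

lemma finP: "finite P"
  using fin part by (auto intro: finite_elements)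

lemma finE: "finite E"
  using finP E_sub by (auto simp: vertices_def intro: finite_subset)

lemma wfE: "wf E"
  using finE acyc by (rule finite_acyclic_wf)

lemma wf_converse: "wf (E\<inverse>)"
  using finE acyc by (rule finite_acyclic_wf_converse)

lemma None_V [simp]: "None \<in> V" and Some_V [simp]: "Some A \<in> V \<longleftrightarrow> A \<in> P"
  by (auto simp: vertices_def)

lemma edge_V: "(u, v) \<in> E \<Longrightarrow> u \<in> V" "(u, v) \<in> E \<Longrightarrow> v \<in> V"
  using E_sub by auto

lemma ch_V: "B \<in> ch v \<Longrightarrow> v \<in> V" "B \<in> ch v \<Longrightarrow> B \<in> P"
  using E_sub by (auto simp: children_def vertices_def)

lemma ch_edge: "B \<in> ch v \<longleftrightarrow> (v, Some B) \<in> E"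
  by (simp add: children_def)

lemma finite_ch [simp, intro]: "finite (ch v)"
  using ch_V finP by (meson finite_subset subsetI)

lemma parent_unique: "(u, v) \<in> E \<Longrightarrow> (u', v) \<in> E \<Longrightarrow> u = u'"
proof (cases v)
  case (Some A)
  assume e: "(u, v) \<in> E" "(u', v) \<in> E"
  then have "A \<in> P" using edge_V(2)[of u v] Some by simp
  with parent_ex1 e Some show ?thesis by blast
qed auto

lemma no_cycle: "(v, v) \<notin> E\<^sup>+"
  using acyc by (auto simp: acyclic_def)

lemma trancl_V: "(u, v) \<in> E\<^sup>+ \<Longrightarrow> u \<in> V \<and> v \<in> V"
  by (meson edge_V tranclD tranclD2)

lemma root_reach: "v \<in> V \<Longrightarrow> (None, v) \<in> E\<^sup>*"
  by (rule rtrancl_from_root[OF wfE _ E_sub]) (use parent_ex1 in blast)+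

lemma antisym_reach: "(u, v) \<in> E\<^sup>* \<Longrightarrow> (v, u) \<in> E\<^sup>* \<Longrightarrow> u = v"
  using no_cycle by (auto simp: rtrancl_eq_or_trancl dest: trancl_trans)

text \<open>Unique parents make the converse of \<open>E\<close> single-valued, hence confluent: the
  ancestors of a vertex form a chain.\<close>

lemma common_descendant: "(u, w) \<in> E\<^sup>* \<Longrightarrow> (u', w) \<in> E\<^sup>* \<Longrightarrow> (u, u') \<in> E\<^sup>* \<or> (u', u) \<in> E\<^sup>*"
proof -
  have "single_valued (E\<inverse>)" using parent_unique by (auto simp: single_valued_def)
  moreover assume "(u, w) \<in> E\<^sup>*" "(u', w) \<in> E\<^sup>*"
  then have "(w, u) \<in> (E\<inverse>)\<^sup>*" "(w, u') \<in> (E\<inverse>)\<^sup>*" by (auto simp: rtrancl_converse)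
  ultimately have "(u, u') \<in> (E\<inverse>)\<^sup>* \<or> (u', u) \<in> (E\<inverse>)\<^sup>*" by (rule single_valued_confluent)
  then show ?thesis by (auto simp: rtrancl_converse)
qed

text \<open>A path from one sibling to another would have to enter through the common parent and
  would close a cycle.\<close>

lemma siblings_disjoint:
  assumes "B \<in> ch v" "C \<in> ch v" "(Some B, w) \<in> E\<^sup>*" "(Some C, w) \<in> E\<^sup>*"
  shows "B = C"
proof -
  have *: "X = Y" if e: "(v, Some X) \<in> E" "(v, Some Y) \<in> E" and "(Some X, Some Y) \<in> E\<^sup>*" for X Y
  proof (rule ccontr)
    assume "X \<noteq> Y"
    with that(3) have "(Some X, Some Y) \<in> E\<^sup>+" by (simp add: rtrancl_eq_or_trancl)
    then obtain z where z: "(Some X, z) \<in> E\<^sup>*" "(z, Some Y) \<in> E" by (blast dest: tranclD2)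
    then have "z = v" using e parent_unique by blast
    with z e have "(v, v) \<in> E\<^sup>+" by (meson rtrancl_into_trancl2)
    with no_cycle show False by blast
  qed
  show ?thesis using common_descendant[OF assms(3,4)] *[of B C] *[of C B] assms(1,2)
    unfolding ch_edge by blast
qed

lemma cluster_ne: "A \<in> P \<Longrightarrow> A \<noteq> {}"
  using part by (auto simp: partition_on_def)

lemma cluster_sub: "A \<in> P \<Longrightarrow> A \<subseteq> I"
  using part by (auto simp: partition_on_def)

lemma cluster_unique: "A \<in> P \<Longrightarrow> B \<in> P \<Longrightarrow> i \<in> A \<Longrightarrow> i \<in> B \<Longrightarrow> A = B"
  using part by (auto simp: partition_on_def disjoint_def)

lemma cluster_ex: "i \<in> I \<Longrightarrow> \<exists>A\<in>P. i \<in> A"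
  using part by (auto simp: partition_on_def)

lemma mem_own: "A \<in> P \<Longrightarrow> i \<in> A \<Longrightarrow> v \<in> V \<Longrightarrow> i \<in> own_coords v \<longleftrightarrow> v = Some A"
  by (cases v) (auto simp: own_coords_def dest: cluster_unique)

text \<open>Blocks are disjoint, so a coordinate identifies its block. Statements about the
  coordinate sets \<open>anc\<close> and \<open>sub\<close> thereby become statements about
  reachability.\<close>

lemma mem_anc: "A \<in> P \<Longrightarrow> i \<in> A \<Longrightarrow> i \<in> anc v \<longleftrightarrow> (Some A, v) \<in> E\<^sup>+"
proof -
  assume a: "A \<in> P" "i \<in> A"
  have "B = A" if "(Some B, v) \<in> E\<^sup>+" "i \<in> B" for B
    using trancl_V[OF that(1)] that(2) a cluster_unique by auto
  with a show ?thesis by (auto simp: anc_coords_def)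
qed

lemma mem_sub: "A \<in> P \<Longrightarrow> i \<in> A \<Longrightarrow> v \<in> V \<Longrightarrow> i \<in> sub v \<longleftrightarrow> (v, Some A) \<in> E\<^sup>*"
proof -
  assume a: "A \<in> P" "i \<in> A" "v \<in> V"
  have "i \<in> desc_coords E v \<longleftrightarrow> (v, Some A) \<in> E\<^sup>+"
  proof -
    have "B = A" if "(v, Some B) \<in> E\<^sup>+" "i \<in> B" for B
      using trancl_V[OF that(1)] that(2) a cluster_unique by auto
    with a show ?thesis by (auto simp: desc_coords_def)
  qed
  then show ?thesis
    using mem_own[OF a] by (auto simp: subtree_coords_def rtrancl_eq_or_trancl)
qed

lemma anc_I: "anc v \<subseteq> I" and own_I: "v \<in> V \<Longrightarrow> own_coords v \<subseteq> I" and sub_I: "v \<in> V \<Longrightarrow> sub v \<subseteq> I"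
proof -
  show "anc v \<subseteq> I" using trancl_V cluster_sub Some_V unfolding anc_coords_def by blast
  show own: "v \<in> V \<Longrightarrow> own_coords v \<subseteq> I" using cluster_sub by (cases v) (auto simp: own_coords_def)
  show "v \<in> V \<Longrightarrow> sub v \<subseteq> I"
    using own trancl_V cluster_sub Some_V unfolding subtree_coords_def desc_coords_def by blast
qed

lemma anc_None [simp]: "anc None = {}"
  by (auto simp: anc_coords_def dest: tranclD2)

lemma own_None [simp]: "own_coords None = {}" and own_Some [simp]: "own_coords (Some A) = A"
  by (auto simp: own_coords_def)

lemma anc_child: "B \<in> ch v \<Longrightarrow> anc (Some B) = anc v \<union> own_coords v"
proof -
  assume "B \<in> ch v"
  then have e: "(v, Some B) \<in> E" by (simp add: ch_edge)
  have "(Some A, Some B) \<in> E\<^sup>+ \<longleftrightarrow> Some A = v \<or> (Some A, v) \<in> E\<^sup>+" for A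
  proof
    assume "(Some A, Some B) \<in> E\<^sup>+"
    then obtain w where w: "(Some A, w) \<in> E\<^sup>*" "(w, Some B) \<in> E" by (blast dest: tranclD2)
    with e parent_unique have "w = v" by blast
    with w show "Some A = v \<or> (Some A, v) \<in> E\<^sup>+" by (auto simp: rtrancl_eq_or_trancl)
  qed (use e in \<open>auto intro: trancl_into_trancl\<close>)
  then show ?thesis by (cases v) (auto simp: anc_coords_def own_coords_def)
qed

text \<open>Together with \<open>anc_child\<close>, the form in which ancestry enters the utility
  recursion: passing to a child moves the own coordinates of the parent to the known ones, and the
  remaining ones are shared out among the children.\<close>

lemma sub_rec: "sub v = own_coords v \<union> (\<Union>B\<in>ch v. sub (Some B))"
proof -
  have *: "(v, Some A) \<in> E\<^sup>+ \<longleftrightarrow> (\<exists>B. (v, Some B) \<in> E \<and> (A = B \<or> (Some B, Some A) \<in> E\<^sup>+))" for A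
  proof
    assume "(v, Some A) \<in> E\<^sup>+"
    then obtain w where w: "(v, w) \<in> E" "(w, Some A) \<in> E\<^sup>*" by (blast dest: tranclD)
    then obtain B where "w = Some B" using no_root_parent by (cases w) auto
    with w show "\<exists>B. (v, Some B) \<in> E \<and> (A = B \<or> (Some B, Some A) \<in> E\<^sup>+)"
      by (auto simp: rtrancl_eq_or_trancl)
  qed (auto intro: trancl_into_trancl2)
  have "desc_coords E v = (\<Union>B\<in>ch v. B \<union> desc_coords E (Some B))"
    unfolding desc_coords_def * children_def by blast
  then show ?thesis by (simp add: subtree_coords_def)
qed

lemma own_sub: "own_coords v \<subseteq> sub v"
  by (auto simp: subtree_coords_def)

lemma child_sub: "B \<in> ch v \<Longrightarrow> sub (Some B) \<subseteq> sub v"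
  using sub_rec by blast

lemma sub_None [simp]: "sub None = I"
proof
  show "I \<subseteq> sub None"
  proof
    fix i assume "i \<in> I"
    then obtain A where "A \<in> P" "i \<in> A" using cluster_ex by blast
    then show "i \<in> sub None" using mem_sub[of A i None] root_reach[of "Some A"] by simp
  qed
qed (use sub_I in simp)

lemma child_cover: "B \<in> ch v \<Longrightarrow> i \<in> anc (Some B) \<union> sub (Some B) \<Longrightarrow> i \<in> anc v \<union> sub v"
  using anc_child child_sub own_sub by blast

lemma anc_own_cover: "i \<in> anc v \<union> own_coords v \<Longrightarrow> i \<in> anc v \<union> sub v"
  using own_sub by blast

lemma child_V: "B \<in> ch v \<Longrightarrow> Some B \<in> V"
  using ch_V by simp

lemma cl_ex: "v \<in> V \<Longrightarrow> i \<in> sub v \<Longrightarrow> \<exists>A\<in>P. i \<in> A"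
  using sub_I cluster_ex by blast

lemma anc_sub_disjoint: "v \<in> V \<Longrightarrow> anc v \<inter> sub v = {}"
proof (rule ccontr)
  assume v: "v \<in> V" and "anc v \<inter> sub v \<noteq> {}"
  then obtain i A where i: "i \<in> anc v" "i \<in> sub v" "A \<in> P" "i \<in> A" using cl_ex by blast
  then have "(Some A, v) \<in> E\<^sup>+" "(v, Some A) \<in> E\<^sup>*" using v by (auto simp: mem_anc mem_sub)
  then show False using no_cycle by (meson trancl_rtrancl_trancl)
qed

lemma own_child_disjoint: "B \<in> ch v \<Longrightarrow> own_coords v \<inter> sub (Some B) = {}"
  using anc_sub_disjoint[of "Some B"] anc_child[of B v] ch_V[of B v] by auto

lemma anc_child_disjoint: "B \<in> ch v \<Longrightarrow> anc v \<inter> sub (Some B) = {}"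
  using anc_sub_disjoint[of "Some B"] anc_child[of B v] ch_V[of B v] by auto

lemma child_child_disjoint:
  assumes "B \<in> ch v" "C \<in> ch v" "B \<noteq> C" shows "sub (Some B) \<inter> sub (Some C) = {}"
proof (rule ccontr)
  assume "\<not> ?thesis"
  then obtain i where i: "i \<in> sub (Some B)" "i \<in> sub (Some C)" by blast
  have BC: "Some B \<in> V" "Some C \<in> V" using assms ch_V by auto
  obtain A where A: "A \<in> P" "i \<in> A" using cl_ex BC(1) i(1) by blast
  have "(Some B, Some A) \<in> E\<^sup>*" "(Some C, Some A) \<in> E\<^sup>*"
    using i mem_sub[OF A] BC by blast+
  with assms siblings_disjoint show False by blast
qed

lemma sub_ne: "A \<in> P \<Longrightarrow> sub (Some A) \<noteq> {}"
  using cluster_ne own_sub[of "Some A"] by auto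

text \<open>Utilities are computed from the leaves upwards, so identities between them are proved
  along this rule; \<open>tree_induct_down\<close> serves for facts about the path to the
  root.\<close>

lemma tree_induct_up [consumes 1, case_names node]:
  assumes "v \<in> V" "\<And>v. v \<in> V \<Longrightarrow> (\<And>B. B \<in> ch v \<Longrightarrow> Q (Some B)) \<Longrightarrow> Q v"
  shows "Q v"
  using wf_converse assms(1)
proof (induction v rule: wf_induct_rule)
  case (less v)
  show ?case
  proof (rule assms(2)[OF less.prems])
    fix B assume "B \<in> ch v"
    then show "Q (Some B)" using less.IH[of "Some B"] by (auto simp: ch_edge dest: edge_V)
  qed
qed

lemma tree_induct_down [consumes 1, case_names root child]:
  assumes "v \<in> V" "Q None" "\<And>v B. v \<in> V \<Longrightarrow> B \<in> ch v \<Longrightarrow> Q v \<Longrightarrow> Q (Some B)"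
  shows "Q v"
  using root_reach[OF assms(1)]
proof (induction rule: rtrancl_induct)
  case (step u w)
  then show ?case using assms(3)[of u] by (cases w) (auto simp: ch_edge dest: edge_V)
qed (rule assms(2))

end

section \<open>Conditional averages over an index space\<close>

section \<open>Lotteries as images of an index distribution\<close>

abbreviation avg :: "'k pmf \<Rightarrow> ('k \<Rightarrow> real) \<Rightarrow> real" where
  "avg \<kappa> f \<equiv> measure_pmf.expectation \<kappa> f"

lemma avg_cong: "(\<And>k. k \<in> set_pmf \<kappa> \<Longrightarrow> f k = g k) \<Longrightarrow> avg \<kappa> f = avg \<kappa> g"
  by (intro integral_cong_AE) (auto simp: AE_measure_pmf_iff)

lemma avg_mono:
  "finite (set_pmf \<kappa>) \<Longrightarrow> (\<And>k. k \<in> set_pmf \<kappa> \<Longrightarrow> f k \<le> g k) \<Longrightarrow> avg \<kappa> f \<le> avg \<kappa> g"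
  by (intro integral_mono_AE integrable_measure_pmf_finite) (auto simp: AE_measure_pmf_iff)

lemma avg_const: "(\<And>k. k \<in> set_pmf \<kappa> \<Longrightarrow> f k = c) \<Longrightarrow> avg \<kappa> f = c"
  using avg_cong[of \<kappa> f "\<lambda>_. c"] by simp

lemma avg_between:
  assumes "finite (set_pmf \<kappa>)" "\<And>k. k \<in> set_pmf \<kappa> \<Longrightarrow> f k \<in> {a..b}"
  shows "avg \<kappa> f \<in> {a..b}"
  using avg_mono[of \<kappa> "\<lambda>_. a" f] avg_mono[of \<kappa> f "\<lambda>_. b"] assms by auto

lemma avg_lin:
  fixes f g :: "'k \<Rightarrow> real"
  assumes "finite (set_pmf \<kappa>)"
  shows "avg \<kappa> (\<lambda>k. a * f k + b * g k) = a * avg \<kappa> f + b * avg \<kappa> g"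
proof -
  have int: "integrable \<kappa> h" for h :: "'k \<Rightarrow> real"
    by (rule integrable_measure_pmf_finite[OF assms])
  have "avg \<kappa> (\<lambda>k. a * f k + b * g k) = avg \<kappa> (\<lambda>k. a * f k) + avg \<kappa> (\<lambda>k. b * g k)"
    by (rule Bochner_Integration.integral_add[OF int int])
  then show ?thesis by simp
qed

lemma cond_pmf_cong:
  assumes "s \<inter> set_pmf \<kappa> = t \<inter> set_pmf \<kappa>" "s \<inter> set_pmf \<kappa> \<noteq> {}"
  shows "cond_pmf \<kappa> s = cond_pmf \<kappa> t"
proof (rule pmf_eqI)
  fix k
  have ne: "set_pmf \<kappa> \<inter> s \<noteq> {}" "set_pmf \<kappa> \<inter> t \<noteq> {}" using assms by (auto simp: Int_commute)
  have "measure \<kappa> (s \<inter> set_pmf \<kappa>) = measure \<kappa> (t \<inter> set_pmf \<kappa>)"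
    by (simp only: assms(1))
  then have m: "measure \<kappa> s = measure \<kappa> t"
    by (simp only: measure_Int_set_pmf)
  show "pmf (cond_pmf \<kappa> s) k = pmf (cond_pmf \<kappa> t) k"
  proof (cases "k \<in> set_pmf \<kappa>")
    case True
    then have "k \<in> s \<longleftrightarrow> k \<in> t" using assms(1) by blast
    then show ?thesis unfolding pmf_cond[OF ne(1)] pmf_cond[OF ne(2)] m by simp
  next
    case False
    then have "pmf \<kappa> k = 0" by (simp add: set_pmf_iff)
    then show ?thesis unfolding pmf_cond[OF ne(1)] pmf_cond[OF ne(2)] by simp
  qed
qed

lemma cond_cond_pmf:
  assumes fin: "finite (set_pmf \<kappa>)" and ne_t: "set_pmf \<kappa> \<inter> t \<noteq> {}" and sub: "t \<subseteq> s"
  shows "cond_pmf (cond_pmf \<kappa> s) t = cond_pmf \<kappa> t"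
proof (rule pmf_eqI)
  fix k
  define \<mu> where "\<mu> = cond_pmf \<kappa> s"
  have ne: "set_pmf \<kappa> \<inter> s \<noteq> {}" using ne_t sub by blast
  have set: "set_pmf \<mu> = set_pmf \<kappa> \<inter> s" unfolding \<mu>_def by (rule set_cond_pmf[OF ne])
  have pmf: "pmf \<mu> x = (if x \<in> s then pmf \<kappa> x / measure \<kappa> s else 0)" for x
    unfolding \<mu>_def by (rule pmf_cond[OF ne])
  have ne_mu: "set_pmf \<mu> \<inter> t \<noteq> {}" unfolding set using ne_t sub by blast
  have int: "t \<inter> set_pmf \<mu> = t \<inter> set_pmf \<kappa>" unfolding set using sub by blast
  have fin_t: "finite (t \<inter> set_pmf \<kappa>)" using fin by (rule finite_Int[OF disjI2])
  have "measure \<mu> t = measure \<mu> (t \<inter> set_pmf \<kappa>)"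
    unfolding int[symmetric] by (rule measure_Int_set_pmf[symmetric])
  also have "\<dots> = sum (pmf \<mu>) (t \<inter> set_pmf \<kappa>)"
    by (rule measure_measure_pmf_finite[OF fin_t])
  also have "\<dots> = (\<Sum>x\<in>t \<inter> set_pmf \<kappa>. pmf \<kappa> x / measure \<kappa> s)"
    by (rule sum.cong[OF refl]) (use sub in \<open>simp add: pmf subset_iff\<close>)
  also have "\<dots> = sum (pmf \<kappa>) (t \<inter> set_pmf \<kappa>) / measure \<kappa> s"
    by (rule sum_divide_distrib[symmetric])
  also have "sum (pmf \<kappa>) (t \<inter> set_pmf \<kappa>) = measure \<kappa> (t \<inter> set_pmf \<kappa>)"
    by (rule measure_measure_pmf_finite[OF fin_t, symmetric])
  also have "\<dots> = measure \<kappa> t" by (rule measure_Int_set_pmf)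
  finally have m: "measure \<mu> t = measure \<kappa> t / measure \<kappa> s" .
  have nz: "measure \<kappa> s \<noteq> 0" by (rule measure_measure_pmf_not_zero[OF ne])
  have "pmf (cond_pmf \<mu> t) k = (if k \<in> t then pmf \<mu> k / measure \<mu> t else 0)"
    by (rule pmf_cond[OF ne_mu])
  also have "\<dots> = (if k \<in> t then pmf \<kappa> k / measure \<kappa> t else 0)"
    using sub nz by (simp add: pmf m subset_iff)
  also have "\<dots> = pmf (cond_pmf \<kappa> t) k" by (rule pmf_cond[OF ne_t, symmetric])
  finally show "pmf (cond_pmf (cond_pmf \<kappa> s) t) k = pmf (cond_pmf \<kappa> t) k"
    unfolding \<mu>_def .
qed

text \<open>The distribution of indices given that the coordinates in \<open>S\<close> take the
  values they have at index \<open>k\<close>. Conditioning indices instead of outcomes lets two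
  families \<open>Z\<close> and \<open>Z'\<close> over the same \<kappa> share one conditional law
  whenever they agree on \<open>S\<close>.\<close>

definition cls :: "'k pmf \<Rightarrow> ('k \<Rightarrow> outcome) \<Rightarrow> nat set \<Rightarrow> 'k \<Rightarrow> 'k pmf" where
  "cls \<kappa> Z S k = cond_pmf \<kappa> {k'. \<forall>i\<in>S. Z k' i = Z k i}"

lemma set_cls: "k \<in> set_pmf \<kappa> \<Longrightarrow> set_pmf (cls \<kappa> Z S k) = {k' \<in> set_pmf \<kappa>. \<forall>i\<in>S. Z k' i = Z k i}"
  unfolding cls_def by (subst set_cond_pmf) auto

lemma finite_cls: "finite (set_pmf \<kappa>) \<Longrightarrow> k \<in> set_pmf \<kappa> \<Longrightarrow> finite (set_pmf (cls \<kappa> Z S k))"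
  by (simp add: set_cls)

lemma cls_cong:
  assumes "k \<in> set_pmf \<kappa>" "\<And>k i. k \<in> set_pmf \<kappa> \<Longrightarrow> i \<in> S \<Longrightarrow> Z k i = Z' k i"
  shows "cls \<kappa> Z S k = cls \<kappa> Z' S k"
  unfolding cls_def
proof (rule cond_pmf_cong)
  have "k \<in> {k'. \<forall>i\<in>S. Z k' i = Z k i} \<inter> set_pmf \<kappa>" using assms(1) by simp
  then show "{k'. \<forall>i\<in>S. Z k' i = Z k i} \<inter> set_pmf \<kappa> \<noteq> {}" by blast
qed (use assms in auto)

lemma cls_all: "k \<in> set_pmf \<kappa> \<Longrightarrow> (\<And>k' i. k' \<in> set_pmf \<kappa> \<Longrightarrow> i \<in> S \<Longrightarrow> Z k' i = Z k i) \<Longrightarrow> cls \<kappa> Z S k = \<kappa>"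
proof -
  assume a: "k \<in> set_pmf \<kappa>" "\<And>k' i. k' \<in> set_pmf \<kappa> \<Longrightarrow> i \<in> S \<Longrightarrow> Z k' i = Z k i"
  have "cls \<kappa> Z S k = cond_pmf \<kappa> UNIV"
    unfolding cls_def
  proof (rule cond_pmf_cong)
    have "set_pmf \<kappa> \<subseteq> {k'. \<forall>i\<in>S. Z k' i = Z k i}"
      by (intro subsetI CollectI ballI a(2))
    then show "{k'. \<forall>i\<in>S. Z k' i = Z k i} \<inter> set_pmf \<kappa> = UNIV \<inter> set_pmf \<kappa>"
      "{k'. \<forall>i\<in>S. Z k' i = Z k i} \<inter> set_pmf \<kappa> \<noteq> {}"
      using a(1) by blast+
  qed
  also have "\<dots> = \<kappa>"
  proof (rule pmf_eqI)
    fix j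
    have ne: "set_pmf \<kappa> \<inter> UNIV \<noteq> {}" by (simp add: set_pmf_not_empty)
    show "pmf (cond_pmf \<kappa> UNIV) j = pmf \<kappa> j" unfolding pmf_cond[OF ne] by simp
  qed
  finally show ?thesis .
qed

text \<open>The law of total expectation: agreement on \<open>T\<close> refines agreement on
  \<open>S\<close>, so averaging within the finer classes first changes nothing.\<close>

lemma avg_tower:
  assumes fin: "finite (set_pmf \<kappa>)" and k: "k \<in> set_pmf \<kappa>" and "S \<subseteq> T"
  shows "avg (cls \<kappa> Z S k) (\<lambda>k'. avg (cls \<kappa> Z T k') f) = avg (cls \<kappa> Z S k) f"
proof -
  define \<mu> where "\<mu> = cls \<kappa> Z S k"
  define r where "r x y \<longleftrightarrow> (\<forall>i\<in>T. Z y i = Z x i)" for x y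
  have set\<mu>: "set_pmf \<mu> = {k' \<in> set_pmf \<kappa>. \<forall>i\<in>S. Z k' i = Z k i}"
    using set_cls[OF k] by (simp add: \<mu>_def)
  then have fin\<mu>: "finite (set_pmf \<mu>)" using fin by simp
  have inner: "cls \<kappa> Z T k' = cond_pmf \<mu> {y. r k' y}" if "k' \<in> set_pmf \<mu>" for k'
  proof -
    have "cond_pmf \<mu> {y. r k' y} = cond_pmf \<kappa> {y. r k' y}"
      unfolding \<mu>_def cls_def
    proof (rule cond_cond_pmf[OF fin])
      have "k' \<in> set_pmf \<kappa> \<inter> {y. r k' y}" using that set\<mu> by (simp add: r_def)
      then show "set_pmf \<kappa> \<inter> {y. r k' y} \<noteq> {}" by (metis empty_iff)
      have k': "Z k' i = Z k i" if "i \<in> S" for i using \<open>k' \<in> set_pmf \<mu>\<close> set\<mu> that by simp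
      show "{y. r k' y} \<subseteq> {k'. \<forall>i\<in>S. Z k' i = Z k i}"
        using k' \<open>S \<subseteq> T\<close> by (auto simp: r_def)
    qed
    then show ?thesis by (simp add: cls_def r_def)
  qed
  have r_refl: "r x x" for x by (simp add: r_def)
  have r_sym: "r x y \<Longrightarrow> r y x" for x y by (simp add: r_def)
  have r_trans: "r x y \<Longrightarrow> r y z \<Longrightarrow> r x z" for x y z by (simp add: r_def)
  have ne: "set_pmf \<mu> \<inter> {y. r x y} \<noteq> {}" "set_pmf \<mu> \<inter> {y. r y x} \<noteq> {}" if "x \<in> set_pmf \<mu>" for x
  proof -
    have "x \<in> set_pmf \<mu> \<inter> {y. r x y}" "x \<in> set_pmf \<mu> \<inter> {y. r y x}"
      using that r_refl by simp_all
    then show "set_pmf \<mu> \<inter> {y. r x y} \<noteq> {}" "set_pmf \<mu> \<inter> {y. r y x} \<noteq> {}"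
      by (metis empty_iff)+
  qed
  \<comment> \<open>Drawing an index and redrawing it within its class returns the original law. The
    side condition compares the masses of the classes of two related indices, which
    coincide.\<close>
  have bind: "bind_pmf \<mu> (\<lambda>x. cond_pmf \<mu> {y. r x y}) = \<mu>"
  proof (rule bind_cond_pmf_cancel)
    fix x y assume xy: "r x y"
    have "{z. r x z} = {z. r z y}"
    proof (intro set_eqI iffI CollectI)
      fix z assume "z \<in> {z. r x z}"
      then have "r x z" by simp
      then show "r z y" using xy by (blast intro: r_sym r_trans)
    next
      fix z assume "z \<in> {z. r z y}"
      then have "r z y" by simp
      then show "r x z" using xy by (blast intro: r_sym r_trans)
    qed
    then show "measure \<mu> {z. r x z} = measure \<mu> {z. r z y}" by simp
  qed (rule ne, assumption)+
  have fin_cond: "finite (set_pmf (cond_pmf \<mu> {y. r x y}))" if "x \<in> set_pmf \<mu>" for x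
    unfolding set_cond_pmf[OF ne(1)[OF that]] using fin\<mu> by simp
  have "avg \<mu> f = avg (bind_pmf \<mu> (\<lambda>x. cond_pmf \<mu> {y. r x y})) f"
    by (simp only: bind)
  also have "\<dots> = (\<Sum>x\<in>set_pmf \<mu>. pmf \<mu> x *\<^sub>R avg (cond_pmf \<mu> {y. r x y}) f)"
    by (rule pmf_expectation_bind[OF fin\<mu> fin_cond]) simp_all
  also have "\<dots> = (\<Sum>x\<in>set_pmf \<mu>. pmf \<mu> x *\<^sub>R avg (cls \<kappa> Z T x) f)"
    by (rule sum.cong) (simp_all add: inner)
  also have "\<dots> = avg \<mu> (\<lambda>k'. avg (cls \<kappa> Z T k') f)"
    by (rule integral_measure_pmf[OF fin\<mu>, symmetric]) simp
  finally show ?thesis by (simp add: \<mu>_def)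
qed

lemma restrict_eq_iff: "restrict f S = restrict g S \<longleftrightarrow> (\<forall>i\<in>S. f i = g i)"
  by (auto simp: fun_eq_iff restrict_def)

section \<open>The utility recursion and degenerate continuations\<close>

section \<open>Node utilities\<close>

locale rct_fun = rct +
  fixes uo :: root_fun and u :: cluster_fun
begin

text \<open>The utility at \<open>v\<close> of the lottery \<open>map_pmf Z \<kappa>\<close>, with
  the history read off the outcome \<open>Z k\<close>. For an index in the support this history has
  positive probability, so the default value 0 does not arise.\<close>

definition eu :: "vertex \<Rightarrow> 'k pmf \<Rightarrow> ('k \<Rightarrow> outcome) \<Rightarrow> 'k \<Rightarrow> real" where
  "eu v \<kappa> Z k = utility E uo u v (restrict (Z k) (anc v)) (map_pmf Z \<kappa>)"

definition val :: "vertex \<Rightarrow> outcome \<Rightarrow> real" where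
  "val v \<omega> = utility E uo u v (restrict \<omega> (anc v)) (return_pmf \<omega>)"

text \<open>The aggregator of a vertex, with root and clusters treated alike; history and own
  coordinates are both read off one full outcome.\<close>

definition G :: "vertex \<Rightarrow> outcome \<Rightarrow> (nat set \<Rightarrow> real) \<Rightarrow> real" where
  "G v \<omega> w = (case v of None \<Rightarrow> uo w | Some A \<Rightarrow> u A (restrict \<omega> (anc v)) (restrict \<omega> A) w)"

lemma val_eu: "val v \<omega> = eu v (return_pmf ()) (\<lambda>_. \<omega>) ()"
  by (simp add: val_def eu_def)

lemma G_cong: "(\<And>i. i \<in> anc v \<union> own_coords v \<Longrightarrow> \<omega> i = \<omega>' i) \<Longrightarrow> G v \<omega> = G v \<omega>'"
proof -
  assume "\<And>i. i \<in> anc v \<union> own_coords v \<Longrightarrow> \<omega> i = \<omega>' i"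
  then have "restrict \<omega> (anc v) = restrict \<omega>' (anc v)"
    "restrict \<omega> (own_coords v) = restrict \<omega>' (own_coords v)"
    by (auto simp: restrict_eq_iff)
  then show ?thesis by (cases v) (auto simp: G_def intro!: ext)
qed

text \<open>Conditioning the image lottery on a history amounts to conditioning the index
  distribution, and the histories passed to the children are again restrictions of the outcomes
  \<open>Z k'\<close>. At the root the average is over a constant.\<close>

lemma eu_rec:
  assumes k: "k \<in> set_pmf \<kappa>"
  shows "eu v \<kappa> Z k = avg (cls \<kappa> Z (anc v) k) (\<lambda>k'. G v (Z k') (\<lambda>B\<in>ch v. eu (Some B) \<kappa> Z k'))"
proof (cases v)
  case None
  have "restrict (Z k') (anc (Some B)) = (\<lambda>_. undefined)" if "B \<in> ch None" for k' B
    using anc_child[OF that] by auto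
  then have "(\<lambda>B\<in>ch None. eu (Some B) \<kappa> Z k') =
      (\<lambda>B\<in>ch None. cluster_utility E u B (\<lambda>_. undefined) (map_pmf Z \<kappa>))" for k'
    by (auto simp: eu_def utility_def restrict_def fun_eq_iff)
  then show ?thesis by (simp add: None eu_def utility_def G_def)
next
  case (Some A)
  let ?C = "anc (Some A)"
  let ?x = "restrict (Z k) ?C"
  have mem: "?x \<in> set_pmf (marginal (map_pmf Z \<kappa>) ?C)"
    using k by (auto simp: marginal_def)
  have "cond_pmf (map_pmf Z \<kappa>) {y. restrict y ?C = ?x} = map_pmf Z (cls \<kappa> Z ?C k)"
    using k by (subst cond_map_pmf) (auto simp: cls_def restrict_eq_iff vimage_def)
  then have cond: "conditional (map_pmf Z \<kappa>) A ?C ?x = map_pmf (\<lambda>k'. restrict (Z k') A) (cls \<kappa> Z ?C k)"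
    by (simp add: conditional_def marginal_def map_pmf_comp)
  have "eu v \<kappa> Z k = avg (cls \<kappa> Z ?C k) (\<lambda>k'. u A ?x (restrict (Z k') A)
      (\<lambda>B\<in>ch (Some A). cluster_utility E u B (merge ?C A (?x, restrict (Z k') A)) (map_pmf Z \<kappa>)))"
    unfolding eu_def Some utility_def
    by (simp, subst cluster_utility_eq[OF is_rct fin]) (use mem in \<open>simp add: cond\<close>)
  also have "\<dots> = avg (cls \<kappa> Z ?C k) (\<lambda>k'. G v (Z k') (\<lambda>B\<in>ch v. eu (Some B) \<kappa> Z k'))"
  proof (rule avg_cong)
    fix k' assume "k' \<in> set_pmf (cls \<kappa> Z ?C k)"
    with set_cls[OF k] have agree: "\<forall>i\<in>?C. Z k' i = Z k i" by blast
    then have x: "?x = restrict (Z k') ?C" by (auto simp: restrict_eq_iff)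
    have m: "merge ?C A (?x, restrict (Z k') A) = restrict (Z k') (anc (Some B))" if "B \<in> ch (Some A)" for B
      using anc_child[OF that] agree by (auto simp: merge_def fun_eq_iff)
    have "(\<lambda>B\<in>ch (Some A). cluster_utility E u B (merge ?C A (?x, restrict (Z k') A)) (map_pmf Z \<kappa>)) =
        (\<lambda>B\<in>ch (Some A). eu (Some B) \<kappa> Z k')"
    proof (rule restrict_ext)
      fix B assume B: "B \<in> ch (Some A)"
      show "cluster_utility E u B (merge ?C A (?x, restrict (Z k') A)) (map_pmf Z \<kappa>) = eu (Some B) \<kappa> Z k'"
        unfolding m[OF B] by (simp add: eu_def utility_def)
    qed
    then show "u A ?x (restrict (Z k') A)
      (\<lambda>B\<in>ch (Some A). cluster_utility E u B (merge ?C A (?x, restrict (Z k') A)) (map_pmf Z \<kappa>)) =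
      G v (Z k') (\<lambda>B\<in>ch v. eu (Some B) \<kappa> Z k')"
      by (simp add: Some G_def x)
  qed
  finally show ?thesis by (simp add: Some)
qed

lemma val_rec: "val v \<omega> = G v \<omega> (\<lambda>B\<in>ch v. val (Some B) \<omega>)"
proof -
  have "cls (return_pmf ()) (\<lambda>_. \<omega>) (anc v) () = return_pmf ()"
    by (rule cls_all) auto
  then show ?thesis
    unfolding val_eu by (subst eu_rec) auto
qed

text \<open>Changes elsewhere in the tree are invisible at \<open>v\<close>, which is what allows
  the subtrees of siblings to be varied separately.\<close>

lemma eu_local:
  assumes "v \<in> V" "k \<in> set_pmf \<kappa>"
    "\<And>k i. k \<in> set_pmf \<kappa> \<Longrightarrow> i \<in> anc v \<union> sub v \<Longrightarrow> Z k i = Z' k i"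
  shows "eu v \<kappa> Z k = eu v \<kappa> Z' k"
  using assms
proof (induction v arbitrary: k rule: tree_induct_up)
  case (node v)
  have "cls \<kappa> Z (anc v) k = cls \<kappa> Z' (anc v) k"
    by (rule cls_cong) (use node in auto)
  moreover have "G v (Z k') (\<lambda>B\<in>ch v. eu (Some B) \<kappa> Z k') = G v (Z' k') (\<lambda>B\<in>ch v. eu (Some B) \<kappa> Z' k')"
    if "k' \<in> set_pmf (cls \<kappa> Z (anc v) k)" for k'
  proof -
    have k': "k' \<in> set_pmf \<kappa>" using that set_cls[OF node.prems(1)] by auto
    have "eu (Some B) \<kappa> Z k' = eu (Some B) \<kappa> Z' k'" if "B \<in> ch v" for B
      by (rule node.IH[OF that k']) (rule node.prems(2)[OF _ child_cover[OF that]])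
    note child_eq = this
    have "(\<lambda>B\<in>ch v. eu (Some B) \<kappa> Z k') = (\<lambda>B\<in>ch v. eu (Some B) \<kappa> Z' k')"
      by (rule restrict_ext) (rule child_eq)
    moreover have "G v (Z k') = G v (Z' k')"
      by (rule G_cong) (rule node.prems(2)[OF k' anc_own_cover])
    ultimately show ?thesis by simp
  qed
  ultimately show ?case
    unfolding eu_rec[OF node.prems(1)] by (auto intro: avg_cong)
qed

lemma val_local:
  assumes "v \<in> V" "\<And>i. i \<in> anc v \<union> sub v \<Longrightarrow> \<omega> i = \<omega>' i"
  shows "val v \<omega> = val v \<omega>'"
  unfolding val_eu by (rule eu_local) (use assms in auto)

text \<open>With a degenerate continuation, the conditional averages at \<open>v\<close> and at all
  vertices below it are over equal values.\<close>

lemma eu_single: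
  assumes "v \<in> V" "k \<in> set_pmf \<kappa>"
    "\<And>k' i. k' \<in> set_pmf \<kappa> \<Longrightarrow> (\<And>i. i \<in> anc v \<Longrightarrow> Z k' i = Z k i) \<Longrightarrow> i \<in> sub v \<Longrightarrow> Z k' i = Z k i"
  shows "eu v \<kappa> Z k = val v (Z k)"
  using assms
proof (induction v arbitrary: k rule: tree_induct_up)
  case (node v)
  have "G v (Z k') (\<lambda>B\<in>ch v. eu (Some B) \<kappa> Z k') = val v (Z k)"
    if "k' \<in> set_pmf (cls \<kappa> Z (anc v) k)" for k'
  proof -
    have k': "k' \<in> set_pmf \<kappa>" "\<And>i. i \<in> anc v \<Longrightarrow> Z k' i = Z k i"
      using that set_cls[OF node.prems(1)] by auto
    have sub: "Z k' i = Z k i" if "i \<in> sub v" for i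
      by (rule node.prems(2)[OF k'(1) _ that]) (rule k'(2))
    have agree: "Z k' i = Z k i" if "i \<in> anc v \<union> sub v" for i
      using that by (elim UnE) (rule k'(2), assumption, rule sub, assumption)
    have "eu (Some B) \<kappa> Z k' = val (Some B) (Z k)" if B: "B \<in> ch v" for B
    proof -
      have "eu (Some B) \<kappa> Z k' = val (Some B) (Z k')"
      proof (rule node.IH[OF B k'(1)])
        fix k'' i assume a: "k'' \<in> set_pmf \<kappa>" "\<And>i. i \<in> anc (Some B) \<Longrightarrow> Z k'' i = Z k' i" "i \<in> sub (Some B)"
        have anc: "Z k'' i = Z k i" if "i \<in> anc v" for i
        proof -
          have "i \<in> anc (Some B)" unfolding anc_child[OF B] using that by simp
          then have "Z k'' i = Z k' i" by (rule a(2))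
          also have "\<dots> = Z k i" by (rule k'(2)[OF that])
          finally show ?thesis .
        qed
        have i: "i \<in> sub v" using child_sub[OF B] a(3) by (rule subsetD)
        have "Z k'' i = Z k i" by (rule node.prems(2)[OF a(1) anc i])
        also have "\<dots> = Z k' i" by (rule sub[OF i, symmetric])
        finally show "Z k'' i = Z k' i" .
      qed
      also have "\<dots> = val (Some B) (Z k)"
        by (rule val_local[OF child_V[OF B]]) (rule agree[OF child_cover[OF B]])
      finally show ?thesis .
    qed
    note child_eq = this
    have "(\<lambda>B\<in>ch v. eu (Some B) \<kappa> Z k') = (\<lambda>B\<in>ch v. val (Some B) (Z k))"
      by (rule restrict_ext) (rule child_eq)
    moreover have "G v (Z k') = G v (Z k)"
      by (rule G_cong) (rule agree[OF anc_own_cover])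
    ultimately show ?thesis by (simp only: val_rec[of v "Z k"])
  qed
  note * = this
  show ?case unfolding eu_rec[OF node.prems(1)] by (rule avg_const) (rule *)
qed

text \<open>If history and own coordinates determine the rest of the subtree, every child is
  evaluated at a point mass. The aggregator then never sees a proper average, and the expectation is
  over final values.\<close>

lemma eu_separated:
  assumes v: "v \<in> V" and k: "k \<in> set_pmf \<kappa>"
    and sep: "\<And>k1 k2 i. k1 \<in> set_pmf \<kappa> \<Longrightarrow> k2 \<in> set_pmf \<kappa> \<Longrightarrow> (\<And>i. i \<in> anc v \<Longrightarrow> Z k1 i = Z k i) \<Longrightarrow>
      (\<And>i. i \<in> anc v \<union> own_coords v \<Longrightarrow> Z k1 i = Z k2 i) \<Longrightarrow> i \<in> sub v \<Longrightarrow> Z k1 i = Z k2 i"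
  shows "eu v \<kappa> Z k = avg (cls \<kappa> Z (anc v) k) (\<lambda>k'. val v (Z k'))"
  unfolding eu_rec[OF k]
proof (rule avg_cong)
  fix k' assume "k' \<in> set_pmf (cls \<kappa> Z (anc v) k)"
  then have k': "k' \<in> set_pmf \<kappa>" "\<And>i. i \<in> anc v \<Longrightarrow> Z k' i = Z k i" using set_cls[OF k] by auto
  have "eu (Some B) \<kappa> Z k' = val (Some B) (Z k')" if B: "B \<in> ch v" for B
  proof (rule eu_single)
    fix k'' i assume a: "k'' \<in> set_pmf \<kappa>" "\<And>i. i \<in> anc (Some B) \<Longrightarrow> Z k'' i = Z k' i" "i \<in> sub (Some B)"
    show "Z k'' i = Z k' i"
    proof (rule sep[OF a(1) k'(1)])
      fix i assume "i \<in> anc v"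
      then show "Z k'' i = Z k i" using a(2)[of i] k'(2)[of i] anc_child[OF B] by simp
    next
      fix i assume "i \<in> anc v \<union> own_coords v"
      then show "Z k'' i = Z k' i" using a(2)[of i] anc_child[OF B] by simp
    qed (rule subsetD[OF child_sub[OF B] a(3)])
  qed (use k' child_V[OF B] in simp_all)
  note child_eq = this
  have "(\<lambda>B\<in>ch v. eu (Some B) \<kappa> Z k') = (\<lambda>B\<in>ch v. val (Some B) (Z k'))"
    by (rule restrict_ext) (rule child_eq)
  then show "G v (Z k') (\<lambda>B\<in>ch v. eu (Some B) \<kappa> Z k') = val v (Z k')"
    by (simp only: val_rec[of v "Z k'"])
qed

lemma eu_leaf: "v \<in> V \<Longrightarrow> k \<in> set_pmf \<kappa> \<Longrightarrow> ch v = {} \<Longrightarrow>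
    eu v \<kappa> Z k = avg (cls \<kappa> Z (anc v) k) (\<lambda>k'. val v (Z k'))"
  by (rule eu_separated) (use sub_rec[of v] in auto)

end

section \<open>From generic interior points to the whole box\<close>

section \<open>Functions on a box\<close>

text \<open>Limits as a perturbation parameter decreases to 0 may ignore finitely many exceptional
  values of it.\<close>

lemma at_right_not_in_finite: "finite (Q :: real set) \<Longrightarrow> \<forall>\<^sub>F s in at_right 0. s \<notin> Q"
proof -
  assume "finite Q"
  then have "\<forall>\<^sub>F s in at_right (0::real). \<forall>x\<in>Q. s \<noteq> x"
    by (simp add: eventually_ball_finite_distrib eventually_neq_at_within)
  then show ?thesis by (rule eventually_mono) blast
qed

lemma at_right_unit: "\<forall>\<^sub>F s in at_right (0::real). 0 < s \<and> s < 1"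
  by (simp add: eventually_conj eventually_at_right_less eventually_at_right_field[of _ 0] exI[of _ 1])

abbreviation Box :: "'b set \<Rightarrow> ('b \<Rightarrow> real) \<Rightarrow> ('b \<Rightarrow> real) \<Rightarrow> ('b \<Rightarrow> real) set" where
  "Box K l h \<equiv> (\<Pi>\<^sub>E B\<in>K. {l B..h B})"

lemma convex_interval:
  fixes x y s :: real
  assumes "x \<in> {l..h}" "y \<in> {l..h}" "0 \<le> s" "s \<le> 1"
  shows "(1 - s) * x + s * y \<in> {l..h}"
proof -
  have "convex {l..h}" by simp
  from convexD_alt[OF this assms(1,2,3,4)] show ?thesis by simp
qed

lemma convex_interval_interior:
  fixes x y s :: real
  assumes "x \<in> {l..h}" "y \<in> {l<..<h}" "0 < s" "s \<le> 1"
  shows "(1 - s) * x + s * y \<in> {l<..<h}"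
proof -
  have "(1 - s) * l + s * l < (1 - s) * x + s * y"
    using assms by (intro add_le_less_mono mult_left_mono mult_strict_left_mono) auto
  moreover have "(1 - s) * x + s * y < (1 - s) * h + s * h"
    using assms by (intro add_le_less_mono mult_left_mono mult_strict_left_mono) auto
  ultimately show ?thesis by (simp add: algebra_simps)
qed

lemma box_mix:
  "w \<in> Box K l h \<Longrightarrow> w' \<in> Box K l h \<Longrightarrow> 0 \<le> s \<Longrightarrow> s \<le> 1 \<Longrightarrow> (\<lambda>B\<in>K. (1 - s) * w B + s * w' B) \<in> Box K l h"
  using convex_interval by (intro restrict_PiE_iff[THEN iffD2] ballI) (blast dest: PiE_mem)

lemma continuous_on_box_compose:
  assumes "continuous_on (Box K l h) G" "\<And>B. B \<in> K \<Longrightarrow> continuous_on S (\<lambda>s. f s B)"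
    "\<And>s. s \<in> S \<Longrightarrow> (\<lambda>B\<in>K. f s B) \<in> Box K l h"
  shows "continuous_on S (\<lambda>s. G (\<lambda>B\<in>K. f s B))"
proof (rule continuous_on_compose2[OF assms(1)])
  show "continuous_on S (\<lambda>s. \<lambda>B\<in>K. f s B)"
  proof (rule continuous_on_coordinatewise_then_product)
    fix B show "continuous_on S (\<lambda>s. restrict (f s) K B)"
      using assms(2) by (cases "B \<in> K") simp_all
  qed
qed (use assms(3) in blast)

lemma tendsto_mix_at_right:
  fixes G :: "('b \<Rightarrow> real) \<Rightarrow> real"
  assumes "continuous_on (Box K l h) G" "a \<in> Box K l h" "c \<in> Box K l h"
  shows "((\<lambda>s. G (\<lambda>B\<in>K. (1 - s) * a B + s * c B)) \<longlongrightarrow> G a) (at_right 0)"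
proof -
  have "continuous_on {0..1} (\<lambda>s. G (\<lambda>B\<in>K. (1 - s) * a B + s * c B))"
    by (rule continuous_on_box_compose[OF assms(1)])
      (use box_mix[OF assms(2,3)] in \<open>auto intro!: continuous_intros\<close>)
  then have "((\<lambda>s. G (\<lambda>B\<in>K. (1 - s) * a B + s * c B)) \<longlongrightarrow> G (\<lambda>B\<in>K. (1 - 0) * a B + 0 * c B)) (at 0 within {0..1})"
    unfolding continuous_on_def by (rule bspec) simp
  moreover have "(\<lambda>B\<in>K. (1 - 0) * a B + 0 * c B) = a"
    using assms(2) by (auto simp: restrict_def PiE_def extensional_def fun_eq_iff)
  moreover have "at (0::real) within {0..1} = at_right 0"
    by (rule at_within_Icc_at_right) simp
  ultimately show ?thesis by simp
qed

lemma finite_affine_vimage: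
  fixes x y :: real
  assumes "finite F" "y \<noteq> 0"
  shows "finite {s. x + s * y \<in> F}"
proof -
  have "inj (\<lambda>s. x + s * y)" using assms(2) by (auto intro!: injI)
  then have "finite ((\<lambda>s. x + s * y) -` F)" by (rule finite_vimageI[OF assms(1)])
  then show ?thesis by (simp add: vimage_def)
qed

text \<open>The hypothesis \<open>loc\<close> covers only generic interior points. The segment from
  \<open>a\<close> to \<open>b\<close> is contracted by the factor \<open>1 - s\<close> towards an
  interior point \<open>c\<close>. For all but finitely many \<open>s\<close> the contracted segment
  is generic off finitely many of its points, so \<open>G\<close> along it is continuous with zero
  derivative there, hence constant. Letting \<open>s\<close> tend to 0 gives the claim.\<close>

lemma constant_along_direction:
  fixes G :: "('b \<Rightarrow> real) \<Rightarrow> real"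
  assumes K: "finite K" and lh: "\<And>B. B \<in> K \<Longrightarrow> l B < h B"
    and cont: "continuous_on (Box K l h) G" and F: "\<And>B. finite (F B)"
    and loc: "\<And>u. u \<in> (\<Pi>\<^sub>E B\<in>K. {l B<..<h B} - F B) \<Longrightarrow>
      \<exists>\<delta>>0. \<forall>\<rho>. \<bar>\<rho>\<bar> < \<delta> \<longrightarrow> G (\<lambda>B\<in>K. u B + \<rho> * d B) = G u"
    and a: "a \<in> Box K l h" and b: "b \<in> Box K l h"
    and ab: "\<And>B. B \<in> K \<Longrightarrow> b B - a B = \<kappa> * d B"
  shows "G a = G b"
proof -
  \<comment> \<open>Of the two points that trisect the interval, at least one differs from
    \<open>a B\<close>.\<close>
  have "\<exists>c\<in>{l B<..<h B}. c \<noteq> a B" if "B \<in> K" for B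
  proof -
    have "l B < (2 * l B + h B) / 3 \<and> (2 * l B + h B) / 3 < h B" "l B < (l B + 2 * h B) / 3 \<and> (l B + 2 * h B) / 3 < h B"
      "(2 * l B + h B) / 3 \<noteq> (l B + 2 * h B) / 3" using lh[OF that] by auto
    then show ?thesis by (metis greaterThanLessThan_iff)
  qed
  then obtain c where c: "\<And>B. B \<in> K \<Longrightarrow> c B \<in> {l B<..<h B}" "\<And>B. B \<in> K \<Longrightarrow> c B \<noteq> a B"
    by metis
  have cbox: "restrict c K \<in> Box K l h" using c(1) by (auto simp: less_imp_le)
  \<comment> \<open>These contain the values of \<open>s\<close> at which a coordinate that is
    constant along the segment hits its exceptional set; \<open>c B \<noteq> a B\<close> makes them
    finitely many.\<close>
  define bad where "bad = (\<Union>B\<in>K. {s. a B + s * (c B - a B) \<in> F B})"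
  have "finite {s. a B + s * (c B - a B) \<in> F B}" if "B \<in> K" for B
    by (rule finite_affine_vimage[OF F]) (use c(2)[OF that] in simp)
  then have bad: "finite bad" unfolding bad_def using K by blast
  have eq: "G (\<lambda>B\<in>K. (1 - s) * a B + s * restrict c K B) = G (\<lambda>B\<in>K. (1 - s) * b B + s * restrict c K B)"
    if s: "0 < s" "s < 1" "s \<notin> bad" for s
  proof -
    define p where "p r B = (1 - s) * (a B + r * (b B - a B)) + s * c B" for r B
    define g where "g r = G (\<lambda>B\<in>K. p r B)" for r
    have ab_mix: "a B + r * (b B - a B) \<in> {l B..h B}" if "r \<in> {0..1}" "B \<in> K" for r B
    proof -
      have "(1 - r) * a B + r * b B \<in> {l B..h B}"
        by (rule convex_interval) (use PiE_mem[OF a that(2)] PiE_mem[OF b that(2)] that(1) in auto)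
      then show ?thesis by (simp add: algebra_simps)
    qed
    have pint: "p r B \<in> {l B<..<h B}" if "r \<in> {0..1}" "B \<in> K" for r B
      unfolding p_def
      by (rule convex_interval_interior[OF ab_mix[OF that] c(1)[OF that(2)]]) (use s in auto)
    have pbox: "(\<lambda>B\<in>K. p r B) \<in> Box K l h" if "r \<in> {0..1}" for r
      using pint[OF that] by (auto simp: less_imp_le)
    have contg: "continuous_on {0..1} g"
      unfolding g_def by (rule continuous_on_box_compose[OF cont _ pbox])
        (auto simp: p_def intro!: continuous_intros)
    \<comment> \<open>The other coordinates vary along the contracted segment and meet their
      exceptional sets only finitely often.\<close>
    define ex where "ex = (\<Union>B\<in>{B\<in>K. a B \<noteq> b B}. {r. p r B \<in> F B})"
    have "finite {r. p r B \<in> F B}" if "B \<in> K" "a B \<noteq> b B" for B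
    proof -
      have "finite {r. ((1 - s) * a B + s * c B) + r * ((1 - s) * (b B - a B)) \<in> F B}"
        by (rule finite_affine_vimage[OF F]) (use that s in simp)
      then show ?thesis by (simp add: p_def algebra_simps)
    qed
    then have ex: "finite ex" unfolding ex_def using K by auto
    have der: "(g has_derivative (\<lambda>h. 0)) (at r within {0..1})" if r: "r \<in> {0..1} - ex" for r
    proof -
      have "p r B \<notin> F B" if B: "B \<in> K" for B
      proof (cases "a B = b B")
        case True
        then have "p r B = a B + s * (c B - a B)" by (simp add: p_def algebra_simps)
        then show ?thesis using s(3) B by (auto simp: bad_def)
      next
        case False
        then show ?thesis using r B by (auto simp: ex_def)
      qed
      then have "(\<lambda>B\<in>K. p r B) \<in> (\<Pi>\<^sub>E B\<in>K. {l B<..<h B} - F B)"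
        using pint r by auto
      from loc[OF this] obtain \<delta> where \<delta>: "\<delta> > 0"
        "\<And>\<rho>. \<bar>\<rho>\<bar> < \<delta> \<Longrightarrow> G (\<lambda>B\<in>K. restrict (p r) K B + \<rho> * d B) = g r" by (auto simp: g_def)
      \<comment> \<open>A parameter change below \<eta> shifts the point by a multiple of
        \<open>d\<close> smaller than \<delta>; the summand 1 covers the case
        \<open>\<kappa> = 0\<close>.\<close>
      define \<eta> where "\<eta> = \<delta> / (\<bar>\<kappa>\<bar> + 1)"
      have \<eta>: "\<eta> > 0" using \<delta>(1) by (simp add: \<eta>_def)
      have near: "g r = g r'" if "dist r' r < \<eta>" for r'
      proof -
        define \<rho> where "\<rho> = (1 - s) * (r' - r) * \<kappa>"
        have "\<bar>\<rho>\<bar> = (1 - s) * \<bar>r' - r\<bar> * \<bar>\<kappa>\<bar>" using s by (simp add: \<rho>_def abs_mult)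
        also have "\<dots> \<le> 1 * \<bar>r' - r\<bar> * (\<bar>\<kappa>\<bar> + 1)"
          using s by (intro mult_mono) auto
        also have "\<dots> < \<delta>" using that by (simp add: \<eta>_def dist_real_def pos_less_divide_eq)
        finally have small: "\<bar>\<rho>\<bar> < \<delta>" .
        have "(\<lambda>B\<in>K. restrict (p r) K B + \<rho> * d B) = (\<lambda>B\<in>K. p r' B)"
        proof (rule restrict_ext)
          fix B assume B: "B \<in> K"
          have "p r' B = p r B + (1 - s) * (r' - r) * (b B - a B)" by (simp add: p_def algebra_simps)
          also have "\<dots> = p r B + \<rho> * d B" by (simp add: ab[OF B] \<rho>_def)
          finally show "restrict (p r) K B + \<rho> * d B = p r' B" using B by simp
        qed
        with \<delta>(2)[OF small] show ?thesis by (simp add: g_def)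
      qed
      show ?thesis
        by (rule has_derivative_transform_within[OF has_derivative_const[of "g r"] \<eta>]) (use r near in auto)
    qed
    have "g 1 = g 0"
      by (rule has_derivative_zero_unique_strong_interval[OF ex contg refl der]) auto
    then show ?thesis by (simp add: g_def p_def cong: restrict_cong)
  qed
  have ev: "\<forall>\<^sub>F s in at_right 0. G (\<lambda>B\<in>K. (1 - s) * a B + s * restrict c K B) = G (\<lambda>B\<in>K. (1 - s) * b B + s * restrict c K B)"
    using at_right_unit at_right_not_in_finite[OF bad] by eventually_elim (use eq in blast)
  have "((\<lambda>s. G (\<lambda>B\<in>K. (1 - s) * b B + s * restrict c K B)) \<longlongrightarrow> G a) (at_right 0)"
    using tendsto_mix_at_right[OF cont a cbox] tendsto_cong[OF ev] by blast
  from tendsto_unique[OF _ this tendsto_mix_at_right[OF cont b cbox]] show ?thesis by simp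
qed

text \<open>The weighted sum \<open>L\<close> is invariant under shifts along \<open>d\<close>, so
  \<open>G\<close> depends on the two coordinates only through \<open>L\<close>. If \<open>L\<close>
  increases, a shift along \<open>d\<close> brings the first point coordinatewise below the second
  one, and strict monotonicity decides.\<close>

lemma ordinally_linear_in_two:
  fixes G :: "('b \<Rightarrow> real) \<Rightarrow> real"
  assumes mono: "\<And>w w'. w \<in> Box K l h \<Longrightarrow> w' \<in> Box K l h \<Longrightarrow> (\<And>D. D \<in> K \<Longrightarrow> w D \<le> w' D) \<Longrightarrow>
      w \<noteq> w' \<Longrightarrow> G w < G w'"
    and gl: "\<And>a b \<kappa>. a \<in> Box K l h \<Longrightarrow> b \<in> Box K l h \<Longrightarrow> (\<And>D. D \<in> K \<Longrightarrow> b D - a D = \<kappa> * d D) \<Longrightarrow> G a = G b"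
    and BC: "B \<in> K" "C \<in> K" "B \<noteq> C" and d: "d B > 0" "d C < 0" "\<And>D. D \<in> K \<Longrightarrow> D \<noteq> B \<Longrightarrow> D \<noteq> C \<Longrightarrow> d D = 0"
    and w: "w \<in> Box K l h" "w' \<in> Box K l h" "\<And>D. D \<in> K \<Longrightarrow> D \<noteq> B \<Longrightarrow> D \<noteq> C \<Longrightarrow> w D = w' D"
  shows "G w \<le> G w' \<longleftrightarrow> - d C * w B + d B * w C \<le> - d C * w' B + d B * w' C"
proof -
  define L where "L w = - d C * w B + d B * w C" for w :: "'b \<Rightarrow> real"
  have eq: "G v = G v'" if v: "v \<in> Box K l h" "v' \<in> Box K l h"
      "\<And>D. D \<in> K \<Longrightarrow> D \<noteq> B \<Longrightarrow> D \<noteq> C \<Longrightarrow> v D = v' D" "L v = L v'" for v v'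
  proof (rule gl[OF v(1,2)])
    fix D assume D: "D \<in> K"
    have C: "v' C - v C = (v' B - v B) / d B * d C"
      using v(4) d(1,2) by (simp add: L_def field_simps)
    show "v' D - v D = (v' B - v B) / d B * d D"
      using C d v(3)[OF D] D by (cases "D = B"; cases "D = C") auto
  qed
  have less: "G v < G v'" if v: "v \<in> Box K l h" "v' \<in> Box K l h"
      "\<And>D. D \<in> K \<Longrightarrow> D \<noteq> B \<Longrightarrow> D \<noteq> C \<Longrightarrow> v D = v' D" "L v < L v'" for v v'
  proof -
    have shift: "G v < G v'"
      if e: "d E < 0 \<and> d E' > 0 \<or> d E > 0 \<and> d E' < 0" "{E, E'} = {B, C}" "v E < v' E" "v' E' \<le> v E'" for E E'
    proof -
      have EK: "E \<in> K" "E' \<in> K" "E \<noteq> E'" using e(2) BC by (auto simp: doubleton_eq_iff)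
      \<comment> \<open>Shift along \<open>d\<close> until coordinate \<open>E'\<close> agrees with
        that of \<open>v'\<close>. Coordinate \<open>E\<close> rises, but it stays below
        \<open>v' E\<close> because \<open>L v'' = L v < L v'\<close>; so the shifted point remains
        in the box.\<close>
      define v'' where "v'' = v(E := v E + d E / d E' * (v' E' - v E'), E' := v' E')"
      have Lt: "L v'' = L v"
        using e(1,2) EK(3) d(1,2) by (auto simp: L_def v''_def doubleton_eq_iff field_simps)
      have "d E / d E' \<le> 0" using e(1) by (auto intro: divide_nonpos_pos divide_nonneg_neg)
      then have "0 \<le> d E / d E' * (v' E' - v E')" using e(4) by (intro mult_nonpos_nonpos) auto
      then have up: "v E \<le> v'' E" using EK(3) by (simp add: v''_def)
      have L': "L v'' < L v'" using Lt v(4) by simp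
      have below: "v'' E < v' E"
        using L' EK(3) e(1,2) d(1,2) by (auto simp: L_def v''_def doubleton_eq_iff mult_less_cancel_left)
      have vm: "v'' \<in> Box K l h"
      proof (rule PiE_I)
        fix D assume D: "D \<in> K"
        show "v'' D \<in> {l D..h D}"
        proof (cases "D = E")
          case True
          then show ?thesis using up below PiE_mem[OF v(1) D] PiE_mem[OF v(2) D] by auto
        next
          case False
          then show ?thesis using PiE_mem[OF v(1) D] PiE_mem[OF v(2) D] by (auto simp: v''_def)
        qed
      next
        fix D assume "D \<notin> K"
        then show "v'' D = undefined" using EK v(1) by (auto simp: v''_def PiE_def extensional_def)
      qed
      have off: "v'' D = v D" if "D \<noteq> B" "D \<noteq> C" for D
        using that e(2) by (auto simp: v''_def doubleton_eq_iff)
      have "G v = G v''" using vm v(1) off Lt by (intro eq) auto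
      also have "\<dots> < G v'"
      proof (rule mono[OF vm v(2)])
        fix D assume D: "D \<in> K"
        show "v'' D \<le> v' D"
        proof (cases "D = E \<or> D = E'")
          case True then show ?thesis using below EK(3) by (auto simp: v''_def)
        next
          case False
          then have "D \<noteq> B" "D \<noteq> C" using e(2) by (auto simp: doubleton_eq_iff)
          then show ?thesis using off v(3)[OF D] by simp
        qed
      qed (use below in auto)
      finally show ?thesis .
    qed
    have "v B < v' B \<or> v C < v' C"
    proof (rule ccontr)
      assume "\<not> ?thesis"
      then have "L v' \<le> L v" unfolding L_def using d(1,2) by (intro add_mono mult_left_mono) auto
      with v(4) show False by simp
    qed
    then consider "v B < v' B" "v' C \<le> v C" | "v C < v' C" "v' B \<le> v B" | "v B < v' B" "v C < v' C" by linarith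
    then show ?thesis
    proof cases
      case 1 then show ?thesis using d(1,2) by (intro shift[of B C]) auto
    next
      case 2 then show ?thesis using d(1,2) by (intro shift[of C B]) auto
    next
      case 3
      show ?thesis
      proof (rule mono[OF v(1,2)])
        fix D assume "D \<in> K" then show "v D \<le> v' D" using 3 v(3) by (cases "D = B"; cases "D = C") auto
      qed (use 3 in auto)
    qed
  qed
  consider "L w = L w'" | "L w < L w'" | "L w' < L w" by linarith
  then have "G w \<le> G w' \<longleftrightarrow> L w \<le> L w'"
  proof cases
    case 1 then show ?thesis using eq[OF w] by simp
  next
    case 2 then show ?thesis using less[OF w] by simp
  next
    case 3 then show ?thesis using less[OF w(2,1)] w(3) by fastforce
  qed
  then show ?thesis by (simp add: L_def)
qed

text \<open>The difference \<open>g\<close> is continuous and locally constant off finitely many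
  points, hence constant; its value at \<open>v1\<close> is \<open>\<pi> * f v1\<close>.\<close>

lemma affine_from_local_increments:
  fixes f :: "real \<Rightarrow> real"
  assumes cont: "continuous_on {l..h} f" and v1: "v1 \<in> {l..h}" and \<pi>: "0 < \<pi>" "\<pi> < 1"
    and loc: "\<And>v. v \<in> {l<..<h} \<Longrightarrow> v \<noteq> v1 \<Longrightarrow> \<exists>\<delta>>0. \<forall>v'. \<bar>v' - v\<bar> < \<delta> \<longrightarrow>
      f (\<pi> * v1 + (1 - \<pi>) * v') - (1 - \<pi>) * f v' = f (\<pi> * v1 + (1 - \<pi>) * v) - (1 - \<pi>) * f v"
    and v: "v \<in> {l..h}"
  shows "f (\<pi> * v1 + (1 - \<pi>) * v) = \<pi> * f v1 + (1 - \<pi>) * f v"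
proof -
  define g where "g v = f (\<pi> * v1 + (1 - \<pi>) * v) - (1 - \<pi>) * f v" for v
  have mix: "\<pi> * v1 + (1 - \<pi>) * v \<in> {l..h}" if "v \<in> {l..h}" for v
    using convex_interval[OF v1 that, of "1 - \<pi>"] \<pi> by simp
  have contg: "continuous_on {l..h} g"
    unfolding g_def
    by (intro continuous_intros continuous_on_compose2[OF cont] cont) (use mix in auto)
  have der: "(g has_derivative (\<lambda>h. 0)) (at v within {l..h})" if "v \<in> {l..h} - {l, h, v1}" for v
  proof -
    have v: "v \<in> {l<..<h}" "v \<noteq> v1" using that by auto
    from loc[OF this] obtain \<delta> where \<delta>: "\<delta> > 0" "\<And>v'. \<bar>v' - v\<bar> < \<delta> \<Longrightarrow> g v' = g v"
      unfolding g_def by blast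
    have near: "g v = g v'" if "dist v' v < \<delta>" for v'
      by (rule \<delta>(2)[symmetric]) (use that in \<open>simp add: dist_real_def\<close>)
    show ?thesis
      by (rule has_derivative_transform_within[OF has_derivative_const[of "g v"] \<delta>(1)]) (use that near in simp_all)
  qed
  have const: "g x = g l" if "x \<in> {l..h}" for x
    by (rule has_derivative_zero_unique_strong_interval[of "{l, h, v1}", OF _ contg refl der that]) auto
  have "g v = g v1" using const[OF v] const[OF v1] by simp
  then show ?thesis by (simp add: g_def algebra_simps)
qed

text \<open>Tests of the dimension relation yield the affine identity only for pairs that differ in
  every coordinate, the second point being interior. Perturbing the two points towards
  \<open>c\<close> and \<open>c'\<close> reaches such pairs, and continuity removes the
  perturbation.\<close>

lemma affine_by_density:
  fixes G :: "('b \<Rightarrow> real) \<Rightarrow> real"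
  assumes K: "finite K" and lh: "\<And>B. B \<in> K \<Longrightarrow> l B < h B"
    and cont: "continuous_on (Box K l h) G" and \<pi>: "0 \<le> \<pi>" "\<pi> \<le> 1"
    and gen: "\<And>w w'. w \<in> Box K l h \<Longrightarrow> w' \<in> (\<Pi>\<^sub>E B\<in>K. {l B<..<h B}) \<Longrightarrow> (\<And>B. B \<in> K \<Longrightarrow> w B \<noteq> w' B) \<Longrightarrow>
      G (\<lambda>B\<in>K. (1 - \<pi>) * w B + \<pi> * w' B) = (1 - \<pi>) * G w + \<pi> * G w'"
    and w: "w \<in> Box K l h" "w' \<in> Box K l h"
  shows "G (\<lambda>B\<in>K. (1 - \<pi>) * w B + \<pi> * w' B) = (1 - \<pi>) * G w + \<pi> * G w'"
proof -
  \<comment> \<open>\<open>c\<close> and \<open>c'\<close> are made of the two trisecting points of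
    each interval: interior, and different in every coordinate.\<close>
  define c where "c = (\<lambda>B\<in>K. (2 * l B + h B) / 3)"
  define c' where "c' = (\<lambda>B\<in>K. (l B + 2 * h B) / 3)"
  have c: "c \<in> Box K l h" "c' \<in> Box K l h" using lh by (auto simp: c_def c'_def field_simps less_imp_le)
  have cint: "c' B \<in> {l B<..<h B}" if "B \<in> K" for B using lh[OF that] that by (auto simp: c'_def field_simps)
  have cc: "c B \<noteq> c' B" if "B \<in> K" for B using lh[OF that] that by (auto simp: c_def c'_def field_simps)
  \<comment> \<open>Perturbation sizes at which the two points agree in some coordinate. Their
    difference is affine in \<open>s\<close> and not identically zero, since it equals
    \<open>c B - c' B\<close> at \<open>s = 1\<close>.\<close>
  define bad where "bad = (\<Union>B\<in>K. {s. (w B - w' B) + s * ((c B - c' B) - (w B - w' B)) \<in> {0}} - {0} - {0})"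
  have mixbox: "(\<lambda>B\<in>K. (1 - \<pi>) * w B + \<pi> * w' B) \<in> Box K l h" "(\<lambda>B\<in>K. (1 - \<pi>) * c B + \<pi> * c' B) \<in> Box K l h"
    using box_mix[OF w \<pi>] box_mix[OF c \<pi>] by auto
  have fin: "finite {s. (w B - w' B) + s * ((c B - c' B) - (w B - w' B)) \<in> {0}}" if "B \<in> K" for B
  proof (cases "(c B - c' B) - (w B - w' B) = 0")
    case True
    then have "w B - w' B \<noteq> 0" using cc[OF that] by simp
    then show ?thesis using True by simp
  next
    case False then show ?thesis by (intro finite_affine_vimage) auto
  qed
  then have bad: "finite bad" unfolding bad_def using K by blast
  let ?W = "\<lambda>s. \<lambda>B\<in>K. (1 - s) * w B + s * c B"
  let ?W' = "\<lambda>s. \<lambda>B\<in>K. (1 - s) * w' B + s * c' B"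
  let ?M = "\<lambda>s. \<lambda>B\<in>K. (1 - s) * (\<lambda>B\<in>K. (1 - \<pi>) * w B + \<pi> * w' B) B + s * (\<lambda>B\<in>K. (1 - \<pi>) * c B + \<pi> * c' B) B"
  have eq: "G (?M s) = (1 - \<pi>) * G (?W s) + \<pi> * G (?W' s)" if s: "0 < s" "s < 1" "s \<notin> bad" for s
  proof -
    have "?M s = (\<lambda>B\<in>K. (1 - \<pi>) * ?W s B + \<pi> * ?W' s B)"
      by (rule restrict_ext) (simp add: algebra_simps)
    moreover have "G \<dots> = (1 - \<pi>) * G (?W s) + \<pi> * G (?W' s)"
    proof (rule gen)
      show "?W s \<in> Box K l h" by (rule box_mix[OF w(1) c(1)]) (use s in auto)
      show "?W' s \<in> (\<Pi>\<^sub>E B\<in>K. {l B<..<h B})"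
        using convex_interval_interior[OF PiE_mem[OF w(2)] cint] s by auto
      fix B assume B: "B \<in> K"
      have "(w B - w' B) + s * ((c B - c' B) - (w B - w' B)) \<noteq> 0"
        using s B by (auto simp: bad_def)
      then show "?W s B \<noteq> ?W' s B" using B by (auto simp: algebra_simps)
    qed
    ultimately show ?thesis by simp
  qed
  have ev: "\<forall>\<^sub>F s in at_right 0. G (?M s) = (1 - \<pi>) * G (?W s) + \<pi> * G (?W' s)"
    using at_right_unit at_right_not_in_finite[OF bad] by eventually_elim (use eq in blast)
  have lim: "((\<lambda>s. (1 - \<pi>) * G (?W s) + \<pi> * G (?W' s)) \<longlongrightarrow> (1 - \<pi>) * G w + \<pi> * G w') (at_right 0)"
    by (intro tendsto_intros tendsto_mix_at_right[OF cont] w c)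
  have "((\<lambda>s. G (?M s)) \<longlongrightarrow> (1 - \<pi>) * G w + \<pi> * G w') (at_right 0)"
    using lim tendsto_cong[OF ev] by blast
  from tendsto_unique[OF _ tendsto_mix_at_right[OF cont mixbox] this] show ?thesis by simp
qed

text \<open>Induction on the support: \<open>x\<close> keeps the weight \<open>p x = 1 - q\<close>,
  and the other points, with weights divided by \<open>q\<close>, are replaced by their mean
  \<open>W\<close>.\<close>

lemma affine_finite_sum:
  fixes G :: "('b \<Rightarrow> real) \<Rightarrow> real"
  assumes aff: "\<And>w w' \<pi>. w \<in> Box K l h \<Longrightarrow> w' \<in> Box K l h \<Longrightarrow> 0 < \<pi> \<Longrightarrow> \<pi> < 1 \<Longrightarrow>
      G (\<lambda>B\<in>K. (1 - \<pi>) * w B + \<pi> * w' B) = (1 - \<pi>) * G w + \<pi> * G w'"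
    and S: "finite S" "S \<noteq> {}" and p: "\<And>k. k \<in> S \<Longrightarrow> p k > 0" "sum p S = 1"
    and w: "\<And>k. k \<in> S \<Longrightarrow> w k \<in> Box K l h"
  shows "(\<lambda>B\<in>K. \<Sum>k\<in>S. p k * w k B) \<in> Box K l h \<and>
    G (\<lambda>B\<in>K. \<Sum>k\<in>S. p k * w k B) = (\<Sum>k\<in>S. p k * G (w k))"
  using S p w
proof (induction S arbitrary: p rule: finite_ne_induct)
  case (singleton x)
  then have "(\<lambda>B\<in>K. w x B) = w x" by (intro ext) (auto simp: restrict_def PiE_def extensional_def)
  with singleton show ?case by simp
next
  case (insert x S)
  define q where "q = 1 - p x"
  have sumS: "sum p S = q" using insert.prems(2) insert.hyps by (simp add: q_def)
  have q0: "q > 0" unfolding sumS[symmetric] using insert by (intro sum_pos) auto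
  have q1: "q < 1" using insert.prems(1)[of x] by (simp add: q_def)
  define W where "W = (\<lambda>B\<in>K. \<Sum>k\<in>S. p k / q * w k B)"
  have IH: "W \<in> Box K l h \<and> G W = (\<Sum>k\<in>S. p k / q * G (w k))"
    unfolding W_def
    by (rule insert.IH) (use insert.prems q0 sumS in \<open>auto simp flip: sum_divide_distrib\<close>)
  have wx: "w x \<in> Box K l h" using insert.prems by simp
  have eq: "(\<lambda>B\<in>K. \<Sum>k\<in>insert x S. p k * w k B) = (\<lambda>B\<in>K. (1 - q) * w x B + q * W B)"
  proof (rule restrict_ext)
    fix B assume "B \<in> K"
    then have "q * W B = (\<Sum>k\<in>S. p k * w k B)" using q0 by (simp add: W_def sum_distrib_left)
    then show "(\<Sum>k\<in>insert x S. p k * w k B) = (1 - q) * w x B + q * W B"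
      using insert.hyps by (simp add: q_def)
  qed
  have "G (\<lambda>B\<in>K. (1 - q) * w x B + q * W B) = (1 - q) * G (w x) + q * G W"
    by (rule aff[OF wx _ q0 q1]) (use IH in blast)
  also have "\<dots> = (\<Sum>k\<in>insert x S. p k * G (w k))"
    using insert.hyps q0 IH by (simp add: q_def sum_distrib_left)
  finally have "G (\<lambda>B\<in>K. \<Sum>k\<in>insert x S. p k * w k B) = (\<Sum>k\<in>insert x S. p k * G (w k))" unfolding eq .
  moreover have "(\<lambda>B\<in>K. (1 - q) * w x B + q * W B) \<in> Box K l h"
    by (rule box_mix[OF wx]) (use IH q0 q1 in auto)
  ultimately show ?case by (simp only: eq)
qed

lemma affine_avg:
  fixes G :: "('b \<Rightarrow> real) \<Rightarrow> real"
  assumes aff: "\<And>w w' \<pi>. w \<in> Box K l h \<Longrightarrow> w' \<in> Box K l h \<Longrightarrow> 0 < \<pi> \<Longrightarrow> \<pi> < 1 \<Longrightarrow>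
      G (\<lambda>B\<in>K. (1 - \<pi>) * w B + \<pi> * w' B) = (1 - \<pi>) * G w + \<pi> * G w'"
    and fin: "finite (set_pmf \<kappa>)" and w: "\<And>k. k \<in> set_pmf \<kappa> \<Longrightarrow> w k \<in> Box K l h"
  shows "G (\<lambda>B\<in>K. avg \<kappa> (\<lambda>k. w k B)) = avg \<kappa> (\<lambda>k. G (w k))"
proof -
  have avg_sum: "avg \<kappa> f = (\<Sum>k\<in>set_pmf \<kappa>. pmf \<kappa> k * f k)" for f
    using integral_measure_pmf[OF fin, of \<kappa> f] by simp
  have "sum (pmf \<kappa>) (set_pmf \<kappa>) = 1" using fin by (intro sum_pmf_eq_1) auto
  then show ?thesis
    unfolding avg_sum
    by (intro affine_finite_sum[OF aff fin set_pmf_not_empty _ _ w, THEN conjunct2])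
      (auto simp: pmf_positive_iff)
qed

section \<open>Lotteries on a subtree viewed as lotteries on all coordinates\<close>

section \<open>Representations node by node\<close>

text \<open>The condition at one vertex, stated for lotteries on all coordinates that are
  concentrated on \<open>z\<close> outside \<open>D\<close>, instead of products of \<open>z\<close>
  with lotteries on \<open>D\<close>. In this form it applies directly to images
  \<open>map_pmf Z \<kappa>\<close>.\<close>

definition node_rep where
  "node_rep I X R C D U \<longleftrightarrow> (\<forall>z\<in>outcomes X (I - D).
     (\<forall>p\<in>lotteries X I. \<forall>q\<in>lotteries X I. (\<forall>\<omega>\<in>set_pmf p \<union> set_pmf q. restrict \<omega> (I - D) = z) \<longrightarrow>
        (R p q \<longleftrightarrow> U (restrict z C) q \<le> (U (restrict z C) p :: real))) \<and>
     continuous_on (outcomes X D) (\<lambda>y. U (restrict z C) (return_pmf (merge (I - D) D (z, y)))) \<and>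
     strict_mono_on (outcomes X D) (\<lambda>y. U (restrict z C) (return_pmf (merge (I - D) D (z, y)))))"

lemma prod_lottery_return1:
  "prod_lottery A B (return_pmf z) p = map_pmf (\<lambda>y. merge A B (z, y)) p"
  by (simp add: prod_lottery_def pair_return_pmf1 map_pmf_comp)

lemma prod_lottery_return2:
  "prod_lottery A B p (return_pmf z) = map_pmf (\<lambda>y. merge A B (y, z)) p"
  by (simp add: prod_lottery_def pair_return_pmf2 map_pmf_comp)

lemma merge_outcomes:
  assumes "z \<in> outcomes X (I - D)" "y \<in> outcomes X D" "D \<subseteq> I"
  shows "merge (I - D) D (z, y) \<in> outcomes X I" "restrict (merge (I - D) D (z, y)) (I - D) = z"
    "restrict (merge (I - D) D (z, y)) D = y" "merge D (I - D) (y, z) = merge (I - D) D (z, y)"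
  using assms by (auto simp: outcomes_def merge_def PiE_def extensional_def fun_eq_iff)

lemma merge_restrict_outcome:
  assumes "\<omega> \<in> outcomes X I" "D \<subseteq> I"
  shows "merge (I - D) D (restrict \<omega> (I - D), restrict \<omega> D) = \<omega>"
  using assms by (auto simp: outcomes_def merge_def PiE_def extensional_def fun_eq_iff)

lemma restrict_outcomes: "\<omega> \<in> outcomes X I \<Longrightarrow> D \<subseteq> I \<Longrightarrow> restrict \<omega> D \<in> outcomes X D"
  by (auto simp: outcomes_def)

lemma restrict_subset_eq: "restrict f S = z \<Longrightarrow> A \<subseteq> S \<Longrightarrow> restrict f A = restrict z A"
  by (auto simp: restrict_eq_iff)

text \<open>A lottery whose coordinates outside \<open>D\<close> are fixed is the product of a point
  mass with its marginal on \<open>D\<close>; this makes the two formulations of the node condition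
  equivalent.\<close>

lemma lottery_split:
  assumes "D \<subseteq> I" "z \<in> outcomes X (I - D)"
  shows "{p \<in> lotteries X I. \<forall>\<omega>\<in>set_pmf p. restrict \<omega> (I - D) = z} =
    prod_lottery (I - D) D (return_pmf z) ` lotteries X D"
proof (intro equalityI subsetI)
  fix p assume "p \<in> {p \<in> lotteries X I. \<forall>\<omega>\<in>set_pmf p. restrict \<omega> (I - D) = z}"
  then have p: "p \<in> lotteries X I" "\<And>\<omega>. \<omega> \<in> set_pmf p \<Longrightarrow> restrict \<omega> (I - D) = z" by auto
  have sup: "\<omega> \<in> outcomes X I" if "\<omega> \<in> set_pmf p" for \<omega> using p(1) that by (auto simp: lotteries_def)
  have "prod_lottery (I - D) D (return_pmf z) (marginal p D) = map_pmf (\<lambda>\<omega>. merge (I - D) D (z, restrict \<omega> D)) p"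
    by (simp add: prod_lottery_return1 marginal_def map_pmf_comp)
  also have "\<dots> = map_pmf (\<lambda>\<omega>. \<omega>) p"
  proof (rule map_pmf_cong[OF refl])
    fix \<omega> assume w: "\<omega> \<in> set_pmf p"
    show "merge (I - D) D (z, restrict \<omega> D) = \<omega>"
      using merge_restrict_outcome[OF sup[OF w] assms(1)] p(2)[OF w] by simp
  qed
  finally have "p = prod_lottery (I - D) D (return_pmf z) (marginal p D)" by simp
  moreover have "marginal p D \<in> lotteries X D"
    using p(1) sup restrict_outcomes[OF _ assms(1)] by (auto simp: lotteries_def marginal_def)
  ultimately show "p \<in> prod_lottery (I - D) D (return_pmf z) ` lotteries X D" by blast
next
  fix p assume "p \<in> prod_lottery (I - D) D (return_pmf z) ` lotteries X D"
  then obtain q where q: "q \<in> lotteries X D" "p = map_pmf (\<lambda>y. merge (I - D) D (z, y)) q"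
    by (auto simp: prod_lottery_return1)
  then have sup: "y \<in> outcomes X D" if "y \<in> set_pmf q" for y using that by (auto simp: lotteries_def)
  show "p \<in> {p \<in> lotteries X I. \<forall>\<omega>\<in>set_pmf p. restrict \<omega> (I - D) = z}"
    using q merge_outcomes[OF assms(2) sup assms(1)] by (auto simp: lotteries_def)
qed

lemma cond_pref_prod_lottery:
  assumes "D \<subseteq> I" "z \<in> outcomes X (I - D)" "p \<in> lotteries X D" "q \<in> lotteries X D"
  shows "cond_pref I R D z p q \<longleftrightarrow>
    R (prod_lottery (I - D) D (return_pmf z) p) (prod_lottery (I - D) D (return_pmf z) q)"
proof -
  have "prod_lottery D (I - D) r (return_pmf z) = prod_lottery (I - D) D (return_pmf z) r"
    if "r \<in> lotteries X D" for r
    unfolding prod_lottery_return1 prod_lottery_return2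
    by (rule map_pmf_cong[OF refl], rule merge_outcomes(4)[OF assms(2) _ assms(1)])
      (use that in \<open>auto simp: lotteries_def\<close>)
  with assms show ?thesis by (simp add: cond_pref_def)
qed

lemma (in rct) smeu_representation_iff:
  "smeu_representation I X R (P, E) uo u \<longleftrightarrow>
    (\<forall>v\<in>V. node_rep I X R (anc v) (sub v) (utility E uo u v))"
proof -
  have "(\<forall>x\<in>outcomes X (anc v). let D = sub v in
         \<forall>z\<in>outcomes X (I - D). restrict z (anc v) = x \<longrightarrow>
           (\<forall>p\<in>lotteries X D. \<forall>q\<in>lotteries X D.
              cond_pref I R D z p q \<longleftrightarrow>
                utility E uo u v x (prod_lottery (I - D) D (return_pmf z) p)
                  \<ge> utility E uo u v x (prod_lottery (I - D) D (return_pmf z) q)) \<and>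
           continuous_on (outcomes X D)
             (\<lambda>y. utility E uo u v x (return_pmf (merge (I - D) D (z, y)))) \<and>
           strict_mono_on (outcomes X D)
             (\<lambda>y. utility E uo u v x (return_pmf (merge (I - D) D (z, y))))) \<longleftrightarrow>
    node_rep I X R (anc v) (sub v) (utility E uo u v)" if v: "v \<in> V" for v
  proof -
    let ?D = "sub v" and ?U = "utility E uo u v"
    have D: "?D \<subseteq> I" by (rule sub_I[OF v])
    have C: "anc v \<subseteq> I - ?D" using anc_I anc_sub_disjoint[OF v] by blast
    have pref: "(\<forall>p\<in>lotteries X ?D. \<forall>q\<in>lotteries X ?D. cond_pref I R ?D z p q \<longleftrightarrow>
          U (prod_lottery (I - ?D) ?D (return_pmf z) q) \<le> (U (prod_lottery (I - ?D) ?D (return_pmf z) p) :: real)) \<longleftrightarrow>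
        (\<forall>p\<in>lotteries X I. \<forall>q\<in>lotteries X I. (\<forall>\<omega>\<in>set_pmf p \<union> set_pmf q. restrict \<omega> (I - ?D) = z) \<longrightarrow>
          (R p q \<longleftrightarrow> U q \<le> U p))" if z: "z \<in> outcomes X (I - ?D)" for z U
    proof -
      have "(\<forall>p\<in>lotteries X I. \<forall>q\<in>lotteries X I. (\<forall>\<omega>\<in>set_pmf p \<union> set_pmf q. restrict \<omega> (I - ?D) = z) \<longrightarrow>
          (R p q \<longleftrightarrow> U q \<le> U p)) \<longleftrightarrow>
        (\<forall>p\<in>{p \<in> lotteries X I. \<forall>\<omega>\<in>set_pmf p. restrict \<omega> (I - ?D) = z}.
         \<forall>q\<in>{p \<in> lotteries X I. \<forall>\<omega>\<in>set_pmf p. restrict \<omega> (I - ?D) = z}. R p q \<longleftrightarrow> U q \<le> U p)"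
        by blast
      also have "\<dots> \<longleftrightarrow> (\<forall>p\<in>lotteries X ?D. \<forall>q\<in>lotteries X ?D. cond_pref I R ?D z p q \<longleftrightarrow>
          U (prod_lottery (I - ?D) ?D (return_pmf z) q) \<le> U (prod_lottery (I - ?D) ?D (return_pmf z) p))"
        unfolding lottery_split[OF D z] by (simp add: cond_pref_prod_lottery[OF D z])
      finally show ?thesis ..
    qed
    have zC: "restrict z (anc v) \<in> outcomes X (anc v)" if "z \<in> outcomes X (I - ?D)" for z
      by (rule restrict_outcomes[OF that C])
    show ?thesis
      unfolding node_rep_def Let_def using pref zC by (auto 0 3)
  qed
  then show ?thesis
    unfolding smeu_representation_def using is_rct by simp
qed

locale smeu = rct_fun +
  fixes lo hi :: "nat \<Rightarrow> real" and X :: "nat \<Rightarrow> real set" and R :: "outcome pmf \<Rightarrow> outcome pmf \<Rightarrow> bool"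
  assumes lohi: "i \<in> I \<Longrightarrow> lo i < hi i" and X_eq: "i \<in> I \<Longrightarrow> X i = {lo i..hi i}"
    and rep: "smeu_representation I X R (P, E) uo u"
begin

definition W :: "outcome set" where "W = outcomes X I"

lemma mem_W: "\<omega> \<in> W \<longleftrightarrow> (\<forall>i\<in>I. lo i \<le> \<omega> i \<and> \<omega> i \<le> hi i) \<and> \<omega> \<in> extensional I"
  using X_eq by (auto simp: W_def outcomes_def PiE_def Pi_def)

lemma W_ext: "\<omega> \<in> W \<Longrightarrow> \<omega>' \<in> W \<Longrightarrow> (\<And>i. i \<in> I \<Longrightarrow> \<omega> i = \<omega>' i) \<Longrightarrow> \<omega> = \<omega>'"
  by (auto simp: mem_W intro: extensionalityI)

lemma W_upd: "\<omega> \<in> W \<Longrightarrow> i \<in> I \<Longrightarrow> lo i \<le> z \<Longrightarrow> z \<le> hi i \<Longrightarrow> fun_upd \<omega> i z \<in> W"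
  by (auto simp: mem_W extensional_def)

lemma node: "v \<in> V \<Longrightarrow> node_rep I X R (anc v) (sub v) (utility E uo u v)"
  using rep smeu_representation_iff by blast

lemma anc_off: "v \<in> V \<Longrightarrow> anc v \<subseteq> I - sub v"
  using anc_I anc_sub_disjoint by blast

text \<open>The interface to the preference. The same two lotteries may be compared at any vertex
  whose subtree contains all the coordinates that vary, and in particular always at the
  root.\<close>

lemma R_iff_eu:
  assumes v: "v \<in> V" and fin: "finite (set_pmf \<kappa>)" "finite (set_pmf \<kappa>')"
    and Z: "\<And>k. k \<in> set_pmf \<kappa> \<Longrightarrow> Z k \<in> W" "\<And>k. k \<in> set_pmf \<kappa>' \<Longrightarrow> Z' k \<in> W"
    and off: "\<And>k i. k \<in> set_pmf \<kappa> \<Longrightarrow> i \<in> I - sub v \<Longrightarrow> Z k i = base i"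
      "\<And>k i. k \<in> set_pmf \<kappa>' \<Longrightarrow> i \<in> I - sub v \<Longrightarrow> Z' k i = base i"
    and k: "k \<in> set_pmf \<kappa>" "k' \<in> set_pmf \<kappa>'"
  shows "R (map_pmf Z \<kappa>) (map_pmf Z' \<kappa>') \<longleftrightarrow> eu v \<kappa>' Z' k' \<le> eu v \<kappa> Z k"
proof -
  define z where "z = restrict base (I - sub v)"
  have r: "restrict (Z j) (I - sub v) = z" if "j \<in> set_pmf \<kappa>" for j
    using off(1)[OF that] by (auto simp: z_def)
  have r': "restrict (Z' j) (I - sub v) = z" if "j \<in> set_pmf \<kappa>'" for j
    using off(2)[OF that] by (auto simp: z_def)
  have z: "z \<in> outcomes X (I - sub v)"
    using restrict_outcomes[of "Z k" X I "I - sub v"] Z(1)[OF k(1)] r[OF k(1)] by (simp add: W_def)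
  have C: "restrict (Z k) (anc v) = restrict z (anc v)" "restrict (Z' k') (anc v) = restrict z (anc v)"
    by (rule restrict_subset_eq[OF r[OF k(1)] anc_off[OF v]], rule restrict_subset_eq[OF r'[OF k(2)] anc_off[OF v]])
  have L: "map_pmf Z \<kappa> \<in> lotteries X I" "map_pmf Z' \<kappa>' \<in> lotteries X I"
    using fin Z by (auto simp: lotteries_def W_def)
  have sup: "\<forall>\<omega>\<in>set_pmf (map_pmf Z \<kappa>) \<union> set_pmf (map_pmf Z' \<kappa>'). restrict \<omega> (I - sub v) = z"
    using r r' by auto
  show ?thesis
    using node[OF v] z L sup unfolding node_rep_def eu_def C by blast
qed

lemma R_iff_val:
  assumes "v \<in> V" "\<omega> \<in> W" "\<omega>' \<in> W" "\<And>i. i \<in> I - sub v \<Longrightarrow> \<omega> i = \<omega>' i"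
  shows "R (return_pmf \<omega>) (return_pmf \<omega>') \<longleftrightarrow> val v \<omega>' \<le> val v \<omega>"
  using R_iff_eu[OF assms(1), of "return_pmf ()" "return_pmf ()" "\<lambda>_. \<omega>" "\<lambda>_. \<omega>'" \<omega>' "()" "()"] assms
  by (simp add: val_eu)

lemma R_iff_eu_root:
  assumes fin: "finite (set_pmf \<kappa>)" "finite (set_pmf \<kappa>')"
    and Z: "\<And>k. k \<in> set_pmf \<kappa> \<Longrightarrow> Z k \<in> W" "\<And>k. k \<in> set_pmf \<kappa>' \<Longrightarrow> Z' k \<in> W"
    and k: "k \<in> set_pmf \<kappa>" "k' \<in> set_pmf \<kappa>'"
  shows "R (map_pmf Z \<kappa>) (map_pmf Z' \<kappa>') \<longleftrightarrow> eu None \<kappa>' Z' k' \<le> eu None \<kappa> Z k"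
  by (rule R_iff_eu[OF _ fin Z _ _ k]) auto

lemma val_merge:
  assumes v: "v \<in> V" and w: "\<omega> \<in> W" and z: "z = restrict \<omega> (I - sub v)"
  shows "val v \<omega> = utility E uo u v (restrict z (anc v))
    (return_pmf (merge (I - sub v) (sub v) (z, restrict \<omega> (sub v))))"
proof -
  have "merge (I - sub v) (sub v) (z, restrict \<omega> (sub v)) = \<omega>"
    unfolding z by (rule merge_restrict_outcome[OF w[unfolded W_def] sub_I[OF v]])
  moreover have "restrict z (anc v) = restrict \<omega> (anc v)"
    using anc_off[OF v] by (auto simp: z restrict_def fun_eq_iff)
  ultimately show ?thesis by (simp add: val_def)
qed

text \<open>Phrased for families of outcomes that are fixed off the subtree, so that it covers
  curves as well as families indexed by a box or by a set of outcomes.\<close>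

lemma val_continuous:
  assumes v: "v \<in> V" and W: "\<And>s. s \<in> S \<Longrightarrow> f s \<in> W"
    and cont: "\<And>i. i \<in> sub v \<Longrightarrow> continuous_on S (\<lambda>s. f s i)"
    and off: "\<And>s i. s \<in> S \<Longrightarrow> i \<in> I - sub v \<Longrightarrow> f s i = base i"
  shows "continuous_on S (\<lambda>s. val v (f s))"
proof (cases "S = {}")
  case False
  define z where "z = restrict base (I - sub v)"
  have z: "z = restrict (f s) (I - sub v)" if "s \<in> S" for s
    using off[OF that] by (auto simp: z_def)
  have zW: "z \<in> outcomes X (I - sub v)"
    using False restrict_outcomes[of _ X I "I - sub v"] W z unfolding W_def by (metis Diff_subset ex_in_conv)
  have node_cont: "continuous_on (outcomes X (sub v))
      (\<lambda>y. utility E uo u v (restrict z (anc v)) (return_pmf (merge (I - sub v) (sub v) (z, y))))"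
    using node[OF v] zW unfolding node_rep_def by blast
  have "continuous_on S (\<lambda>s. utility E uo u v (restrict z (anc v))
      (return_pmf (merge (I - sub v) (sub v) (z, restrict (f s) (sub v)))))"
  proof (rule continuous_on_compose2[OF node_cont])
    show "continuous_on S (\<lambda>s. restrict (f s) (sub v))"
    proof (rule continuous_on_coordinatewise_then_product)
      fix i show "continuous_on S (\<lambda>s. restrict (f s) (sub v) i)"
        using cont by (cases "i \<in> sub v") simp_all
    qed
  qed (use restrict_outcomes[OF _ sub_I[OF v]] W in \<open>auto simp: W_def\<close>)
  then show ?thesis
    by (rule continuous_on_eq) (simp add: val_merge[OF v W z])
qed simp

lemma val_strict:
  assumes v: "v \<in> V" and W: "\<omega> \<in> W" "\<omega>' \<in> W" and off: "\<And>i. i \<in> I - sub v \<Longrightarrow> \<omega> i = \<omega>' i"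
    and le: "\<And>i. i \<in> sub v \<Longrightarrow> \<omega> i \<le> \<omega>' i" and j: "j \<in> sub v" "\<omega> j < \<omega>' j"
  shows "val v \<omega> < val v \<omega>'"
proof -
  define z where "z = restrict \<omega> (I - sub v)"
  have z': "z = restrict \<omega>' (I - sub v)" using off by (auto simp: z_def)
  have zW: "z \<in> outcomes X (I - sub v)"
    using restrict_outcomes[of \<omega> X I "I - sub v"] W(1) unfolding W_def z_def by blast
  have "strict_mono_on (outcomes X (sub v))
      (\<lambda>y. utility E uo u v (restrict z (anc v)) (return_pmf (merge (I - sub v) (sub v) (z, y))))"
    using node[OF v] zW unfolding node_rep_def by blast
  moreover have "restrict \<omega> (sub v) \<in> outcomes X (sub v)" "restrict \<omega>' (sub v) \<in> outcomes X (sub v)"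
    using restrict_outcomes[OF _ sub_I[OF v]] W unfolding W_def by blast+
  moreover have "restrict \<omega> (sub v) < restrict \<omega>' (sub v)"
  proof -
    have "restrict \<omega> (sub v) \<le> restrict \<omega>' (sub v)" using le by (auto simp: le_fun_def)
    moreover have "restrict \<omega> (sub v) j < restrict \<omega>' (sub v) j" using j by simp
    then have "\<not> restrict \<omega>' (sub v) \<le> restrict \<omega> (sub v)" by (metis le_funD not_le)
    ultimately show ?thesis by (simp add: less_le_not_le)
  qed
  ultimately show ?thesis
    unfolding val_merge[OF v W(1) z_def] val_merge[OF v W(2) z'] strict_mono_on_def by blast
qed

lemma val_mono:
  assumes v: "v \<in> V" and W: "\<omega> \<in> W" "\<omega>' \<in> W" and off: "\<And>i. i \<in> I - sub v \<Longrightarrow> \<omega> i = \<omega>' i"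
    and le: "\<And>i. i \<in> sub v \<Longrightarrow> \<omega> i \<le> \<omega>' i"
  shows "val v \<omega> \<le> val v \<omega>'"
proof (cases "\<exists>j\<in>sub v. \<omega> j < \<omega>' j")
  case True
  then show ?thesis using val_strict[OF assms] by fastforce
next
  case False
  then have "\<omega> i = \<omega>' i" if "i \<in> I" for i
    using that off[of i] le[of i] by (cases "i \<in> sub v") force+
  then have "\<omega> = \<omega>'" by (rule W_ext[OF W])
  then show ?thesis by simp
qed

end

section \<open>The box of attainable child utilities\<close>

section \<open>The range of the continuation utilities\<close>

context smeu begin

definition br :: "vertex \<Rightarrow> nat \<Rightarrow> nat set" where
  "br v i = (THE B. B \<in> ch v \<and> i \<in> sub (Some B))"

text \<open>All coordinates below child \<open>B\<close> are put at the relative position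
  \<open>t B\<close> between their bounds; the rest of \<omega> is kept. Along these diagonals the
  utilities of the children vary independently of each other, continuously and strictly
  monotonically.\<close>

definition dg :: "vertex \<Rightarrow> outcome \<Rightarrow> (nat set \<Rightarrow> real) \<Rightarrow> outcome" where
  "dg v \<omega> t = (\<lambda>i. if i \<in> (\<Union>B\<in>ch v. sub (Some B)) then lo i + t (br v i) * (hi i - lo i) else \<omega> i)"

text \<open>By monotonicity, the ends \<open>bl\<close> and \<open>bh\<close> of this curve are the
  least and the greatest utility that child \<open>B\<close> can have, given the coordinates of
  \<omega> at \<open>v\<close> and above.\<close>

definition bt :: "vertex \<Rightarrow> outcome \<Rightarrow> nat set \<Rightarrow> real \<Rightarrow> real" where
  "bt v \<omega> B s = val (Some B) (dg v \<omega> (\<lambda>_. s))"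

definition bl where "bl v \<omega> B = bt v \<omega> B 0"
definition bh where "bh v \<omega> B = bt v \<omega> B 1"

abbreviation bx where "bx v \<omega> \<equiv> Box (ch v) (bl v \<omega>) (bh v \<omega>)"

lemma br_eq: "B \<in> ch v \<Longrightarrow> i \<in> sub (Some B) \<Longrightarrow> br v i = B"
  unfolding br_def using child_child_disjoint by (intro the_equality) blast+

lemma dg_child: "B \<in> ch v \<Longrightarrow> i \<in> sub (Some B) \<Longrightarrow> dg v \<omega> t i = lo i + t B * (hi i - lo i)"
  unfolding dg_def using br_eq by auto

lemma dg_anc_own: "i \<in> anc v \<union> own_coords v \<Longrightarrow> dg v \<omega> t i = \<omega> i"
proof -
  assume i: "i \<in> anc v \<union> own_coords v"
  have "i \<notin> sub (Some B)" if "B \<in> ch v" for B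
    using i own_child_disjoint[OF that] anc_child_disjoint[OF that] by blast
  then show ?thesis by (simp add: dg_def)
qed

lemma dg_off: "i \<notin> sub v \<Longrightarrow> dg v \<omega> t i = \<omega> i"
  unfolding dg_def using child_sub by auto

lemma sub_cases:
  assumes "i \<in> sub v"
  obtains "i \<in> own_coords v" | B where "B \<in> ch v" "i \<in> sub (Some B)"
  using assms sub_rec by blast

lemma in_I: "v \<in> V \<Longrightarrow> i \<in> sub v \<Longrightarrow> i \<in> I"
  using sub_I by blast

lemma dg_W:
  assumes "v \<in> V" "\<omega> \<in> W" "\<And>B. B \<in> ch v \<Longrightarrow> t B \<in> {0..1}"
  shows "dg v \<omega> t \<in> W"
  unfolding mem_W
proof (intro conjI ballI)
  fix i assume i: "i \<in> I"
  have "dg v \<omega> t i \<in> {lo i..hi i}"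
  proof (cases "\<exists>B\<in>ch v. i \<in> sub (Some B)")
    case True
    then obtain B where B: "B \<in> ch v" "i \<in> sub (Some B)" by blast
    have "(1 - t B) * lo i + t B * hi i \<in> {lo i..hi i}"
      by (rule convex_interval) (use lohi[OF i] assms(3)[OF B(1)] in auto)
    then show ?thesis by (simp add: dg_child[OF B] algebra_simps)
  next
    case False
    then have "dg v \<omega> t i = \<omega> i" by (simp add: dg_def)
    then show ?thesis using assms(2) i by (simp add: mem_W)
  qed
  then show "lo i \<le> dg v \<omega> t i" "dg v \<omega> t i \<le> hi i" by auto
next
  show "dg v \<omega> t \<in> extensional I"
    unfolding extensional_def
  proof (intro CollectI allI impI)
    fix i assume i: "i \<notin> I"
    then have "dg v \<omega> t i = \<omega> i" using dg_off in_I[OF assms(1)] by blast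
    then show "dg v \<omega> t i = undefined" using assms(2) i by (simp add: mem_W extensional_def)
  qed
qed

lemma val_dg: "B \<in> ch v \<Longrightarrow> val (Some B) (dg v \<omega> t) = bt v \<omega> B (t B)"
  unfolding bt_def
proof (rule val_local[OF child_V])
  fix i assume B: "B \<in> ch v" and "i \<in> anc (Some B) \<union> sub (Some B)"
  then show "dg v \<omega> t i = dg v \<omega> (\<lambda>_. t B) i"
    using dg_child[OF B] dg_anc_own[of i v] anc_child[OF B] by auto
qed

text \<open>Moving only the diagonal of \<open>B\<close>, with the siblings at their lower ends,
  keeps the outcome fixed off the subtree of \<open>B\<close>, as \<open>val_strict\<close> and
  \<open>val_continuous\<close> demand.\<close>

lemma bt_dg1: "B \<in> ch v \<Longrightarrow> bt v \<omega> B s = val (Some B) (dg v \<omega> ((\<lambda>_. 0)(B := s)))"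
  using val_dg[of B v \<omega> "(\<lambda>_. 0)(B := s)"] by simp

lemma dg_sibling:
  assumes "v \<in> V" "B \<in> ch v" "i \<in> I - sub (Some B)"
  shows "dg v \<omega> (t(B := s)) i = dg v \<omega> (t(B := s')) i"
proof (cases "\<exists>C\<in>ch v. i \<in> sub (Some C)")
  case True
  then obtain C where "C \<in> ch v" "i \<in> sub (Some C)" by blast
  then show ?thesis using assms by (cases "C = B") (auto simp: dg_child)
qed (simp add: dg_def)

lemma bt_strict:
  assumes v: "v \<in> V" and w: "\<omega> \<in> W" and B: "B \<in> ch v" and s: "0 \<le> s" "s < s'" "s' \<le> 1"
  shows "bt v \<omega> B s < bt v \<omega> B s'"
  unfolding bt_dg1[OF B]
proof -
  obtain j where j: "j \<in> sub (Some B)" using sub_ne[of B] ch_V[OF B] by blast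
  have j': "j \<in> I" by (rule in_I[OF child_V[OF B] j])
  show "val (Some B) (dg v \<omega> ((\<lambda>_. 0)(B := s))) < val (Some B) (dg v \<omega> ((\<lambda>_. 0)(B := s')))"
  proof (rule val_strict[OF child_V[OF B] _ _ _ _ j])
    show "dg v \<omega> ((\<lambda>_. 0)(B := s)) \<in> W" "dg v \<omega> ((\<lambda>_. 0)(B := s')) \<in> W"
      by (rule dg_W[OF v w], use s in simp)+
    show "dg v \<omega> ((\<lambda>_. 0)(B := s)) i = dg v \<omega> ((\<lambda>_. 0)(B := s')) i" if "i \<in> I - sub (Some B)" for i
      by (rule dg_sibling[OF v B that])
    show "dg v \<omega> ((\<lambda>_. 0)(B := s)) i \<le> dg v \<omega> ((\<lambda>_. 0)(B := s')) i" if "i \<in> sub (Some B)" for i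
      using s lohi[OF in_I[OF child_V[OF B] that]] by (simp add: dg_child[OF B that] mult_right_mono)
    show "dg v \<omega> ((\<lambda>_. 0)(B := s)) j < dg v \<omega> ((\<lambda>_. 0)(B := s')) j"
      using s lohi[OF j'] by (simp add: dg_child[OF B j] mult_strict_right_mono)
  qed
qed

lemma bt_le_iff:
  assumes "v \<in> V" "\<omega> \<in> W" "B \<in> ch v" "s \<in> {0..1}" "s' \<in> {0..1}"
  shows "bt v \<omega> B s \<le> bt v \<omega> B s' \<longleftrightarrow> s \<le> s'"
  using bt_strict[OF assms(1-3), of s s'] bt_strict[OF assms(1-3), of s' s] assms(4,5)
  by (cases s s' rule: linorder_cases) auto

lemma bt_inj:
  assumes "v \<in> V" "\<omega> \<in> W" "B \<in> ch v" "s \<in> {0..1}" "s' \<in> {0..1}"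
  shows "bt v \<omega> B s = bt v \<omega> B s' \<longleftrightarrow> s = s'"
  using bt_le_iff[OF assms(1-3), of s s'] bt_le_iff[OF assms(1-3), of s' s] assms(4,5) by auto

lemma bl_less_bh: "v \<in> V \<Longrightarrow> \<omega> \<in> W \<Longrightarrow> B \<in> ch v \<Longrightarrow> bl v \<omega> B < bh v \<omega> B"
  unfolding bl_def bh_def by (rule bt_strict) auto

lemma bt_continuous:
  assumes v: "v \<in> V" and w: "\<omega> \<in> W" and B: "B \<in> ch v"
  shows "continuous_on {0..1} (bt v \<omega> B)"
  unfolding bt_dg1[OF B]
proof (rule val_continuous[OF child_V[OF B], where base = "dg v \<omega> ((\<lambda>_. 0)(B := 0))"])
  show "dg v \<omega> ((\<lambda>_. 0)(B := s)) \<in> W" if "s \<in> {0..1}" for s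
    by (rule dg_W[OF v w]) (use that in auto)
  show "continuous_on {0..1} (\<lambda>s. dg v \<omega> ((\<lambda>_. 0)(B := s)) i)" if "i \<in> sub (Some B)" for i
    by (simp add: dg_child[OF B that]) (intro continuous_intros)
qed (rule dg_sibling[OF v B])

lemma bt_range:
  assumes v: "v \<in> V" and w: "\<omega> \<in> W" and B: "B \<in> ch v" and y: "y \<in> {bl v \<omega> B..bh v \<omega> B}"
  shows "\<exists>s\<in>{0..1}. bt v \<omega> B s = y"
  using IVT'[of "bt v \<omega> B" 0 y 1] bt_continuous[OF v w B] y by (auto simp: bl_def bh_def)

lemma bt_in_range:
  assumes v: "v \<in> V" and w: "\<omega> \<in> W" and B: "B \<in> ch v" and s: "s \<in> {0..1}"
  shows "bt v \<omega> B s \<in> {bl v \<omega> B..bh v \<omega> B}"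
  unfolding bl_def bh_def using bt_le_iff[OF v w B, of 0 s] bt_le_iff[OF v w B, of s 1] s by auto

text \<open>Each curve \<open>bt\<close> covers its interval by the intermediate value theorem, so
  every vector in the box comes from a deterministic outcome. With \<open>G_dg\<close>, statements
  about \<open>G\<close> on the box become statements about \<open>val\<close>.\<close>

lemma box_param:
  assumes v: "v \<in> V" and w: "\<omega> \<in> W" and x: "x \<in> bx v \<omega>"
  obtains t where "\<And>B. t B \<in> {0..1}" "x = (\<lambda>B\<in>ch v. bt v \<omega> B (t B))"
proof -
  have "\<exists>s\<in>{0..1}. B \<in> ch v \<longrightarrow> bt v \<omega> B s = x B" for B
  proof (cases "B \<in> ch v")
    case True
    from bt_range[OF v w True PiE_mem[OF x True]] show ?thesis by blast
  qed (auto intro: bexI[of _ 0])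
  then obtain t where t: "\<And>B. t B \<in> {0..1}" "\<And>B. B \<in> ch v \<Longrightarrow> bt v \<omega> B (t B) = x B" by metis
  have "x = (\<lambda>B\<in>ch v. bt v \<omega> B (t B))"
    using t(2) x by (intro ext) (auto simp: PiE_def extensional_def)
  with t(1) show ?thesis by (rule that)
qed

lemma G_dg: "G v \<omega> (\<lambda>B\<in>ch v. bt v \<omega> B (t B)) = val v (dg v \<omega> t)"
proof -
  have "(\<lambda>B\<in>ch v. val (Some B) (dg v \<omega> t)) = (\<lambda>B\<in>ch v. bt v \<omega> B (t B))"
    by (rule restrict_ext) (rule val_dg)
  moreover have "G v (dg v \<omega> t) = G v \<omega>" by (rule G_cong) (rule dg_anc_own)
  ultimately show ?thesis by (simp only: val_rec[of v "dg v \<omega> t"])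
qed

lemma G_strict:
  assumes v: "v \<in> V" and w: "\<omega> \<in> W" and x: "x \<in> bx v \<omega>" "y \<in> bx v \<omega>"
    and le: "\<And>B. B \<in> ch v \<Longrightarrow> x B \<le> y B" and ne: "x \<noteq> y"
  shows "G v \<omega> x < G v \<omega> y"
proof -
  obtain s where s: "\<And>B. s B \<in> {0..1}" "x = (\<lambda>B\<in>ch v. bt v \<omega> B (s B))" using box_param[OF v w x(1)] by metis
  obtain t where t: "\<And>B. t B \<in> {0..1}" "y = (\<lambda>B\<in>ch v. bt v \<omega> B (t B))" using box_param[OF v w x(2)] by metis
  have st: "s B \<le> t B" if "B \<in> ch v" for B
    using le[OF that] bt_le_iff[OF v w that s(1) t(1)] that by (simp add: s(2) t(2))
  obtain B where B: "B \<in> ch v" "x B \<noteq> y B" using PiE_ext[OF x] ne by blast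
  then have "s B \<noteq> t B" by (auto simp: s(2) t(2))
  then have lt: "s B < t B" using st[OF B(1)] by simp
  obtain j where j: "j \<in> sub (Some B)" using sub_ne[of B] ch_V[OF B(1)] by blast
  have j': "j \<in> I" by (rule in_I[OF child_V[OF B(1)] j])
  show ?thesis unfolding s(2) t(2) G_dg
  proof (rule val_strict[OF v])
    show "dg v \<omega> s \<in> W" "dg v \<omega> t \<in> W" by (rule dg_W[OF v w], rule s t)+
    show "dg v \<omega> s i = dg v \<omega> t i" if "i \<in> I - sub v" for i using that by (simp add: dg_off)
    show "dg v \<omega> s i \<le> dg v \<omega> t i" if i: "i \<in> sub v" for i
      using i
    proof (cases rule: sub_cases)
      case 1 then show ?thesis by (simp add: dg_anc_own)
    next
      case (2 C)
      then show ?thesis using st[OF 2(1)] lohi[OF in_I[OF v i]] by (simp add: dg_child mult_right_mono)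
    qed
    show "j \<in> sub v" using j child_sub[OF B(1)] by blast
    show "dg v \<omega> s j < dg v \<omega> t j" using lt lohi[OF j'] by (simp add: dg_child[OF B(1) j] mult_strict_right_mono)
  qed
qed

lemma G_mono:
  assumes "v \<in> V" "\<omega> \<in> W" "x \<in> bx v \<omega>" "y \<in> bx v \<omega>" "\<And>B. B \<in> ch v \<Longrightarrow> x B \<le> y B"
  shows "G v \<omega> x \<le> G v \<omega> y"
  using G_strict[OF assms] by (cases "x = y") auto

text \<open>The curves \<open>bt\<close> are continuous injections of a compact interval, so their
  inverses \<tau> are continuous, and on the box \<open>G\<close> is \<open>val v\<close> composed
  with them.\<close>

lemma G_continuous:
  assumes v: "v \<in> V" and w: "\<omega> \<in> W"
  shows "continuous_on (bx v \<omega>) (G v \<omega>)"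
proof -
  define \<tau> where "\<tau> B = inv_into {0..1} (bt v \<omega> B)" for B
  have inj: "inj_on (bt v \<omega> B) {0..1}" if "B \<in> ch v" for B
    using bt_inj[OF v w that] by (auto intro: inj_onI)
  have img: "bt v \<omega> B ` {0..1} = {bl v \<omega> B..bh v \<omega> B}" if "B \<in> ch v" for B
    using bt_range[OF v w that] bt_in_range[OF v w that] by blast
  have cont: "continuous_on {bl v \<omega> B..bh v \<omega> B} (\<tau> B)" if "B \<in> ch v" for B
    unfolding img[OF that, symmetric]
    by (rule continuous_on_inv[OF bt_continuous[OF v w that]]) (use inj[OF that] in \<open>auto simp: \<tau>_def\<close>)
  have tau: "\<tau> B y \<in> {0..1}" "bt v \<omega> B (\<tau> B y) = y" if "B \<in> ch v" "y \<in> {bl v \<omega> B..bh v \<omega> B}" for B y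
    using that(2) unfolding img[OF that(1), symmetric] \<tau>_def by (rule inv_into_into, rule f_inv_into_f)
  have "continuous_on (bx v \<omega>) (\<lambda>x. val v (dg v \<omega> (\<lambda>B. \<tau> B (x B))))"
  proof (rule val_continuous[OF v, where base = \<omega>])
    show "dg v \<omega> (\<lambda>B. \<tau> B (x B)) \<in> W" if "x \<in> bx v \<omega>" for x
      by (rule dg_W[OF v w], rule tau, assumption, rule PiE_mem[OF that])
    show "dg v \<omega> (\<lambda>B. \<tau> B (x B)) i = \<omega> i" if "i \<in> I - sub v" for x i
      using that by (simp add: dg_off)
    show "continuous_on (bx v \<omega>) (\<lambda>x. dg v \<omega> (\<lambda>B. \<tau> B (x B)) i)" if i: "i \<in> sub v" for i
      using i
    proof (cases rule: sub_cases)
      case 1 then show ?thesis by (simp add: dg_anc_own)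
    next
      case (2 B)
      have coord: "continuous_on (bx v \<omega>) (\<lambda>x. x B)"
        by (rule continuous_on_subset[OF continuous_on_product_coordinates]) simp
      have "continuous_on (bx v \<omega>) (\<lambda>x. \<tau> B (x B))"
        by (rule continuous_on_compose2[OF cont[OF 2(1)] coord]) (use 2(1) in auto)
      then show ?thesis by (simp add: dg_child[OF 2]) (intro continuous_intros)
    qed
  qed
  then show ?thesis
  proof (rule continuous_on_eq)
    fix x assume x: "x \<in> bx v \<omega>"
    have "(\<lambda>B\<in>ch v. bt v \<omega> B (\<tau> B (x B))) = x"
    proof
      fix B show "(\<lambda>B\<in>ch v. bt v \<omega> B (\<tau> B (x B))) B = x B"
      proof (cases "B \<in> ch v")
        case True
        then show ?thesis using tau(2)[OF True PiE_mem[OF x True]] by simp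
      next
        case False
        then show ?thesis using PiE_arb[OF x False] by simp
      qed
    qed
    with G_dg[of v \<omega> "\<lambda>B. \<tau> B (x B)"] show "val v (dg v \<omega> (\<lambda>B. \<tau> B (x B))) = G v \<omega> x" by simp
  qed
qed

lemma bt_cong:
  assumes "B \<in> ch v" "\<And>i. i \<in> anc v \<union> own_coords v \<Longrightarrow> \<omega> i = \<omega>' i"
  shows "bt v \<omega> B = bt v \<omega>' B"
proof
  fix s show "bt v \<omega> B s = bt v \<omega>' B s"
    unfolding bt_def
  proof (rule val_local[OF child_V[OF assms(1)]])
    fix i assume "i \<in> anc (Some B) \<union> sub (Some B)"
    then consider "i \<in> anc v \<union> own_coords v" | "i \<in> sub (Some B)" using anc_child[OF assms(1)] by blast
    then show "dg v \<omega> (\<lambda>_. s) i = dg v \<omega>' (\<lambda>_. s) i"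
      by cases (simp_all add: dg_anc_own assms(2) dg_child[OF assms(1)])
  qed
qed

lemma bx_cong:
  assumes "\<And>i. i \<in> anc v \<union> own_coords v \<Longrightarrow> \<omega> i = \<omega>' i"
  shows "bx v \<omega> = bx v \<omega>'"
proof (rule PiE_cong)
  fix B assume "B \<in> ch v"
  then have "bt v \<omega> B = bt v \<omega>' B" by (rule bt_cong) (rule assms)
  then show "{bl v \<omega> B..bh v \<omega> B} = {bl v \<omega>' B..bh v \<omega>' B}" by (simp add: bl_def bh_def)
qed

lemma override_W:
  assumes "v \<in> V" "\<omega> \<in> W" "\<And>i. i \<in> I \<Longrightarrow> f i \<in> {lo i..hi i}"
  shows "override_on \<omega> f (sub v) \<in> W"
  using assms(2,3) in_I[OF assms(1)] by (auto simp: mem_W override_on_def extensional_def)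

text \<open>Conditional averages stay between the values at the lowest and the highest completion of
  the history. Bounds for the children put their utility vector into the box, where the vector is
  realized by an outcome, and this gives the bounds at \<open>v\<close>.\<close>

lemma eu_range:
  assumes "v \<in> V" "finite (set_pmf \<kappa>)" "\<And>k. k \<in> set_pmf \<kappa> \<Longrightarrow> Z k \<in> W" "k \<in> set_pmf \<kappa>"
  shows "eu v \<kappa> Z k \<in> {val v (override_on (Z k) lo (sub v))..val v (override_on (Z k) hi (sub v))} \<and>
    (\<lambda>B\<in>ch v. eu (Some B) \<kappa> Z k) \<in> bx v (Z k)"
  using assms(1,4)
proof (induction v arbitrary: k rule: tree_induct_up)
  case (node v)
  have child_box: "(\<lambda>B\<in>ch v. eu (Some B) \<kappa> Z k') \<in> bx v (Z k')" if k': "k' \<in> set_pmf \<kappa>" for k'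
  proof (rule restrict_PiE_iff[THEN iffD2], rule ballI)
    fix B assume B: "B \<in> ch v"
    have "val (Some B) (override_on (Z k') lo (sub (Some B))) = bl v (Z k') B"
      unfolding bl_def bt_def
      by (rule val_local[OF child_V[OF B]])
        (use anc_sub_disjoint[OF child_V[OF B]] anc_child[OF B] in
          \<open>auto simp: override_on_def dg_child[OF B] dg_anc_own\<close>)
    moreover have "val (Some B) (override_on (Z k') hi (sub (Some B))) = bh v (Z k') B"
      unfolding bh_def bt_def
      by (rule val_local[OF child_V[OF B]])
        (use anc_sub_disjoint[OF child_V[OF B]] anc_child[OF B] in
          \<open>auto simp: override_on_def dg_child[OF B] dg_anc_own\<close>)
    ultimately show "eu (Some B) \<kappa> Z k' \<in> {bl v (Z k') B..bh v (Z k') B}"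
      using node.IH[OF B k'] by simp
  qed
  have "G v (Z k') (\<lambda>B\<in>ch v. eu (Some B) \<kappa> Z k') \<in>
      {val v (override_on (Z k) lo (sub v))..val v (override_on (Z k) hi (sub v))}"
    if "k' \<in> set_pmf (cls \<kappa> Z (anc v) k)" for k'
  proof -
    have k': "k' \<in> set_pmf \<kappa>" "\<forall>i\<in>anc v. Z k' i = Z k i" using that set_cls[OF node.prems] by auto
    have eqs: "val v (override_on (Z k) f (sub v)) = val v (override_on (Z k') f (sub v))" for f
      by (rule val_local[OF node.hyps]) (use k'(2) anc_sub_disjoint[OF node.hyps] in \<open>auto simp: override_on_def\<close>)
    obtain t where t: "\<And>B. t B \<in> {0..1}" "(\<lambda>B\<in>ch v. eu (Some B) \<kappa> Z k') = (\<lambda>B\<in>ch v. bt v (Z k') B (t B))"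
      using box_param[OF node.hyps assms(3)[OF k'(1)] child_box[OF k'(1)]] by metis
    have D: "dg v (Z k') t \<in> W" by (rule dg_W[OF node.hyps assms(3)[OF k'(1)] t(1)])
    have range: "lo i \<le> dg v (Z k') t i" "dg v (Z k') t i \<le> hi i" if "i \<in> sub v" for i
      using D in_I[OF node.hyps that] by (auto simp: mem_W)
    have lh: "lo i \<in> {lo i..hi i}" "hi i \<in> {lo i..hi i}" if "i \<in> I" for i using lohi[OF that] by auto
    have "val v (override_on (Z k') lo (sub v)) \<le> val v (dg v (Z k') t)"
      by (rule val_mono[OF node.hyps override_W[OF node.hyps assms(3)[OF k'(1)] lh(1)] D])
        (use range in \<open>auto simp: override_on_def dg_off\<close>)
    moreover have "val v (dg v (Z k') t) \<le> val v (override_on (Z k') hi (sub v))"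
      by (rule val_mono[OF node.hyps D override_W[OF node.hyps assms(3)[OF k'(1)] lh(2)]])
        (use range in \<open>auto simp: override_on_def dg_off\<close>)
    ultimately show ?thesis unfolding t(2) G_dg eqs by simp
  qed
  then have "eu v \<kappa> Z k \<in> {val v (override_on (Z k) lo (sub v))..val v (override_on (Z k) hi (sub v))}"
    unfolding eu_rec[OF node.prems] by (intro avg_between finite_cls assms(2) node.prems) auto
  then show ?case using child_box[OF node.prems] by (rule conjI)
qed

lemmas eu_in_box = eu_range[THEN conjunct2]

lemma val_in_box: "v \<in> V \<Longrightarrow> \<omega> \<in> W \<Longrightarrow> (\<lambda>B\<in>ch v. val (Some B) \<omega>) \<in> bx v \<omega>"
  using eu_in_box[of v "return_pmf ()" "\<lambda>_. \<omega>" "()"] by (simp add: val_eu)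

section \<open>Improvements inside a subtree carry over to the root\<close>

section \<open>Dominance\<close>

text \<open>An improvement at a vertex for every index raises the aggregator of its parent index by
  index. The conditional laws at the parent are the same for both families because these agree on
  the history, so the average improves too; this is repeated along the path to the root.\<close>

lemma dominance:
  assumes "v \<in> V" and fin: "finite (set_pmf \<kappa>)"
    and Z: "\<And>k. k \<in> set_pmf \<kappa> \<Longrightarrow> Z k \<in> W" "\<And>k. k \<in> set_pmf \<kappa> \<Longrightarrow> Z' k \<in> W"
    and "\<And>k i. k \<in> set_pmf \<kappa> \<Longrightarrow> i \<in> I - sub v \<Longrightarrow> Z k i = Z' k i"
    and "\<And>k. k \<in> set_pmf \<kappa> \<Longrightarrow> eu v \<kappa> Z' k \<le> eu v \<kappa> Z k"
    and "k \<in> set_pmf \<kappa>"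
  shows "eu None \<kappa> Z' k \<le> eu None \<kappa> Z k"
  using assms(1,5-)
proof (induction v arbitrary: k rule: tree_induct_down)
  case root
  then show ?case by blast
next
  case (child v B)
  have off: "Z k i = Z' k i" if "k \<in> set_pmf \<kappa>" "i \<notin> sub (Some B)" "i \<in> I" for k i
    using child.prems(1) that by blast
  have anc_I_off: "i \<in> I" "i \<notin> sub (Some B)" if "i \<in> anc v \<union> own_coords v" for i
    using that anc_I own_I[OF child.hyps(1)] own_child_disjoint[OF child.hyps(2)] anc_child_disjoint[OF child.hyps(2)]
    by blast+
  show ?case
  proof (rule child.IH[OF _ _ child.prems(3)])
    show "Z k i = Z' k i" if "k \<in> set_pmf \<kappa>" "i \<in> I - sub v" for k i
      using off[OF that(1)] that(2) child_sub[OF child.hyps(2)] by blast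
    show "eu v \<kappa> Z' k \<le> eu v \<kappa> Z k" if k: "k \<in> set_pmf \<kappa>" for k
    proof -
      have cls: "cls \<kappa> Z (anc v) k = cls \<kappa> Z' (anc v) k"
        by (rule cls_cong[OF k]) (use off anc_I_off in blast)
      have "G v (Z' k') (\<lambda>B\<in>ch v. eu (Some B) \<kappa> Z' k') \<le> G v (Z k') (\<lambda>B\<in>ch v. eu (Some B) \<kappa> Z k')"
        if "k' \<in> set_pmf (cls \<kappa> Z (anc v) k)" for k'
      proof -
        have k': "k' \<in> set_pmf \<kappa>" using that set_cls[OF k] by auto
        have same: "Z' k' i = Z k' i" if "i \<in> anc v \<union> own_coords v" for i
          using off[OF k'] anc_I_off[OF that] by simp
        have "(\<lambda>B\<in>ch v. eu (Some B) \<kappa> Z' k') \<in> bx v (Z' k')"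
          by (rule eu_in_box[OF child.hyps(1) fin Z(2) k'])
        then have in': "(\<lambda>B\<in>ch v. eu (Some B) \<kappa> Z' k') \<in> bx v (Z k')"
          by (simp only: bx_cong[OF same])
        have in1: "(\<lambda>B\<in>ch v. eu (Some B) \<kappa> Z k') \<in> bx v (Z k')"
          by (rule eu_in_box[OF child.hyps(1) fin Z(1) k'])
        have "eu (Some C) \<kappa> Z' k' \<le> eu (Some C) \<kappa> Z k'" if C: "C \<in> ch v" for C
        proof (cases "C = B")
          case True then show ?thesis using child.prems(2)[OF k'] by simp
        next
          case False
          have "eu (Some C) \<kappa> Z k' = eu (Some C) \<kappa> Z' k'"
          proof (rule eu_local[OF child_V[OF C] k'])
            fix k i assume "k \<in> set_pmf \<kappa>" "i \<in> anc (Some C) \<union> sub (Some C)"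
            then show "Z k i = Z' k i"
              using off[of k i] anc_I_off[of i] anc_child[OF C] child_child_disjoint[OF C child.hyps(2) False]
                in_I[OF child_V[OF C]] by blast
          qed
          then show ?thesis by simp
        qed
        then have "G v (Z k') (\<lambda>B\<in>ch v. eu (Some B) \<kappa> Z' k') \<le> G v (Z k') (\<lambda>B\<in>ch v. eu (Some B) \<kappa> Z k')"
          by (intro G_mono[OF child.hyps(1) Z(1)[OF k'] in' in1]) auto
        moreover have "G v (Z' k') = G v (Z k')" by (rule G_cong) (rule same)
        ultimately show ?thesis by simp
      qed
      then show ?thesis
        unfolding eu_rec[OF k] cls[symmetric] by (intro avg_mono finite_cls fin k)
    qed
  qed
qed

end

section \<open>Mixtures tested by the dimension relation\<close>

section \<open>Mixtures and the dimension relation\<close>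

text \<open>The index distribution depends on the weights alone, so both mixtures in the definition
  of the dimension relation are images of one \<kappa>. Indices of weight zero drop out of its
  support.\<close>

lemma mixture_as_map:
  fixes n :: nat
  assumes "\<And>k. k \<in> {1..n} \<Longrightarrow> \<pi> k \<ge> (0::real)" "(\<Sum>k=1..n. \<pi> k) = 1"
  obtains \<kappa> :: "nat pmf" where "finite (set_pmf \<kappa>)" "set_pmf \<kappa> \<subseteq> {1..n}" "\<And>x. mixture n \<pi> x = map_pmf x \<kappa>"
proof -
  let ?l = "map (\<lambda>k. (k, \<pi> k)) [1..<Suc n]"
  have set_upt: "set [1..<Suc n] = {1..n}" by auto
  have wf: "pmf_of_list_wf ?l"
    using assms by (intro pmf_of_list_wfI)
      (auto simp: o_def interv_sum_list_conv_sum_set_nat simp del: upt_Suc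
         simp flip: atLeastLessThanSuc_atLeastAtMost)
  define \<kappa> where "\<kappa> = pmf_of_list ?l"
  have set: "set_pmf \<kappa> \<subseteq> {1..n}"
    using set_pmf_of_list[OF wf] unfolding \<kappa>_def by (auto simp del: upt_Suc)
  have pmf: "pmf \<kappa> j = \<pi> j" if "j \<in> {1..n}" for j
  proof -
    have "pmf \<kappa> j = sum_list (map \<pi> (filter (\<lambda>k. k = j) [1..<Suc n]))"
      unfolding \<kappa>_def pmf_pmf_of_list[OF wf] by (simp add: filter_map o_def del: upt_Suc)
    also have "\<dots> = (\<Sum>k=1..n. if k = j then \<pi> k else 0)"
      by (simp only: sum_list_map_filter' interv_sum_list_conv_sum_set_nat set_upt)
    also have "\<dots> = \<pi> j" using that by simp
    finally show ?thesis .
  qed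
  have "mixture n \<pi> x = map_pmf x \<kappa>" for x
  proof (rule pmf_eqI)
    fix z
    have "pmf (map_pmf x \<kappa>) z = avg \<kappa> (\<lambda>k. pmf (return_pmf (x k)) z)"
      by (simp only: map_pmf_def pmf_bind)
    also have "\<dots> = (\<Sum>k\<in>{1..n}. pmf (return_pmf (x k)) z * pmf \<kappa> k)"
      by (rule integral_measure_pmf_real) (use set in auto)
    also have "\<dots> = (\<Sum>k=1..n. \<pi> k * pmf (return_pmf (x k)) z)"
      by (rule sum.cong[OF refl]) (simp only: pmf mult.commute)
    also have "\<dots> = pmf (mixture n \<pi> x) z" by (rule pmf_mixture[OF assms, symmetric])
    finally show "pmf (mixture n \<pi> x) z = pmf (map_pmf x \<kappa>) z" ..
  qed
  with set show ?thesis using that[of \<kappa>] finite_subset by blast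
qed

lemma cls_memD: "k \<in> set_pmf \<kappa> \<Longrightarrow> k' \<in> set_pmf (cls \<kappa> Z S k) \<Longrightarrow> k' \<in> set_pmf \<kappa>"
  by (simp add: set_cls)

lemma cls_agree: "k \<in> set_pmf \<kappa> \<Longrightarrow> k' \<in> set_pmf (cls \<kappa> Z S k) \<Longrightarrow> i \<in> S \<Longrightarrow> Z k' i = Z k i"
  by (simp add: set_cls)

abbreviation two :: "'a \<Rightarrow> 'a \<Rightarrow> bool \<Rightarrow> 'a" where "two x y \<equiv> \<lambda>k. if k then x else y"

text \<open>Consequences of the relation are drawn from two-point mixtures only; a Bernoulli
  variable serves as their index.\<close>

lemma mixture_two:
  assumes "0 < \<pi>" "\<pi> < 1"
  shows "mixture 2 (\<lambda>k. if k = 1 then \<pi> else 1 - \<pi>) (\<lambda>k. if k = 1 then x else y) =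
    map_pmf (two x y) (bernoulli_pmf \<pi>)"
proof (rule pmf_eqI)
  fix z
  have set2: "{1..2::nat} = {1, 2}" "{Suc 0..2} = {Suc 0, 2}" by auto
  have "pmf (map_pmf (two x y) (bernoulli_pmf \<pi>)) z =
      avg (bernoulli_pmf \<pi>) (\<lambda>k. pmf (return_pmf (two x y k)) z)"
    by (simp only: map_pmf_def pmf_bind)
  also have "\<dots> = pmf (return_pmf x) z * \<pi> + pmf (return_pmf y) z * (1 - \<pi>)"
    using assms by simp
  also have "\<dots> = (\<Sum>k=1..2. (if k = 1 then \<pi> else 1 - \<pi>) * pmf (return_pmf (if k = (1::nat) then x else y)) z)"
    unfolding set2(1) by (simp del: pmf_return)
  also have "\<dots> = pmf (mixture 2 (\<lambda>k. if k = 1 then \<pi> else 1 - \<pi>) (\<lambda>k. if k = 1 then x else y)) z"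
    by (rule pmf_mixture[symmetric]) (use assms in \<open>auto simp: set2\<close>)
  finally show "pmf (mixture 2 (\<lambda>k. if k = 1 then \<pi> else 1 - \<pi>) (\<lambda>k. if k = 1 then x else y)) z =
      pmf (map_pmf (two x y) (bernoulli_pmf \<pi>)) z" ..
qed

context smeu begin

lemma dim_relI:
  assumes "\<And>(\<kappa> :: nat pmf) Z Z' k. finite (set_pmf \<kappa>) \<Longrightarrow> (\<And>k. k \<in> set_pmf \<kappa> \<Longrightarrow> Z k \<in> W) \<Longrightarrow>
      (\<And>k. k \<in> set_pmf \<kappa> \<Longrightarrow> Z' k \<in> W) \<Longrightarrow> inj_on (\<lambda>k. Z k i) (set_pmf \<kappa>) \<Longrightarrow> inj_on (\<lambda>k. Z' k i) (set_pmf \<kappa>) \<Longrightarrow>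
      (\<And>k l. k \<in> set_pmf \<kappa> \<Longrightarrow> l \<in> I \<Longrightarrow> l \<noteq> i \<Longrightarrow> l \<noteq> j \<Longrightarrow> Z k l = Z' k l) \<Longrightarrow>
      (\<And>k. k \<in> set_pmf \<kappa> \<Longrightarrow> R (return_pmf (Z k)) (return_pmf (Z' k))) \<Longrightarrow> k \<in> set_pmf \<kappa> \<Longrightarrow>
      eu None \<kappa> Z' k \<le> eu None \<kappa> Z k"
  shows "dim_rel I X R i j"
  unfolding dim_rel_def
proof (intro allI impI, elim conjE)
  fix n :: nat and \<pi> x y
  assume a: "\<forall>k\<in>{1..n}. x k \<in> outcomes X I \<and> y k \<in> outcomes X I \<and> 0 \<le> \<pi> k \<and> \<pi> k < (1::real)"
    and sum: "(\<Sum>k=1..n. \<pi> k) = 1"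
    and inj: "inj_on (\<lambda>k. x k i) {1..n}" "inj_on (\<lambda>k. y k i) {1..n}"
    and xy: "\<forall>k\<in>{1..n}. restrict (x k) (I - {i, j}) = restrict (y k) (I - {i, j}) \<and>
           R (return_pmf (x k)) (return_pmf (y k))"
  obtain \<kappa> :: "nat pmf" where \<kappa>: "finite (set_pmf \<kappa>)" "set_pmf \<kappa> \<subseteq> {1..n}" "\<And>x. mixture n \<pi> x = map_pmf x \<kappa>"
    using mixture_as_map[of n \<pi>] a sum by blast
  have W: "x k \<in> W" "y k \<in> W" if "k \<in> set_pmf \<kappa>" for k using a \<kappa>(2) that by (auto simp: W_def)
  obtain k where k: "k \<in> set_pmf \<kappa>" using set_pmf_not_empty[of \<kappa>] by auto
  have "eu None \<kappa> y k \<le> eu None \<kappa> x k"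
  proof (rule assms[OF \<kappa>(1) _ _ _ _ _ _ k])
    show "inj_on (\<lambda>k. x k i) (set_pmf \<kappa>)" "inj_on (\<lambda>k. y k i) (set_pmf \<kappa>)"
      using inj \<kappa>(2) by (auto intro: inj_on_subset)
    show "R (return_pmf (x k)) (return_pmf (y k))" if "k \<in> set_pmf \<kappa>" for k
      using xy \<kappa>(2) that by blast
    show "x k l = y k l" if "k \<in> set_pmf \<kappa>" "l \<in> I" "l \<noteq> i" "l \<noteq> j" for k l
    proof -
      have "restrict (x k) (I - {i, j}) = restrict (y k) (I - {i, j})" using xy \<kappa>(2) that(1) by blast
      then show ?thesis using that by (auto simp: restrict_eq_iff)
    qed
  qed (rule W, assumption)+
  then show "R (mixture n \<pi> x) (mixture n \<pi> y)"
    unfolding \<kappa>(3) by (subst R_iff_eu_root[OF \<kappa>(1) \<kappa>(1) _ _ k k]) (rule W, assumption)+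
qed

lemma dim_rel_two:
  assumes "dim_rel I X R i j" "0 < \<pi>" "\<pi> < 1" "x1 \<in> W" "x2 \<in> W" "y1 \<in> W" "y2 \<in> W"
    "x1 i \<noteq> x2 i" "y1 i \<noteq> y2 i"
    "\<And>l. l \<noteq> i \<Longrightarrow> l \<noteq> j \<Longrightarrow> x1 l = y1 l" "\<And>l. l \<noteq> i \<Longrightarrow> l \<noteq> j \<Longrightarrow> x2 l = y2 l"
    "R (return_pmf x1) (return_pmf y1)" "R (return_pmf x2) (return_pmf y2)"
  shows "R (map_pmf (two x1 x2) (bernoulli_pmf \<pi>)) (map_pmf (two y1 y2) (bernoulli_pmf \<pi>))"
proof -
  let ?\<pi> = "\<lambda>k. if k = (1::nat) then \<pi> else 1 - \<pi>"
  let ?x = "\<lambda>k. if k = (1::nat) then x1 else x2" and ?y = "\<lambda>k. if k = (1::nat) then y1 else y2"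
  have set2: "{1..2::nat} = {1, 2}" "{Suc 0..2} = {Suc 0, 2}" by auto
  have "R (mixture 2 ?\<pi> ?x) (mixture 2 ?\<pi> ?y)"
    by (rule assms(1)[unfolded dim_rel_def, rule_format])
      (use assms(2-) in \<open>auto simp: set2 W_def restrict_eq_iff\<close>)
  then show ?thesis by (simp only: mixture_two[OF assms(2,3)])
qed

text \<open>With indifferent pairs the relation applies in both directions. A one-sided condition on
  preferences thus becomes an equation between utilities at \<open>v\<close>.\<close>

lemma dim_rel_indifferent:
  assumes v: "v \<in> V" and d: "dim_rel I X R i j" and p: "0 < \<pi>" "\<pi> < 1"
    and W: "x1 \<in> W" "x2 \<in> W" "y1 \<in> W" "y2 \<in> W"
    and off: "\<And>l. l \<in> I - sub v \<Longrightarrow> x1 l = base l" "\<And>l. l \<in> I - sub v \<Longrightarrow> x2 l = base l"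
      "\<And>l. l \<in> I - sub v \<Longrightarrow> y1 l = base l" "\<And>l. l \<in> I - sub v \<Longrightarrow> y2 l = base l"
    and dist: "x1 i \<noteq> x2 i" "y1 i \<noteq> y2 i"
    and same: "\<And>l. l \<noteq> i \<Longrightarrow> l \<noteq> j \<Longrightarrow> x1 l = y1 l" "\<And>l. l \<noteq> i \<Longrightarrow> l \<noteq> j \<Longrightarrow> x2 l = y2 l"
    and eq: "val v x1 = val v y1" "val v x2 = val v y2"
  shows "eu v (bernoulli_pmf \<pi>) (two x1 x2) k = eu v (bernoulli_pmf \<pi>) (two y1 y2) k"
proof -
  have R1: "R (return_pmf x1) (return_pmf y1)" "R (return_pmf y1) (return_pmf x1)"
    using R_iff_val[OF v W(1,3)] R_iff_val[OF v W(3,1)] off eq by auto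
  have R2: "R (return_pmf x2) (return_pmf y2)" "R (return_pmf y2) (return_pmf x2)"
    using R_iff_val[OF v W(2,4)] R_iff_val[OF v W(4,2)] off eq by auto
  have Rxy: "R (map_pmf (two x1 x2) (bernoulli_pmf \<pi>)) (map_pmf (two y1 y2) (bernoulli_pmf \<pi>))"
    by (rule dim_rel_two[OF d p W dist same R1(1) R2(1)])
  have Ryx: "R (map_pmf (two y1 y2) (bernoulli_pmf \<pi>)) (map_pmf (two x1 x2) (bernoulli_pmf \<pi>))"
    by (rule dim_rel_two[OF d p W(3,4,1,2) dist(2,1) same[symmetric] R1(2) R2(2)])
  have k: "k \<in> set_pmf (bernoulli_pmf \<pi>)" using p by simp
  have fin: "finite (set_pmf (bernoulli_pmf \<pi>))" by simp
  have "eu v (bernoulli_pmf \<pi>) (two y1 y2) k \<le> eu v (bernoulli_pmf \<pi>) (two x1 x2) k"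
    by (rule R_iff_eu[OF v fin fin _ _ _ _ k k, of _ _ base, THEN iffD1, OF _ _ _ _ Rxy])
      (use W off in auto)
  moreover have "eu v (bernoulli_pmf \<pi>) (two x1 x2) k \<le> eu v (bernoulli_pmf \<pi>) (two y1 y2) k"
    by (rule R_iff_eu[OF v fin fin _ _ _ _ k k, of _ _ base, THEN iffD1, OF _ _ _ _ Ryx])
      (use W off in auto)
  ultimately show ?thesis by simp
qed

text \<open>If distinct values in dimension \<open>i\<close> turn the utility at \<open>v\<close>
  into a plain conditional average, a comparison outcome by outcome passes to it, and
  \<open>dominance\<close> lifts the result to the root. Both dimensions lie in the subtree of
  \<open>v\<close>, so the two families agree off it.\<close>

lemma dim_rel_if_eu_val:
  assumes v: "v \<in> V" and ij: "i \<in> sub v" "j \<in> sub v"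
    and eu: "\<And>(\<kappa> :: nat pmf) Z k. finite (set_pmf \<kappa>) \<Longrightarrow> (\<And>k. k \<in> set_pmf \<kappa> \<Longrightarrow> Z k \<in> W) \<Longrightarrow>
      inj_on (\<lambda>k. Z k i) (set_pmf \<kappa>) \<Longrightarrow> k \<in> set_pmf \<kappa> \<Longrightarrow>
      eu v \<kappa> Z k = avg (cls \<kappa> Z (anc v) k) (\<lambda>k'. val v (Z k'))"
  shows "dim_rel I X R i j"
proof (rule dim_relI)
  fix \<kappa> :: "nat pmf" and Z Z' k
  assume fin: "finite (set_pmf \<kappa>)" and W: "\<And>k. k \<in> set_pmf \<kappa> \<Longrightarrow> Z k \<in> W" "\<And>k. k \<in> set_pmf \<kappa> \<Longrightarrow> Z' k \<in> W"
    and inj: "inj_on (\<lambda>k. Z k i) (set_pmf \<kappa>)" "inj_on (\<lambda>k. Z' k i) (set_pmf \<kappa>)"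
    and same: "\<And>k l. k \<in> set_pmf \<kappa> \<Longrightarrow> l \<in> I \<Longrightarrow> l \<noteq> i \<Longrightarrow> l \<noteq> j \<Longrightarrow> Z k l = Z' k l"
    and R: "\<And>k. k \<in> set_pmf \<kappa> \<Longrightarrow> R (return_pmf (Z k)) (return_pmf (Z' k))" and k: "k \<in> set_pmf \<kappa>"
  have off: "Z k l = Z' k l" if "k \<in> set_pmf \<kappa>" "l \<in> I - sub v" for k l
    by (rule same[OF that(1)]) (use that(2) ij in auto)
  have le: "val v (Z' k) \<le> val v (Z k)" if "k \<in> set_pmf \<kappa>" for k
    using R_iff_val[OF v W[OF that] off[OF that]] R[OF that] by blast
  show "eu None \<kappa> Z' k \<le> eu None \<kappa> Z k"
  proof (rule dominance[OF v fin W off _ k])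
    fix k assume k: "k \<in> set_pmf \<kappa>"
    have "cls \<kappa> Z (anc v) k = cls \<kappa> Z' (anc v) k"
      by (rule cls_cong[OF k]) (use off anc_off[OF v] in blast)
    moreover have "avg (cls \<kappa> Z (anc v) k) (\<lambda>k'. val v (Z' k')) \<le> avg (cls \<kappa> Z (anc v) k) (\<lambda>k'. val v (Z k'))"
      by (rule avg_mono[OF finite_cls[OF fin k]]) (use le set_cls[OF k] in auto)
    moreover have "eu v \<kappa> Z k = avg (cls \<kappa> Z (anc v) k) (\<lambda>k'. val v (Z k'))"
      by (rule eu[OF fin W(1) inj(1) k])
    moreover have "eu v \<kappa> Z' k = avg (cls \<kappa> Z' (anc v) k) (\<lambda>k'. val v (Z' k'))"
      by (rule eu[OF fin W(2) inj(2) k])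
    ultimately show "eu v \<kappa> Z' k \<le> eu v \<kappa> Z k" by simp
  qed
qed

lemma dim_rel_descendant:
  assumes A: "A \<in> P" and i: "i \<in> A" and j: "j \<in> sub (Some A)"
  shows "dim_rel I X R i j"
proof (rule dim_rel_if_eu_val[of "Some A"])
  fix \<kappa> :: "nat pmf" and Z :: "nat \<Rightarrow> outcome" and k
  assume inj: "inj_on (\<lambda>k. Z k i) (set_pmf \<kappa>)" and k: "k \<in> set_pmf \<kappa>"
  show "eu (Some A) \<kappa> Z k = avg (cls \<kappa> Z (anc (Some A)) k) (\<lambda>k'. val (Some A) (Z k'))"
  proof (rule eu_separated[OF _ k])
    fix k1 k2 l assume a: "k1 \<in> set_pmf \<kappa>" "k2 \<in> set_pmf \<kappa>"
      "\<And>i. i \<in> anc (Some A) \<union> own_coords (Some A) \<Longrightarrow> Z k1 i = Z k2 i"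
    have "Z k1 i = Z k2 i" by (rule a(3)) (use i in simp)
    then have "k1 = k2" using inj_onD[OF inj _ a(1,2)] by simp
    then show "Z k1 l = Z k2 l" by simp
  qed (use A in simp)
qed (use A i j own_sub[of "Some A"] in auto)

lemma continuous_on_upd:
  "continuous_on S (\<lambda>z. (f(i := z)) l)" "continuous_on S (\<lambda>t. (f(j := t, i := z)) l)"
  for f :: outcome
  by (cases "l = i"; cases "l = j"; simp)+

text \<open>Raising and lowering dimension \<open>j\<close> by \<open>h\<close> brackets the value
  of \<open>x\<close> strictly. By continuity the bracket survives for \<open>z\<close> close to
  \<open>x i\<close>, and the intermediate value theorem yields the compensating
  \<open>z'\<close>.\<close>

lemma compensate:
  assumes v: "v \<in> V" and x: "x \<in> W" and i: "i \<in> sub v" and j: "j \<in> sub v" and ij: "i \<noteq> j"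
    and xj: "lo j < x j" "x j < hi j" and \<eta>: "\<eta> > 0"
  obtains \<epsilon> where "\<epsilon> > 0" "\<And>z. lo i \<le> z \<Longrightarrow> z \<le> hi i \<Longrightarrow> \<bar>z - x i\<bar> < \<epsilon> \<Longrightarrow>
    \<exists>z'. \<bar>z' - x j\<bar> < \<eta> \<and> lo j \<le> z' \<and> z' \<le> hi j \<and> val v (x(i := z, j := z')) = val v x"
proof -
  have I: "i \<in> I" "j \<in> I" using in_I[OF v] i j by auto
  \<comment> \<open>Half of \<eta> makes the change strictly smaller than \<eta>; the other two
    bounds keep \<open>x j - h\<close> and \<open>x j + h\<close> in the interval.\<close>
  define h where "h = min (\<eta> / 2) (min (x j - lo j) (hi j - x j))"
  have h: "h > 0" "h < \<eta>" "lo j \<le> x j - h" "x j + h \<le> hi j" using xj \<eta> by (auto simp: h_def)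
  have xi: "lo i \<le> x i" "x i \<le> hi i" using x I by (auto simp: mem_W)
  have upW: "x(j := t, i := z) \<in> W" if "lo i \<le> z" "z \<le> hi i" "lo j \<le> t" "t \<le> hi j" for t z
    by (intro W_upd x I that)
  have cont: "continuous_on {lo i..hi i} (\<lambda>z. val v (x(j := t, i := z)))" if t: "lo j \<le> t" "t \<le> hi j" for t
    by (rule val_continuous[OF v upW continuous_on_upd(1), where base = x]) (use t i j in auto)
  have self: "x(j := t, i := x i) = x(j := t)" for t using ij by auto
  have less: "val v (x(j := x j - h)) < val v x" "val v x < val v (x(j := x j + h))"
  proof -
    have "x(j := x j - h) \<in> W" "x(j := x j + h) \<in> W" using h by (auto intro!: W_upd x I)
    then show "val v (x(j := x j - h)) < val v x" "val v x < val v (x(j := x j + h))"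
      using h x j by (auto intro!: val_strict[OF v _ _ _ _ j])
  qed
  have "\<exists>e>0. \<forall>z\<in>{lo i..hi i}. dist z (x i) < e \<longrightarrow> dist (val v (x(j := x j + h, i := z))) (val v (x(j := x j + h, i := x i))) < val v (x(j := x j + h)) - val v x"
    by (rule cont[of "x j + h", unfolded continuous_on_iff, rule_format]) (use h xi less in auto)
  then obtain e1 where e1: "e1 > 0" "\<And>z. z \<in> {lo i..hi i} \<Longrightarrow> dist z (x i) < e1 \<Longrightarrow>
      dist (val v (x(j := x j + h, i := z))) (val v (x(j := x j + h))) < val v (x(j := x j + h)) - val v x"
    unfolding self by blast
  have "\<exists>e>0. \<forall>z\<in>{lo i..hi i}. dist z (x i) < e \<longrightarrow> dist (val v (x(j := x j - h, i := z))) (val v (x(j := x j - h, i := x i))) < val v x - val v (x(j := x j - h))"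
    by (rule cont[of "x j - h", unfolded continuous_on_iff, rule_format]) (use h xi less in auto)
  then obtain e2 where e2: "e2 > 0" "\<And>z. z \<in> {lo i..hi i} \<Longrightarrow> dist z (x i) < e2 \<Longrightarrow>
      dist (val v (x(j := x j - h, i := z))) (val v (x(j := x j - h))) < val v x - val v (x(j := x j - h))"
    unfolding self by blast
  show ?thesis
  proof (rule that[of "min e1 e2"])
    show "min e1 e2 > 0" using e1(1) e2(1) by simp
    fix z assume z: "lo i \<le> z" "z \<le> hi i" "\<bar>z - x i\<bar> < min e1 e2"
    have up: "val v x \<le> val v (x(j := x j + h, i := z))"
      using e1(2)[of z] z by (auto simp: dist_real_def abs_less_iff)
    have down: "val v (x(j := x j - h, i := z)) \<le> val v x"
      using e2(2)[of z] z by (auto simp: dist_real_def abs_less_iff)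
    have "continuous_on {x j - h..x j + h} (\<lambda>t. val v (x(j := t, i := z)))"
      by (rule val_continuous[OF v upW continuous_on_upd(2), where base = x]) (use z h i j in auto)
    then obtain z' where "x j - h \<le> z'" "z' \<le> x j + h" "val v (x(j := z', i := z)) = val v x"
      using IVT'[of "\<lambda>t. val v (x(j := t, i := z))" "x j - h" "val v x" "x j + h"] up down h(1) by auto
    moreover have "x(i := z, j := z') = x(j := z', i := z)" using ij by (rule fun_upd_twist)
    ultimately show "\<exists>z'. \<bar>z' - x j\<bar> < \<eta> \<and> lo j \<le> z' \<and> z' \<le> hi j \<and> val v (x(i := z, j := z')) = val v x"
      using h by (intro exI[of _ z']) auto
  qed
qed

lemma eu_class:
  assumes "\<And>i. i \<in> anc v \<Longrightarrow> Z k i = Z k' i"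
  shows "eu v \<kappa> Z k = eu v \<kappa> Z k'"
proof -
  have "restrict (Z k) (anc v) = restrict (Z k') (anc v)" by (rule restrict_ext) (rule assms)
  then show ?thesis by (simp only: eu_def)
qed

text \<open>When all indices share history and own coordinates, nothing is resolved at
  \<open>v\<close>: all children face one common history, and the aggregator is applied
  once.\<close>

lemma eu_common:
  assumes k: "k \<in> set_pmf \<kappa>" and same: "\<And>k i. k \<in> set_pmf \<kappa> \<Longrightarrow> i \<in> anc v \<union> own_coords v \<Longrightarrow> Z k i = x i"
  shows "eu v \<kappa> Z k = G v x (\<lambda>B\<in>ch v. eu (Some B) \<kappa> Z k)"
proof (subst eu_rec[OF k], rule avg_const)
  fix k' assume "k' \<in> set_pmf (cls \<kappa> Z (anc v) k)"
  then have k': "k' \<in> set_pmf \<kappa>" using set_cls[OF k] by auto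
  have "(\<lambda>B\<in>ch v. eu (Some B) \<kappa> Z k') = (\<lambda>B\<in>ch v. eu (Some B) \<kappa> Z k)"
  proof (rule restrict_ext)
    fix B assume B: "B \<in> ch v"
    show "eu (Some B) \<kappa> Z k' = eu (Some B) \<kappa> Z k"
    proof (rule eu_class)
      fix i assume "i \<in> anc (Some B)"
      then have i: "i \<in> anc v \<union> own_coords v" by (simp add: anc_child[OF B])
      show "Z k' i = Z k i" using same[OF k' i] same[OF k i] by simp
    qed
  qed
  moreover have "G v (Z k') = G v x" by (rule G_cong) (rule same[OF k'])
  ultimately show "G v (Z k') (\<lambda>B\<in>ch v. eu (Some B) \<kappa> Z k') = G v x (\<lambda>B\<in>ch v. eu (Some B) \<kappa> Z k)" by simp
qed

text \<open>The two outcomes part within the cluster \<open>B\<close> itself, so the uncertainty is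
  resolved there and enters as an expectation of final values.\<close>

lemma eu_two_separated:
  assumes B: "B \<in> P" and p: "0 < \<pi>" "\<pi> < 1" and same: "\<And>i. i \<in> anc (Some B) \<Longrightarrow> x1 i = x2 i"
    and m: "m \<in> B" "x1 m \<noteq> x2 m"
  shows "eu (Some B) (bernoulli_pmf \<pi>) (two x1 x2) k = \<pi> * val (Some B) x1 + (1 - \<pi>) * val (Some B) x2"
proof -
  have k: "k \<in> set_pmf (bernoulli_pmf \<pi>)" using p by simp
  have "eu (Some B) (bernoulli_pmf \<pi>) (two x1 x2) k =
      avg (cls (bernoulli_pmf \<pi>) (two x1 x2) (anc (Some B)) k) (\<lambda>k'. val (Some B) (two x1 x2 k'))"
  proof (rule eu_separated[OF _ k])
    fix k1 k2 l assume "\<And>i. i \<in> anc (Some B) \<union> own_coords (Some B) \<Longrightarrow> two x1 x2 k1 i = two x1 x2 k2 i"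
    from this[of m] have "k1 = k2" using m by (cases k1; cases k2) auto
    then show "two x1 x2 k1 l = two x1 x2 k2 l" by simp
  qed (use B in simp)
  also have "cls (bernoulli_pmf \<pi>) (two x1 x2) (anc (Some B)) k = bernoulli_pmf \<pi>"
    by (rule cls_all[OF k]) (cases k; simp add: same)
  also have "avg (bernoulli_pmf \<pi>) (\<lambda>k'. val (Some B) (two x1 x2 k')) = \<pi> * val (Some B) x1 + (1 - \<pi>) * val (Some B) x2"
    using p by simp
  finally show ?thesis .
qed

text \<open>Here the uncertainty is resolved only at the children, each of which averages on its own
  before \<open>v\<close> aggregates. Equating this with \<open>eu_two_separated\<close> at
  \<open>v\<close> is the source of affinity.\<close>

lemma eu_two_children:
  assumes p: "0 < \<pi>" "\<pi> < 1"
    and same: "\<And>i. i \<in> anc v \<union> own_coords v \<Longrightarrow> x1 i = x i" "\<And>i. i \<in> anc v \<union> own_coords v \<Longrightarrow> x2 i = x i"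
    and m: "\<And>B. B \<in> ch v \<Longrightarrow> \<exists>m\<in>B. x1 m \<noteq> x2 m"
  shows "eu v (bernoulli_pmf \<pi>) (two x1 x2) k =
    G v x (\<lambda>B\<in>ch v. \<pi> * val (Some B) x1 + (1 - \<pi>) * val (Some B) x2)"
proof -
  have "eu v (bernoulli_pmf \<pi>) (two x1 x2) k = G v x (\<lambda>B\<in>ch v. eu (Some B) (bernoulli_pmf \<pi>) (two x1 x2) k)"
    by (rule eu_common) (use p same in auto)
  moreover have "(\<lambda>B\<in>ch v. eu (Some B) (bernoulli_pmf \<pi>) (two x1 x2) k) =
      (\<lambda>B\<in>ch v. \<pi> * val (Some B) x1 + (1 - \<pi>) * val (Some B) x2)"
  proof (rule restrict_ext)
    fix B assume B: "B \<in> ch v"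
    obtain m where "m \<in> B" "x1 m \<noteq> x2 m" using m[OF B] by blast
    then show "eu (Some B) (bernoulli_pmf \<pi>) (two x1 x2) k = \<pi> * val (Some B) x1 + (1 - \<pi>) * val (Some B) x2"
      by (intro eu_two_separated[OF ch_V(2)[OF B] p]) (simp_all add: anc_child[OF B] same)
  qed
  ultimately show ?thesis by simp
qed

text \<open>Required on the box only, since nothing is known about \<open>G\<close>
  elsewhere.\<close>

definition affine_node :: "vertex \<Rightarrow> outcome \<Rightarrow> bool" where
  "affine_node v x \<longleftrightarrow> (\<forall>w\<in>bx v x. \<forall>w'\<in>bx v x. \<forall>\<pi>. 0 < \<pi> \<longrightarrow> \<pi> < 1 \<longrightarrow>
     G v x (\<lambda>B\<in>ch v. (1 - \<pi>) * w B + \<pi> * w' B) = (1 - \<pi>) * G v x w + \<pi> * G v x w')"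

lemma affine_nodeD: "affine_node v x \<Longrightarrow> w \<in> bx v x \<Longrightarrow> w' \<in> bx v x \<Longrightarrow> 0 < \<pi> \<Longrightarrow> \<pi> < 1 \<Longrightarrow>
    G v x (\<lambda>B\<in>ch v. (1 - \<pi>) * w B + \<pi> * w' B) = (1 - \<pi>) * G v x w + \<pi> * G v x w'"
  unfolding affine_node_def by blast

text \<open>An affine aggregator commutes with the conditional average that its children have in
  common; the nested averages that result collapse by \<open>avg_tower\<close>.\<close>

lemma eu_affine:
  assumes v: "v \<in> V" and fin: "finite (set_pmf \<kappa>)" and W: "\<And>k. k \<in> set_pmf \<kappa> \<Longrightarrow> Z k \<in> W"
    and aff: "\<And>x. x \<in> W \<Longrightarrow> affine_node v x" and k: "k \<in> set_pmf \<kappa>"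
    and children: "\<And>B k. B \<in> ch v \<Longrightarrow> k \<in> set_pmf \<kappa> \<Longrightarrow>
      eu (Some B) \<kappa> Z k = avg (cls \<kappa> Z (anc (Some B)) k) (\<lambda>k'. val (Some B) (Z k'))"
  shows "eu v \<kappa> Z k = avg (cls \<kappa> Z (anc v) k) (\<lambda>k'. val v (Z k'))"
proof -
  let ?S = "anc v \<union> own_coords v"
  have "G v (Z k') (\<lambda>B\<in>ch v. eu (Some B) \<kappa> Z k') = avg (cls \<kappa> Z ?S k') (\<lambda>k''. val v (Z k''))"
    if k': "k' \<in> set_pmf \<kappa>" for k'
  proof -
    have e: "(\<lambda>B\<in>ch v. eu (Some B) \<kappa> Z k') =
        (\<lambda>B\<in>ch v. avg (cls \<kappa> Z ?S k') (\<lambda>k''. (\<lambda>B\<in>ch v. val (Some B) (Z k'')) B))"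
      by (rule restrict_ext) (simp add: children k' anc_child)
    have "G v (Z k') (\<lambda>B\<in>ch v. eu (Some B) \<kappa> Z k') =
        avg (cls \<kappa> Z ?S k') (\<lambda>k''. G v (Z k') (\<lambda>B\<in>ch v. val (Some B) (Z k'')))"
      unfolding e
    proof (rule affine_avg)
      show "finite (set_pmf (cls \<kappa> Z ?S k'))" by (rule finite_cls[OF fin k'])
      fix k'' assume "k'' \<in> set_pmf (cls \<kappa> Z ?S k')"
      note k'' = cls_memD[OF k' this] cls_agree[OF k' this]
      show "(\<lambda>B\<in>ch v. val (Some B) (Z k'')) \<in> bx v (Z k')"
        using val_in_box[OF v W[OF k''(1)]] by (simp only: bx_cong[OF k''(2)])
    qed (rule affine_nodeD[OF aff[OF W[OF k']]])
    also have "\<dots> = avg (cls \<kappa> Z ?S k') (\<lambda>k''. val v (Z k''))"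
    proof (rule avg_cong)
      fix k'' assume "k'' \<in> set_pmf (cls \<kappa> Z ?S k')"
      note k'' = cls_agree[OF k' this]
      show "G v (Z k') (\<lambda>B\<in>ch v. val (Some B) (Z k'')) = val v (Z k'')"
        unfolding val_rec[of v "Z k''"] by (simp only: G_cong[OF k''])
    qed
    finally show ?thesis .
  qed
  then have "eu v \<kappa> Z k = avg (cls \<kappa> Z (anc v) k) (\<lambda>k'. avg (cls \<kappa> Z ?S k') (\<lambda>k''. val v (Z k'')))"
    unfolding eu_rec[OF k] by (intro avg_cong) (auto simp: set_cls[OF k])
  also have "\<dots> = avg (cls \<kappa> Z (anc v) k) (\<lambda>k'. val v (Z k'))"
    by (rule avg_tower[OF fin k]) simp
  finally show ?thesis .
qed

end

section \<open>Affine aggregators and linear trade-offs forced by the relation\<close>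

section \<open>What the dimension relation says about the utilities\<close>

context smeu begin

lemma nearby_point:
  assumes "lo i < hi i" "lo i \<le> y" "y \<le> hi i" "0 < e"
  obtains z where "lo i \<le> z" "z \<le> hi i" "\<bar>z - y\<bar> < e" "z \<noteq> y"
proof (cases "y < hi i")
  case True
  then show ?thesis using assms by (intro that[of "min (hi i) (y + e / 2)"]) (auto simp: min_def)
next
  case False
  then show ?thesis using assms by (intro that[of "max (lo i) (y - e / 2)"]) (auto simp: max_def)
qed

lemma interior_param:
  assumes v: "v \<in> V" and x: "x \<in> W" and B: "B \<in> ch v" and s: "s \<in> {0..1}"
    and int: "bt v x B s \<in> {bl v x B<..<bh v x B}"
  shows "0 < s" "s < 1"
  using int s unfolding bl_def bh_def by (cases "s = 0"; cases "s = 1"; auto)+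

lemma affine_coord:
  assumes "i \<in> I" shows "lo i + s * (hi i - lo i) = lo i + s' * (hi i - lo i) \<longleftrightarrow> s = s'"
    "0 < s \<Longrightarrow> lo i < lo i + s * (hi i - lo i)" "s < 1 \<Longrightarrow> lo i + s * (hi i - lo i) < hi i"
proof -
  have d: "hi i - lo i > 0" using lohi[OF assms] by simp
  then show "lo i + s * (hi i - lo i) = lo i + s' * (hi i - lo i) \<longleftrightarrow> s = s'" by simp
  show "0 < s \<Longrightarrow> lo i < lo i + s * (hi i - lo i)" using d by simp
  assume "s < 1"
  then have "s * (hi i - lo i) < 1 * (hi i - lo i)" using d by (rule mult_strict_right_mono)
  then show "lo i + s * (hi i - lo i) < hi i" by simp
qed

text \<open>Replace \<open>x2\<close> by an indifferent \<open>y2\<close> with another value of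
  \<open>i\<close>. The mixture of \<open>x1\<close> and \<open>x2\<close> is resolved below
  \<open>A\<close> and gives \<open>G\<close> at the mean vector; the mixture of \<open>x1\<close>
  and \<open>y2\<close> is already resolved at \<open>A\<close> and gives the mean of two values of
  \<open>G\<close>. The relation, applied with distinct values of \<open>j\<close>, equates the
  two.\<close>

lemma affine_if_dim_rel:
  assumes A: "A \<in> P" "i \<in> A" and B0: "B0 \<in> ch (Some A)" and j: "j \<in> sub (Some B0)"
    and rel: "dim_rel I X R j i" and x: "x \<in> W"
  shows "affine_node (Some A) x"
proof -
  let ?v = "Some A"
  have v: "?v \<in> V" using A by simp
  have iv: "i \<in> sub ?v" using A(2) own_sub[of ?v] by auto
  have jv: "j \<in> sub ?v" using j child_sub[OF B0] by blast
  have I: "i \<in> I" "j \<in> I" using in_I[OF v] iv jv by auto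
  have ij: "j \<noteq> i" using own_child_disjoint[OF B0] A(2) j by auto
  have gen: "G ?v x (\<lambda>B\<in>ch ?v. (1 - \<pi>) * w B + \<pi> * w' B) = (1 - \<pi>) * G ?v x w + \<pi> * G ?v x w'"
    if p: "0 < \<pi>" "\<pi> < 1" and w: "w \<in> bx ?v x" and w': "w' \<in> (\<Pi>\<^sub>E B\<in>ch ?v. {bl ?v x B<..<bh ?v x B})"
      and ne: "\<And>B. B \<in> ch ?v \<Longrightarrow> w B \<noteq> w' B" for \<pi> w w'
  proof -
    have w'bx: "w' \<in> bx ?v x"
      using w' by (rule subsetD[OF PiE_mono, rotated]) auto
    obtain t where t: "\<And>B. t B \<in> {0..1}" "w = (\<lambda>B\<in>ch ?v. bt ?v x B (t B))"
      using box_param[OF v x w] by metis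
    obtain t' where t': "\<And>B. t' B \<in> {0..1}" "w' = (\<lambda>B\<in>ch ?v. bt ?v x B (t' B))"
      using box_param[OF v x w'bx] by metis
    have tt: "t B \<noteq> t' B" if "B \<in> ch ?v" for B using ne[OF that] that by (auto simp: t(2) t'(2))
    have t'01: "0 < t' B0" "t' B0 < 1"
      using interior_param[OF v x B0 t'(1)[of B0]] PiE_mem[OF w' B0] B0 by (simp_all add: t'(2))
    define x1 where "x1 = dg ?v x t"
    define x2 where "x2 = dg ?v x t'"
    have W: "x1 \<in> W" "x2 \<in> W" unfolding x1_def x2_def by (rule dg_W[OF v x], rule t t')+
    have own: "x1 l = x l" "x2 l = x l" if "l \<in> anc ?v \<union> own_coords ?v" for l
      unfolding x1_def x2_def using that by (simp_all only: dg_anc_own)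
    have off: "x1 l = x l" "x2 l = x l" if "l \<in> I - sub ?v" for l
      unfolding x1_def x2_def using that by (simp_all add: dg_off)
    have xj: "x1 j = lo j + t B0 * (hi j - lo j)" "x2 j = lo j + t' B0 * (hi j - lo j)"
      unfolding x1_def x2_def by (rule dg_child[OF B0 j])+
    have xjne: "x1 j \<noteq> x2 j" unfolding xj affine_coord(1)[OF I(2)] by (rule tt[OF B0])
    have x2j: "lo j < x2 j" "x2 j < hi j" unfolding xj using affine_coord(2,3)[OF I(2)] t'01 by auto
    \<comment> \<open>A change of \<open>x2 j\<close> by less than its distance to
      \<open>x1 j\<close> keeps the two values of \<open>j\<close> distinct, as the relation
      demands.\<close>
    have eta: "0 < \<bar>x1 j - x2 j\<bar>" using xjne by simp
    obtain \<epsilon> where e: "\<epsilon> > 0" "\<And>z. lo i \<le> z \<Longrightarrow> z \<le> hi i \<Longrightarrow> \<bar>z - x2 i\<bar> < \<epsilon> \<Longrightarrow>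
        \<exists>z'. \<bar>z' - x2 j\<bar> < \<bar>x1 j - x2 j\<bar> \<and> lo j \<le> z' \<and> z' \<le> hi j \<and> val ?v (x2(i := z, j := z')) = val ?v x2"
      using compensate[OF v W(2) iv jv ij[symmetric] x2j eta] by metis
    have x2i: "lo i \<le> x2 i" "x2 i \<le> hi i" using W(2) I(1) by (auto simp: mem_W)
    obtain z where z: "lo i \<le> z" "z \<le> hi i" "\<bar>z - x2 i\<bar> < \<epsilon>" "z \<noteq> x2 i"
      using nearby_point[OF lohi[OF I(1)] x2i e(1)] by metis
    obtain z' where z': "\<bar>z' - x2 j\<bar> < \<bar>x1 j - x2 j\<bar>" "lo j \<le> z'" "z' \<le> hi j"
        "val ?v (x2(i := z, j := z')) = val ?v x2"
      using e(2)[OF z(1-3)] by blast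
    define y2 where "y2 = x2(i := z, j := z')"
    have y2W: "y2 \<in> W" unfolding y2_def by (intro W_upd W I z z')
    have y2: "y2 i = z" "y2 j = z'" "\<And>l. l \<noteq> i \<Longrightarrow> l \<noteq> j \<Longrightarrow> y2 l = x2 l"
      using ij by (simp_all add: y2_def)
    have y2off: "y2 l = x l" if "l \<in> I - sub ?v" for l
      using that iv jv y2(3)[of l] off(2)[OF that] by auto
    have xi: "x1 i = x i" "x2 i = x i" using own[of i] A(2) by auto
    \<comment> \<open>The weight \<open>1 - \<pi>\<close> belongs to \<open>x1\<close>, the outcome
      with index \<open>True\<close>.\<close>
    have p': "0 < 1 - \<pi>" "1 - \<pi> < 1" using p by auto
    have eq: "eu ?v (bernoulli_pmf (1 - \<pi>)) (two x1 x2) True = eu ?v (bernoulli_pmf (1 - \<pi>)) (two x1 y2) True"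
    proof (rule dim_rel_indifferent[OF v rel p' W(1,2,1) y2W off(1,2,1) y2off xjne])
      show "x1 j \<noteq> y2 j" unfolding y2(2) using z'(1) by auto
      show "val ?v x2 = val ?v y2" unfolding y2_def by (rule z'(4)[symmetric])
      show "x2 l = y2 l" if "l \<noteq> j" "l \<noteq> i" for l using y2(3)[OF that(2,1)] by simp
    qed auto
    have "eu ?v (bernoulli_pmf (1 - \<pi>)) (two x1 x2) True =
        G ?v x (\<lambda>B\<in>ch ?v. (1 - \<pi>) * val (Some B) x1 + (1 - (1 - \<pi>)) * val (Some B) x2)"
    proof (rule eu_two_children[OF p' own])
      fix B assume B: "B \<in> ch ?v"
      obtain m where m: "m \<in> B" using cluster_ne[OF ch_V(2)[OF B]] by blast
      have mB: "m \<in> sub (Some B)" using m own_sub[of "Some B"] by auto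
      have "x1 m \<noteq> x2 m"
        unfolding x1_def x2_def dg_child[OF B mB] affine_coord(1)[OF in_I[OF child_V[OF B] mB]] by (rule tt[OF B])
      with m show "\<exists>m\<in>B. x1 m \<noteq> x2 m" by blast
    qed
    also have "(\<lambda>B\<in>ch ?v. (1 - \<pi>) * val (Some B) x1 + (1 - (1 - \<pi>)) * val (Some B) x2) =
        (\<lambda>B\<in>ch ?v. (1 - \<pi>) * w B + \<pi> * w' B)"
      by (rule restrict_ext) (simp add: x1_def x2_def val_dg t(2) t'(2))
    finally have lhs: "eu ?v (bernoulli_pmf (1 - \<pi>)) (two x1 x2) True =
        G ?v x (\<lambda>B\<in>ch ?v. (1 - \<pi>) * w B + \<pi> * w' B)" .
    have "eu ?v (bernoulli_pmf (1 - \<pi>)) (two x1 y2) True = (1 - \<pi>) * val ?v x1 + (1 - (1 - \<pi>)) * val ?v y2"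
    proof (rule eu_two_separated[OF A(1) p' _ A(2)])
      show "x1 i \<noteq> y2 i" unfolding y2(1) xi(1) using z(4) xi(2) by simp
      fix l assume l: "l \<in> anc ?v"
      then have "l \<in> I - sub ?v" using anc_off[OF v] by blast
      then show "x1 l = y2 l" using off(1) y2off by simp
    qed
    also have "val ?v y2 = val ?v x2" unfolding y2_def by (rule z'(4))
    also have "val ?v x1 = G ?v x w" unfolding x1_def t(2) by (rule G_dg[symmetric])
    also have "val ?v x2 = G ?v x w'" unfolding x2_def t'(2) by (rule G_dg[symmetric])
    finally show ?thesis using lhs eq by simp
  qed
  show ?thesis
    unfolding affine_node_def
  proof (intro ballI allI impI)
    fix w w' and \<pi> :: real
    assume w: "w \<in> bx ?v x" "w' \<in> bx ?v x" and p: "0 < \<pi>" "\<pi> < 1"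
    show "G ?v x (\<lambda>B\<in>ch ?v. (1 - \<pi>) * w B + \<pi> * w' B) = (1 - \<pi>) * G ?v x w + \<pi> * G ?v x w'"
      by (rule affine_by_density[OF finite_ch bl_less_bh[OF v x] G_continuous[OF v x] _ _ gen[OF p] w])
        (use p in auto)
  qed
qed

text \<open>If \<open>y\<close> is to be a mixture of \<open>a\<close>, with weight \<rho>, and a
  second point, then the second point is this quotient; it tends to \<open>y\<close> as \<rho>
  decreases to 0.\<close>

lemma tendsto_extrapolation:
  fixes y a :: real
  assumes "open Op" "y \<in> Op"
  shows "\<forall>\<^sub>F \<rho> in at_right 0. (y - \<rho> * a) / (1 - \<rho>) \<in> Op"
proof -
  have "((\<lambda>\<rho>. (y - \<rho> * a) / (1 - \<rho>)) \<longlongrightarrow> (y - 0 * a) / (1 - 0)) (at_right 0)"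
    by (intro tendsto_intros) auto
  then show ?thesis using assms by (auto simp: tendsto_def)
qed

text \<open>An ordinal condition: with the other entries fixed, \<open>G\<close> is some strictly
  increasing function of the weighted sum, possibly a different one for each choice of those
  entries.\<close>

definition linear_in where
  "linear_in v x B C \<alpha> \<beta> \<longleftrightarrow> (\<forall>w\<in>bx v x. \<forall>w'\<in>bx v x.
     (\<forall>D\<in>ch v. D \<noteq> B \<longrightarrow> D \<noteq> C \<longrightarrow> w D = w' D) \<longrightarrow>
     (G v x w \<le> G v x w' \<longleftrightarrow> \<alpha> * w B + \<beta> * w C \<le> \<alpha> * w' B + (\<beta> :: real) * w' C))"

lemma linear_inD: "linear_in v x B C \<alpha> \<beta> \<Longrightarrow> w \<in> bx v x \<Longrightarrow> w' \<in> bx v x \<Longrightarrow>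
     (\<And>D. D \<in> ch v \<Longrightarrow> D \<noteq> B \<Longrightarrow> D \<noteq> C \<Longrightarrow> w D = w' D) \<Longrightarrow>
     G v x w \<le> G v x w' \<longleftrightarrow> \<alpha> * w B + \<beta> * w C \<le> \<alpha> * w' B + \<beta> * w' C"
  unfolding linear_in_def by blast

text \<open>From a central outcome \<open>x1\<close>, raise \<open>b\<close> and lower
  \<open>c\<close> to obtain an indifferent \<open>y1\<close>. The child utilities then move by a
  vector \<open>d\<close> that is positive at \<open>B\<close>, negative at \<open>C\<close> and
  zero elsewhere. Mixing \<open>x1\<close> and \<open>y1\<close> with a common generic outcome shows
  that adding a small multiple of \<open>d\<close> at a generic point does not change
  \<open>G\<close>. \<open>constant_along_direction\<close> and
  \<open>ordinally_linear_in_two\<close> turn this into the linear trade-off.\<close>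

lemma siblings_linear:
  assumes v: "v \<in> V" and B: "B \<in> ch v" and C: "C \<in> ch v" and BC: "B \<noteq> C"
    and b: "b \<in> B" and c: "c \<in> C" and rel: "dim_rel I X R b c" and x: "x \<in> W"
  obtains \<alpha> \<beta> where "\<alpha> > 0" "\<beta> > 0" "linear_in v x B C \<alpha> \<beta>"
proof -
  \<comment> \<open>The middle of every diagonal, so that \<open>b\<close> and \<open>c\<close> have
    room to move in both directions.\<close>
  define x1 where "x1 = dg v x (\<lambda>_. 1 / 2)"
  have x1W: "x1 \<in> W" unfolding x1_def by (rule dg_W[OF v x]) simp
  have bB: "b \<in> sub (Some B)" and cC: "c \<in> sub (Some C)"
    using b c own_sub[of "Some B"] own_sub[of "Some C"] by auto
  have bv: "b \<in> sub v" and cv: "c \<in> sub v" using bB cC child_sub[OF B] child_sub[OF C] by auto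
  have disj: "sub (Some B) \<inter> sub (Some C) = {}" by (rule child_child_disjoint[OF B C BC])
  have bc: "b \<noteq> c" "b \<notin> sub (Some C)" "c \<notin> sub (Some B)" using disj bB cC by auto
  have I: "b \<in> I" "c \<in> I" using in_I[OF v] bv cv by auto
  have x1b: "x1 b = lo b + 1 / 2 * (hi b - lo b)" unfolding x1_def by (rule dg_child[OF B bB])
  have x1c: "x1 c = lo c + 1 / 2 * (hi c - lo c)" unfolding x1_def by (rule dg_child[OF C cC])
  have x1c_int: "lo c < x1 c" "x1 c < hi c" unfolding x1c using affine_coord(2,3)[OF I(2), of "1/2"] by auto
  have x1b_int: "lo b < x1 b" "x1 b < hi b" unfolding x1b using affine_coord(2,3)[OF I(1), of "1/2"] by auto
  obtain \<epsilon> where e: "\<epsilon> > 0" "\<And>z. lo b \<le> z \<Longrightarrow> z \<le> hi b \<Longrightarrow> \<bar>z - x1 b\<bar> < \<epsilon> \<Longrightarrow>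
      \<exists>z'. \<bar>z' - x1 c\<bar> < 1 \<and> lo c \<le> z' \<and> z' \<le> hi c \<and> val v (x1(b := z, c := z')) = val v x1"
    using compensate[OF v x1W bv cv bc(1) x1c_int, of 1] by (metis zero_less_one)
  \<comment> \<open>A value strictly above \<open>x1 b\<close>, in range and within \<epsilon> of
    it; the increase is what makes \<open>d B\<close> positive.\<close>
  define z where "z = min (hi b) (x1 b + \<epsilon> / 2)"
  have z: "x1 b < z" "lo b \<le> z" "z \<le> hi b" "\<bar>z - x1 b\<bar> < \<epsilon>"
    using x1b_int e(1) by (auto simp: z_def min_def)
  obtain z' where z': "lo c \<le> z'" "z' \<le> hi c" "val v (x1(b := z, c := z')) = val v x1"
    using e(2)[OF z(2-4)] by blast
  define y1 where "y1 = x1(b := z, c := z')"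
  have y1W: "y1 \<in> W" unfolding y1_def by (intro W_upd x1W I z z')
  have y1: "y1 b = z" "y1 c = z'" "\<And>l. l \<noteq> b \<Longrightarrow> l \<noteq> c \<Longrightarrow> y1 l = x1 l" using bc(1) by (simp_all add: y1_def)
  have val_y1: "val v x1 = val v y1" using z'(3) by (simp only: y1_def)
  have offeq: "x1 l = y1 l" if "l \<in> I - sub v" for l
  proof -
    have "l \<noteq> b" "l \<noteq> c" using that bv cv by auto
    then show ?thesis using y1(3) by simp
  qed
  \<comment> \<open>Otherwise \<open>y1\<close> would dominate \<open>x1\<close> and could not be
    indifferent to it.\<close>
  have z'less: "z' < x1 c"
  proof (rule ccontr)
    assume "\<not> z' < x1 c"
    then have le: "x1 l \<le> y1 l" for l using y1 z(1) by (cases "l = b"; cases "l = c") auto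
    have "val v x1 < val v y1"
      by (rule val_strict[OF v x1W y1W offeq le bv]) (simp_all add: y1(1) z(1))
    with val_y1 show False by simp
  qed
  have off1: "x1 l = x l" if "l \<in> I - sub v" for l unfolding x1_def using that by (simp add: dg_off)
  have off1': "y1 l = x l" if "l \<in> I - sub v" for l
    using offeq[OF that] off1[OF that] by simp
  have own1: "x1 l = x l" if "l \<in> anc v \<union> own_coords v" for l unfolding x1_def by (rule dg_anc_own[OF that])
  have own_not: "l \<noteq> b \<and> l \<noteq> c" if "l \<in> anc v \<union> own_coords v" for l
    using that bB cC own_child_disjoint[OF B] own_child_disjoint[OF C] anc_child_disjoint[OF B] anc_child_disjoint[OF C]
    by blast
  have own1': "y1 l = x l" if "l \<in> anc v \<union> own_coords v" for l
    using y1(3)[of l] own_not[OF that] own1[OF that] by simp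
  define d where "d D = val (Some D) y1 - val (Some D) x1" for D
  have dB: "d B > 0"
  proof -
    have "val (Some B) y1 = val (Some B) (x1(b := z))"
      by (rule val_local[OF child_V[OF B]])
        (use bc own_not anc_child[OF B] in \<open>auto simp: y1_def\<close>)
    moreover have "val (Some B) x1 < val (Some B) (x1(b := z))"
      by (rule val_strict[OF child_V[OF B] x1W W_upd[OF x1W I(1) z(2,3)] _ _ bB]) (use z bB in auto)
    ultimately show ?thesis by (simp add: d_def)
  qed
  have dC: "d C < 0"
  proof -
    have "val (Some C) y1 = val (Some C) (x1(c := z'))"
      by (rule val_local[OF child_V[OF C]])
        (use bc own_not anc_child[OF C] in \<open>auto simp: y1_def\<close>)
    moreover have "val (Some C) (x1(c := z')) < val (Some C) x1"
      by (rule val_strict[OF child_V[OF C] W_upd[OF x1W I(2) z'(1,2)] x1W _ _ cC]) (use z'less cC in auto)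
    ultimately show ?thesis by (simp add: d_def)
  qed
  have d0: "d D = 0" if D: "D \<in> ch v" "D \<noteq> B" "D \<noteq> C" for D
  proof -
    have "b \<notin> sub (Some D)" "c \<notin> sub (Some D)"
      using child_child_disjoint[OF D(1) B D(2)] child_child_disjoint[OF D(1) C D(3)] bB cC by auto
    then have "val (Some D) y1 = val (Some D) x1"
      by (intro val_local[OF child_V[OF D(1)]]) (use own_not anc_child[OF D(1)] in \<open>auto simp: y1_def\<close>)
    then show ?thesis by (simp add: d_def)
  qed
  define sb where "sb = (z - lo b) / (hi b - lo b)"
  define sc where "sc = (z' - lo c) / (hi c - lo c)"
  have sb: "lo b + s * (hi b - lo b) = z \<longleftrightarrow> s = sb" for s
    using lohi[OF I(1)] by (auto simp: sb_def field_simps)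
  have sc: "lo c + s * (hi c - lo c) = z' \<longleftrightarrow> s = sc" for s
    using lohi[OF I(2)] by (auto simp: sc_def field_simps)
  \<comment> \<open>Utilities that the generic outcome \<open>x2\<close> has to avoid: at the
    relative positions 1/2, \<open>sb\<close> and \<open>sc\<close> it could share a coordinate with
    \<open>x1\<close> or \<open>y1\<close>.\<close>
  define F where "F D = {bt v x D (1 / 2), bt v x D sb, bt v x D sc}" for D
  have finF: "finite (F D)" for D by (simp add: F_def)
  define Op where "Op D = {bl v x D<..<bh v x D} - F D" for D
  have Op: "open (Op D)" for D unfolding Op_def by (intro open_Diff finite_imp_closed finF) simp
  have mix: "G v x (\<lambda>D\<in>ch v. r * val (Some D) x1 + (1 - r) * w2 D) =
      G v x (\<lambda>D\<in>ch v. r * val (Some D) y1 + (1 - r) * w2 D)"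
    if r: "0 < r" "r < 1" and w2: "\<And>D. D \<in> ch v \<Longrightarrow> w2 D \<in> Op D" for r w2
  proof -
    have "restrict w2 (ch v) \<in> bx v x" using w2 by (auto simp: Op_def less_imp_le)
    then obtain t where t: "\<And>D. t D \<in> {0..1}" "restrict w2 (ch v) = (\<lambda>D\<in>ch v. bt v x D (t D))"
      using box_param[OF v x] by metis
    have bt_t: "bt v x D (t D) = w2 D" if "D \<in> ch v" for D
      using fun_cong[OF t(2), of D] that by simp
    have tne: "t D \<noteq> 1 / 2" "t D \<noteq> sb" "t D \<noteq> sc" if "D \<in> ch v" for D
    proof -
      have "w2 D \<noteq> bt v x D (1 / 2)" "w2 D \<noteq> bt v x D sb" "w2 D \<noteq> bt v x D sc"
        using w2[OF that] by (auto simp: Op_def F_def)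
      then show "t D \<noteq> 1 / 2" "t D \<noteq> sb" "t D \<noteq> sc" unfolding bt_t[OF that, symmetric] by metis+
    qed
    define x2 where "x2 = dg v x t"
    have x2W: "x2 \<in> W" unfolding x2_def by (rule dg_W[OF v x t(1)])
    have off2: "x2 l = x l" if "l \<in> I - sub v" for l unfolding x2_def using that by (simp add: dg_off)
    have own2: "x2 l = x l" if "l \<in> anc v \<union> own_coords v" for l unfolding x2_def by (rule dg_anc_own[OF that])
    have x2D: "x2 l = lo l + t D * (hi l - lo l)" if "D \<in> ch v" "l \<in> sub (Some D)" for l D
      unfolding x2_def by (rule dg_child[OF that])
    have ne1: "x1 l \<noteq> x2 l" if D: "D \<in> ch v" "l \<in> sub (Some D)" for l D
      unfolding x2D[OF D] unfolding x1_def dg_child[OF D] affine_coord(1)[OF in_I[OF child_V[OF D(1)] D(2)]]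
      using tne(1)[OF D(1)] by simp
    have y1b: "y1 b \<noteq> x2 b" unfolding y1(1) x2D[OF B bB] using tne(2)[OF B] sb[of "t B"] by metis
    have y1c: "y1 c \<noteq> x2 c" unfolding y1(2) x2D[OF C cC] using tne(3)[OF C] sc[of "t C"] by metis
    have v2: "val (Some D) x2 = w2 D" if "D \<in> ch v" for D
      unfolding x2_def val_dg[OF that] by (rule bt_t[OF that])
    have eq: "eu v (bernoulli_pmf r) (two x1 x2) True = eu v (bernoulli_pmf r) (two y1 x2) True"
      by (rule dim_rel_indifferent[OF v rel r x1W x2W y1W x2W off1 off2 off1' off2 ne1[OF B bB] y1b _ _ val_y1])
        (use y1(3) in auto)
    have "eu v (bernoulli_pmf r) (two x1 x2) True = G v x (\<lambda>D\<in>ch v. r * val (Some D) x1 + (1 - r) * val (Some D) x2)"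
    proof (rule eu_two_children[OF r own1 own2])
      fix D assume D: "D \<in> ch v"
      obtain m where m: "m \<in> D" using cluster_ne[OF ch_V(2)[OF D]] by blast
      have "m \<in> sub (Some D)" using m own_sub[of "Some D"] by auto
      from ne1[OF D this] m show "\<exists>m\<in>D. x1 m \<noteq> x2 m" by blast
    qed
    moreover have "eu v (bernoulli_pmf r) (two y1 x2) True = G v x (\<lambda>D\<in>ch v. r * val (Some D) y1 + (1 - r) * val (Some D) x2)"
    proof (rule eu_two_children[OF r own1' own2])
      fix D assume D: "D \<in> ch v"
      obtain m where m: "m \<in> D" using cluster_ne[OF ch_V(2)[OF D]] by blast
      have mD: "m \<in> sub (Some D)" using m own_sub[of "Some D"] by auto
      show "\<exists>m\<in>D. y1 m \<noteq> x2 m"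
      proof (cases "m = b \<or> m = c")
        case True
        then have "y1 m \<noteq> x2 m" using y1b y1c by blast
        with m show ?thesis by blast
      next
        case False
        then have "y1 m = x1 m" using y1(3) by blast
        then have "y1 m \<noteq> x2 m" using ne1[OF D mD] by (simp only: not_False_eq_True)
        with m show ?thesis by (rule bexI[rotated])
      qed
    qed
    moreover have "(\<lambda>D\<in>ch v. r * val (Some D) x1 + (1 - r) * val (Some D) x2) = (\<lambda>D\<in>ch v. r * val (Some D) x1 + (1 - r) * w2 D)"
      "(\<lambda>D\<in>ch v. r * val (Some D) y1 + (1 - r) * val (Some D) x2) = (\<lambda>D\<in>ch v. r * val (Some D) y1 + (1 - r) * w2 D)"
      by (rule restrict_ext, simp add: v2)+
    ultimately show ?thesis using eq by simp
  qed
  have cancel: "(1 - r) * (a / (1 - r)) = a" if "r < 1" for a r :: real using that by simp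
  have loc: "\<exists>\<delta>>0. \<forall>\<rho>. \<bar>\<rho>\<bar> < \<delta> \<longrightarrow> G v x (\<lambda>D\<in>ch v. y D + \<rho> * d D) = G v x y"
    if y: "y \<in> (\<Pi>\<^sub>E D\<in>ch v. {bl v x D<..<bh v x D} - F D)" for y
  proof -
    have yO: "y D \<in> Op D" if "D \<in> ch v" for D using PiE_mem[OF y that] by (simp add: Op_def)
    have yext: "(\<lambda>D\<in>ch v. y D) = y" using y by (auto simp: PiE_def extensional_def fun_eq_iff restrict_def)
    have "\<forall>\<^sub>F \<rho> in at_right 0. \<forall>D\<in>ch v. (y D - \<rho> * val (Some D) x1) / (1 - \<rho>) \<in> Op D \<and>
        (y D - \<rho> * val (Some D) y1) / (1 - \<rho>) \<in> Op D"
      by (intro eventually_ball_finite ballI eventually_conj tendsto_extrapolation Op yO finite_ch)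
    then obtain \<delta> where \<delta>: "\<delta> > 0" "\<And>\<rho> D. 0 < \<rho> \<Longrightarrow> \<rho> < \<delta> \<Longrightarrow> D \<in> ch v \<Longrightarrow>
        (y D - \<rho> * val (Some D) x1) / (1 - \<rho>) \<in> Op D \<and> (y D - \<rho> * val (Some D) y1) / (1 - \<rho>) \<in> Op D"
      unfolding eventually_at_right_field by blast
    have "G v x (\<lambda>D\<in>ch v. y D + \<rho> * d D) = G v x y" if rho: "\<bar>\<rho>\<bar> < min \<delta> 1" for \<rho>
    proof -
      \<comment> \<open>A negative multiple of \<open>d\<close> is obtained by exchanging the roles
        of \<open>x1\<close> and \<open>y1\<close>.\<close>
      consider "\<rho> = 0" | "0 < \<rho>" "\<rho> < \<delta>" "\<rho> < 1" | "0 < - \<rho>" "- \<rho> < \<delta>" "- \<rho> < 1" using rho by linarith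
      then show ?thesis
      proof cases
        case 1 then show ?thesis using yext by simp
      next
        case 2
        have "G v x (\<lambda>D\<in>ch v. \<rho> * val (Some D) x1 + (1 - \<rho>) * ((y D - \<rho> * val (Some D) x1) / (1 - \<rho>))) =
            G v x (\<lambda>D\<in>ch v. \<rho> * val (Some D) y1 + (1 - \<rho>) * ((y D - \<rho> * val (Some D) x1) / (1 - \<rho>)))"
          by (rule mix[OF 2(1,3)]) (use \<delta>(2)[OF 2(1,2)] in blast)
        moreover have "(\<lambda>D\<in>ch v. \<rho> * val (Some D) x1 + (1 - \<rho>) * ((y D - \<rho> * val (Some D) x1) / (1 - \<rho>))) = (\<lambda>D\<in>ch v. y D)"
          unfolding cancel[OF 2(3)] by (rule restrict_ext) simp
        moreover have "(\<lambda>D\<in>ch v. \<rho> * val (Some D) y1 + (1 - \<rho>) * ((y D - \<rho> * val (Some D) x1) / (1 - \<rho>))) = (\<lambda>D\<in>ch v. y D + \<rho> * d D)"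
          unfolding cancel[OF 2(3)] by (rule restrict_ext) (simp add: d_def algebra_simps)
        ultimately show ?thesis using yext by simp
      next
        case 3
        have "G v x (\<lambda>D\<in>ch v. - \<rho> * val (Some D) x1 + (1 - - \<rho>) * ((y D - - \<rho> * val (Some D) y1) / (1 - - \<rho>))) =
            G v x (\<lambda>D\<in>ch v. - \<rho> * val (Some D) y1 + (1 - - \<rho>) * ((y D - - \<rho> * val (Some D) y1) / (1 - - \<rho>)))"
          by (rule mix[OF 3(1,3)]) (use \<delta>(2)[OF 3(1,2)] in blast)
        moreover have "(\<lambda>D\<in>ch v. - \<rho> * val (Some D) x1 + (1 - - \<rho>) * ((y D - - \<rho> * val (Some D) y1) / (1 - - \<rho>))) = (\<lambda>D\<in>ch v. y D + \<rho> * d D)"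
          unfolding cancel[OF 3(3)] by (rule restrict_ext) (simp add: d_def algebra_simps)
        moreover have "(\<lambda>D\<in>ch v. - \<rho> * val (Some D) y1 + (1 - - \<rho>) * ((y D - - \<rho> * val (Some D) y1) / (1 - - \<rho>))) = (\<lambda>D\<in>ch v. y D)"
          unfolding cancel[OF 3(3)] by (rule restrict_ext) simp
        ultimately show ?thesis using yext by simp
      qed
    qed
    then show ?thesis using \<delta>(1) by (intro exI[of _ "min \<delta> 1"]) simp
  qed
  have gl: "G v x a = G v x a'" if "a \<in> bx v x" "a' \<in> bx v x" "\<And>D. D \<in> ch v \<Longrightarrow> a' D - a D = \<kappa> * d D" for a a' \<kappa>
    by (rule constant_along_direction[OF finite_ch bl_less_bh[OF v x] G_continuous[OF v x] finF loc that])
  \<comment> \<open>The weights are those for which the sum is invariant under shifts along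
    \<open>d\<close>.\<close>
  have "linear_in v x B C (- d C) (d B)"
    unfolding linear_in_def
  proof (intro ballI impI)
    fix w w' assume w: "w \<in> bx v x" "w' \<in> bx v x" "\<forall>D\<in>ch v. D \<noteq> B \<longrightarrow> D \<noteq> C \<longrightarrow> w D = w' D"
    show "G v x w \<le> G v x w' \<longleftrightarrow> - d C * w B + d B * w C \<le> - d C * w' B + d B * w' C"
      by (rule ordinally_linear_in_two[OF G_strict[OF v x] gl B C BC dB dC d0 w(1,2)]) (use w(3) in auto)
  qed
  then show ?thesis using that[of "- d C" "d B"] dB dC by simp
qed

end

context smeu begin

text \<open>The weighted sum of the two sibling utilities decides at \<open>v\<close>, and for
  leaves both utilities are plain conditional averages. An inequality between these sums outcome by
  outcome therefore survives averaging, whichever of the two dimensions the mixture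
  separates.\<close>

lemma leaf_siblings_sym:
  assumes v: "v \<in> V" and B: "B \<in> ch v" and C: "C \<in> ch v" and BC: "B \<noteq> C"
    and leaf: "ch (Some B) = {}" "ch (Some C) = {}"
    and b: "b \<in> B" and c: "c \<in> C" and rel: "dim_rel I X R b c"
  shows "dim_rel I X R c b"
proof (rule dim_relI)
  fix \<kappa> :: "nat pmf" and Z Z' k
  assume fin: "finite (set_pmf \<kappa>)" and W: "\<And>k. k \<in> set_pmf \<kappa> \<Longrightarrow> Z k \<in> W" "\<And>k. k \<in> set_pmf \<kappa> \<Longrightarrow> Z' k \<in> W"
    and same: "\<And>k l. k \<in> set_pmf \<kappa> \<Longrightarrow> l \<in> I \<Longrightarrow> l \<noteq> c \<Longrightarrow> l \<noteq> b \<Longrightarrow> Z k l = Z' k l"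
    and R: "\<And>k. k \<in> set_pmf \<kappa> \<Longrightarrow> R (return_pmf (Z k)) (return_pmf (Z' k))" and k: "k \<in> set_pmf \<kappa>"
  have bB: "b \<in> sub (Some B)" and cC: "c \<in> sub (Some C)"
    using b c own_sub[of "Some B"] own_sub[of "Some C"] by auto
  have bv: "b \<in> sub v" and cv: "c \<in> sub v" using bB cC child_sub[OF B] child_sub[OF C] by auto
  have own_not: "l \<in> I \<and> l \<noteq> b \<and> l \<noteq> c" if "l \<in> anc v \<union> own_coords v" for l
    using that bB cC own_child_disjoint[OF B] own_child_disjoint[OF C] anc_child_disjoint[OF B] anc_child_disjoint[OF C]
      anc_I own_I[OF v] by blast
  have own: "Z k l = Z' k l" if "k \<in> set_pmf \<kappa>" "l \<in> anc v \<union> own_coords v" for k l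
    by (rule same[OF that(1)]) (use own_not[OF that(2)] in auto)
  have off: "Z k l = Z' k l" if "k \<in> set_pmf \<kappa>" "l \<in> I - sub v" for k l
    by (rule same[OF that(1)]) (use that(2) bv cv in auto)
  have le: "val v (Z' k) \<le> val v (Z k)" if "k \<in> set_pmf \<kappa>" for k
    using R_iff_val[OF v W(1)[OF that] W(2)[OF that] off[OF that]] R[OF that] by blast
  let ?S = "anc v \<union> own_coords v"
  show "eu None \<kappa> Z' k \<le> eu None \<kappa> Z k"
  proof (rule dominance[OF v fin W off _ k])
    fix k assume k: "k \<in> set_pmf \<kappa>"
    have cls: "cls \<kappa> Z (anc v) k = cls \<kappa> Z' (anc v) k"
      by (rule cls_cong[OF k]) (rule own, assumption, simp)
    have node_le: "G v (Z' k') (\<lambda>B\<in>ch v. eu (Some B) \<kappa> Z' k') \<le> G v (Z k') (\<lambda>B\<in>ch v. eu (Some B) \<kappa> Z k')"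
      if k': "k' \<in> set_pmf \<kappa>" for k'
    proof -
      obtain \<alpha> \<beta> where ab: "\<alpha> > 0" "\<beta> > 0" and lin: "linear_in v (Z k') B C \<alpha> \<beta>"
        using siblings_linear[OF v B C BC b c rel W(1)[OF k']] by metis
      have clsS: "cls \<kappa> Z ?S k' = cls \<kappa> Z' ?S k'" by (rule cls_cong[OF k']) (rule own)
      have Gv: "G v (Z' k') = G v (Z k')" by (rule G_cong) (rule own[OF k', symmetric])
      have bx': "bx v (Z' k') = bx v (Z k')" by (rule bx_cong) (rule own[OF k', symmetric])
      have in1: "(\<lambda>B\<in>ch v. eu (Some B) \<kappa> Z k') \<in> bx v (Z k')" by (rule eu_in_box[OF v fin W(1) k'])
      have in2: "(\<lambda>B\<in>ch v. eu (Some B) \<kappa> Z' k') \<in> bx v (Z k')"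
        unfolding bx'[symmetric] by (rule eu_in_box[OF v fin W(2) k'])
      have off_BC: "eu (Some D) \<kappa> Z' k' = eu (Some D) \<kappa> Z k'" if D: "D \<in> ch v" "D \<noteq> B" "D \<noteq> C" for D
      proof (rule eu_local[OF child_V[OF D(1)] k'])
        fix k i assume k: "k \<in> set_pmf \<kappa>" and i: "i \<in> anc (Some D) \<union> sub (Some D)"
        have "i \<in> I \<and> i \<noteq> b \<and> i \<noteq> c"
        proof (cases "i \<in> sub (Some D)")
          case True
          then show ?thesis using child_child_disjoint[OF D(1) B D(2)] child_child_disjoint[OF D(1) C D(3)] bB cC
              in_I[OF child_V[OF D(1)]] by blast
        next
          case False
          then have "i \<in> anc v \<union> own_coords v" using i anc_child[OF D(1)] by blast
          then show ?thesis by (rule own_not)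
        qed
        then show "Z' k i = Z k i" using same[OF k, of i] by simp
      qed
      \<comment> \<open>The comparison of single outcomes, read off at \<open>v\<close> and
        translated into the weighted sum; every other child has the same value on both
        sides.\<close>
      have vals: "\<alpha> * val (Some B) (Z' k'') + \<beta> * val (Some C) (Z' k'') \<le> \<alpha> * val (Some B) (Z k'') + \<beta> * val (Some C) (Z k'')"
        if k'': "k'' \<in> set_pmf (cls \<kappa> Z ?S k')" for k''
      proof -
        have k2: "k'' \<in> set_pmf \<kappa>" by (rule cls_memD[OF k' k''])
        have ag: "Z k'' i = Z k' i" if "i \<in> ?S" for i by (rule cls_agree[OF k' k'' that])
        have ag': "Z' k'' i = Z k' i" if "i \<in> ?S" for i using own[OF k2 that] ag[OF that] by simp
        have m1: "(\<lambda>B\<in>ch v. val (Some B) (Z k'')) \<in> bx v (Z k')"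
          using val_in_box[OF v W(1)[OF k2]] by (simp only: bx_cong[OF ag])
        have m2: "(\<lambda>B\<in>ch v. val (Some B) (Z' k'')) \<in> bx v (Z k')"
          using val_in_box[OF v W(2)[OF k2]] by (simp only: bx_cong[OF ag'])
        have same_D: "val (Some D) (Z' k'') = val (Some D) (Z k'')" if D: "D \<in> ch v" "D \<noteq> B" "D \<noteq> C" for D
        proof (rule val_local[OF child_V[OF D(1)]])
          fix i assume i: "i \<in> anc (Some D) \<union> sub (Some D)"
          have "i \<in> I \<and> i \<noteq> b \<and> i \<noteq> c"
          proof (cases "i \<in> sub (Some D)")
            case True
            then show ?thesis using child_child_disjoint[OF D(1) B D(2)] child_child_disjoint[OF D(1) C D(3)] bB cC
                in_I[OF child_V[OF D(1)]] by blast
          next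
            case False
            then have "i \<in> anc v \<union> own_coords v" using i anc_child[OF D(1)] by blast
            then show ?thesis by (rule own_not)
          qed
          then show "Z' k'' i = Z k'' i" using same[OF k2, of i] by simp
        qed
        have "G v (Z k') (\<lambda>B\<in>ch v. val (Some B) (Z' k'')) \<le> G v (Z k') (\<lambda>B\<in>ch v. val (Some B) (Z k''))"
          using le[OF k2] unfolding val_rec[of v "Z k''"] val_rec[of v "Z' k''"]
          by (simp only: G_cong[OF ag] G_cong[OF ag'])
        then show ?thesis
          using linear_inD[OF lin m2 m1] same_D B C by simp
      qed
      have leafB: "eu (Some B) \<kappa> Z k' = avg (cls \<kappa> Z ?S k') (\<lambda>k''. val (Some B) (Z k''))"
        "eu (Some B) \<kappa> Z' k' = avg (cls \<kappa> Z ?S k') (\<lambda>k''. val (Some B) (Z' k''))"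
        using eu_leaf[OF child_V[OF B] k' leaf(1), of Z] eu_leaf[OF child_V[OF B] k' leaf(1), of Z']
        by (simp_all only: anc_child[OF B] clsS)
      have leafC: "eu (Some C) \<kappa> Z k' = avg (cls \<kappa> Z ?S k') (\<lambda>k''. val (Some C) (Z k''))"
        "eu (Some C) \<kappa> Z' k' = avg (cls \<kappa> Z ?S k') (\<lambda>k''. val (Some C) (Z' k''))"
        using eu_leaf[OF child_V[OF C] k' leaf(2), of Z] eu_leaf[OF child_V[OF C] k' leaf(2), of Z']
        by (simp_all only: anc_child[OF C] clsS)
      have fS: "finite (set_pmf (cls \<kappa> Z ?S k'))" by (rule finite_cls[OF fin k'])
      have "\<alpha> * eu (Some B) \<kappa> Z' k' + \<beta> * eu (Some C) \<kappa> Z' k' \<le> \<alpha> * eu (Some B) \<kappa> Z k' + \<beta> * eu (Some C) \<kappa> Z k'"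
        unfolding leafB leafC avg_lin[OF fS, symmetric] by (rule avg_mono[OF fS vals])
      then have "G v (Z k') (\<lambda>B\<in>ch v. eu (Some B) \<kappa> Z' k') \<le> G v (Z k') (\<lambda>B\<in>ch v. eu (Some B) \<kappa> Z k')"
        using linear_inD[OF lin in2 in1] off_BC B C by simp
      then show ?thesis by (simp only: Gv)
    qed
    show "eu v \<kappa> Z' k \<le> eu v \<kappa> Z k"
      unfolding eu_rec[OF k] cls[symmetric]
      by (rule avg_mono[OF finite_cls[OF fin k]], rule node_le, rule cls_memD[OF k])
  qed
qed

text \<open>Let \<open>f\<close> send the utility of \<open>D\<close> to that of \<open>B\<close>.
  An outcome is changed in \<open>d\<close> and compensated in \<open>c\<close>. The trade-off at
  \<open>v\<close> expresses the compensation once for the pure outcome and once inside a mixture;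
  eliminating the utility of \<open>C\<close> shows that the increments of \<open>f\<close> at the
  mixture are \<open>1 - \<pi>\<close> times those at the component, which makes \<open>f\<close>
  affine.\<close>

lemma sibling_forces_affine:
  assumes v: "v \<in> V" and B: "B \<in> ch v" and C: "C \<in> ch v" and BC: "B \<noteq> C"
    and ab: "\<alpha> > 0" and lin: "linear_in v x B C \<alpha> \<beta>"
    and D: "ch (Some B) = {D}" and d: "d \<in> D" and c: "c \<in> C"
    and rel: "dim_rel I X R c d \<or> dim_rel I X R d c" and x: "x \<in> W"
  shows "affine_node (Some B) x"
proof -
  let ?B = "Some B"
  have DB: "D \<in> ch ?B" using D by simp
  have BV: "?B \<in> V" and CV: "Some C \<in> V" and DV: "Some D \<in> V"
    using child_V[OF B] child_V[OF C] child_V[OF DB] by auto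
  have dD: "d \<in> sub (Some D)" and cC: "c \<in> sub (Some C)"
    using d c own_sub[of "Some D"] own_sub[of "Some C"] by auto
  have dB: "d \<in> sub ?B" using dD child_sub[OF DB] by blast
  have dv: "d \<in> sub v" and cv: "c \<in> sub v" using dB cC child_sub[OF B] child_sub[OF C] by auto
  have disj: "sub ?B \<inter> sub (Some C) = {}" by (rule child_child_disjoint[OF B C BC])
  have dc: "d \<noteq> c" using disj dB cC by blast
  have I: "d \<in> I" "c \<in> I" using in_I[OF v] dv cv by auto
  define f where "f y = G ?B x (\<lambda>_\<in>{D}. y)" for y
  let ?l = "bl ?B x D" and ?h = "bh ?B x D"
  have bx1: "(\<lambda>_\<in>{D}. y) \<in> bx ?B x \<longleftrightarrow> y \<in> {?l..?h}" for y by (simp add: D)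
  have contf: "continuous_on {?l..?h} f"
    unfolding f_def
    by (rule continuous_on_box_compose[OF G_continuous[OF BV x, unfolded D]])
      (use bx1 in \<open>auto intro!: continuous_intros simp: D\<close>)
  \<comment> \<open>The subtree of \<open>D\<close> at relative position \<open>t\<close>, that of
    \<open>C\<close> at \<open>r\<close>, and all else as in \<open>x\<close>.\<close>
  define pt where "pt t r = override_on (dg ?B x (\<lambda>_. t)) (\<lambda>i. lo i + r * (hi i - lo i)) (sub (Some C))" for t r
  have ptW: "pt t r \<in> W" if "t \<in> {0..1}" "r \<in> {0..1}" for t r
    unfolding pt_def
  proof (rule override_W[OF CV dg_W[OF BV x]])
    fix i assume i: "i \<in> I"
    have "(1 - r) * lo i + r * hi i \<in> {lo i..hi i}"
      by (rule convex_interval) (use that lohi[OF i] in auto)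
    then show "lo i + r * (hi i - lo i) \<in> {lo i..hi i}" by (simp add: algebra_simps)
  qed (use that in simp)
  have pt_C: "pt t r i = lo i + r * (hi i - lo i)" if "i \<in> sub (Some C)" for t r i
    using that by (simp add: pt_def override_on_def)
  have pt_nC: "pt t r i = dg ?B x (\<lambda>_. t) i" if "i \<notin> sub (Some C)" for t r i
    using that by (simp add: pt_def override_on_def)
  have pt_D: "pt t r i = lo i + t * (hi i - lo i)" if "i \<in> sub (Some D)" for t r i
    using that pt_nC[of i t r] disj child_sub[OF DB] dg_child[OF DB that, of x "\<lambda>_. t"] by auto
  have pt_other: "pt t r i = x i" if "i \<notin> sub (Some C)" "i \<notin> sub (Some D)" for t r i
    using that pt_nC[of i t r] by (simp add: dg_def D)
  have ancD: "anc (Some D) = anc ?B \<union> B" using anc_child[OF DB] by simp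
  have ancB: "anc ?B = anc v \<union> own_coords v" by (rule anc_child[OF B])
  have own_not: "i \<notin> sub (Some C) \<and> i \<notin> sub (Some D)" if "i \<in> anc v \<union> own_coords v" for i
    using that own_child_disjoint[OF B] own_child_disjoint[OF C] anc_child_disjoint[OF B] anc_child_disjoint[OF C]
      child_sub[OF DB] by blast
  have B_not: "i \<notin> sub (Some C) \<and> i \<notin> sub (Some D)" if "i \<in> anc ?B \<union> own_coords ?B" for i
    using that own_not[of i] own_child_disjoint[OF DB] own_sub[of ?B] disj ancB by auto
  have off_not: "i \<notin> sub (Some C) \<and> i \<notin> sub (Some D)" if "i \<in> I - sub v" for i
    using that child_sub[OF C] child_sub[OF B] child_sub[OF DB] by blast
  have val_D: "val (Some D) y = bt ?B x D t"
    if "\<And>i. i \<in> anc ?B \<union> own_coords ?B \<Longrightarrow> y i = x i" "\<And>i. i \<in> sub (Some D) \<Longrightarrow> y i = lo i + t * (hi i - lo i)" for y t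
    unfolding bt_def
  proof (rule val_local[OF DV])
    fix i assume "i \<in> anc (Some D) \<union> sub (Some D)"
    then consider "i \<in> anc ?B \<union> own_coords ?B" | "i \<in> sub (Some D)" using ancD by auto
    then show "y i = dg ?B x (\<lambda>_. t) i"
      by cases (simp_all only: that dg_anc_own dg_child[OF DB])
  qed
  have affine: "f (\<pi> * v1 + (1 - \<pi>) * v2) = \<pi> * f v1 + (1 - \<pi>) * f v2"
    if p: "0 < \<pi>" "\<pi> < 1" and v1: "v1 \<in> {?l..?h}" and v2: "v2 \<in> {?l..?h}" for \<pi> v1 v2
  proof (rule affine_from_local_increments[OF contf v1 p _ v2])
    fix w assume w: "w \<in> {?l<..<?h}" and wne: "w \<noteq> v1"
    obtain t1 where t1: "t1 \<in> {0..1}" "bt ?B x D t1 = v1" using bt_range[OF BV x DB v1] by blast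
    obtain t2 where t2: "t2 \<in> {0..1}" "bt ?B x D t2 = w" using bt_range[OF BV x DB, of w] w by auto
    have t2i: "0 < t2" "t2 < 1" using interior_param[OF BV x DB t2(1)] t2(2) w by auto
    have t12: "t1 \<noteq> t2" using t1 t2 wne by auto
    \<comment> \<open>The positions 1/3 and 1/2 differ, so \<open>c\<close> takes distinct values in
      \<open>x1\<close> and \<open>x2\<close>; the second one is interior, which leaves room for the
      compensation.\<close>
    define x1 where "x1 = pt t1 (1 / 3)"
    define x2 where "x2 = pt t2 (1 / 2)"
    have W: "x1 \<in> W" "x2 \<in> W" unfolding x1_def x2_def by (rule ptW; use t1 t2 in simp)+
    have own: "x1 i = x i" "x2 i = x i" if "i \<in> anc v \<union> own_coords v" for i
      unfolding x1_def x2_def using pt_other own_not[OF that] by simp_all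
    have ownB: "x1 i = x i" "x2 i = x i" if "i \<in> anc ?B \<union> own_coords ?B" for i
      unfolding x1_def x2_def using pt_other B_not[OF that] by simp_all
    have off: "x1 i = x i" "x2 i = x i" if "i \<in> I - sub v" for i
      unfolding x1_def x2_def using pt_other off_not[OF that] by simp_all
    have xc: "x1 c = lo c + 1 / 3 * (hi c - lo c)" "x2 c = lo c + 1 / 2 * (hi c - lo c)"
      unfolding x1_def x2_def by (rule pt_C[OF cC])+
    have xd: "x1 d = lo d + t1 * (hi d - lo d)" "x2 d = lo d + t2 * (hi d - lo d)"
      unfolding x1_def x2_def by (rule pt_D[OF dD])+
    have xcne: "x1 c \<noteq> x2 c" unfolding xc affine_coord(1)[OF I(2)] by simp
    have xdne: "x1 d \<noteq> x2 d" unfolding xd affine_coord(1)[OF I(1)] by (rule t12)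
    have x2c: "lo c < x2 c" "x2 c < hi c" unfolding xc using affine_coord(2,3)[OF I(2), of "1/2"] by auto
    have x2d: "lo d < x2 d" "x2 d < hi d" unfolding xd using affine_coord(2,3)[OF I(1), of t2] t2i by auto
    have v1D: "val (Some D) x1 = v1" and wD: "val (Some D) x2 = w"
      unfolding t1(2)[symmetric] t2(2)[symmetric] x1_def x2_def
      by (rule val_D; use pt_other B_not pt_D in simp)+
    obtain \<epsilon> where e: "\<epsilon> > 0" "\<And>z. lo d \<le> z \<Longrightarrow> z \<le> hi d \<Longrightarrow> \<bar>z - x2 d\<bar> < \<epsilon> \<Longrightarrow>
        \<exists>z'. \<bar>z' - x2 c\<bar> < \<bar>x1 c - x2 c\<bar> \<and> lo c \<le> z' \<and> z' \<le> hi c \<and> val v (x2(d := z, c := z')) = val v x2"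
      using compensate[OF v W(2) dv cv dc x2c, of "\<bar>x1 c - x2 c\<bar>"] xcne by (metis zero_less_abs_iff eq_iff_diff_eq_0)
    \<comment> \<open>A change of \<open>d\<close> by at most \<open>h\<close> stays in range, is
      small enough to be compensated, and keeps \<open>d\<close> different from
      \<open>x1 d\<close>.\<close>
    define h where "h = min (min (x2 d - lo d) (hi d - x2 d)) (min (\<epsilon> / 2) (\<bar>x1 d - x2 d\<bar> / 2))"
    have h: "h > 0" "lo d \<le> x2 d - h" "x2 d + h \<le> hi d" "h < \<epsilon>" "h < \<bar>x1 d - x2 d\<bar>"
    proof -
      have pos: "0 < \<bar>x1 d - x2 d\<bar>" using xdne by simp
      then show "h > 0" unfolding h_def using x2d e(1) by simp
      have bounds: "h \<le> x2 d - lo d" "h \<le> hi d - x2 d" "h \<le> \<epsilon> / 2" "h \<le> \<bar>x1 d - x2 d\<bar> / 2"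
        unfolding h_def by (simp_all only: min_le_iff_disj order_refl simp_thms)
      then show "lo d \<le> x2 d - h" "x2 d + h \<le> hi d" "h < \<epsilon>" using e(1) by linarith+
      have "\<bar>x1 d - x2 d\<bar> / 2 < \<bar>x1 d - x2 d\<bar>" using pos by simp
      with bounds(4) show "h < \<bar>x1 d - x2 d\<bar>" by (rule order.strict_trans1)
    qed
    define g where "g z = val (Some D) (x2(d := z))" for z
    have x2self: "x2(d := x2 d) = x2" by simp
    have g_less: "g z < g z'" if "lo d \<le> z" "z < z'" "z' \<le> hi d" for z z'
      unfolding g_def
      by (rule val_strict[OF DV _ _ _ _ dD]) (use that W(2) I dD in \<open>auto intro!: W_upd\<close>)
    have g0: "g (x2 d) = w" unfolding g_def x2self by (rule wD)
    have gcont: "continuous_on {x2 d - h..x2 d + h} g"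
      unfolding g_def
      by (rule val_continuous[OF DV W_upd[OF W(2) I(1)] continuous_on_upd(1), where base = x2])
        (use h dD in auto)
    \<comment> \<open>By continuity, every utility of \<open>D\<close> within \<delta> of
      \<open>w\<close> is reached by changing \<open>d\<close> by at most \<open>h\<close>.\<close>
    define \<delta> where "\<delta> = min (w - g (x2 d - h)) (g (x2 d + h) - w)"
    have \<delta>: "\<delta> > 0" using g_less[of "x2 d - h" "x2 d"] g_less[of "x2 d" "x2 d + h"] h x2d g0 by (simp add: \<delta>_def)
    have "f (\<pi> * v1 + (1 - \<pi>) * w') - (1 - \<pi>) * f w' = f (\<pi> * v1 + (1 - \<pi>) * w) - (1 - \<pi>) * f w"
      if w': "\<bar>w' - w\<bar> < \<delta>" for w'
    proof -
      have "g (x2 d - h) \<le> w'" "w' \<le> g (x2 d + h)" using w' by (auto simp: \<delta>_def abs_less_iff)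
      then obtain z where z: "x2 d - h \<le> z" "z \<le> x2 d + h" "g z = w'"
        using IVT'[OF _ _ _ gcont, of w'] h(1) by auto
      have zI: "lo d \<le> z" "z \<le> hi d" "\<bar>z - x2 d\<bar> < \<epsilon>" "z \<noteq> x1 d" using z h by auto
      obtain z' where z': "\<bar>z' - x2 c\<bar> < \<bar>x1 c - x2 c\<bar>" "lo c \<le> z'" "z' \<le> hi c"
          "val v (x2(d := z, c := z')) = val v x2"
        using e(2)[OF zI(1-3)] by blast
      define y2 where "y2 = x2(d := z, c := z')"
      have y2W: "y2 \<in> W" unfolding y2_def by (intro W_upd W I zI z')
      have y2: "y2 d = z" "y2 c = z'" "\<And>i. i \<noteq> d \<Longrightarrow> i \<noteq> c \<Longrightarrow> y2 i = x2 i" using dc by (simp_all add: y2_def)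
      have y2same: "y2 i = x2 i" if "i \<notin> sub (Some C) \<and> i \<notin> sub (Some D)" for i
        using that cC dD y2(3)[of i] by auto
      have y2own: "y2 i = x i" if "i \<in> anc v \<union> own_coords v" for i
        using y2same[OF own_not[OF that]] own(2)[OF that] by simp
      have y2ownB: "y2 i = x i" if "i \<in> anc ?B \<union> own_coords ?B" for i
        using y2same[OF B_not[OF that]] ownB(2)[OF that] by simp
      have y2off: "y2 i = x i" if "i \<in> I - sub v" for i
        using y2same[OF off_not[OF that]] off(2)[OF that] by simp
      have y2c: "x1 c \<noteq> y2 c" unfolding y2(2) using z'(1) by auto
      have y2d: "x1 d \<noteq> y2 d" unfolding y2(1) using zI(4) by simp
      have val_eq: "val v x2 = val v y2" unfolding y2_def by (rule z'(4)[symmetric])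
      let ?\<kappa> = "bernoulli_pmf \<pi>"
      \<comment> \<open>Both the values of \<open>c\<close> and those of \<open>d\<close> are
        distinct in the mixtures, so either direction of the relation serves.\<close>
      have eq: "eu v ?\<kappa> (two x1 x2) True = eu v ?\<kappa> (two x1 y2) True"
        using rel
      proof
        assume rel: "dim_rel I X R c d"
        show ?thesis
          by (rule dim_rel_indifferent[OF v rel p W(1,2,1) y2W off(1,2,1) y2off xcne y2c _ _ _ val_eq])
            (use y2(3) in simp_all)
      next
        assume rel: "dim_rel I X R d c"
        show ?thesis
          by (rule dim_rel_indifferent[OF v rel p W(1,2,1) y2W off(1,2,1) y2off xdne y2d _ _ _ val_eq])
            (use y2(3) in simp_all)
      qed
      have T: "True \<in> set_pmf ?\<kappa>" using p by simp
      have fin: "finite (set_pmf ?\<kappa>)" by simp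
      have ex: "eu v ?\<kappa> (two x1 x2) True = G v x (\<lambda>E\<in>ch v. eu (Some E) ?\<kappa> (two x1 x2) True)"
        by (rule eu_common[OF T]) (use own in simp)
      have ey: "eu v ?\<kappa> (two x1 y2) True = G v x (\<lambda>E\<in>ch v. eu (Some E) ?\<kappa> (two x1 y2) True)"
        by (rule eu_common[OF T]) (use own y2own in simp)
      have bx1': "bx v x1 = bx v x" by (rule bx_cong) (rule own(1))
      have inx: "(\<lambda>E\<in>ch v. eu (Some E) ?\<kappa> (two x1 x2) True) \<in> bx v x"
      proof -
        have "(\<lambda>E\<in>ch v. eu (Some E) ?\<kappa> (two x1 x2) True) \<in> bx v (two x1 x2 True)"
          by (rule eu_in_box[OF v fin _ T]) (simp add: W)
        then show ?thesis by (simp only: if_True bx1')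
      qed
      have iny: "(\<lambda>E\<in>ch v. eu (Some E) ?\<kappa> (two x1 y2) True) \<in> bx v x"
      proof -
        have "(\<lambda>E\<in>ch v. eu (Some E) ?\<kappa> (two x1 y2) True) \<in> bx v (two x1 y2 True)"
          by (rule eu_in_box[OF v fin _ T]) (simp add: W y2W)
        then show ?thesis by (simp only: if_True bx1')
      qed
      have other: "i \<notin> sub (Some C) \<and> i \<notin> sub (Some D)"
        if E: "E \<in> ch v" "E \<noteq> B" "E \<noteq> C" and i: "i \<in> anc (Some E) \<union> sub (Some E)" for E i
      proof (cases "i \<in> sub (Some E)")
        case True
        then show ?thesis using child_child_disjoint[OF E(1) B E(2)] child_child_disjoint[OF E(1) C E(3)] child_sub[OF DB]
          by blast
      next
        case False
        then show ?thesis using i own_not[of i] anc_child[OF E(1)] by blast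
      qed
      have "eu (Some E) ?\<kappa> (two x1 x2) True = eu (Some E) ?\<kappa> (two x1 y2) True"
        if E: "E \<in> ch v" "E \<noteq> B" "E \<noteq> C" for E
      proof (rule eu_local[OF child_V[OF E(1)] T])
        fix k i assume "i \<in> anc (Some E) \<union> sub (Some E)"
        then have "y2 i = x2 i" by (intro y2same other[OF E])
        then show "two x1 x2 k i = two x1 y2 k i" by simp
      qed
      then have lin_mix: "\<alpha> * eu ?B ?\<kappa> (two x1 x2) True + \<beta> * eu (Some C) ?\<kappa> (two x1 x2) True =
          \<alpha> * eu ?B ?\<kappa> (two x1 y2) True + \<beta> * eu (Some C) ?\<kappa> (two x1 y2) True"
        using linear_inD[OF lin inx iny] linear_inD[OF lin iny inx] eq B C unfolding ex ey by (simp add: order_antisym)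
      have euB: "eu ?B ?\<kappa> (two x1 y) True = f (\<pi> * v1 + (1 - \<pi>) * val (Some D) y)"
        if yB: "\<And>i. i \<in> anc ?B \<union> own_coords ?B \<Longrightarrow> y i = x i" and yd: "x1 d \<noteq> y d" for y
      proof -
        have "eu ?B ?\<kappa> (two x1 y) True = G ?B x (\<lambda>E\<in>ch ?B. \<pi> * val (Some E) x1 + (1 - \<pi>) * val (Some E) y)"
          by (rule eu_two_children[OF p ownB(1) yB]) (use D d yd in auto)
        also have "(\<lambda>E\<in>ch ?B. \<pi> * val (Some E) x1 + (1 - \<pi>) * val (Some E) y) = (\<lambda>_\<in>{D}. \<pi> * v1 + (1 - \<pi>) * val (Some D) y)"
          unfolding D by (rule restrict_ext) (simp add: v1D)
        finally show ?thesis by (simp only: f_def)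
      qed
      have euC: "eu (Some C) ?\<kappa> (two x1 y) True = \<pi> * val (Some C) x1 + (1 - \<pi>) * val (Some C) y"
        if yv: "\<And>i. i \<in> anc v \<union> own_coords v \<Longrightarrow> y i = x i" and yc: "x1 c \<noteq> y c" for y
      proof (rule eu_two_separated[OF ch_V(2)[OF C] p _ c])
        show "x1 c \<noteq> y c" by (rule yc)
        show "x1 i = y i" if "i \<in> anc (Some C)" for i
          using that own(1)[of i] yv[of i] by (simp add: anc_child[OF C])
      qed
      have valB: "val ?B y = f (val (Some D) y)" if yB: "\<And>i. i \<in> anc ?B \<union> own_coords ?B \<Longrightarrow> y i = x i" for y
      proof -
        have "G ?B y = G ?B x" by (rule G_cong) (rule yB)
        moreover have "(\<lambda>E\<in>ch ?B. val (Some E) y) = (\<lambda>_\<in>{D}. val (Some D) y)"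
          unfolding D by (rule restrict_ext) simp
        ultimately show ?thesis unfolding val_rec[of ?B y] by (simp only: f_def)
      qed
      have valD: "val (Some D) y2 = w'"
      proof -
        have "val (Some D) y2 = val (Some D) (x2(d := z))"
        proof (rule val_local[OF DV])
          fix i assume "i \<in> anc (Some D) \<union> sub (Some D)"
          then have "i \<noteq> c" using B_not[of i] ancD cC disj child_sub[OF DB] by auto
          then show "y2 i = (x2(d := z)) i" by (simp add: y2_def)
        qed
        then show ?thesis using z(3) by (simp only: g_def)
      qed
      have m: "(\<lambda>E\<in>ch v. val (Some E) x2) \<in> bx v x" "(\<lambda>E\<in>ch v. val (Some E) y2) \<in> bx v x"
        using val_in_box[OF v W(2)] val_in_box[OF v y2W] by (simp_all only: bx_cong[OF own(2)] bx_cong[OF y2own])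
      have "val (Some E) x2 = val (Some E) y2" if E: "E \<in> ch v" "E \<noteq> B" "E \<noteq> C" for E
        by (rule val_local[OF child_V[OF E(1)]]) (rule y2same[OF other[OF E], symmetric])
      moreover have "G v x (\<lambda>E\<in>ch v. val (Some E) x2) = G v x (\<lambda>E\<in>ch v. val (Some E) y2)"
        using val_eq unfolding val_rec[of v x2] val_rec[of v y2] by (simp only: G_cong[OF own(2)] G_cong[OF y2own])
      ultimately have lin_val: "\<alpha> * val ?B x2 + \<beta> * val (Some C) x2 = \<alpha> * val ?B y2 + \<beta> * val (Some C) y2"
        using linear_inD[OF lin m] linear_inD[OF lin m(2,1)] B C by (simp add: order_antisym)
      define cx where "cx = val (Some C) x2"
      define cy where "cy = val (Some C) y2"
      define c1 where "c1 = val (Some C) x1"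
      \<comment> \<open>The trade-off inside the mixture, followed by the one for the pure outcome;
        \<open>cx\<close> and \<open>cy\<close> are eliminated between the two.\<close>
      have 1: "\<alpha> * f (\<pi> * v1 + (1 - \<pi>) * w) + \<beta> * (\<pi> * c1 + (1 - \<pi>) * cx) =
          \<alpha> * f (\<pi> * v1 + (1 - \<pi>) * w') + \<beta> * (\<pi> * c1 + (1 - \<pi>) * cy)"
        using lin_mix by (simp only: euB[of x2, OF ownB(2) xdne] euB[of y2, OF y2ownB y2d]
          euC[of x2, OF own(2) xcne] euC[of y2, OF y2own y2c] valD wD cx_def cy_def c1_def)
      have 2: "\<alpha> * f w + \<beta> * cx = \<alpha> * f w' + \<beta> * cy"
        using lin_val by (simp only: valB[of x2, OF ownB(2)] valB[of y2, OF y2ownB] valD wD cx_def cy_def)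
      have "\<beta> * (cx - cy) = \<alpha> * (f w' - f w)" using 2 by (simp add: algebra_simps)
      moreover have "\<alpha> * (f (\<pi> * v1 + (1 - \<pi>) * w') - f (\<pi> * v1 + (1 - \<pi>) * w)) = (1 - \<pi>) * (\<beta> * (cx - cy))"
        using 1 by (simp add: algebra_simps)
      ultimately have "\<alpha> * (f (\<pi> * v1 + (1 - \<pi>) * w') - f (\<pi> * v1 + (1 - \<pi>) * w)) = \<alpha> * ((1 - \<pi>) * (f w' - f w))"
        by simp
      then have "f (\<pi> * v1 + (1 - \<pi>) * w') - f (\<pi> * v1 + (1 - \<pi>) * w) = (1 - \<pi>) * (f w' - f w)"
        using ab by simp
      then show ?thesis by (simp add: algebra_simps)
    qed
    then show "\<exists>\<delta>>0. \<forall>w'. \<bar>w' - w\<bar> < \<delta> \<longrightarrow>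
        f (\<pi> * v1 + (1 - \<pi>) * w') - (1 - \<pi>) * f w' = f (\<pi> * v1 + (1 - \<pi>) * w) - (1 - \<pi>) * f w"
      using \<delta> by blast
  qed
  show ?thesis
    unfolding affine_node_def
  proof (intro ballI allI impI)
    fix w w' and \<pi> :: real
    assume w: "w \<in> bx ?B x" "w' \<in> bx ?B x" and p: "0 < \<pi>" "\<pi> < 1"
    have sing: "y = (\<lambda>_\<in>{D}. y D)" if "y \<in> bx ?B x" for y
      using that unfolding D by (intro ext) (auto simp: PiE_def extensional_def)
    have p': "0 < 1 - \<pi>" "1 - \<pi> < 1" using p by auto
    have wD: "w D \<in> {?l..?h}" "w' D \<in> {?l..?h}" using PiE_mem[OF w(1) DB] PiE_mem[OF w(2) DB] .
    have "f ((1 - \<pi>) * w D + (1 - (1 - \<pi>)) * w' D) = (1 - \<pi>) * f (w D) + (1 - (1 - \<pi>)) * f (w' D)"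
      by (rule affine[OF p' wD])
    moreover have "(\<lambda>E\<in>ch ?B. (1 - \<pi>) * w E + \<pi> * w' E) = (\<lambda>_\<in>{D}. (1 - \<pi>) * w D + \<pi> * w' D)"
      unfolding D by (rule restrict_ext) simp
    ultimately show "G ?B x (\<lambda>E\<in>ch ?B. (1 - \<pi>) * w E + \<pi> * w' E) = (1 - \<pi>) * G ?B x w + \<pi> * G ?B x w'"
      using sing[OF w(1)] sing[OF w(2)] unfolding f_def by simp
  qed
qed

text \<open>Distinct values of \<open>d\<close> make the utility of \<open>D\<close> a conditional
  average, and the affine aggregator of \<open>B\<close> passes this on to \<open>B\<close>.\<close>

lemma dim_rel_of_affine_child:
  assumes B: "B \<in> P" "b \<in> B" and D: "ch (Some B) = {D}" and d: "d \<in> D"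
    and aff: "\<And>x. x \<in> W \<Longrightarrow> affine_node (Some B) x"
  shows "dim_rel I X R d b"
proof (rule dim_rel_if_eu_val[of "Some B"])
  have DB: "D \<in> ch (Some B)" using D by simp
  show "Some B \<in> V" using B by simp
  show "d \<in> sub (Some B)" using d own_sub[of "Some D"] child_sub[OF DB] by auto
  show "b \<in> sub (Some B)" using B own_sub[of "Some B"] by auto
  fix \<kappa> :: "nat pmf" and Z :: "nat \<Rightarrow> outcome" and k
  assume fin: "finite (set_pmf \<kappa>)" and W: "\<And>k. k \<in> set_pmf \<kappa> \<Longrightarrow> Z k \<in> W"
    and inj: "inj_on (\<lambda>k. Z k d) (set_pmf \<kappa>)" and k: "k \<in> set_pmf \<kappa>"
  show "eu (Some B) \<kappa> Z k = avg (cls \<kappa> Z (anc (Some B)) k) (\<lambda>k'. val (Some B) (Z k'))"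
  proof (rule eu_affine[OF _ fin W aff k])
    fix E k assume E: "E \<in> ch (Some B)" and k: "k \<in> set_pmf \<kappa>"
    then have E: "E = D" using D by simp
    show "eu (Some E) \<kappa> Z k = avg (cls \<kappa> Z (anc (Some E)) k) (\<lambda>k'. val (Some E) (Z k'))"
      unfolding E
    proof (rule eu_separated[OF child_V[OF DB] k])
      fix k1 k2 l assume a: "k1 \<in> set_pmf \<kappa>" "k2 \<in> set_pmf \<kappa>"
        "\<And>i. i \<in> anc (Some D) \<union> own_coords (Some D) \<Longrightarrow> Z k1 i = Z k2 i"
      have "Z k1 d = Z k2 d" by (rule a(3)) (use d in simp)
      then have "k1 = k2" using inj_onD[OF inj _ a(1,2)] by simp
      then show "Z k1 l = Z k2 l" by simp
    qed
  qed (use B in simp_all)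
qed

end

section \<open>Transferring node conditions between trees\<close>

section \<open>Constructing representations\<close>

text \<open>The condition at a vertex with subtree coordinates \<open>S\<close>, for an arbitrary
  evaluation \<open>e\<close> of a lottery at an outcome of its support and an arbitrary utility
  \<open>f\<close> of outcomes. No tree occurs in it, so it carries over to another tree as soon as
  the evaluations agree (\<open>node_ok_cong\<close>).\<close>

definition node_ok where
  "node_ok I X R S e f \<longleftrightarrow>
    (\<forall>p\<in>lotteries X I. \<forall>q\<in>lotteries X I. \<forall>x\<in>set_pmf p. \<forall>y\<in>set_pmf q.
       (\<forall>z\<in>set_pmf p \<union> set_pmf q. \<forall>i\<in>I - S. z i = x i) \<longrightarrow> (R p q \<longleftrightarrow> e q y \<le> (e p x :: real))) \<and>
    (\<forall>x\<in>outcomes X I. continuous_on {y\<in>outcomes X I. \<forall>i\<in>I - S. y i = x i} f) \<and>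
    (\<forall>x\<in>outcomes X I. \<forall>y\<in>outcomes X I. (\<forall>i\<in>I - S. x i = y i) \<longrightarrow> (\<forall>i\<in>S. x i \<le> y i) \<longrightarrow>
       x \<noteq> y \<longrightarrow> f x < (f y :: real))"

lemma node_okI:
  assumes "\<And>p q x y. p \<in> lotteries X I \<Longrightarrow> q \<in> lotteries X I \<Longrightarrow> x \<in> set_pmf p \<Longrightarrow> y \<in> set_pmf q \<Longrightarrow>
      (\<And>z i. z \<in> set_pmf p \<Longrightarrow> i \<in> I - S \<Longrightarrow> z i = x i) \<Longrightarrow>
      (\<And>z i. z \<in> set_pmf q \<Longrightarrow> i \<in> I - S \<Longrightarrow> z i = x i) \<Longrightarrow> R p q \<longleftrightarrow> e q y \<le> e p x"
    and "\<And>x. x \<in> outcomes X I \<Longrightarrow> continuous_on {y\<in>outcomes X I. \<forall>i\<in>I - S. y i = x i} f"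
    and "\<And>x y. x \<in> outcomes X I \<Longrightarrow> y \<in> outcomes X I \<Longrightarrow> (\<And>i. i \<in> I - S \<Longrightarrow> x i = y i) \<Longrightarrow>
      (\<And>i. i \<in> S \<Longrightarrow> x i \<le> y i) \<Longrightarrow> x \<noteq> y \<Longrightarrow> f x < f y"
  shows "node_ok I X R S e f"
  unfolding node_ok_def
proof (intro conjI ballI impI)
  fix p q x y assume a: "p \<in> lotteries X I" "q \<in> lotteries X I" "x \<in> set_pmf p" "y \<in> set_pmf q"
    "\<forall>z\<in>set_pmf p \<union> set_pmf q. \<forall>i\<in>I - S. z i = x i"
  show "R p q \<longleftrightarrow> e q y \<le> e p x"
  proof (rule assms(1)[OF a(1-4)])
    fix z i assume "z \<in> set_pmf p" "i \<in> I - S" then show "z i = x i" using a(5) by blast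
  next
    fix z i assume "z \<in> set_pmf q" "i \<in> I - S" then show "z i = x i" using a(5) by blast
  qed
next
  fix x assume "x \<in> outcomes X I"
  then show "continuous_on {y\<in>outcomes X I. \<forall>i\<in>I - S. y i = x i} f" by (rule assms(2))
next
  fix x y assume a: "x \<in> outcomes X I" "y \<in> outcomes X I" "\<forall>i\<in>I - S. x i = y i" "\<forall>i\<in>S. x i \<le> y i" "x \<noteq> y"
  show "f x < f y"
    by (rule assms(3)[OF a(1,2) _ _ a(5)]) (use a(3,4) in blast)+
qed

lemma node_okD:
  assumes "node_ok I X R S e f"
  shows "p \<in> lotteries X I \<Longrightarrow> q \<in> lotteries X I \<Longrightarrow> x \<in> set_pmf p \<Longrightarrow> y \<in> set_pmf q \<Longrightarrow>
      (\<And>z i. z \<in> set_pmf p \<Longrightarrow> i \<in> I - S \<Longrightarrow> z i = x i) \<Longrightarrow>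
      (\<And>z i. z \<in> set_pmf q \<Longrightarrow> i \<in> I - S \<Longrightarrow> z i = x i) \<Longrightarrow> R p q \<longleftrightarrow> e q y \<le> e p x"
    and "x \<in> outcomes X I \<Longrightarrow> continuous_on {y\<in>outcomes X I. \<forall>i\<in>I - S. y i = x i} f"
    and "x \<in> outcomes X I \<Longrightarrow> y \<in> outcomes X I \<Longrightarrow> (\<And>i. i \<in> I - S \<Longrightarrow> x i = y i) \<Longrightarrow>
      (\<And>i. i \<in> S \<Longrightarrow> x i \<le> y i) \<Longrightarrow> x \<noteq> y \<Longrightarrow> f x < f y"
proof -
  note parts = assms[unfolded node_ok_def]
  {
    assume p: "p \<in> lotteries X I" "q \<in> lotteries X I" "x \<in> set_pmf p" "y \<in> set_pmf q"
      and off: "\<And>z i. z \<in> set_pmf p \<Longrightarrow> i \<in> I - S \<Longrightarrow> z i = x i"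
        "\<And>z i. z \<in> set_pmf q \<Longrightarrow> i \<in> I - S \<Longrightarrow> z i = x i"
    have "\<forall>z\<in>set_pmf p \<union> set_pmf q. \<forall>i\<in>I - S. z i = x i"
    proof (intro ballI)
      fix z i assume "z \<in> set_pmf p \<union> set_pmf q" "i \<in> I - S"
      then show "z i = x i" by (elim UnE) (rule off, assumption+)+
    qed
    then show "R p q \<longleftrightarrow> e q y \<le> e p x"
      by (rule bspec[OF bspec[OF bspec[OF bspec[OF conjunct1[OF parts] p(1)] p(2)] p(3)] p(4), THEN mp])
  }
  show "continuous_on {y\<in>outcomes X I. \<forall>i\<in>I - S. y i = x i} f" if "x \<in> outcomes X I"
    by (rule bspec[OF conjunct1[OF conjunct2[OF parts]] that])
  show "f x < f y" if "x \<in> outcomes X I" "y \<in> outcomes X I" "\<And>i. i \<in> I - S \<Longrightarrow> x i = y i"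
      "\<And>i. i \<in> S \<Longrightarrow> x i \<le> y i" "x \<noteq> y"
    by (rule bspec[OF bspec[OF conjunct2[OF conjunct2[OF parts]] that(1)] that(2), THEN mp, THEN mp, THEN mp])
      (use that in blast)+
qed

lemma node_ok_cong:
  assumes ok: "node_ok I X R S e f" and e: "\<And>p x. p \<in> lotteries X I \<Longrightarrow> x \<in> set_pmf p \<Longrightarrow> e' p x = e p x"
    and f: "\<And>x. x \<in> outcomes X I \<Longrightarrow> f' x = f x"
  shows "node_ok I X R S e' f'"
proof (rule node_okI)
  fix p q x y assume a: "p \<in> lotteries X I" "q \<in> lotteries X I" "x \<in> set_pmf p" "y \<in> set_pmf q"
    "\<And>z i. z \<in> set_pmf p \<Longrightarrow> i \<in> I - S \<Longrightarrow> z i = x i" "\<And>z i. z \<in> set_pmf q \<Longrightarrow> i \<in> I - S \<Longrightarrow> z i = x i"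
  show "R p q \<longleftrightarrow> e' q y \<le> e' p x"
    unfolding e[OF a(1,3)] e[OF a(2,4)] by (rule node_okD(1)[OF ok a(1-4)]) (rule a(5,6), assumption+)+
next
  fix x assume "x \<in> outcomes X I"
  from node_okD(2)[OF ok this] show "continuous_on {y\<in>outcomes X I. \<forall>i\<in>I - S. y i = x i} f'"
    by (rule continuous_on_eq) (simp add: f)
next
  fix x y assume a: "x \<in> outcomes X I" "y \<in> outcomes X I" "\<And>i. i \<in> I - S \<Longrightarrow> x i = y i"
    "\<And>i. i \<in> S \<Longrightarrow> x i \<le> y i" "x \<noteq> y"
  show "f' x < f' y" unfolding f[OF a(1)] f[OF a(2)] by (rule node_okD(3)[OF ok a(1,2) _ _ a(5)]) (rule a(3,4), assumption)+
qed

lemma (in smeu) smeu_node_ok: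
  assumes v: "v \<in> V"
  shows "node_ok I X R (sub v) (\<lambda>p x. eu v p (\<lambda>x. x) x) (val v)"
proof (rule node_okI)
  fix p q x y assume a: "p \<in> lotteries X I" "q \<in> lotteries X I" "x \<in> set_pmf p" "y \<in> set_pmf q"
    and off: "\<And>z i. z \<in> set_pmf p \<Longrightarrow> i \<in> I - sub v \<Longrightarrow> z i = x i" "\<And>z i. z \<in> set_pmf q \<Longrightarrow> i \<in> I - sub v \<Longrightarrow> z i = x i"
  have fin: "finite (set_pmf p)" "finite (set_pmf q)" using a by (auto simp: lotteries_def)
  have W: "z \<in> W" if "z \<in> set_pmf p" for z using a(1) that by (auto simp: lotteries_def W_def)
  have W': "z \<in> W" if "z \<in> set_pmf q" for z using a(2) that by (auto simp: lotteries_def W_def)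
  have "R (map_pmf (\<lambda>x. x) p) (map_pmf (\<lambda>x. x) q) \<longleftrightarrow> eu v q (\<lambda>x. x) y \<le> eu v p (\<lambda>x. x) x"
    by (rule R_iff_eu[OF v fin W W' off a(3,4)])
  then show "R p q \<longleftrightarrow> eu v q (\<lambda>x. x) y \<le> eu v p (\<lambda>x. x) x" by simp
next
  fix x assume x: "x \<in> outcomes X I"
  show "continuous_on {y\<in>outcomes X I. \<forall>i\<in>I - sub v. y i = x i} (val v)"
    by (rule val_continuous[OF v, where base = x])
      (auto simp: W_def intro: continuous_on_subset[OF continuous_on_product_coordinates])
next
  fix x y assume a: "x \<in> outcomes X I" "y \<in> outcomes X I" "\<And>i. i \<in> I - sub v \<Longrightarrow> x i = y i"
    "\<And>i. i \<in> sub v \<Longrightarrow> x i \<le> y i" "x \<noteq> y"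
  have W: "x \<in> W" "y \<in> W" using a by (auto simp: W_def)
  have "\<exists>j\<in>sub v. x j < y j"
  proof (rule ccontr)
    assume n: "\<not> ?thesis"
    have "x = y"
    proof (rule W_ext[OF W])
      fix i assume i: "i \<in> I"
      show "x i = y i"
      proof (cases "i \<in> sub v")
        case True then show ?thesis using n a(4)[OF True] by (meson order.not_eq_order_implies_strict)
      next
        case False then show ?thesis using a(3) i by simp
      qed
    qed
    with a(5) show False by simp
  qed
  then obtain j where j: "j \<in> sub v" "x j < y j" by blast
  show "val v x < val v y"
    by (rule val_strict[OF v W _ _ j]) (rule a(3,4), assumption)+
qed

lemma (in rct_fun) node_repI:
  assumes v: "v \<in> V" and ok: "node_ok I X R (sub v) (\<lambda>p x. eu v p (\<lambda>x. x) x) (val v)"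
  shows "node_rep I X R (anc v) (sub v) (utility E uo u v)"
  unfolding node_rep_def
proof (intro ballI conjI impI)
  fix z assume z: "z \<in> outcomes X (I - sub v)"
  have C: "anc v \<subseteq> I - sub v" using anc_I anc_sub_disjoint[OF v] by blast
  have U: "utility E uo u v (restrict z (anc v)) p = eu v p (\<lambda>x. x) x" if "restrict x (I - sub v) = z" for p x
    unfolding eu_def restrict_subset_eq[OF that C] by simp
  note mo = merge_outcomes[OF z _ sub_I[OF v]]
  have Uval: "utility E uo u v (restrict z (anc v)) (return_pmf (merge (I - sub v) (sub v) (z, y))) =
      val v (merge (I - sub v) (sub v) (z, y))" if "y \<in> outcomes X (sub v)" for y
    unfolding val_def restrict_subset_eq[OF mo(2)[OF that] C] ..
  {
    fix p q assume pq: "p \<in> lotteries X I" "q \<in> lotteries X I"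
      and sup: "\<forall>x\<in>set_pmf p \<union> set_pmf q. restrict x (I - sub v) = z"
    obtain x where x: "x \<in> set_pmf p" using set_pmf_not_empty[of p] by auto
    obtain y where y: "y \<in> set_pmf q" using set_pmf_not_empty[of q] by auto
    have zx: "restrict x (I - sub v) = z" and zy: "restrict y (I - sub v) = z" using sup x y by auto
    have agree: "w i = x i" if "restrict w (I - sub v) = z" "i \<in> I - sub v" for w i
      using that zx by (metis restrict_apply')
    have "R p q \<longleftrightarrow> eu v q (\<lambda>x. x) y \<le> eu v p (\<lambda>x. x) x"
      by (rule node_okD(1)[OF ok pq x y]) (rule agree, use sup in blast, assumption)+
    then show "R p q \<longleftrightarrow> utility E uo u v (restrict z (anc v)) q \<le> utility E uo u v (restrict z (anc v)) p"
      unfolding U[OF zx, of p] U[OF zy, of q] .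
  }
  show "continuous_on (outcomes X (sub v))
      (\<lambda>y. utility E uo u v (restrict z (anc v)) (return_pmf (merge (I - sub v) (sub v) (z, y))))"
  proof (cases "outcomes X (sub v) = {}")
    case False
    then obtain y0 where y0: "y0 \<in> outcomes X (sub v)" by blast
    let ?x = "merge (I - sub v) (sub v) (z, y0)"
    have "continuous_on (outcomes X (sub v)) (\<lambda>y. val v (merge (I - sub v) (sub v) (z, y)))"
    proof (rule continuous_on_compose2[OF node_okD(2)[OF ok mo(1)[OF y0]]])
      show "continuous_on (outcomes X (sub v)) (\<lambda>y. merge (I - sub v) (sub v) (z, y))"
      proof (rule continuous_on_coordinatewise_then_product)
        fix i
        have "continuous_on (outcomes X (sub v)) (\<lambda>y. y i)"
          by (rule continuous_on_subset[OF continuous_on_product_coordinates]) simp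
        then show "continuous_on (outcomes X (sub v)) (\<lambda>y. merge (I - sub v) (sub v) (z, y) i)"
          by (cases "i \<in> I - sub v"; cases "i \<in> sub v") (simp_all add: merge_def)
      qed
      have "merge (I - sub v) (sub v) (z, y) i = ?x i" if "i \<in> I - sub v" for y i
        using that by (simp add: merge_def)
      then show "(\<lambda>y. merge (I - sub v) (sub v) (z, y)) ` outcomes X (sub v) \<subseteq>
          {y \<in> outcomes X I. \<forall>i\<in>I - sub v. y i = ?x i}"
        using mo(1) by blast
    qed
    then show ?thesis by (rule continuous_on_eq) (simp add: Uval)
  qed simp
  show "strict_mono_on (outcomes X (sub v))
      (\<lambda>y. utility E uo u v (restrict z (anc v)) (return_pmf (merge (I - sub v) (sub v) (z, y))))"
  proof (rule strict_mono_onI)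
    fix y y' assume y: "y \<in> outcomes X (sub v)" "y' \<in> outcomes X (sub v)" "y < y'"
    have ne: "merge (I - sub v) (sub v) (z, y) \<noteq> merge (I - sub v) (sub v) (z, y')"
      using mo(3)[OF y(1)] mo(3)[OF y(2)] y(3) by (metis less_irrefl)
    have le: "y i \<le> y' i" for i using y(3) by (metis le_funD order_less_imp_le)
    show "utility E uo u v (restrict z (anc v)) (return_pmf (merge (I - sub v) (sub v) (z, y))) <
        utility E uo u v (restrict z (anc v)) (return_pmf (merge (I - sub v) (sub v) (z, y')))"
      unfolding Uval[OF y(1)] Uval[OF y(2)]
      by (rule node_okD(3)[OF ok mo(1)[OF y(1)] mo(1)[OF y(2)] _ _ ne]) (auto simp: merge_def le)
  qed
qed

lemma (in rct_fun) smeu_representationI: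
  assumes "\<And>v. v \<in> V \<Longrightarrow> node_ok I X R (sub v) (\<lambda>p x. eu v p (\<lambda>x. x) x) (val v)"
  shows "smeu_representation I X R (P, E) uo u"
  unfolding smeu_representation_iff using node_repI assms by blast

subsection \<open>Stars\<close>

abbreviation star :: "nat set set \<Rightarrow> vertex rel" where "star Q \<equiv> (\<lambda>A. (None, Some A)) ` Q"

lemma star_rct:
  assumes "finite I" "partition_on I Q"
  shows "rct I Q (star Q)"
proof
  show "is_rct I (Q, star Q)"
  proof (rule is_rctI)
    show "finite Q" using assms by (auto intro: finite_elements)
    have "wf (inv_image less_than (\<lambda>v. case v of None \<Rightarrow> 0::nat | Some (_::nat set) \<Rightarrow> 1))"
      by (rule wf_inv_image[OF wf_less_than])
    moreover have "star Q \<subseteq> inv_image less_than (\<lambda>v. case v of None \<Rightarrow> 0::nat | Some (_::nat set) \<Rightarrow> 1)"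
      by auto
    ultimately show "acyclic (star Q)" using wf_subset wf_acyclic by blast
  qed (use assms in \<open>auto simp: vertices_def\<close>)
qed (rule assms)

lemma star_structure:
  assumes "finite I" "partition_on I Q"
  shows "children (star Q) None = Q" "children (star Q) (Some A) = {}"
    "A \<in> Q \<Longrightarrow> anc_coords (star Q) (Some A) = {}" "subtree_coords (star Q) (Some A) = A"
proof -
  interpret rct I Q "star Q" by (rule star_rct[OF assms])
  show ch: "children (star Q) None = Q" "children (star Q) (Some A) = {}" by (auto simp: children_def)
  show "A \<in> Q \<Longrightarrow> anc_coords (star Q) (Some A) = {}" using anc_child[of A None] ch by simp
  show "subtree_coords (star Q) (Some A) = A" using sub_rec[of "Some A"] ch by simp
qed

text \<open>On a star every cluster is a leaf without history, so its utility is a plain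
  expectation, and the root aggregates a vector of expectations.\<close>

lemma star_representation:
  assumes fin: "finite I" and part: "partition_on I Q"
    and loc: "\<And>A x. A \<in> Q \<Longrightarrow> Vf A (restrict x A) = (Vf A x :: real)"
    and root: "node_ok I X R I (\<lambda>p x. uo' (\<lambda>A\<in>Q. avg p (Vf A))) (\<lambda>x. uo' (\<lambda>A\<in>Q. Vf A x))"
    and node: "\<And>A. A \<in> Q \<Longrightarrow> node_ok I X R A (\<lambda>p x. avg p (Vf A)) (Vf A)"
  shows "smeu_representation I X R (Q, star Q) uo' (\<lambda>A x y w. Vf A y)"
proof -
  interpret rct I Q "star Q" by (rule star_rct[OF fin part])
  interpret rct_fun I Q "star Q" uo' "\<lambda>A x y w. Vf A y" ..
  note st = star_structure[OF fin part]
  have leaf: "eu (Some A) p Z k = avg p (\<lambda>x. Vf A (Z x))" if A: "A \<in> Q" and k: "k \<in> set_pmf p"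
    for A and p :: "'k pmf" and Z k
  proof -
    have "cls p Z (anc (Some A)) k = p" by (rule cls_all[OF k]) (simp add: st(3)[OF A])
    then show ?thesis unfolding eu_rec[OF k] by (simp add: G_def loc[OF A])
  qed
  have vleaf: "val (Some A) x = Vf A x" if "A \<in> Q" for A x
    unfolding val_rec[of "Some A"] by (simp add: G_def loc[OF that])
  have rootv: "eu None p Z k = uo' (\<lambda>A\<in>Q. avg p (\<lambda>x. Vf A (Z x)))" if k: "k \<in> set_pmf p"
    for p :: "'k pmf" and Z k
  proof -
    have "cls p Z (anc None) k = p" by (rule cls_all[OF k]) simp
    moreover have "(\<lambda>B\<in>ch None. eu (Some B) p Z k') = (\<lambda>A\<in>Q. avg p (\<lambda>x. Vf A (Z x)))"
      if "k' \<in> set_pmf p" for k'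
      unfolding st(1) by (rule restrict_ext) (rule leaf[OF _ that])
    ultimately show ?thesis
      unfolding eu_rec[OF k] by (intro avg_const) (simp add: G_def)
  qed
  have rval: "val None x = uo' (\<lambda>A\<in>Q. Vf A x)" for x
    using rootv[of "()" "return_pmf ()" "\<lambda>_. x"] by (simp add: val_eu)
  show ?thesis
  proof (rule smeu_representationI)
    fix v assume v: "v \<in> V"
    show "node_ok I X R (sub v) (\<lambda>p x. eu v p (\<lambda>x. x) x) (val v)"
    proof (cases v)
      case None
      show ?thesis unfolding None sub_None
        by (rule node_ok_cong[OF root]) (simp_all only: rootv rval)
    next
      case (Some A)
      then have A: "A \<in> Q" using v by simp
      show ?thesis unfolding Some st(4)
        by (rule node_ok_cong[OF node[OF A]]) (simp_all only: leaf[OF A] vleaf[OF A])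
    qed
  qed
qed

context smeu begin

lemma anc_child_root: "B \<in> ch None \<Longrightarrow> anc (Some B) = {}"
  by (simp add: anc_child)

lemma eu_avg_of_affine:
  assumes "v \<in> V" "v \<noteq> None" and fin: "finite (set_pmf \<kappa>)" and W: "\<And>k. k \<in> set_pmf \<kappa> \<Longrightarrow> Z k \<in> W"
    and aff: "\<And>A x. A \<in> P \<Longrightarrow> x \<in> W \<Longrightarrow> affine_node (Some A) x" and k: "k \<in> set_pmf \<kappa>"
  shows "eu v \<kappa> Z k = avg (cls \<kappa> Z (anc v) k) (\<lambda>k'. val v (Z k'))"
  using assms(1,2) k
proof (induction v arbitrary: k rule: tree_induct_up)
  case (node v)
  then obtain A where "v = Some A" "A \<in> P" by (cases v) auto
  then have a: "affine_node v x" if "x \<in> W" for x using aff that by blast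
  show ?case
  proof (rule eu_affine[OF node.hyps fin _ _ node.prems(2)])
    fix B k assume "B \<in> ch v" "k \<in> set_pmf \<kappa>"
    then show "eu (Some B) \<kappa> Z k = avg (cls \<kappa> Z (anc (Some B)) k) (\<lambda>k'. val (Some B) (Z k'))"
      by (intro node.IH) simp_all
  qed (rule W a, assumption)+
qed

text \<open>With affine aggregators, the utility of each child of the root is the expectation of its
  value on outcomes, so its whole subtree can serve as one cluster of a star.\<close>

lemma flatten:
  assumes aff: "\<And>A x. A \<in> P \<Longrightarrow> x \<in> W \<Longrightarrow> affine_node (Some A) x"
  shows "\<exists>Q uo' u'. partition_on I Q \<and> smeu_representation I X R (Q, star Q) uo' u'"
proof -
  define S where "S B = sub (Some B)" for B
  define Q where "Q = S ` ch None"
  have S_ne: "S B \<noteq> {}" if "B \<in> ch None" for B using sub_ne ch_V[OF that] by (simp add: S_def)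
  have S_disj: "S B \<inter> S C = {}" if "B \<in> ch None" "C \<in> ch None" "B \<noteq> C" for B C
    using child_child_disjoint[OF that] by (simp add: S_def)
  have inj: "inj_on S (ch None)"
    by (rule inj_onI) (metis S_disj S_ne inf.idem)
  have UQ: "\<Union>Q = I" using sub_rec[of None] by (simp add: Q_def S_def)
  have part: "partition_on I Q"
    unfolding partition_on_def disjoint_def
  proof (intro conjI ballI impI)
    show "{} \<notin> Q" using S_ne by (auto simp: Q_def)
    fix A A' assume "A \<in> Q" "A' \<in> Q" "A \<noteq> A'"
    then show "A \<inter> A' = {}" using S_disj by (auto simp: Q_def)
  qed (rule UQ)
  \<comment> \<open>The clusters of the star are named by their coordinates; \<open>T\<close>
    translates back to the children of the root.\<close>
  define T where "T = inv_into (ch None) S"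
  have T: "T (S B) = B" if "B \<in> ch None" for B unfolding T_def by (rule inv_into_f_f[OF inj that])
  define Vf where "Vf A = val (Some (T A))" for A
  define uo' where "uo' w = uo (\<lambda>B\<in>ch None. w (S B))" for w :: "nat set \<Rightarrow> real"
  have VfS: "Vf (S B) = val (Some B)" if "B \<in> ch None" for B by (simp add: Vf_def T[OF that])
  have child: "eu (Some B) p (\<lambda>x. x) x = avg p (Vf (S B))"
    if B: "B \<in> ch None" and p: "p \<in> lotteries X I" and x: "x \<in> set_pmf p" for B p x
  proof -
    have "cls p (\<lambda>x. x) (anc (Some B)) x = p"
      by (rule cls_all[OF x]) (simp add: anc_child_root[OF B])
    moreover have "eu (Some B) p (\<lambda>x. x) x = avg (cls p (\<lambda>x. x) (anc (Some B)) x) (\<lambda>k'. val (Some B) k')"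
      by (rule eu_avg_of_affine[OF child_V[OF B] _ _ _ aff x]) (use p in \<open>auto simp: lotteries_def W_def\<close>)
    ultimately show ?thesis by (simp add: VfS[OF B])
  qed
  have uo'_eq: "uo' (\<lambda>A\<in>Q. g A) = uo (\<lambda>B\<in>ch None. g (S B))" for g
  proof -
    have "(\<lambda>B\<in>ch None. (\<lambda>A\<in>Q. g A) (S B)) = (\<lambda>B\<in>ch None. g (S B))"
      by (rule restrict_ext) (simp add: Q_def)
    then show ?thesis by (simp only: uo'_def)
  qed
  have "smeu_representation I X R (Q, star Q) uo' (\<lambda>A x y w. Vf A y)"
  proof (rule star_representation[OF fin part])
    fix A x assume "A \<in> Q"
    then obtain B where B: "B \<in> ch None" "A = S B" by (auto simp: Q_def)
    show "Vf A (restrict x A) = Vf A x"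
      unfolding B(2) VfS[OF B(1)]
      by (rule val_local[OF child_V[OF B(1)]]) (simp add: anc_child_root[OF B(1)] S_def)
  next
    show "node_ok I X R I (\<lambda>p x. uo' (\<lambda>A\<in>Q. avg p (Vf A))) (\<lambda>x. uo' (\<lambda>A\<in>Q. Vf A x))"
    proof (rule node_ok_cong[OF smeu_node_ok[OF None_V, unfolded sub_None]])
      fix p x assume p: "p \<in> lotteries X I" "x \<in> set_pmf p"
      have c: "cls p (\<lambda>x. x) (anc None) x = p" by (rule cls_all[OF p(2)]) simp
      have e: "(\<lambda>B\<in>ch None. eu (Some B) p (\<lambda>x. x) y) = (\<lambda>B\<in>ch None. avg p (Vf (S B)))" if "y \<in> set_pmf p" for y
        by (rule restrict_ext) (rule child[OF _ p(1) that])
      have "eu None p (\<lambda>x. x) x = uo (\<lambda>B\<in>ch None. avg p (Vf (S B)))"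
        unfolding eu_rec[OF p(2)] c by (rule avg_const) (simp only: e G_def option.case)
      then show "uo' (\<lambda>A\<in>Q. avg p (Vf A)) = eu None p (\<lambda>x. x) x" by (simp only: uo'_eq)
    next
      fix x
      have "(\<lambda>B\<in>ch None. Vf (S B) x) = (\<lambda>B\<in>ch None. val (Some B) x)"
        by (rule restrict_ext) (simp add: VfS)
      then show "uo' (\<lambda>A\<in>Q. Vf A x) = val None x"
        unfolding uo'_eq val_rec[of None x] by (simp add: G_def)
    qed
  next
    fix A assume "A \<in> Q"
    then obtain B where B: "B \<in> ch None" "A = S B" by (auto simp: Q_def)
    have ok: "node_ok I X R A (\<lambda>p x. eu (Some B) p (\<lambda>x. x) x) (val (Some B))"
      using smeu_node_ok[OF child_V[OF B(1)]] by (simp add: B(2) S_def)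
    show "node_ok I X R A (\<lambda>p x. avg p (Vf A)) (Vf A)"
      by (rule node_ok_cong[OF ok]) (simp_all add: child[OF B(1)] B(2) VfS[OF B(1)])
  qed
  with part show ?thesis by blast
qed

text \<open>The merged cluster is given the weighted sum of the two utilities, which is again an
  expectation. The root receives only this sum and has to reconstruct its former argument; that any
  attainable reconstruction works is the linear trade-off.\<close>

lemma merge_star:
  assumes E: "E = star P" and B: "B \<in> P" and C: "C \<in> P" and BC: "B \<noteq> C" and b: "b \<in> B" and c: "c \<in> C"
    and rel: "dim_rel I X R b c"
  shows "\<exists>uo' u'. partition_on I (insert (B \<union> C) (P - {B, C})) \<and>
    smeu_representation I X R (insert (B \<union> C) (P - {B, C}), star (insert (B \<union> C) (P - {B, C}))) uo' u'"
proof -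
  let ?Q = "insert (B \<union> C) (P - {B, C})"
  note st = star_structure[OF fin part, folded E]
  have disj: "B \<inter> C = {}" using part B C BC by (auto simp: partition_on_def disjoint_def)
  have D_disj: "D \<inter> (B \<union> C) = {}" if "D \<in> P - {B, C}" for D
    using part B C that by (auto simp: partition_on_def disjoint_def)
  have ne: "D \<noteq> {}" if "D \<in> P" for D using cluster_ne[OF that] .
  have BC_notin: "B \<union> C \<notin> P"
  proof
    assume "B \<union> C \<in> P"
    then have "B \<union> C = B" using cluster_unique[OF _ B _ b] b by blast
    with disj ne[OF C] show False by blast
  qed
  have partQ: "partition_on I ?Q"
    unfolding partition_on_def disjoint_def
  proof (intro conjI ballI impI)
    show "\<Union>?Q = I" using part B C by (auto simp: partition_on_def)
    show "{} \<notin> ?Q" using ne B by auto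
    fix A A' assume "A \<in> ?Q" "A' \<in> ?Q" and ne: "A \<noteq> A'"
    then consider "A = B \<union> C" "A' \<in> P - {B, C}" | "A' = B \<union> C" "A \<in> P - {B, C}" | "A \<in> P" "A' \<in> P"
      by blast
    then show "A \<inter> A' = {}"
    proof cases
      case 1 then show ?thesis using D_disj[of A'] by (simp only: Int_commute)
    next
      case 2 then show ?thesis using D_disj[of A] by simp
    next
      case 3 then show ?thesis using part ne by (simp add: partition_on_def disjoint_def)
    qed
  qed
  have "\<exists>x. x \<in> W"
  proof -
    have "(\<lambda>i\<in>I. lo i) \<in> W" using lohi by (auto simp: mem_W less_imp_le)
    then show ?thesis by blast
  qed
  then obtain x0 where x0: "x0 \<in> W" by blast
  have chB: "B \<in> ch None" and chC: "C \<in> ch None" using B C st(1) by auto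
  obtain \<alpha> \<beta> where ab: "\<alpha> > 0" "\<beta> > 0" and lin: "linear_in None x0 B C \<alpha> \<beta>"
    using siblings_linear[OF None_V chB chC BC b c rel x0] by metis
  define Vf where "Vf A x = (if A = B \<union> C then \<alpha> * val (Some B) x + \<beta> * val (Some C) x else val (Some A) x)" for A x
  \<comment> \<open>Some attainable pair of utilities with the given weighted sum; by
    \<open>linear_in\<close> the value at the root does not depend on the choice.\<close>
  define pr where "pr s = (SOME (s1, s2). s1 \<in> {bl None x0 B..bh None x0 B} \<and> s2 \<in> {bl None x0 C..bh None x0 C} \<and> \<alpha> * s1 + \<beta> * s2 = s)" for s
  define ext where "ext w = (\<lambda>D\<in>P. if D = B then fst (pr (w (B \<union> C))) else if D = C then snd (pr (w (B \<union> C))) else w D)"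
    for w :: "nat set \<Rightarrow> real"
  define uo' where "uo' w = uo (ext w)" for w
  \<comment> \<open>At the root neither the aggregator nor the box depends on an outcome, so
    \<open>x0\<close> may be any point of \<open>W\<close>.\<close>
  have G0: "G None x = uo" for x by (simp add: G_def fun_eq_iff)
  have bx0: "bx None x = bx None x0" for x by (rule bx_cong) simp
  have uo'_eq: "uo' (\<lambda>A\<in>?Q. if A = B \<union> C then \<alpha> * w B + \<beta> * w C else w A) = uo w" if w: "w \<in> bx None x0" for w
  proof -
    let ?s = "\<alpha> * w B + \<beta> * w C"
    have "case (w B, w C) of (s1, s2) \<Rightarrow> s1 \<in> {bl None x0 B..bh None x0 B} \<and> s2 \<in> {bl None x0 C..bh None x0 C} \<and> \<alpha> * s1 + \<beta> * s2 = ?s"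
      using PiE_mem[OF w chB] PiE_mem[OF w chC] by simp
    then have "case pr ?s of (s1, s2) \<Rightarrow> s1 \<in> {bl None x0 B..bh None x0 B} \<and> s2 \<in> {bl None x0 C..bh None x0 C} \<and> \<alpha> * s1 + \<beta> * s2 = ?s"
      unfolding pr_def by (rule someI)
    then have pr: "fst (pr ?s) \<in> {bl None x0 B..bh None x0 B}" "snd (pr ?s) \<in> {bl None x0 C..bh None x0 C}"
      "\<alpha> * fst (pr ?s) + \<beta> * snd (pr ?s) = ?s" by (auto simp: case_prod_unfold)
    define w' where "w' = ext (\<lambda>A\<in>?Q. if A = B \<union> C then ?s else w A)"
    have w'B: "w' B = fst (pr ?s)" "w' C = snd (pr ?s)" using B C BC by (simp_all add: w'_def ext_def)
    have w'D: "w' D = w D" if "D \<in> P" "D \<noteq> B" "D \<noteq> C" for D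
      using that BC_notin by (auto simp: w'_def ext_def)
    have w'bx: "w' \<in> bx None x0"
    proof (rule PiE_I)
      fix D assume D: "D \<in> ch None"
      show "w' D \<in> {bl None x0 D..bh None x0 D}"
        using pr w'B w'D[of D] PiE_mem[OF w D] D st(1) by (cases "D = B"; cases "D = C") auto
    next
      fix D assume "D \<notin> ch None"
      then show "w' D = undefined" by (simp add: w'_def ext_def st(1))
    qed
    have same: "w' D = w D" if "D \<in> ch None" "D \<noteq> B" "D \<noteq> C" for D using w'D that st(1) by simp
    have "G None x0 w' \<le> G None x0 w" "G None x0 w \<le> G None x0 w'"
      using linear_inD[OF lin w'bx w] linear_inD[OF lin w w'bx] same pr(3) w'B by simp_all
    then have "uo w' = uo w" by (simp add: G0)
    then show ?thesis by (simp only: uo'_def w'_def)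
  qed
  have leaf: "eu (Some A) p (\<lambda>x. x) x = avg p (val (Some A))" if A: "A \<in> P" and x: "x \<in> set_pmf p" for A p x
  proof -
    have "cls p (\<lambda>x. x) (anc (Some A)) x = p" by (rule cls_all[OF x]) (simp add: st(3)[OF A])
    with eu_leaf[of "Some A" x p "\<lambda>x. x"] st(2) A x show ?thesis by simp
  qed
  have Vf_fun: "Vf A = (if A = B \<union> C then (\<lambda>x. \<alpha> * val (Some B) x + \<beta> * val (Some C) x) else val (Some A))" for A
    by (rule ext) (simp add: Vf_def)
  have avgVf: "avg p (Vf A) = (if A = B \<union> C then \<alpha> * avg p (val (Some B)) + \<beta> * avg p (val (Some C)) else avg p (val (Some A)))"
    if p: "p \<in> lotteries X I" for p A
  proof -
    have fin: "finite (set_pmf p)" using p by (simp add: lotteries_def)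
    show ?thesis using avg_lin[OF fin, of \<alpha> "val (Some B)" \<beta> "val (Some C)"] by (simp add: Vf_fun)
  qed
  have inW: "y \<in> W" if "p \<in> lotteries X I" "y \<in> set_pmf p" for p y using that by (auto simp: lotteries_def W_def)
  have eu_root: "eu None p (\<lambda>x. x) x = uo (\<lambda>A\<in>P. avg p (val (Some A)))"
    and eu_box: "(\<lambda>A\<in>P. avg p (val (Some A))) \<in> bx None x0"
    if p: "p \<in> lotteries X I" and x: "x \<in> set_pmf p" for p x
  proof -
    have e: "(\<lambda>B\<in>ch None. eu (Some B) p (\<lambda>x. x) x) = (\<lambda>A\<in>P. avg p (val (Some A)))"
      unfolding st(1) by (rule restrict_ext) (rule leaf[OF _ x])
    have "eu None p (\<lambda>x. x) x = G None x (\<lambda>B\<in>ch None. eu (Some B) p (\<lambda>x. x) x)"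
      by (rule eu_common[OF x]) simp
    then show "eu None p (\<lambda>x. x) x = uo (\<lambda>A\<in>P. avg p (val (Some A)))" by (simp only: e G0)
    have "(\<lambda>B\<in>ch None. eu (Some B) p (\<lambda>x. x) x) \<in> bx None x"
    proof (rule eu_in_box[OF None_V _ _ x])
      show "finite (set_pmf p)" using p by (simp add: lotteries_def)
    qed (rule inW[OF p])
    then show "(\<lambda>A\<in>P. avg p (val (Some A))) \<in> bx None x0" unfolding e bx0[of x] .
  qed
  have local: "val (Some A) x = val (Some A) y" if "A \<in> P" "\<And>i. i \<in> A \<Longrightarrow> x i = y i" for A x y
    by (rule val_local) (use that st(3)[OF that(1)] st(4) in auto)
  have over: "override_on x y A \<in> W" "val (Some A) y = val (Some A) (override_on x y A)"
    if "A \<in> P" "x \<in> W" "y \<in> W" for A x y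
  proof -
    have "override_on x y (sub (Some A)) \<in> W" by (rule override_W) (use that in \<open>auto simp: mem_W\<close>)
    then show "override_on x y A \<in> W" by (simp only: st(4))
    show "val (Some A) y = val (Some A) (override_on x y A)" by (rule local[OF that(1)]) simp
  qed
  have "smeu_representation I X R (?Q, star ?Q) uo' (\<lambda>A x y w. Vf A y)"
  proof (rule star_representation[OF fin partQ])
    fix A x assume "A \<in> ?Q"
    then show "Vf A (restrict x A) = Vf A x"
      unfolding Vf_def using local[of B "restrict x A" x] local[of C "restrict x A" x] local[of A "restrict x A" x] B C by auto
  next
    show "node_ok I X R I (\<lambda>p x. uo' (\<lambda>A\<in>?Q. avg p (Vf A))) (\<lambda>x. uo' (\<lambda>A\<in>?Q. Vf A x))"
    proof (rule node_ok_cong[OF smeu_node_ok[OF None_V, unfolded sub_None]])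
      fix p x assume p: "p \<in> lotteries X I" "x \<in> set_pmf p"
      have "(\<lambda>A\<in>?Q. avg p (Vf A)) = (\<lambda>A\<in>?Q. if A = B \<union> C then \<alpha> * (\<lambda>A\<in>P. avg p (val (Some A))) B + \<beta> * (\<lambda>A\<in>P. avg p (val (Some A))) C else (\<lambda>A\<in>P. avg p (val (Some A))) A)"
        by (rule restrict_ext) (use B C in \<open>auto simp: avgVf[OF p(1)]\<close>)
      then show "uo' (\<lambda>A\<in>?Q. avg p (Vf A)) = eu None p (\<lambda>x. x) x"
        using uo'_eq[OF eu_box[OF p]] eu_root[OF p] by simp
    next
      fix x assume "x \<in> outcomes X I"
      then have p: "return_pmf x \<in> lotteries X I" "x \<in> set_pmf (return_pmf x)" by (auto simp: lotteries_def)
      have "(\<lambda>A\<in>?Q. Vf A x) = (\<lambda>A\<in>?Q. if A = B \<union> C then \<alpha> * (\<lambda>A\<in>P. avg (return_pmf x) (val (Some A))) B + \<beta> * (\<lambda>A\<in>P. avg (return_pmf x) (val (Some A))) C else (\<lambda>A\<in>P. avg (return_pmf x) (val (Some A))) A)"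
        by (rule restrict_ext) (use B C in \<open>auto simp: Vf_def\<close>)
      moreover have "val None x = eu None (return_pmf x) (\<lambda>x. x) x" by (simp add: val_def eu_def)
      ultimately show "uo' (\<lambda>A\<in>?Q. Vf A x) = val None x"
        using uo'_eq[OF eu_box[OF p]] eu_root[OF p] by simp
    qed
  next
    fix A assume A: "A \<in> ?Q"
    show "node_ok I X R A (\<lambda>p x. avg p (Vf A)) (Vf A)"
    proof (cases "A = B \<union> C")
      case False
      then have AP: "A \<in> P" using A by simp
      have ok: "node_ok I X R A (\<lambda>p x. eu (Some A) p (\<lambda>x. x) x) (val (Some A))"
        using smeu_node_ok[of "Some A"] AP by (simp add: st(4))
      show ?thesis
        by (rule node_ok_cong[OF ok]) (simp_all add: leaf[OF AP] Vf_def False avgVf)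
    next
      case True
      have VfBC: "Vf A x = \<alpha> * val (Some B) x + \<beta> * val (Some C) x" for x by (simp add: Vf_def True)
      show ?thesis
      proof (rule node_okI)
        fix p q x y assume p: "p \<in> lotteries X I" and q: "q \<in> lotteries X I" and x: "x \<in> set_pmf p" and y: "y \<in> set_pmf q"
          and off: "\<And>z i. z \<in> set_pmf p \<Longrightarrow> i \<in> I - A \<Longrightarrow> z i = x i" "\<And>z i. z \<in> set_pmf q \<Longrightarrow> i \<in> I - A \<Longrightarrow> z i = x i"
        \<comment> \<open>The preference between lotteries that vary only on
          \<open>B \<union> C\<close> is read at the root, where the other entries coincide and the
          trade-off applies.\<close>
        have "R p q \<longleftrightarrow> eu None q (\<lambda>x. x) y \<le> eu None p (\<lambda>x. x) x"
          by (rule node_okD(1)[OF smeu_node_ok[OF None_V] p q x y]) simp_all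
        also have "\<dots> \<longleftrightarrow> G None x0 (\<lambda>A\<in>P. avg q (val (Some A))) \<le> G None x0 (\<lambda>A\<in>P. avg p (val (Some A)))"
          by (simp only: eu_root[OF p x] eu_root[OF q y] G0)
        also have "\<dots> \<longleftrightarrow> avg q (Vf A) \<le> avg p (Vf A)"
        proof -
          have const: "avg r (val (Some D)) = val (Some D) x"
            if D: "D \<in> P" "D \<noteq> B" "D \<noteq> C" and r: "\<And>z i. z \<in> set_pmf r \<Longrightarrow> i \<in> I - A \<Longrightarrow> z i = x i" for D r
          proof (rule avg_const)
            fix z assume z: "z \<in> set_pmf r"
            show "val (Some D) z = val (Some D) x"
            proof (rule local[OF D(1)])
              fix i assume "i \<in> D"
              then have "i \<in> I - A" using cluster_sub[OF D(1)] D_disj[of D] D True by auto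
              then show "z i = x i" by (rule r[OF z])
            qed
          qed
          have "(\<lambda>A\<in>P. avg q (val (Some A))) D = (\<lambda>A\<in>P. avg p (val (Some A))) D"
            if "D \<in> ch None" "D \<noteq> B" "D \<noteq> C" for D
            using const[of D p] const[of D q] off that st(1) by simp
          note iff = linear_inD[OF lin eu_box[OF q y] eu_box[OF p x] this]
          show ?thesis
            by (subst iff, assumption+) (use B C in \<open>simp add: avgVf[OF p] avgVf[OF q] True\<close>)
        qed
        finally show "R p q \<longleftrightarrow> avg q (Vf A) \<le> avg p (Vf A)" .
      next
        fix x assume x: "x \<in> outcomes X I"
        have xW: "x \<in> W" using x by (simp add: W_def)
        have "continuous_on {y \<in> outcomes X I. \<forall>i\<in>I - A. y i = x i} (val (Some D))" if D: "D \<in> P" for D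
        proof -
          \<comment> \<open>\<open>val (Some D)\<close> sees only the coordinates in
            \<open>D\<close>, so the others can be frozen at \<open>x\<close>, as
            \<open>val_continuous\<close> demands.\<close>
          have "continuous_on {y \<in> outcomes X I. \<forall>i\<in>I - A. y i = x i} (\<lambda>y. val (Some D) (override_on x y D))"
          proof (rule val_continuous[where base = x])
            show "override_on x y D \<in> W" if "y \<in> {y \<in> outcomes X I. \<forall>i\<in>I - A. y i = x i}" for y
              by (rule over(1)[OF D xW]) (use that in \<open>simp add: W_def\<close>)
            show "continuous_on {y \<in> outcomes X I. \<forall>i\<in>I - A. y i = x i} (\<lambda>y. override_on x y D i)" for i
              by (cases "i \<in> D") (auto intro: continuous_on_subset[OF continuous_on_product_coordinates])
          qed (use D in \<open>auto simp: st(4)\<close>)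
          then show ?thesis
            by (rule continuous_on_eq) (use over(2)[OF D xW] in \<open>auto simp: W_def\<close>)
        qed
        then have "continuous_on {y \<in> outcomes X I. \<forall>i\<in>I - A. y i = x i} (\<lambda>y. \<alpha> * val (Some B) y + \<beta> * val (Some C) y)"
          using B C by (intro continuous_intros)
        then show "continuous_on {y \<in> outcomes X I. \<forall>i\<in>I - A. y i = x i} (Vf A)"
          by (simp only: VfBC[abs_def])
      next
        fix x y assume xy: "x \<in> outcomes X I" "y \<in> outcomes X I" "\<And>i. i \<in> I - A \<Longrightarrow> x i = y i"
          "\<And>i. i \<in> A \<Longrightarrow> x i \<le> y i" "x \<noteq> y"
        have W: "x \<in> W" "y \<in> W" using xy by (auto simp: W_def)
        have le: "val (Some D) x \<le> val (Some D) y" if D: "D \<in> {B, C}" for D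
        proof -
          have DP: "D \<in> P" using D B C by auto
          have "val (Some D) x \<le> val (Some D) (override_on x y D)"
            by (rule val_mono[OF _ W(1) over(1)[OF DP W]]) (use DP D True xy(4) st(4) in \<open>auto simp: override_on_def\<close>)
          then show ?thesis using over(2)[OF DP W] by simp
        qed
        have less: "val (Some D) x < val (Some D) y" if D: "D \<in> {B, C}" and j: "j \<in> D" "x j < y j" for D j
        proof -
          have DP: "D \<in> P" using D B C by auto
          have "val (Some D) x < val (Some D) (override_on x y D)"
            by (rule val_strict[OF _ W(1) over(1)[OF DP W], where j = j])
              (use DP D True xy(4) st(4) j in \<open>auto simp: override_on_def\<close>)
          then show ?thesis using over(2)[OF DP W] by simp
        qed
        have "\<exists>j\<in>A. x j < y j"
        proof (rule ccontr)
          assume n: "\<not> ?thesis"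
          have "x i = y i" if "i \<in> I" for i
          proof (cases "i \<in> A")
            case True then show ?thesis using n xy(4)[OF True] by (meson order.not_eq_order_implies_strict)
          next
            case False then show ?thesis using xy(3) that by simp
          qed
          then have "x = y" by (rule W_ext[OF W])
          with xy(5) show False by simp
        qed
        then obtain j where j: "j \<in> A" "x j < y j" by blast
        have leB: "\<alpha> * val (Some B) x \<le> \<alpha> * val (Some B) y" and leC: "\<beta> * val (Some C) x \<le> \<beta> * val (Some C) y"
          using le ab by (auto intro!: mult_left_mono)
        from j(1) True consider "j \<in> B" | "j \<in> C" by blast
        then show "Vf A x < Vf A y"
        proof cases
          case 1
          then have "\<alpha> * val (Some B) x < \<alpha> * val (Some B) y" using less[of B j] j(2) ab by simp
          then show ?thesis unfolding VfBC using leC by linarith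
        next
          case 2
          then have "\<beta> * val (Some C) x < \<beta> * val (Some C) y" using less[of C j] j(2) ab by simp
          then show ?thesis unfolding VfBC using leB by linarith
        qed
      qed
    qed
  qed
  with partQ show ?thesis by blast
qed

end

section \<open>Replacing a cluster by a parent with a single child, and back\<close>

subsection \<open>Splitting a cluster\<close>

context rct begin

text \<open>The number of proper ancestors, a rank by which modified edge sets are shown to be
  acyclic.\<close>

definition rk :: "vertex \<Rightarrow> nat" where "rk v = card {w. (w, v) \<in> E\<^sup>+}"

lemma rk_less: "(v, w) \<in> E \<Longrightarrow> rk v < rk w"
  unfolding rk_def
proof (rule psubset_card_mono)
  assume e: "(v, w) \<in> E"
  have "finite V" using finP by (simp add: vertices_def)
  then show "finite {z. (z, w) \<in> E\<^sup>+}"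
    by (rule finite_subset[rotated]) (use trancl_V in auto)
  have "v \<in> {z. (z, w) \<in> E\<^sup>+}" "v \<notin> {z. (z, v) \<in> E\<^sup>+}" using e no_cycle by auto
  moreover have "{z. (z, v) \<in> E\<^sup>+} \<subseteq> {z. (z, w) \<in> E\<^sup>+}" using e by (auto intro: trancl_into_trancl)
  ultimately show "{z. (z, v) \<in> E\<^sup>+} \<subset> {z. (z, w) \<in> E\<^sup>+}" by blast
qed

lemma no_loop: "(v, v) \<notin> E"
  using no_cycle by blast

end

lemma acyclic_rank:
  fixes r :: "'a \<Rightarrow> nat"
  assumes "\<And>v w. (v, w) \<in> E \<Longrightarrow> r v < r w"
  shows "acyclic E"
proof -
  have "E \<subseteq> inv_image less_than r" using assms by auto
  then show ?thesis using wf_subset[OF wf_inv_image[OF wf_less_than]] wf_acyclic by blast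
qed

text \<open>In the second tree the cluster \<open>A \<union> B\<close> of the first one is replaced
  by \<open>A\<close> with the single child \<open>B\<close>, which inherits the children; all else
  is unchanged up to renaming. One locale serves for splitting and for merging.\<close>

locale tree_split = T1: rct I P1 E1 + T2: rct I P2 E2
  for I :: "nat set" and P1 P2 :: "nat set set" and E1 E2 :: "vertex rel" +
  fixes Q :: "nat set set" and A B :: "nat set"
  assumes P1: "P1 = insert (A \<union> B) Q" and P2: "P2 = insert A (insert B Q)"
    and notin: "A \<union> B \<notin> Q" "A \<notin> Q" "B \<notin> Q" and disj: "A \<inter> B = {}"
    and chA: "children E2 (Some A) = {B}" and chB: "children E2 (Some B) = children E1 (Some (A \<union> B))"
    and chQ: "\<And>v. v \<in> insert None (Some ` Q) \<Longrightarrow>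
      children E2 v = (\<lambda>D. if D = A \<union> B then A else D) ` children E1 v"
begin

text \<open>\<open>ren\<close> acts on clusters and \<open>inn\<close> on vertices; the split
  cluster is identified with its upper half \<open>A\<close>.\<close>

definition ren :: "nat set \<Rightarrow> nat set" where "ren D = (if D = A \<union> B then A else D)"
definition inn :: "vertex \<Rightarrow> vertex" where "inn v = (if v = Some (A \<union> B) then Some A else v)"

lemma ne: "A \<noteq> {}" "B \<noteq> {}"
  using T2.cluster_ne by (auto simp: P2)

lemma ne2: "A \<noteq> A \<union> B" "B \<noteq> A \<union> B" "A \<noteq> B"
  using ne disj by auto

lemma ch2: "v \<in> insert None (Some ` Q) \<Longrightarrow> children E2 v = ren ` children E1 v"
  using chQ[of v] by (simp add: ren_def[abs_def])

lemma V1_cases: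
  assumes "v \<in> T1.V"
  obtains "v = Some (A \<union> B)" "inn v = Some A" | "v \<in> insert None (Some ` Q)" "inn v = v" "v \<noteq> Some (A \<union> B)"
  using assms notin by (auto simp: vertices_def P1 inn_def)

lemma inn_Some: "inn (Some D) = Some (ren D)"
  by (simp add: inn_def ren_def)

lemma chC_not: "D \<in> children E1 (Some (A \<union> B)) \<Longrightarrow> D \<noteq> A \<union> B"
  using T1.no_loop by (auto simp: children_def)

lemma ch1_P1: "D \<in> children E1 v \<Longrightarrow> D \<noteq> A"
  using T1.ch_V(2)[of D v] ne2 notin by (auto simp: P1)

text \<open>With \<open>anc_eq\<close>: the old vertices keep their subtree and ancestor
  coordinates, so their node conditions carry over literally and \<open>B\<close> is the only new
  vertex.\<close>

lemma sub_eq: "v \<in> T1.V \<Longrightarrow> subtree_coords E2 (inn v) = subtree_coords E1 v"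
proof (induction v rule: T1.tree_induct_up)
  case (node v)
  have IH: "subtree_coords E2 (Some (ren D)) = subtree_coords E1 (Some D)" if "D \<in> children E1 v" for D
    using node.IH[OF that] by (simp only: inn_Some)
  from node.hyps show ?case
  proof (cases rule: V1_cases)
    case 1
    have "subtree_coords E2 (Some A) = A \<union> (B \<union> (\<Union>D\<in>children E2 (Some B). subtree_coords E2 (Some D)))"
      using T2.sub_rec[of "Some A"] T2.sub_rec[of "Some B"] by (simp add: chA)
    also have "(\<Union>D\<in>children E2 (Some B). subtree_coords E2 (Some D)) = (\<Union>D\<in>children E1 (Some (A \<union> B)). subtree_coords E1 (Some D))"
      unfolding chB
    proof (rule SUP_cong[OF refl])
      fix D assume D: "D \<in> children E1 (Some (A \<union> B))"
      then have "ren D = D" using chC_not by (simp add: ren_def)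
      then show "subtree_coords E2 (Some D) = subtree_coords E1 (Some D)" using IH[of D] D 1(1) by simp
    qed
    also have "A \<union> (B \<union> (\<Union>D\<in>children E1 (Some (A \<union> B)). subtree_coords E1 (Some D))) = subtree_coords E1 (Some (A \<union> B))"
      using T1.sub_rec[of "Some (A \<union> B)"] by (simp add: Un_assoc)
    finally show ?thesis using 1 by simp
  next
    case 2
    have "subtree_coords E2 v = own_coords v \<union> (\<Union>D\<in>children E1 v. subtree_coords E2 (Some (ren D)))"
      using T2.sub_rec[of v] ch2[OF 2(1)] by simp
    also have "\<dots> = subtree_coords E1 v" using T1.sub_rec[of v] IH by simp
    finally show ?thesis using 2(2) by simp
  qed
qed

lemma anc_B: "anc_coords E2 (Some B) = anc_coords E2 (Some A) \<union> A"
  using T2.anc_child[of B "Some A"] by (simp add: chA)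

lemma anc_eq: "v \<in> T1.V \<Longrightarrow> anc_coords E2 (inn v) = anc_coords E1 v"
proof (induction v rule: T1.tree_induct_down)
  case root
  then show ?case by (simp add: inn_def)
next
  case (child v D)
  from child.hyps(1) show ?case
  proof (cases rule: V1_cases)
    case 1
    have D: "D \<in> children E1 (Some (A \<union> B))" using child.hyps(2) 1 by simp
    then have "inn (Some D) = Some D" using chC_not by (simp add: inn_def)
    moreover have "anc_coords E2 (Some D) = anc_coords E2 (Some B) \<union> B"
      using T2.anc_child[of D "Some B"] D by (simp add: chB)
    moreover have "anc_coords E2 (Some A) = anc_coords E1 v" using child.IH 1 by simp
    ultimately show ?thesis using T1.anc_child[OF child.hyps(2)] 1 by (simp add: anc_B Un_assoc)
  next
    case 2
    have "ren D \<in> children E2 v" using ch2[OF 2(1)] child.hyps(2) by simp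
    then have "anc_coords E2 (Some (ren D)) = anc_coords E2 v \<union> own_coords v" by (rule T2.anc_child)
    then show ?thesis using T1.anc_child[OF child.hyps(2)] child.IH 2(2) by (simp add: inn_Some)
  qed
qed

lemma C_V: "Some (A \<union> B) \<in> T1.V" and A_V: "Some A \<in> T2.V" and B_V: "Some B \<in> T2.V"
  by (auto simp: vertices_def P1 P2)

lemma anc_C: "anc_coords E2 (Some A) = anc_coords E1 (Some (A \<union> B))"
  using anc_eq[OF C_V] by (simp add: inn_def)

lemma sub_C: "subtree_coords E2 (Some A) = subtree_coords E1 (Some (A \<union> B))"
  using sub_eq[OF C_V] by (simp add: inn_def)

lemma sub_B: "subtree_coords E2 (Some B) \<subseteq> subtree_coords E1 (Some (A \<union> B))"
  using T2.child_sub[of B "Some A"] by (simp add: chA sub_C)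

lemma V2_cases:
  assumes "v \<in> T2.V"
  obtains w where "w \<in> T1.V" "v = inn w" | "v = Some B"
proof (cases "v = Some B")
  case False
  then have "v \<in> T1.V \<and> v \<noteq> Some (A \<union> B) \<or> v = Some A" using assms notin by (auto simp: vertices_def P1 P2)
  then show ?thesis using that(1)[of v] that(1)[OF C_V] by (auto simp: inn_def)
qed (rule that(2))

lemma inn_V: "v \<in> T1.V \<Longrightarrow> inn v \<in> T2.V"
  by (auto simp: vertices_def P1 P2 inn_def)

end

locale split_fun = tree_split I P1 P2 E1 E2 Q A B +
    F1: rct_fun I P1 E1 uo1 u1 + F2: rct_fun I P2 E2 uo2 u2
  for I :: "nat set" and P1 P2 :: "nat set set" and E1 E2 :: "vertex rel" and Q A B and uo1 uo2 u1 u2 +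
  assumes G_rel: "\<And>v x g. v \<in> insert None (Some ` Q) \<Longrightarrow>
    F2.G v x (\<lambda>D\<in>children E2 v. g D) = F1.G v x (\<lambda>D\<in>children E1 v. g (ren D))"
begin

text \<open>Away from the split cluster both utilities obey the same recursion, so their equality
  has to be checked only there.\<close>

lemma eu_transfer:
  assumes C: "\<And>x. x \<in> set_pmf p \<Longrightarrow>
      (\<And>D y. D \<in> children E1 (Some (A \<union> B)) \<Longrightarrow> y \<in> set_pmf p \<Longrightarrow>
        F2.eu (Some D) p (\<lambda>x. x) y = F1.eu (Some D) p (\<lambda>x. x) y) \<Longrightarrow>
      F2.eu (Some A) p (\<lambda>x. x) x = F1.eu (Some (A \<union> B)) p (\<lambda>x. x) x"
    and "v \<in> T1.V" "x \<in> set_pmf p"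
  shows "F2.eu (inn v) p (\<lambda>x. x) x = F1.eu v p (\<lambda>x. x) x"
  using assms(2,3)
proof (induction v arbitrary: x rule: T1.tree_induct_up)
  case (node v)
  from node.hyps show ?case
  proof (cases rule: V1_cases)
    case 1
    have "F2.eu (Some D) p (\<lambda>x. x) y = F1.eu (Some D) p (\<lambda>x. x) y"
      if D: "D \<in> children E1 (Some (A \<union> B))" and y: "y \<in> set_pmf p" for D y
    proof -
      have "inn (Some D) = Some D" using chC_not[OF D] by (simp add: inn_def)
      then show ?thesis using node.IH[of D y] D y 1(1) by simp
    qed
    from C[OF node.prems this] show ?thesis using 1 by simp
  next
    case 2
    have cls: "cls p (\<lambda>x. x) (anc_coords E2 v) x = cls p (\<lambda>x. x) (anc_coords E1 v) x"
      using anc_eq[OF node.hyps] 2(2) by simp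
    have "F2.eu v p (\<lambda>x. x) x = F1.eu v p (\<lambda>x. x) x"
      unfolding F2.eu_rec[OF node.prems, of v] F1.eu_rec[OF node.prems, of v] cls
    proof (rule avg_cong)
      fix y assume "y \<in> set_pmf (cls p (\<lambda>x. x) (anc_coords E1 v) x)"
      then have y: "y \<in> set_pmf p" by (rule cls_memD[OF node.prems])
      have "(\<lambda>D\<in>children E1 v. F2.eu (Some (ren D)) p (\<lambda>x. x) y) = (\<lambda>D\<in>children E1 v. F1.eu (Some D) p (\<lambda>x. x) y)"
        by (rule restrict_ext) (use node.IH[OF _ y] in \<open>simp only: inn_Some\<close>)
      then show "F2.G v y (\<lambda>B\<in>children E2 v. F2.eu (Some B) p (\<lambda>x. x) y) = F1.G v y (\<lambda>B\<in>children E1 v. F1.eu (Some B) p (\<lambda>x. x) y)"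
        unfolding G_rel[OF 2(1)] by simp
    qed
    then show ?thesis using 2(2) by simp
  qed
qed

end

lemma (in rct_fun) val_id: "val v x = eu v (return_pmf x) (\<lambda>x. x) x"
  by (simp add: val_def eu_def)

text \<open>\<open>A\<close> passes on the expected utility of \<open>B\<close>, and
  \<open>B\<close> uses the old aggregator of \<open>A \<union> B\<close>. Taking the expectation in
  two stages instead of one changes nothing, by \<open>avg_tower\<close>.\<close>

lemma split_representation:
  assumes sp: "tree_split I P1 P2 E1 E2 Q A B" and S1: "smeu I P1 E1 uo1 u1 lo hi X R"
  shows "\<exists>uo2 u2. smeu_representation I X R (P2, E2) uo2 u2"
proof -
  interpret tree_split I P1 P2 E1 E2 Q A B by (rule sp)
  interpret S1: smeu I P1 E1 uo1 u1 lo hi X R by (rule S1)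
  let ?C = "A \<union> B"
  define uo2 where "uo2 w = uo1 (\<lambda>D\<in>children E1 None. w (ren D))" for w
  \<comment> \<open>For \<open>B\<close>, the coordinates in \<open>A\<close> belong to the history;
    they are merged with those in \<open>B\<close> to feed the old aggregator.\<close>
  define u2 where "u2 D x y w = (if D = A then w B
      else if D = B then u1 ?C (restrict x (anc_coords E1 (Some ?C))) (merge A B (restrict x A, y)) w
      else u1 D x y (\<lambda>D\<in>children E1 (Some D). w (ren D)))" for D x y w
  interpret F2: rct_fun I P2 E2 uo2 u2 ..
  have GA: "F2.G (Some A) x w = w B" for x w by (simp add: F2.G_def u2_def)
  have GB: "F2.G (Some B) x w = S1.G (Some ?C) x w" for x w
  proof -
    have "merge A B (restrict x A, restrict x B) = restrict x ?C" by (auto simp: merge_def fun_eq_iff)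
    moreover have "anc_coords E2 (Some B) \<inter> A = A" "anc_coords E2 (Some B) \<inter> anc_coords E1 (Some ?C) = anc_coords E1 (Some ?C)"
      by (auto simp: anc_B anc_C)
    ultimately show ?thesis using ne2 by (simp add: F2.G_def S1.G_def u2_def)
  qed
  have G_rel: "F2.G v x (\<lambda>D\<in>children E2 v. g D) = S1.G v x (\<lambda>D\<in>children E1 v. g (ren D))"
    if v: "v \<in> insert None (Some ` Q)" for v x and g :: "nat set \<Rightarrow> real"
  proof -
    have e: "(\<lambda>D\<in>children E1 v. (\<lambda>D\<in>children E2 v. g D) (ren D)) = (\<lambda>D\<in>children E1 v. g (ren D))"
      by (rule restrict_ext) (simp add: ch2[OF v])
    show ?thesis
    proof (cases v)
      case None
      then show ?thesis using e by (simp only: F2.G_def S1.G_def uo2_def option.case)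
    next
      case (Some D)
      have D: "D \<noteq> A" "D \<noteq> B" "D \<in> Q" using v Some notin by auto
      have "v \<in> T1.V" using Some D(3) by (auto simp: vertices_def P1)
      moreover have "D \<noteq> A \<union> B" using D(3) notin by blast
      then have "inn v = v" by (simp only: inn_def Some option.inject if_False)
      ultimately      have "anc_coords E2 v = anc_coords E1 v" using anc_eq by metis
      then show ?thesis using e D by (simp only: F2.G_def S1.G_def u2_def option.case Some if_False)
    qed
  qed
  interpret split_fun I P1 P2 E1 E2 Q A B uo1 uo2 u1 u2 by unfold_locales (rule G_rel)
  have eu_A: "F2.eu (Some A) p (\<lambda>x. x) x = avg (cls p (\<lambda>x. x) (anc_coords E2 (Some A)) x) (\<lambda>y. F2.eu (Some B) p (\<lambda>x. x) y)"
    if "x \<in> set_pmf p" for p x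
    unfolding F2.eu_rec[OF that, of "Some A"] GA chA by simp
  have eu: "F2.eu (inn v) p (\<lambda>x. x) x = S1.eu v p (\<lambda>x. x) x"
    if p: "p \<in> lotteries X I" and v: "v \<in> T1.V" and x: "x \<in> set_pmf p" for p v x
  proof (rule eu_transfer[OF _ v x])
    fix x assume x: "x \<in> set_pmf p" and D: "\<And>D y. D \<in> children E1 (Some ?C) \<Longrightarrow> y \<in> set_pmf p \<Longrightarrow>
        F2.eu (Some D) p (\<lambda>x. x) y = S1.eu (Some D) p (\<lambda>x. x) y"
    have fin: "finite (set_pmf p)" using p by (simp add: lotteries_def)
    have eu_B: "F2.eu (Some B) p (\<lambda>x. x) y = avg (cls p (\<lambda>x. x) (anc_coords E2 (Some B)) y)
        (\<lambda>z. S1.G (Some ?C) z (\<lambda>D\<in>children E1 (Some ?C). S1.eu (Some D) p (\<lambda>x. x) z))" if y: "y \<in> set_pmf p" for y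
      unfolding F2.eu_rec[OF y, of "Some B"] GB chB
    proof (rule avg_cong)
      fix z assume "z \<in> set_pmf (cls p (\<lambda>x. x) (anc_coords E2 (Some B)) y)"
      then have z: "z \<in> set_pmf p" by (rule cls_memD[OF y])
      have "(\<lambda>D\<in>children E1 (Some ?C). F2.eu (Some D) p (\<lambda>x. x) z) = (\<lambda>D\<in>children E1 (Some ?C). S1.eu (Some D) p (\<lambda>x. x) z)"
        by (rule restrict_ext) (rule D[OF _ z])
      then show "S1.G (Some ?C) z (\<lambda>D\<in>children E1 (Some ?C). F2.eu (Some D) p (\<lambda>x. x) z) =
          S1.G (Some ?C) z (\<lambda>D\<in>children E1 (Some ?C). S1.eu (Some D) p (\<lambda>x. x) z)" by simp
    qed
    have "F2.eu (Some A) p (\<lambda>x. x) x = avg (cls p (\<lambda>x. x) (anc_coords E2 (Some A)) x)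
        (\<lambda>y. avg (cls p (\<lambda>x. x) (anc_coords E2 (Some B)) y)
          (\<lambda>z. S1.G (Some ?C) z (\<lambda>D\<in>children E1 (Some ?C). S1.eu (Some D) p (\<lambda>x. x) z)))"
      unfolding eu_A[OF x] by (rule avg_cong) (rule eu_B, rule cls_memD[OF x])
    also have "\<dots> = avg (cls p (\<lambda>x. x) (anc_coords E2 (Some A)) x)
          (\<lambda>z. S1.G (Some ?C) z (\<lambda>D\<in>children E1 (Some ?C). S1.eu (Some D) p (\<lambda>x. x) z))"
      by (rule avg_tower[OF fin x]) (simp add: anc_B)
    also have "\<dots> = S1.eu (Some ?C) p (\<lambda>x. x) x"
      unfolding anc_C by (rule S1.eu_rec[OF x, symmetric])
    finally show "F2.eu (Some A) p (\<lambda>x. x) x = S1.eu (Some ?C) p (\<lambda>x. x) x" .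
  qed
  have valAB: "F2.val (Some A) x = F2.val (Some B) x" for x
    unfolding F2.val_rec[of "Some A"] GA chA by simp
  have innC: "inn (Some ?C) = Some A" by (simp add: inn_def)
  have retL: "return_pmf x \<in> lotteries X I" if "x \<in> outcomes X I" for x using that by (simp add: lotteries_def)
  have val: "F2.val (inn v) x = S1.val v x" if "v \<in> T1.V" "x \<in> outcomes X I" for v x
    unfolding F2.val_id S1.val_id by (rule eu[OF retL[OF that(2)] that(1)]) simp
  note okC = S1.smeu_node_ok[OF C_V]
  have "smeu_representation I X R (P2, E2) uo2 u2"
  proof (rule F2.smeu_representationI)
    fix v assume "v \<in> T2.V"
    then show "node_ok I X R (subtree_coords E2 v) (\<lambda>p x. F2.eu v p (\<lambda>x. x) x) (F2.val v)"
    proof (cases rule: V2_cases)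
      case (1 w)
      show ?thesis unfolding 1(2) sub_eq[OF 1(1)]
        by (rule node_ok_cong[OF S1.smeu_node_ok[OF 1(1)]]) (simp_all add: eu val 1(1))
    next
      case 2
      \<comment> \<open>All outcomes agree off the subtree of \<open>B\<close>, so the average taken
        at \<open>A\<close> is over a single history; the old condition at
        \<open>A \<union> B\<close> then yields the one at \<open>B\<close>.\<close>
      have euB: "S1.eu (Some ?C) p (\<lambda>x. x) x = F2.eu (Some B) p (\<lambda>x. x) x"
        if p: "p \<in> lotteries X I" and x: "x \<in> set_pmf p"
          and off: "\<And>z i. z \<in> set_pmf p \<Longrightarrow> i \<in> I - subtree_coords E2 (Some B) \<Longrightarrow> z i = x i" for p x
      proof -
        have "avg (cls p (\<lambda>x. x) (anc_coords E2 (Some A)) x) (\<lambda>y. F2.eu (Some B) p (\<lambda>x. x) y) = F2.eu (Some B) p (\<lambda>x. x) x"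
        proof (rule avg_const)
          fix y assume "y \<in> set_pmf (cls p (\<lambda>x. x) (anc_coords E2 (Some A)) x)"
          then have y: "y \<in> set_pmf p" by (rule cls_memD[OF x])
          have "y i = x i" if "i \<in> anc_coords E2 (Some B)" for i
            by (rule off[OF y]) (use that T2.anc_I T2.anc_sub_disjoint[OF B_V] in blast)
          then show "F2.eu (Some B) p (\<lambda>x. x) y = F2.eu (Some B) p (\<lambda>x. x) x"
            unfolding F2.eu_def by (metis restrict_ext)
        qed
        then show ?thesis using eu[OF p C_V x] eu_A[OF x] innC by simp
      qed
      have valB: "F2.val (Some B) x = S1.val (Some ?C) x" if "x \<in> outcomes X I" for x
        using val[OF C_V that] innC valAB by simp
      show ?thesis unfolding 2
      proof (rule node_okI)
        fix p q x y assume p: "p \<in> lotteries X I" and q: "q \<in> lotteries X I" and x: "x \<in> set_pmf p" and y: "y \<in> set_pmf q"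
          and off: "\<And>z i. z \<in> set_pmf p \<Longrightarrow> i \<in> I - subtree_coords E2 (Some B) \<Longrightarrow> z i = x i"
            "\<And>z i. z \<in> set_pmf q \<Longrightarrow> i \<in> I - subtree_coords E2 (Some B) \<Longrightarrow> z i = x i"
        have off_q: "z i = y i" if "z \<in> set_pmf q" "i \<in> I - subtree_coords E2 (Some B)" for z i
          using off(2)[OF that] off(2)[OF y that(2)] by simp
        have sm: "i \<in> I - subtree_coords E2 (Some B)" if "i \<in> I - subtree_coords E1 (Some ?C)" for i
          using that sub_B by blast
        have "R p q \<longleftrightarrow> S1.eu (Some ?C) q (\<lambda>x. x) y \<le> S1.eu (Some ?C) p (\<lambda>x. x) x"
          by (rule node_okD(1)[OF okC p q x y]) (rule off, assumption, rule sm, assumption)+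
        moreover have "S1.eu (Some ?C) p (\<lambda>x. x) x = F2.eu (Some B) p (\<lambda>x. x) x"
          by (rule euB[OF p x]) (rule off(1), assumption+)
        moreover have "S1.eu (Some ?C) q (\<lambda>x. x) y = F2.eu (Some B) q (\<lambda>x. x) y"
          by (rule euB[OF q y]) (rule off_q, assumption+)
        ultimately show "R p q \<longleftrightarrow> F2.eu (Some B) q (\<lambda>x. x) y \<le> F2.eu (Some B) p (\<lambda>x. x) x" by simp
      next
        fix x assume x: "x \<in> outcomes X I"
        have "continuous_on {y \<in> outcomes X I. \<forall>i\<in>I - subtree_coords E2 (Some B). y i = x i} (S1.val (Some ?C))"
          by (rule continuous_on_subset[OF node_okD(2)[OF okC x]]) (use sub_B in blast)
        then show "continuous_on {y \<in> outcomes X I. \<forall>i\<in>I - subtree_coords E2 (Some B). y i = x i} (F2.val (Some B))"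
          by (rule continuous_on_eq) (simp add: valB)
      next
        fix x y assume a: "x \<in> outcomes X I" "y \<in> outcomes X I" "\<And>i. i \<in> I - subtree_coords E2 (Some B) \<Longrightarrow> x i = y i"
          "\<And>i. i \<in> subtree_coords E2 (Some B) \<Longrightarrow> x i \<le> y i" "x \<noteq> y"
        show "F2.val (Some B) x < F2.val (Some B) y"
          unfolding valB[OF a(1)] valB[OF a(2)]
        proof (rule node_okD(3)[OF okC a(1,2) _ _ a(5)])
          fix i assume "i \<in> I - subtree_coords E1 (Some ?C)"
          then show "x i = y i" using a(3) sub_B by blast
        next
          fix i assume i: "i \<in> subtree_coords E1 (Some ?C)"
          then have "i \<in> I" using T1.sub_I[OF C_V] by blast
          then show "x i \<le> y i" using a(3)[of i] a(4)[of i] by (cases "i \<in> subtree_coords E2 (Some B)") auto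
        qed
      qed
    qed
  qed
  then show ?thesis by blast
qed

text \<open>Merging feeds values of the aggregator of a child, before they are averaged, into that
  of its parent. They must lie in the box on which the latter is known to be affine.\<close>

lemma (in smeu) G_in_range:
  assumes v: "v \<in> V" and B: "B \<in> ch v" and x: "x \<in> W" and w: "w \<in> bx (Some B) x"
  shows "G (Some B) x w \<in> {bl v x B..bh v x B}"
proof -
  obtain t where t: "\<And>D. t D \<in> {0..1}" "w = (\<lambda>D\<in>ch (Some B). bt (Some B) x D (t D))"
    using box_param[OF child_V[OF B] x w] by metis
  define y where "y = dg (Some B) x t"
  have yW: "y \<in> W" unfolding y_def by (rule dg_W[OF child_V[OF B] x t(1)])
  have same: "y i = x i" if "i \<in> anc v \<union> own_coords v" for i
    unfolding y_def by (rule dg_anc_own) (use that anc_child[OF B] in blast)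
  have "(\<lambda>D\<in>ch v. val (Some D) y) \<in> bx v x"
    using val_in_box[OF v yW] by (simp only: bx_cong[OF same])
  from PiE_mem[OF this B] have "val (Some B) y \<in> {bl v x B..bh v x B}" using B by simp
  then show ?thesis unfolding t(2) G_dg y_def .
qed

text \<open>The merged cluster aggregates by the composition of the two aggregators. Affinity lets
  the one of \<open>A\<close> be moved inside the expectation taken at \<open>B\<close>, after which
  the two expectations form one.\<close>

lemma merge_representation:
  assumes sp: "tree_split I P1 P2 E1 E2 Q A B" and S2: "smeu I P2 E2 uo2 u2 lo hi X R"
    and aff: "\<And>x. x \<in> outcomes X I \<Longrightarrow> smeu.affine_node E2 uo2 u2 lo hi (Some A) x"
  shows "\<exists>uo1 u1. smeu_representation I X R (P1, E1) uo1 u1"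
proof -
  interpret tree_split I P1 P2 E1 E2 Q A B by (rule sp)
  interpret S2: smeu I P2 E2 uo2 u2 lo hi X R by (rule S2)
  let ?C = "A \<union> B"
  define ren' where "ren' D = (if D = A then ?C else D)" for D
  define uo1 where "uo1 w = uo2 (\<lambda>D\<in>children E2 None. w (ren' D))" for w :: "nat set \<Rightarrow> real"
  define u1 where "u1 D x y w = (if D = ?C then u2 A x (restrict y A)
        (\<lambda>_\<in>{B}. u2 B (merge (anc_coords E2 (Some A)) A (x, y)) (restrict y B) w)
      else u2 D x y (\<lambda>D\<in>children E2 (Some D). w (ren' D)))" for D x y and w :: "nat set \<Rightarrow> real"
  interpret F1: rct_fun I P1 E1 uo1 u1 ..
  have GC: "F1.G (Some ?C) x w = S2.G (Some A) x (\<lambda>_\<in>{B}. S2.G (Some B) x w)" for x w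
  proof -
    have "merge (anc_coords E2 (Some A)) A (restrict x (anc_coords E1 (Some ?C)), restrict x ?C) = restrict x (anc_coords E2 (Some B))"
      by (auto simp: merge_def fun_eq_iff anc_B anc_C)
    moreover have "?C \<inter> A = A" "?C \<inter> B = B" by auto
    ultimately show ?thesis by (simp add: F1.G_def S2.G_def u1_def anc_C)
  qed
  have G_rel: "S2.G v x (\<lambda>D\<in>children E2 v. g D) = F1.G v x (\<lambda>D\<in>children E1 v. g (ren D))"
    if v: "v \<in> insert None (Some ` Q)" for v x and g :: "nat set \<Rightarrow> real"
  proof -
    have e: "(\<lambda>D\<in>children E2 v. (\<lambda>D\<in>children E1 v. g (ren D)) (ren' D)) = (\<lambda>D\<in>children E2 v. g D)"
    proof (rule restrict_ext)
      fix D assume "D \<in> children E2 v"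
      then obtain D0 where D0: "D0 \<in> children E1 v" "D = ren D0" by (auto simp: ch2[OF v])
      then have "ren' D = D0" using ch1_P1[OF D0(1)] by (auto simp: ren'_def ren_def)
      then show "(\<lambda>D\<in>children E1 v. g (ren D)) (ren' D) = g D" using D0 by simp
    qed
    show ?thesis
    proof (cases v)
      case None
      then show ?thesis using e by (simp only: F1.G_def S2.G_def uo1_def option.case)
    next
      case (Some D)
      have D: "D \<noteq> ?C" "D \<in> Q" using v Some notin by auto
      have "v \<in> T1.V" using Some D(2) by (auto simp: vertices_def P1)
      moreover have "inn v = v" using D(1) by (simp only: inn_def Some option.inject if_False)
      ultimately      have "anc_coords E2 v = anc_coords E1 v" using anc_eq by metis
      then show ?thesis using e D by (simp only: F1.G_def S2.G_def u1_def option.case Some if_False)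
    qed
  qed
  interpret split_fun I P1 P2 E1 E2 Q A B uo1 uo2 u1 u2 by unfold_locales (rule G_rel)
  have eu: "S2.eu (inn v) p (\<lambda>x. x) x = F1.eu v p (\<lambda>x. x) x"
    if p: "p \<in> lotteries X I" and v: "v \<in> T1.V" and x: "x \<in> set_pmf p" for p v x
  proof (rule eu_transfer[OF _ v x])
    fix x assume x: "x \<in> set_pmf p" and D: "\<And>D y. D \<in> children E1 (Some ?C) \<Longrightarrow> y \<in> set_pmf p \<Longrightarrow>
        S2.eu (Some D) p (\<lambda>x. x) y = F1.eu (Some D) p (\<lambda>x. x) y"
    have fin: "finite (set_pmf p)" using p by (simp add: lotteries_def)
    have inW: "y \<in> S2.W" if "y \<in> set_pmf p" for y using p that by (auto simp: lotteries_def S2.W_def)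
    define g where "g z = S2.G (Some B) z (\<lambda>D\<in>children E2 (Some B). S2.eu (Some D) p (\<lambda>x. x) z)" for z
    have BA: "B \<in> children E2 (Some A)" by (simp add: chA)
    let ?S = "anc_coords E2 (Some B)"
    have S: "?S = anc_coords E2 (Some A) \<union> own_coords (Some A)" by (simp add: anc_B)
    have inner: "S2.G (Some A) y (\<lambda>D\<in>children E2 (Some A). S2.eu (Some D) p (\<lambda>x. x) y) =
        avg (cls p (\<lambda>x. x) ?S y) (\<lambda>z. S2.G (Some A) z (\<lambda>_\<in>{B}. g z))" if y: "y \<in> set_pmf p" for y
    proof -
      have e: "(\<lambda>D\<in>children E2 (Some A). S2.eu (Some D) p (\<lambda>x. x) y) =
          (\<lambda>D\<in>children E2 (Some A). avg (cls p (\<lambda>x. x) ?S y) (\<lambda>z. (\<lambda>_\<in>{B}. g z) D))"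
        by (rule restrict_ext) (simp add: chA g_def S2.eu_rec[OF y, of "Some B"])
      have "S2.G (Some A) y (\<lambda>D\<in>children E2 (Some A). S2.eu (Some D) p (\<lambda>x. x) y) =
          avg (cls p (\<lambda>x. x) ?S y) (\<lambda>z. S2.G (Some A) y (\<lambda>_\<in>{B}. g z))"
        unfolding e
      proof (rule affine_avg)
        show "finite (set_pmf (cls p (\<lambda>x. x) ?S y))" by (rule finite_cls[OF fin y])
        fix z assume z: "z \<in> set_pmf (cls p (\<lambda>x. x) ?S y)"
        have zp: "z \<in> set_pmf p" by (rule cls_memD[OF y z])
        have same: "z i = y i" if "i \<in> anc_coords E2 (Some A) \<union> own_coords (Some A)" for i
          by (rule cls_agree[OF y z]) (use that S in simp)
        have "g z \<in> {S2.bl (Some A) z B..S2.bh (Some A) z B}"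
          unfolding g_def
          by (rule S2.G_in_range[OF A_V BA inW[OF zp]], rule S2.eu_in_box[OF B_V fin inW zp], assumption)
        then have "(\<lambda>_\<in>{B}. g z) \<in> S2.bx (Some A) z" by (simp add: chA)
        then show "(\<lambda>_\<in>{B}. g z) \<in> S2.bx (Some A) y" by (simp only: S2.bx_cong[OF same])
      qed (rule S2.affine_nodeD[OF aff], use inW[OF y] in \<open>simp_all add: S2.W_def\<close>)
      also have "\<dots> = avg (cls p (\<lambda>x. x) ?S y) (\<lambda>z. S2.G (Some A) z (\<lambda>_\<in>{B}. g z))"
      proof (rule avg_cong)
        fix z assume z: "z \<in> set_pmf (cls p (\<lambda>x. x) ?S y)"
        have same: "z i = y i" if "i \<in> anc_coords E2 (Some A) \<union> own_coords (Some A)" for i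
          by (rule cls_agree[OF y z]) (use that S in simp)
        show "S2.G (Some A) y (\<lambda>_\<in>{B}. g z) = S2.G (Some A) z (\<lambda>_\<in>{B}. g z)"
          by (simp only: S2.G_cong[OF same])
      qed
      finally show ?thesis .
    qed
    have "S2.eu (Some A) p (\<lambda>x. x) x = avg (cls p (\<lambda>x. x) (anc_coords E2 (Some A)) x)
        (\<lambda>y. avg (cls p (\<lambda>x. x) ?S y) (\<lambda>z. S2.G (Some A) z (\<lambda>_\<in>{B}. g z)))"
      unfolding S2.eu_rec[OF x, of "Some A"] by (rule avg_cong) (rule inner, rule cls_memD[OF x])
    also have "\<dots> = avg (cls p (\<lambda>x. x) (anc_coords E2 (Some A)) x) (\<lambda>z. S2.G (Some A) z (\<lambda>_\<in>{B}. g z))"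
      by (rule avg_tower[OF fin x]) (simp add: anc_B)
    also have "\<dots> = F1.eu (Some ?C) p (\<lambda>x. x) x"
      unfolding F1.eu_rec[OF x, of "Some ?C"] anc_C
    proof (rule avg_cong)
      fix z assume "z \<in> set_pmf (cls p (\<lambda>x. x) (anc_coords E1 (Some ?C)) x)"
      then have z: "z \<in> set_pmf p" by (rule cls_memD[OF x])
      have "(\<lambda>D\<in>children E1 (Some ?C). F1.eu (Some D) p (\<lambda>x. x) z) = (\<lambda>D\<in>children E2 (Some B). S2.eu (Some D) p (\<lambda>x. x) z)"
        unfolding chB by (rule restrict_ext) (rule D[OF _ z, symmetric])
      then show "S2.G (Some A) z (\<lambda>_\<in>{B}. g z) =
          F1.G (Some ?C) z (\<lambda>D\<in>children E1 (Some ?C). F1.eu (Some D) p (\<lambda>x. x) z)"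
        by (simp only: GC g_def)
    qed
    finally show "S2.eu (Some A) p (\<lambda>x. x) x = F1.eu (Some ?C) p (\<lambda>x. x) x" .
  qed
  have retL: "return_pmf x \<in> lotteries X I" if "x \<in> outcomes X I" for x using that by (simp add: lotteries_def)
  have val: "S2.val (inn v) x = F1.val v x" if "v \<in> T1.V" "x \<in> outcomes X I" for v x
    unfolding F1.val_id S2.val_id by (rule eu[OF retL[OF that(2)] that(1)]) simp
  have "smeu_representation I X R (P1, E1) uo1 u1"
  proof (rule F1.smeu_representationI)
    fix v assume v: "v \<in> T1.V"
    show "node_ok I X R (subtree_coords E1 v) (\<lambda>p x. F1.eu v p (\<lambda>x. x) x) (F1.val v)"
      unfolding sub_eq[OF v, symmetric]
      by (rule node_ok_cong[OF S2.smeu_node_ok[OF inn_V[OF v]]]) (simp_all add: eu val v)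
  qed
  then show ?thesis by blast
qed

lemma (in rct) split_exists:
  assumes AB_P: "A \<union> B \<in> P" and disj: "A \<inter> B = {}" and ne: "A \<noteq> {}" "B \<noteq> {}"
  shows "\<exists>P2 E2. tree_split I P P2 E E2 (P - {A \<union> B}) A B"
proof -
  define C where C_def: "C = A \<union> B"
  let ?Q = "P - {C}"
  let ?P2 = "insert A (insert B ?Q)"
  \<comment> \<open>\<open>si\<close> redirects edges into \<open>C\<close> to \<open>A\<close>, and
    \<open>so\<close> makes edges out of \<open>C\<close> start at \<open>B\<close>.\<close>
  define si where "si v = (if v = Some C then Some A else v)" for v
  define so where "so v = (if v = Some C then Some B else v)" for v
  define E2 where "E2 = (\<lambda>(v, w). (so v, si w)) ` E \<union> {(Some A, Some B)}"
  have C: "C \<in> P" using AB_P by (simp only: C_def)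
  have AB: "A \<noteq> C" "B \<noteq> C" "A \<noteq> B" using disj ne by (auto simp: C_def)
  have notin: "A \<notin> P" "B \<notin> P"
  proof -
    obtain a b where ab: "a \<in> A" "b \<in> B" using ne by blast
    show "A \<notin> P" using cluster_unique[OF _ C, of A a] ab AB by (auto simp: C_def)
    show "B \<notin> P" using cluster_unique[OF _ C, of B b] ab AB by (auto simp: C_def)
  qed
  have edgeV: "v \<noteq> Some A \<and> v \<noteq> Some B \<and> w \<noteq> Some A \<and> w \<noteq> Some B \<and> w \<noteq> None"
    if "(v, w) \<in> E" for v w
    using edge_V[OF that] that notin by (cases w) auto
  have memE2: "(v, w) \<in> E2 \<longleftrightarrow> (\<exists>v' w'. (v', w') \<in> E \<and> v = so v' \<and> w = si w') \<or> (v = Some A \<and> w = Some B)" for v w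
    by (auto simp: E2_def)
  have chA: "children E2 (Some A) = {B}"
    unfolding children_def memE2 using edgeV AB by (auto simp: so_def split: if_splits)
  have chB: "children E2 (Some B) = children E (Some C)"
  proof -
    have "(Some B, Some D) \<in> E2 \<longleftrightarrow> (Some C, Some D) \<in> E" for D
    proof
      assume "(Some B, Some D) \<in> E2"
      then obtain v' w' where e: "(v', w') \<in> E" "Some B = so v'" "Some D = si w'" unfolding memE2 using AB by auto
      then have v': "v' = Some C" using edgeV[OF e(1)] by (auto simp: so_def split: if_splits)
      with e(1) no_loop have "w' \<noteq> Some C" by blast
      with e v' show "(Some C, Some D) \<in> E" by (simp add: si_def)
    next
      assume e: "(Some C, Some D) \<in> E"
      with no_loop have "D \<noteq> C" by blast
      then have "Some B = so (Some C)" "Some D = si (Some D)" by (simp_all add: so_def si_def)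
      with e show "(Some B, Some D) \<in> E2" unfolding memE2 by blast
    qed
    then show ?thesis by (simp add: children_def)
  qed
  have chQ: "children E2 v = (\<lambda>D. if D = C then A else D) ` children E v" if v: "v \<in> insert None (Some ` ?Q)" for v
  proof -
    have v': "v \<noteq> Some A" "v \<noteq> Some B" "v \<noteq> Some C" using v notin by auto
    have "(v, Some D) \<in> E2 \<longleftrightarrow> (\<exists>D0. (v, Some D0) \<in> E \<and> D = (if D0 = C then A else D0))" for D
    proof
      assume "(v, Some D) \<in> E2"
      then obtain v1 w1 where e: "(v1, w1) \<in> E" "v = so v1" "Some D = si w1" unfolding memE2 using v' by auto
      then have "v1 = v" using v' by (auto simp: so_def split: if_splits)
      moreover obtain D0 where "w1 = Some D0" using edgeV[OF e(1)] by (cases w1) auto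
      ultimately show "\<exists>D0. (v, Some D0) \<in> E \<and> D = (if D0 = C then A else D0)"
        using e by (auto simp: si_def split: if_splits)
    next
      assume "\<exists>D0. (v, Some D0) \<in> E \<and> D = (if D0 = C then A else D0)"
      then obtain D0 where e: "(v, Some D0) \<in> E" "D = (if D0 = C then A else D0)" by blast
      have "v = so v" "Some D = si (Some D0)" using v' e(2) by (auto simp: so_def si_def)
      with e(1) show "(v, Some D) \<in> E2" unfolding memE2 by blast
    qed
    then show ?thesis by (auto simp: children_def)
  qed
  have D_disj: "D \<inter> C = {}" if "D \<in> ?Q" for D
    using part C that by (auto simp: partition_on_def disjoint_def)
  have "is_rct I (?P2, E2)"
  proof (rule is_rctI)
    show "partition_on I ?P2"
      unfolding partition_on_def disjoint_def
    proof (intro conjI ballI impI)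
      have "\<Union>?P2 = \<Union>P" using C by (auto simp: C_def)
      then show "\<Union>?P2 = I" using part by (simp add: partition_on_def)
      show "{} \<notin> ?P2" using part ne by (auto simp: partition_on_def)
      fix D D' assume "D \<in> ?P2" "D' \<in> ?P2" and neD: "D \<noteq> D'"
      then consider "D \<in> {A, B}" "D' \<in> {A, B}" | "D \<in> {A, B}" "D' \<in> ?Q" | "D \<in> ?Q" "D' \<in> {A, B}" | "D \<in> P" "D' \<in> P"
        by blast
      then show "D \<inter> D' = {}"
      proof cases
        case 1 then show ?thesis using neD disj by auto
      next
        case 2 then show ?thesis using D_disj[of D'] by (auto simp: C_def)
      next
        case 3 then show ?thesis using D_disj[of D] by (auto simp: C_def)
      next
        case 4 then show ?thesis using part neD by (simp add: partition_on_def disjoint_def)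
      qed
    qed
    show "finite ?P2" using finP by simp
    show "E2 \<subseteq> vertices ?P2 \<times> vertices ?P2"
    proof
      fix e assume e: "e \<in> E2"
      have so: "so v \<in> vertices ?P2" and si: "si v \<in> vertices ?P2" if "v \<in> V" for v
        using that by (cases v; simp add: so_def si_def vertices_def image_iff)+
      obtain x y where xy: "e = (x, y)" by (cases e)
      from e[unfolded xy memE2] consider v w where "(v, w) \<in> E" "e = (so v, si w)" | "e = (Some A, Some B)"
        unfolding xy by blast
      then show "e \<in> vertices ?P2 \<times> vertices ?P2"
      proof cases
        case 1 then show ?thesis using so si edge_V by blast
      next
        case 2 then show ?thesis by (simp add: vertices_def)
      qed
    qed
    show "acyclic E2"
    \<comment> \<open>Doubling the ranks makes room for \<open>B\<close> between \<open>A\<close>,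
      which takes the place of \<open>C\<close>, and the children of \<open>C\<close>.\<close>
    proof (rule acyclic_rank[where r = "\<lambda>v. if v = Some A then 2 * rk (Some C) else if v = Some B then 2 * rk (Some C) + 1 else 2 * rk v"])
      fix v w assume "(v, w) \<in> E2"
      then consider v' w' where "(v', w') \<in> E" "v = so v'" "w = si w'" | "v = Some A" "w = Some B" unfolding memE2 by blast
      then show "(if v = Some A then 2 * rk (Some C) else if v = Some B then 2 * rk (Some C) + 1 else 2 * rk v) <
          (if w = Some A then 2 * rk (Some C) else if w = Some B then 2 * rk (Some C) + 1 else 2 * rk w)"
      proof cases
        case 1
        note lt = rk_less[OF 1(1)] and ev = edgeV[OF 1(1)]
        have "(if v = Some A then 2 * rk (Some C) else if v = Some B then 2 * rk (Some C) + 1 else 2 * rk v) \<le> 2 * rk v' + 1"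
          using ev AB 1(2) by (auto simp: so_def)
        moreover have "(if w = Some A then 2 * rk (Some C) else if w = Some B then 2 * rk (Some C) + 1 else 2 * rk w) = 2 * rk w'"
          using ev AB 1(3) by (auto simp: si_def)
        ultimately show ?thesis using lt by linarith
      next
        case 2 then show ?thesis using AB by simp
      qed
    qed
    show "(v, None) \<notin> E2" for v unfolding memE2 using edgeV by (auto simp: si_def split: if_splits)
    fix D assume D: "D \<in> ?P2"
    show "\<exists>!v. (v, Some D) \<in> E2"
    proof (cases "D = B")
      case True
      have "v = Some A" if "(v, Some B) \<in> E2" for v
        using that edgeV AB unfolding memE2 by (auto simp: si_def split: if_splits)
      then show ?thesis using True memE2 by blast
    next
      case False
      define D0 where "D0 = (if D = A then C else D)"
      have D0: "D0 \<in> P" "D = A \<longleftrightarrow> D0 = C" using D False C notin by (auto simp: D0_def)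
      have "si w = Some D \<longleftrightarrow> w = Some D0" if "(v, w) \<in> E" for v w
        using edgeV[OF that] D0(2) by (auto simp: si_def D0_def split: if_splits)
      then have "(v, Some D) \<in> E2 \<longleftrightarrow> (\<exists>v'. (v', Some D0) \<in> E \<and> v = so v')" for v
        unfolding memE2 using False by (metis option.inject)
      with parent_ex1[OF D0(1)] show ?thesis by auto
    qed
  qed
  then have r2: "rct I ?P2 E2" using fin by unfold_locales
  have "tree_split I P ?P2 E E2 ?Q A B"
    by (intro tree_split.intro tree_split_axioms.intro r2 rct_axioms)
      (use C notin AB disj chA chB chQ in \<open>simp_all add: C_def[symmetric] insert_absorb\<close>)
  then show ?thesis unfolding C_def by blast
qed

lemma (in rct) merge_exists:
  assumes A: "A \<in> P" and chA: "children E (Some A) = {B}"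
  shows "\<exists>P1 E1. tree_split I P1 P E1 E (P - {A, B}) A B"
proof -
  define C where C_def: "C = A \<union> B"
  let ?Q = "P - {A, B}"
  let ?P1 = "insert C ?Q"
  have eAB: "(Some A, Some B) \<in> E" using chA by (auto simp: children_def)
  have B: "B \<in> P" using edge_V(2)[OF eAB] by simp
  have ABne: "A \<noteq> B" using eAB no_loop by auto
  have disj: "A \<inter> B = {}" using part A B ABne by (auto simp: partition_on_def disjoint_def)
  have ne: "A \<noteq> {}" "B \<noteq> {}" using cluster_ne A B by auto
  have AB: "A \<noteq> C" "B \<noteq> C" using disj ne by (auto simp: C_def)
  have Cnot: "C \<notin> P"
  proof
    assume "C \<in> P"
    moreover obtain a where "a \<in> A" using ne by blast
    ultimately show False using cluster_unique[OF _ A, of C a] AB by (auto simp: C_def)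
  qed
  have edgeV: "v \<noteq> Some C \<and> w \<noteq> Some C \<and> w \<noteq> None" if "(v, w) \<in> E" for v w
    using edge_V[OF that] that Cnot by (cases w) auto
  have fromA: "w = Some B" if "(Some A, w) \<in> E" for w
  proof -
    have "w \<noteq> None" using edgeV[OF that] by blast
    then obtain D where "w = Some D" by blast
    with that chA show ?thesis by (auto simp: children_def)
  qed
  have toB: "v = Some A" if "(v, Some B) \<in> E" for v by (rule parent_unique[OF that eAB])
  have noBA: "(Some B, Some A) \<notin> E" using eAB no_cycle[of "Some A"] by (meson r_into_trancl trancl_into_trancl)
  \<comment> \<open>Both vertices are identified with \<open>C\<close>; the edge between them, which
    would become a loop, is dropped.\<close>
  define m where "m v = (if v = Some A \<or> v = Some B then Some C else v)" for v
  define E1 where "E1 = (\<lambda>(v, w). (m v, m w)) ` (E - {(Some A, Some B)})"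
  have memE1: "(v, w) \<in> E1 \<longleftrightarrow> (\<exists>v' w'. (v', w') \<in> E \<and> v' \<noteq> Some A \<and> w' \<noteq> Some B \<and> v = m v' \<and> w = m w')" for v w
    unfolding E1_def using fromA toB by auto
  have chB: "children E (Some B) = children E1 (Some C)"
  proof -
    have "(Some C, Some D) \<in> E1 \<longleftrightarrow> (Some B, Some D) \<in> E" for D
    proof
      assume "(Some C, Some D) \<in> E1"
      then obtain v' w' where e: "(v', w') \<in> E" "v' \<noteq> Some A" "w' \<noteq> Some B" "Some C = m v'" "Some D = m w'" unfolding memE1 by blast
      have v': "v' = Some B" using e(2,4) edgeV[OF e(1)] by (auto simp: m_def split: if_splits)
      then have "w' \<noteq> Some A" using e(1) noBA by blast
      with e v' show "(Some B, Some D) \<in> E" by (simp add: m_def)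
    next
      assume e: "(Some B, Some D) \<in> E"
      have "D \<noteq> A" "D \<noteq> B" using e noBA no_loop by auto
      then have "Some C = m (Some B)" "Some D = m (Some D)" by (simp_all add: m_def)
      moreover have "Some B \<noteq> Some A" "Some D \<noteq> Some B" using ABne \<open>D \<noteq> B\<close> by auto
      ultimately show "(Some C, Some D) \<in> E1" unfolding memE1 using e by blast
    qed
    then show ?thesis by (simp add: children_def)
  qed
  have chQ: "children E v = (\<lambda>D. if D = C then A else D) ` children E1 v" if v: "v \<in> insert None (Some ` ?Q)" for v
  proof -
    have v': "v \<noteq> Some A" "v \<noteq> Some B" "v \<noteq> Some C" using v Cnot by auto
    have "(v, Some D) \<in> E \<longleftrightarrow> (\<exists>D1. (v, Some D1) \<in> E1 \<and> D = (if D1 = C then A else D1))" for D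
    proof
      assume e: "(v, Some D) \<in> E"
      have "D \<noteq> B" using toB e v' by blast
      moreover have "D \<noteq> C" using edgeV[OF e] by simp
      moreover have "v = m v" using v' by (simp add: m_def)
      ultimately have "(v, m (Some D)) \<in> E1" unfolding memE1 using e v' by blast
      then show "\<exists>D1. (v, Some D1) \<in> E1 \<and> D = (if D1 = C then A else D1)"
        using \<open>D \<noteq> B\<close> \<open>D \<noteq> C\<close> by (cases "D = A") (auto simp: m_def)
    next
      assume "\<exists>D1. (v, Some D1) \<in> E1 \<and> D = (if D1 = C then A else D1)"
      then obtain D1 v1 w1 where e: "(v1, w1) \<in> E" "w1 \<noteq> Some B" "v = m v1" "Some D1 = m w1" "D = (if D1 = C then A else D1)"
        unfolding memE1 by blast
      have "v1 = v" using e(3) v' by (auto simp: m_def split: if_splits)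
      moreover have "w1 = Some D" using e(2,4,5) edgeV[OF e(1)] by (auto simp: m_def split: if_splits)
      ultimately show "(v, Some D) \<in> E" using e(1) by simp
    qed
    then show ?thesis by (auto simp: children_def)
  qed
  have D_disj: "D \<inter> C = {}" if "D \<in> ?Q" for D
    using part A B that by (auto simp: partition_on_def disjoint_def C_def)
  have "is_rct I (?P1, E1)"
  proof (rule is_rctI)
    show "partition_on I ?P1"
      unfolding partition_on_def disjoint_def
    proof (intro conjI ballI impI)
      have "\<Union>?P1 = \<Union>P" using A B by (auto simp: C_def)
      then show "\<Union>?P1 = I" using part by (simp add: partition_on_def)
      show "{} \<notin> ?P1" using part ne by (auto simp: partition_on_def C_def)
      fix D D' assume "D \<in> ?P1" "D' \<in> ?P1" and neD: "D \<noteq> D'"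
      then consider "D = C" "D' \<in> ?Q" | "D \<in> ?Q" "D' = C" | "D \<in> P" "D' \<in> P"
        by blast
      then show "D \<inter> D' = {}"
      proof cases
        case 1 then show ?thesis using D_disj[of D'] by (simp only: Int_commute)
      next
        case 2 then show ?thesis using D_disj[of D] by simp
      next
        case 3 then show ?thesis using part neD by (simp add: partition_on_def disjoint_def)
      qed
    qed
    show "finite ?P1" using finP by simp
    show "E1 \<subseteq> vertices ?P1 \<times> vertices ?P1"
    proof
      fix e assume e: "e \<in> E1"
      have m: "m v \<in> vertices ?P1" if "v \<in> V" for v
        using that by (cases v; simp add: m_def vertices_def image_iff)
      obtain x y where xy: "e = (x, y)" by (cases e)
      from e[unfolded xy memE1] obtain v w where "(v, w) \<in> E" "e = (m v, m w)" unfolding xy by blast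
      then show "e \<in> vertices ?P1 \<times> vertices ?P1" using m edge_V by blast
    qed
    show "acyclic E1"
    \<comment> \<open>\<open>C\<close> takes the rank of the lower vertex \<open>B\<close>: edges
      out of \<open>C\<close> started at \<open>B\<close>, and edges into \<open>C\<close> ended at
      \<open>A\<close>, whose rank is smaller.\<close>
    proof (rule acyclic_rank[where r = "\<lambda>v. if v = Some C then rk (Some B) else rk v"])
      fix v w assume "(v, w) \<in> E1"
      then obtain v' w' where e: "(v', w') \<in> E" "v' \<noteq> Some A" "w' \<noteq> Some B" "v = m v'" "w = m w'" unfolding memE1 by blast
      have "(if v = Some C then rk (Some B) else rk v) = rk v'"
        using e(2,4) edgeV[OF e(1)] by (auto simp: m_def)
      moreover have "rk w' \<le> (if w = Some C then rk (Some B) else rk w)"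
        using e(3,5) edgeV[OF e(1)] rk_less[OF eAB] by (auto simp: m_def)
      ultimately show "(if v = Some C then rk (Some B) else rk v) < (if w = Some C then rk (Some B) else rk w)"
        using rk_less[OF e(1)] by linarith
    qed
    show "(v, None) \<notin> E1" for v unfolding memE1 using edgeV by (auto simp: m_def split: if_splits)
    fix D assume D: "D \<in> ?P1"
    define D0 where "D0 = (if D = C then A else D)"
    have D0: "D0 \<in> P" "D0 \<noteq> B" using D A ABne by (auto simp: D0_def)
    have w: "w \<noteq> Some B \<and> m w = Some D \<longleftrightarrow> w = Some D0" if "(v, w) \<in> E" for v w
      using edgeV[OF that] D ABne by (auto simp: m_def D0_def split: if_splits)
    have notA: "v \<noteq> Some A" if "(v, Some D0) \<in> E" for v using fromA[of "Some D0"] that D0(2) by auto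
    have "(v, Some D) \<in> E1 \<longleftrightarrow> (\<exists>v'. (v', Some D0) \<in> E \<and> v = m v')" for v
      unfolding memE1 using w notA by metis
    with parent_ex1[OF D0(1)] show "\<exists>!v. (v, Some D) \<in> E1" by auto
  qed
  then have r1: "rct I ?P1 E1" using fin by unfold_locales
  have "tree_split I ?P1 P E1 E ?Q A B"
    by (intro tree_split.intro tree_split_axioms.intro r1 rct_axioms)
      (use A B Cnot ABne disj chA chB chQ in \<open>auto simp: C_def[symmetric]\<close>)
  then show ?thesis by blast
qed

section \<open>Uniqueness of the tree and the three special cases\<close>

section \<open>Characterization of the special cases\<close>

context rct begin

text \<open>If \<open>w\<close> lies strictly below \<open>v\<close>, the path to it must continue
  through the only child of \<open>v\<close>.\<close>

lemma chain_comparable: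
  assumes chain: "\<And>v. v \<in> V \<Longrightarrow> card (ch v) \<le> 1" and "v \<in> V" and w: "w \<in> V"
  shows "(v, w) \<in> E\<^sup>* \<or> (w, v) \<in> E\<^sup>*"
  using assms(2)
proof (induction v rule: tree_induct_down)
  case root
  then show ?case using root_reach[OF w] by blast
next
  case (child v B)
  have e: "(v, Some B) \<in> E" using child.hyps(2) by (simp add: ch_edge)
  from child.IH show ?case
  proof
    assume "(v, w) \<in> E\<^sup>*"
    then show ?thesis
    proof (cases rule: converse_rtranclE)
      case base
      then show ?thesis using e by blast
    next
      case (step z)
      then obtain D where D: "z = Some D" "D \<in> ch v" using no_root_parent by (cases z) (auto simp: ch_edge)
      have "D = B" using card_le_Suc0_iff_eq[OF finite_ch, of v] chain[OF child.hyps(1)] D(2) child.hyps(2) by auto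
      then show ?thesis using step(2) D(1) by simp
    qed
  next
    assume "(w, v) \<in> E\<^sup>*"
    then show ?thesis using e by (meson rtrancl_into_rtrancl)
  qed
qed

text \<open>Edges are the covering pairs of reachability, so a tree is determined by which of its
  vertices reach which. This yields uniqueness when the relation is a linear order.\<close>

lemma edge_iff:
  "(v, w) \<in> E \<longleftrightarrow> v \<in> V \<and> w \<in> V \<and> v \<noteq> w \<and> (v, w) \<in> E\<^sup>* \<and>
     (\<forall>z\<in>V. (v, z) \<in> E\<^sup>* \<longrightarrow> (z, w) \<in> E\<^sup>* \<longrightarrow> z = v \<or> z = w)"
proof
  assume e: "(v, w) \<in> E"
  have "z = v \<or> z = w" if z: "(v, z) \<in> E\<^sup>*" "(z, w) \<in> E\<^sup>*" for z
  proof (cases "z = w")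
    case False
    with z(2) have "(z, w) \<in> E\<^sup>+" by (simp add: rtrancl_eq_or_trancl)
    then obtain y where y: "(z, y) \<in> E\<^sup>*" "(y, w) \<in> E" by (blast dest: tranclD2)
    then have "y = v" using e parent_unique by blast
    then show ?thesis using y(1) z(1) antisym_reach by blast
  qed simp
  moreover have "v \<noteq> w" using e no_loop by blast
  ultimately show "v \<in> V \<and> w \<in> V \<and> v \<noteq> w \<and> (v, w) \<in> E\<^sup>* \<and>
     (\<forall>z\<in>V. (v, z) \<in> E\<^sup>* \<longrightarrow> (z, w) \<in> E\<^sup>* \<longrightarrow> z = v \<or> z = w)"
    using e edge_V[OF e] by blast
next
  assume a: "v \<in> V \<and> w \<in> V \<and> v \<noteq> w \<and> (v, w) \<in> E\<^sup>* \<and>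
     (\<forall>z\<in>V. (v, z) \<in> E\<^sup>* \<longrightarrow> (z, w) \<in> E\<^sup>* \<longrightarrow> z = v \<or> z = w)"
  then have "v \<noteq> w" "(v, w) \<in> E\<^sup>*" by blast+
  then have "(v, w) \<in> E\<^sup>+" by (simp add: rtrancl_eq_or_trancl)
  then obtain y where y: "(v, y) \<in> E\<^sup>*" "(y, w) \<in> E" by (blast dest: tranclD2)
  have "y = v \<or> y = w" using a y edge_V[OF y(2)] by blast
  then show "(v, w) \<in> E" using y(2) no_loop by blast
qed

lemma not_reach_root: "(v, None) \<in> E\<^sup>* \<Longrightarrow> v = None"
  by (erule rtranclE) auto

lemma sole_child:
  assumes "card (ch v) \<le> 1" "B \<in> ch v"
  shows "ch v = {B}"
  using assms finite_ch by (metis One_nat_def card_le_Suc0_iff_eq insertI1 is_singletonI' is_singleton_def singletonD empty_iff)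

end

context smeu begin

lemma linear_in_sym: "linear_in v x B C \<alpha> \<beta> \<Longrightarrow> linear_in v x C B \<beta> \<alpha>"
  unfolding linear_in_def by (simp add: add.commute)

lemma siblings_linear':
  assumes "v \<in> V" "B \<in> ch v" "C \<in> ch v" "B \<noteq> C" "b \<in> B" "c \<in> C"
    and rel: "dim_rel I X R b c \<or> dim_rel I X R c b" and x: "x \<in> W"
  obtains \<alpha> \<beta> where "\<alpha> > 0" "linear_in v x B C \<alpha> \<beta>"
  using rel
proof
  assume "dim_rel I X R b c"
  from siblings_linear[OF assms(1-6) this x] show ?thesis using that by metis
next
  assume "dim_rel I X R c b"
  from siblings_linear[OF assms(1,3,2) assms(4)[symmetric] assms(6,5) this x] show ?thesis
    using that linear_in_sym by metis
qed

text \<open>A child \<open>D\<close> of \<open>B\<close> would force the aggregator of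
  \<open>B\<close> to be affine, so a dimension of \<open>D\<close> would be related to
  \<open>b\<close> in both directions, against antisymmetry.\<close>

lemma sibling_is_leaf:
  assumes v: "v \<in> V" and B: "B \<in> ch v" and C: "C \<in> ch v" and BC: "B \<noteq> C" and b: "b \<in> B" and c: "c \<in> C"
    and bc: "dim_rel I X R b c \<or> dim_rel I X R c b" and card: "card (ch (Some B)) \<le> 1"
    and total: "\<And>d. d \<in> sub (Some B) \<Longrightarrow> dim_rel I X R c d \<or> dim_rel I X R d c"
    and antisym: "\<And>d. d \<in> I \<Longrightarrow> dim_rel I X R b d \<Longrightarrow> dim_rel I X R d b \<Longrightarrow> d = b"
  shows "ch (Some B) = {}"
proof (rule ccontr)
  assume "ch (Some B) \<noteq> {}"
  then obtain D where DB: "D \<in> ch (Some B)" by blast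
  then have D: "ch (Some B) = {D}" by (rule sole_child[OF card])
  obtain d where d: "d \<in> D" using cluster_ne[OF ch_V(2)[OF DB]] by blast
  have dD: "d \<in> sub (Some D)" using d own_sub[of "Some D"] by auto
  then have dB: "d \<in> sub (Some B)" using child_sub[OF DB] by blast
  have "affine_node (Some B) x" if x: "x \<in> W" for x
  proof -
    obtain \<alpha> \<beta> where ab: "\<alpha> > 0" "linear_in v x B C \<alpha> \<beta>"
      using siblings_linear'[OF v B C BC b c bc x] by metis
    show ?thesis by (rule sibling_forces_affine[OF v B C BC ab D d c total[OF dB] x])
  qed
  then have "dim_rel I X R d b" by (rule dim_rel_of_affine_child[OF ch_V(2)[OF B] b D d])
  moreover have "dim_rel I X R b d" by (rule dim_rel_descendant[OF ch_V(2)[OF B] b dB])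
  ultimately have "d = b" using antisym in_I[OF child_V[OF B] dB] by blast
  then show False using own_child_disjoint[OF DB] b dD by auto
qed

lemma affine_if_all_related:
  assumes rel: "\<And>i j. i \<in> I \<Longrightarrow> j \<in> I \<Longrightarrow> dim_rel I X R i j" and A: "A \<in> P" and x: "x \<in> W"
  shows "affine_node (Some A) x"
proof (cases "ch (Some A) = {}")
  case True
  \<comment> \<open>Without children the box has a single point, at which the affine identity is
    trivial.\<close>
  then show ?thesis unfolding affine_node_def by (auto simp: algebra_simps)
next
  case False
  then obtain B where B: "B \<in> ch (Some A)" by blast
  obtain i j where ij: "i \<in> A" "j \<in> B" using cluster_ne[OF A] cluster_ne[OF ch_V(2)[OF B]] by blast
  have "j \<in> sub (Some B)" using ij own_sub[of "Some B"] by auto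
  moreover have "dim_rel I X R j i"
    by (rule rel) (use ij cluster_sub[OF A] cluster_sub[OF ch_V(2)[OF B]] in auto)
  ultimately show ?thesis using affine_if_dim_rel[OF A ij(1) B] x by blast
qed

end

text \<open>Only the preference is fixed here. Trees and their functions vary, and each representing
  tree is entered by a local interpretation of \<open>smeu\<close>.\<close>

locale preference =
  fixes I :: "nat set" and lo hi :: "nat \<Rightarrow> real" and X :: "nat \<Rightarrow> real set" and R :: "outcome pmf \<Rightarrow> outcome pmf \<Rightarrow> bool"
  assumes finI: "finite I" and I_ne: "I \<noteq> {}" and lohi: "\<And>i. i \<in> I \<Longrightarrow> lo i < hi i"
    and X_eq: "\<And>i. i \<in> I \<Longrightarrow> X i = {lo i..hi i}" and smeu: "has_smeu I X R"
begin

abbreviation rel where "rel \<equiv> dim_rel I X R"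

lemma smeuI:
  assumes "smeu_representation I X R (P, E) uo u"
  shows "smeu I P E uo u lo hi X R"
proof
  show "is_rct I (P, E)" using assms by (simp add: smeu_representation_def)
qed (use finI lohi X_eq assms in auto)

lemma rctsE:
  assumes "(P, E) \<in> smeu_rcts I X R"
  obtains uo u where "smeu I P E uo u lo hi X R"
proof -
  obtain uo u where "smeu_representation I X R (P, E) uo u" using assms by (auto simp: smeu_rcts_def)
  then show thesis using that smeuI by blast
qed

lemma ex_rct: obtains P E where "(P, E) \<in> smeu_rcts I X R"
  using smeu by (auto simp: has_smeu_def smeu_rcts_def)

text \<open>All dimensions being related, any two clusters can be merged. Each merger lowers their
  number by one, until a single cluster remains.\<close>

lemma fate_from_star:
  assumes all: "\<And>i j. i \<in> I \<Longrightarrow> j \<in> I \<Longrightarrow> rel i j"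
    and "partition_on I Q" "smeu_representation I X R (Q, star Q) uo u"
  shows "has_fate I X R"
  using assms(2,3)
proof (induction "card Q" arbitrary: Q uo u rule: less_induct)
  case less
  interpret smeu I Q "star Q" uo u lo hi X R by (rule smeuI[OF less.prems(2)])
  have "Q \<noteq> {}" using less.prems(1) I_ne by (auto simp: partition_on_def)
  then obtain B where B: "B \<in> Q" by blast
  show ?case
  proof (cases "Q = {B}")
    case True
    then have "B = I" using less.prems(1) by (auto simp: partition_on_def)
    then have "(Q, star Q) \<in> smeu_rcts I X R" "children (star Q) None = {I}"
      using True less.prems by (auto simp: smeu_rcts_def children_def)
    then show ?thesis unfolding has_fate_def by blast
  next
    case False
    then obtain C where C: "C \<in> Q" "B \<noteq> C" using B by blast
    obtain b c where bc: "b \<in> B" "c \<in> C" using cluster_ne B C by blast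
    have "rel b c" by (rule all) (use bc cluster_sub B C in auto)
    from merge_star[OF refl B C bc this] obtain uo' u' where
      m: "partition_on I (insert (B \<union> C) (Q - {B, C}))"
        "smeu_representation I X R (insert (B \<union> C) (Q - {B, C}), star (insert (B \<union> C) (Q - {B, C}))) uo' u'"
      by blast
    have "card (Q - {B, C}) = card Q - 2" using B C finP by (subst card_Diff_subset) auto
    moreover have "card Q \<ge> 2" using card_mono[OF finP, of "{B, C}"] B C by auto
    moreover have "card (insert (B \<union> C) (Q - {B, C})) \<le> Suc (card (Q - {B, C}))" using finP by (simp add: card_insert_if)
    ultimately have "card (insert (B \<union> C) (Q - {B, C})) < card Q" by linarith
    from less.hyps[OF this m] show ?thesis .
  qed
qed

lemma fate_iff: "has_fate I X R \<longleftrightarrow> (\<forall>i\<in>I. \<forall>j\<in>I. rel i j)"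
proof
  assume "has_fate I X R"
  then obtain P E where T: "(P, E) \<in> smeu_rcts I X R" and ch: "children E None = {I}"
    unfolding has_fate_def by (elim exE conjE)
  from rctsE[OF T] obtain uo u where "smeu I P E uo u lo hi X R" .
  then interpret smeu I P E uo u lo hi X R .
  have "I \<in> P" using ch_V(2)[of I None] ch by simp
  then show "\<forall>i\<in>I. \<forall>j\<in>I. rel i j" using dim_rel_descendant own_sub[of "Some I"] by auto
next
  assume all: "\<forall>i\<in>I. \<forall>j\<in>I. rel i j"
  obtain P E where T: "(P, E) \<in> smeu_rcts I X R" by (rule ex_rct)
  from rctsE[OF T] obtain uo u where "smeu I P E uo u lo hi X R" .
  then interpret smeu I P E uo u lo hi X R .
  have "\<exists>Q uo' u'. partition_on I Q \<and> smeu_representation I X R (Q, star Q) uo' u'"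
    by (rule flatten) (rule affine_if_all_related, use all in blast)
  then show "has_fate I X R" using fate_from_star all by blast
qed

lemma singletons:
  assumes "partition_on I P" "\<And>A i j. A \<in> P \<Longrightarrow> i \<in> A \<Longrightarrow> j \<in> A \<Longrightarrow> i = j"
  shows "P = (\<lambda>i. {i}) ` I"
proof
  show "P \<subseteq> (\<lambda>i. {i}) ` I"
  proof
    fix A assume A: "A \<in> P"
    then have "A \<noteq> {}" using assms(1) by (auto simp: partition_on_def)
    then obtain i where i: "i \<in> A" by blast
    then have "A = {i}" using assms(2)[OF A] by blast
    moreover have "i \<in> I" using assms(1) A i by (auto simp: partition_on_def)
    ultimately show "A \<in> (\<lambda>i. {i}) ` I" by blast
  qed
  show "(\<lambda>i. {i}) ` I \<subseteq> P"
  proof clarify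
    fix i assume "i \<in> I"
    then have "i \<in> \<Union> P" using assms(1) by (simp add: partition_on_def)
    then obtain A where A: "A \<in> P" "i \<in> A" by blast
    then have "A = {i}" using assms(2)[OF A(1)] by blast
    with A show "{i} \<in> P" by simp
  qed
qed

lemma feta_iff: "has_feta I X R \<longleftrightarrow> (\<forall>i\<in>I. \<forall>j\<in>I. rel i j \<longleftrightarrow> i = j)"
proof
  assume "has_feta I X R"
  then obtain P E where T: "smeu_rcts I X R = {(P, E)}" and ch: "children E None = (\<lambda>i. {i}) ` I"
    unfolding has_feta_def by (elim exE conjE)
  have "(P, E) \<in> smeu_rcts I X R" unfolding T by simp
  from rctsE[OF this] obtain uo u where "smeu I P E uo u lo hi X R" .
  then interpret smeu I P E uo u lo hi X R .
  have chE: "(None, Some A) \<in> E \<longleftrightarrow> A \<in> (\<lambda>i. {i}) ` I" for A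
    unfolding ch[symmetric] by (simp only: children_def mem_Collect_eq)
  have sing: "{i} \<in> P" if "i \<in> I" for i
  proof -
    have "(None, Some {i}) \<in> E" unfolding chE using that by (rule imageI)
    then have "Some {i} \<in> V" by (rule edge_V(2))
    then show ?thesis by simp
  qed
  have P: "P = (\<lambda>i. {i}) ` I"
  proof (rule singletons[OF part])
    fix A i j assume a: "A \<in> P" "i \<in> A" "j \<in> A"
    have "A = {i}" using cluster_unique[OF a(1) sing a(2)] a cluster_sub by blast
    then show "i = j" using a(3) by simp
  qed
  have E: "E = star P"
  proof
    show "star P \<subseteq> E"
    proof clarify
      fix A assume "A \<in> P"
      then show "(None, Some A) \<in> E" unfolding chE P .
    qed
    show "E \<subseteq> star P"
    proof
      fix e assume e: "e \<in> E"
      obtain v w where vw: "e = (v, w)" by (cases e)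
      then have vwE: "(v, w) \<in> E" using e by simp
      obtain A where A: "w = Some A" "A \<in> P"
        using vwE no_root_parent edge_V(2)[OF vwE] by (cases w) auto
      have "(None, Some A) \<in> E" using A(2) unfolding chE P .
      moreover have "(v, Some A) \<in> E" using e vw A(1) by simp
      ultimately have "v = None" using parent_unique by blast
      then show "e \<in> star P" using vw A by simp
    qed
  qed
  show "\<forall>i\<in>I. \<forall>j\<in>I. rel i j \<longleftrightarrow> i = j"
  proof (intro ballI iffI)
    fix i j assume ij: "i \<in> I" "j \<in> I" "i = j"
    show "rel i j" using dim_rel_descendant[OF sing[OF ij(1)], of i j] own_sub[of "Some {i}"] ij(3) by auto
  next
    fix i j assume ij: "i \<in> I" "j \<in> I" "rel i j"
    show "i = j"
    proof (rule ccontr)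
      assume ne: "i \<noteq> j"
      then have ne': "{i} \<noteq> {j}" by simp
      define Q where "Q = insert ({i} \<union> {j}) (P - {{i}, {j}})"
      obtain uo' u' where "smeu_representation I X R (Q, star Q) uo' u'"
        using merge_star[OF E sing[OF ij(1)] sing[OF ij(2)] ne' singletonI singletonI ij(3)] unfolding Q_def by blast
      then have "(Q, star Q) \<in> smeu_rcts I X R" unfolding smeu_rcts_def by blast
      then have "Q = P" unfolding T by simp
      then have "{i} \<union> {j} \<in> P" unfolding Q_def by (metis insertI1)
      then obtain k where "{i} \<union> {j} = {k}" unfolding P by blast
      then have "i = k" "j = k" by blast+
      then show False using ne by simp
    qed
  qed
next
  assume rel: "\<forall>i\<in>I. \<forall>j\<in>I. rel i j \<longleftrightarrow> i = j"
  let ?P = "(\<lambda>i. {i}) ` I"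
  have eq: "P = ?P \<and> E = star ?P" if T: "(P, E) \<in> smeu_rcts I X R" for P E
  proof -
    from rctsE[OF T] obtain uo u where "smeu I P E uo u lo hi X R" .
    then interpret smeu I P E uo u lo hi X R .
    have P: "P = ?P"
    proof (rule singletons[OF part])
      fix A i j assume a: "A \<in> P" "i \<in> A" "j \<in> A"
      have "rel i j" by (rule dim_rel_descendant[OF a(1,2)]) (use a(3) own_sub[of "Some A"] in auto)
      then show "i = j" using rel a cluster_sub by blast
    qed
    \<comment> \<open>A cluster with a child would relate two distinct dimensions, so every edge
      starts at the root.\<close>
    have root: "v = None" if e: "(v, w) \<in> E" for v w
    proof (cases v)
      case (Some A)
      obtain D where D: "w = Some D" using e no_root_parent by (cases w) auto
      have DA: "D \<in> ch (Some A)" using e Some D by (simp add: ch_edge)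
      have AP: "A \<in> P" using edge_V(1)[OF e] Some by simp
      obtain i j where ij: "i \<in> A" "j \<in> D" using cluster_ne AP ch_V(2)[OF DA] by blast
      have jD: "j \<in> sub (Some D)" using ij own_sub[of "Some D"] by auto
      have "rel i j" by (rule dim_rel_descendant[OF AP ij(1)]) (use jD child_sub[OF DA] in blast)
      then have "i = j" using rel cluster_sub[OF AP] cluster_sub[OF ch_V(2)[OF DA]] ij by blast
      then show ?thesis using own_child_disjoint[OF DA] ij jD by auto
    qed
    have "E = star P"
    proof
      show "E \<subseteq> star P"
      proof
        fix e assume e: "e \<in> E"
        obtain v w where vw: "e = (v, w)" by (cases e)
        then have vwE: "(v, w) \<in> E" using e by simp
        obtain A where A: "w = Some A" "A \<in> P"
          using vwE no_root_parent edge_V(2)[OF vwE] by (cases w) auto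
        have "v = None" by (rule root) (use e vw in simp)
        then show "e \<in> star P" using A vw by simp
      qed
      show "star P \<subseteq> E"
      proof clarify
        fix A assume "A \<in> P"
        then obtain v where v: "(v, Some A) \<in> E" using parent_ex1 by blast
        then show "(None, Some A) \<in> E" using root by blast
      qed
    qed
    then have "E = star ?P" unfolding P .
    with P show ?thesis by (rule conjI)
  qed
  obtain P E where T: "(P, E) \<in> smeu_rcts I X R" by (rule ex_rct)
  have "smeu_rcts I X R = {(?P, star ?P)}"
  proof
    show "smeu_rcts I X R \<subseteq> {(?P, star ?P)}"
    proof
      fix T' assume T': "T' \<in> smeu_rcts I X R"
      obtain P1 E1 where p: "T' = (P1, E1)" by (cases T')
      then have "(P1, E1) \<in> smeu_rcts I X R" using T' by simp
      from eq[OF this] have "P1 = ?P" "E1 = star ?P" by (blast, blast)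
      then show "T' \<in> {(?P, star ?P)}" using p by simp
    qed
    have "P = ?P" "E = star ?P" using eq[OF T] by (blast, blast)
    then show "{(?P, star ?P)} \<subseteq> smeu_rcts I X R" using T by simp
  qed
  moreover have "children (star ?P) None = ?P" by (auto simp: children_def)
  ultimately show "has_feta I X R" unfolding has_feta_def by blast
qed

lemma recursive_iff: "has_recursive I X R \<longleftrightarrow> linear_order_on I {(i, j). i \<in> I \<and> j \<in> I \<and> rel i j}"
proof
  assume "has_recursive I X R"
  then obtain P E where T: "smeu_rcts I X R = {(P, E)}" and all_card: "\<forall>v\<in>vertices P. card (children E v) \<le> 1"
    unfolding has_recursive_def by (elim exE conjE)
  note card = bspec[OF all_card]
  have "(P, E) \<in> smeu_rcts I X R" unfolding T by simp
  from rctsE[OF this] obtain uo u where S: "smeu I P E uo u lo hi X R" .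
  then interpret smeu I P E uo u lo hi X R .
  \<comment> \<open>Splitting \<open>{i}\<close> off a larger cluster would give a second
    representing tree.\<close>
  have P: "P = (\<lambda>i. {i}) ` I"
  proof (rule singletons[OF part], rule ccontr)
    fix A i j assume a: "A \<in> P" "i \<in> A" "j \<in> A" "i \<noteq> j"
    have un: "{i} \<union> (A - {i}) = A" using a(2) by blast
    have neA: "A - {i} \<noteq> {}" using a(3,4) by blast
    obtain P2 E2 where sp: "tree_split I P P2 E E2 (P - {{i} \<union> (A - {i})}) {i} (A - {i})"
      using split_exists[of "{i}" "A - {i}"] a(1) neA un by auto
    have "(P2, E2) \<in> smeu_rcts I X R" using split_representation[OF sp S] by (auto simp: smeu_rcts_def)
    then have "P2 = P" using T by simp
    then have "{i} \<in> P" using tree_split.P2[OF sp] by blast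
    then have "A = {i}" using cluster_unique[OF a(1) _ a(2)] by blast
    then show False using a(3,4) by simp
  qed
  have sing: "{i} \<in> P" if "i \<in> I" for i using P that by blast
  have rel_if: "rel i j" if ij: "i \<in> I" "j \<in> I" "(Some {i}, Some {j}) \<in> E\<^sup>*" for i j
    by (rule dim_rel_descendant[OF sing[OF ij(1)]]) (use mem_sub[OF sing[OF ij(2)], of j "Some {i}"] ij(3) sing[OF ij(1)] in auto)
  \<comment> \<open>Otherwise \<open>{j}\<close> lies strictly above \<open>{i}\<close> in the
    chain. The relation then makes the aggregator of \<open>{j}\<close> affine, so
    \<open>{j}\<close> can be merged with its sole child: again a second tree.\<close>
  have only_if: "(Some {i}, Some {j}) \<in> E\<^sup>*" if ij: "i \<in> I" "j \<in> I" "rel i j" for i j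
  proof (rule ccontr)
    assume n: "(Some {i}, Some {j}) \<notin> E\<^sup>*"
    have V: "Some {i} \<in> V" "Some {j} \<in> V" using sing ij by auto
    have below: "(Some {j}, Some {i}) \<in> E\<^sup>*" using chain_comparable[OF card V] n by blast
    have ne: "i \<noteq> j" using n by auto
    have "i \<in> sub (Some {j})" using mem_sub[OF sing[OF ij(1)], of i "Some {j}"] below V by simp
    then obtain B where B: "B \<in> ch (Some {j})" "i \<in> sub (Some B)"
      by (cases rule: sub_cases) (use ne in auto)
    have chj: "ch (Some {j}) = {B}" by (rule sole_child[OF card[OF V(2)] B(1)])
    obtain P1 E1 where sp: "tree_split I P1 P E1 E (P - {{j}, B}) {j} B"
      using merge_exists[OF sing[OF ij(2)] chj] by blast
    have aff: "affine_node (Some {j}) x" if "x \<in> outcomes X I" for x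
      by (rule affine_if_dim_rel[OF sing[OF ij(2)] _ B ij(3)]) (use that in \<open>simp_all add: W_def\<close>)
    have "(P1, E1) \<in> smeu_rcts I X R" using merge_representation[OF sp S aff] by (auto simp: smeu_rcts_def)
    then have "P1 = P" using T by simp
    then have "{j} \<in> P1" using sing[OF ij(2)] by simp
    then show False using tree_split.P1[OF sp] tree_split.ne2(1)[OF sp] by auto
  qed
  have iff: "rel i j \<longleftrightarrow> (Some {i}, Some {j}) \<in> E\<^sup>*" if "i \<in> I" "j \<in> I" for i j
    using that rel_if only_if by blast
  show "linear_order_on I {(i, j). i \<in> I \<and> j \<in> I \<and> rel i j}"
    unfolding order_on_defs
  proof (intro conjI)
    show "refl_on I {(i, j). i \<in> I \<and> j \<in> I \<and> rel i j}" using iff by (auto simp: refl_on_def)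
    show "trans {(i, j). i \<in> I \<and> j \<in> I \<and> rel i j}"
    proof (rule transI)
      fix i j k assume "(i, j) \<in> {(i, j). i \<in> I \<and> j \<in> I \<and> rel i j}" "(j, k) \<in> {(i, j). i \<in> I \<and> j \<in> I \<and> rel i j}"
      then show "(i, k) \<in> {(i, j). i \<in> I \<and> j \<in> I \<and> rel i j}" using iff by (auto intro: rtrancl_trans)
    qed
    show "antisym {(i, j). i \<in> I \<and> j \<in> I \<and> rel i j}"
    proof (rule antisymI)
      fix i j assume "(i, j) \<in> {(i, j). i \<in> I \<and> j \<in> I \<and> rel i j}" "(j, i) \<in> {(i, j). i \<in> I \<and> j \<in> I \<and> rel i j}"
      then have "(Some {i}, Some {j}) \<in> E\<^sup>*" "(Some {j}, Some {i}) \<in> E\<^sup>*" using iff by auto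
      then show "i = j" using antisym_reach by blast
    qed
    show "total_on I {(i, j). i \<in> I \<and> j \<in> I \<and> rel i j}"
    proof (rule total_onI)
      fix i j assume ij: "i \<in> I" "j \<in> I" "i \<noteq> j"
      then have "(Some {i}, Some {j}) \<in> E\<^sup>* \<or> (Some {j}, Some {i}) \<in> E\<^sup>*"
        using chain_comparable[OF card] sing by auto
      then show "(i, j) \<in> {(i, j). i \<in> I \<and> j \<in> I \<and> rel i j} \<or> (j, i) \<in> {(i, j). i \<in> I \<and> j \<in> I \<and> rel i j}"
        using iff ij by auto
    qed
  qed auto
next
  assume lin: "linear_order_on I {(i, j). i \<in> I \<and> j \<in> I \<and> rel i j}"
  have asym: "i = j" if "i \<in> I" "j \<in> I" "rel i j" "rel j i" for i j
    using lin that unfolding order_on_defs antisym_def by blast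
  have total: "rel i j \<or> rel j i" if "i \<in> I" "j \<in> I" "i \<noteq> j" for i j
    using lin that unfolding order_on_defs total_on_def by blast
  let ?P = "(\<lambda>i. {i}) ` I"
  define V' where "V' = vertices ?P"
  \<comment> \<open>Reachability as it must look in every representing tree: the root comes first,
    then the order given by the relation. Its covering pairs \<open>E'\<close> involve the relation
    only, so all representing trees coincide.\<close>
  define reach where "reach v w \<longleftrightarrow> v = None \<or> (\<exists>i\<in>I. \<exists>j\<in>I. v = Some {i} \<and> w = Some {j} \<and> rel i j)" for v w :: vertex
  define E' where "E' = {(v, w). v \<in> V' \<and> w \<in> V' \<and> v \<noteq> w \<and> reach v w \<and> (\<forall>z\<in>V'. reach v z \<longrightarrow> reach z w \<longrightarrow> z = v \<or> z = w)}"
  have main: "P = ?P \<and> E = E' \<and> (\<forall>v\<in>vertices P. card (children E v) \<le> 1)" if T: "(P, E) \<in> smeu_rcts I X R" for P E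
  proof -
    from rctsE[OF T] obtain uo u where "smeu I P E uo u lo hi X R" .
    then interpret smeu I P E uo u lo hi X R .
    have P: "P = ?P"
    proof (rule singletons[OF part])
      fix A i j assume a: "A \<in> P" "i \<in> A" "j \<in> A"
      have "rel i j" "rel j i"
        by (rule dim_rel_descendant[OF a(1)]; use a own_sub[of "Some A"] in auto)+
      then show "i = j" using asym a cluster_sub by blast
    qed
    have sing: "{i} \<in> P" if "i \<in> I" for i using P that by blast
    have chain: "card (ch v) \<le> 1" if v: "v \<in> V" for v
    proof (rule ccontr)
      assume "\<not> card (ch v) \<le> 1"
      \<comment> \<open>Choose a vertex with several children none of whose children has several;
        \<open>sibling_is_leaf\<close> then applies to any two of its children.\<close>
      then have bad: "v \<in> {v \<in> V. \<not> card (ch v) \<le> 1}" using v by simp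
      from wf_converse bad obtain y where y: "y \<in> {v \<in> V. \<not> card (ch v) \<le> 1}"
        and min: "\<And>z. (z, y) \<in> E\<inverse> \<Longrightarrow> z \<notin> {v \<in> V. \<not> card (ch v) \<le> 1}"
        by (rule wfE_min) blast
      have yV: "y \<in> V" using y by simp
      have child_card: "card (ch (Some B)) \<le> 1" if "B \<in> ch y" for B
        using min[of "Some B"] that child_V[OF that] by (simp add: ch_edge)
      have "\<exists>B\<in>ch y. \<exists>C\<in>ch y. B \<noteq> C" using y card_le_Suc0_iff_eq[OF finite_ch, of y] by auto
      then obtain B C where BC: "B \<in> ch y" "C \<in> ch y" "B \<noteq> C" by blast
      obtain b c where bc: "b \<in> B" "c \<in> C" using cluster_ne ch_V(2) BC by blast
      have bcI: "b \<in> I" "c \<in> I" using bc cluster_sub ch_V(2) BC by blast+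
      have bc_sub: "b \<in> sub (Some B)" "c \<in> sub (Some C)" using bc own_sub[of "Some B"] own_sub[of "Some C"] by auto
      have disj: "sub (Some B) \<inter> sub (Some C) = {}" by (rule child_child_disjoint[OF BC])
      have ne: "b \<noteq> c" using disj bc_sub by blast
      have tot: "rel b c \<or> rel c b" by (rule total[OF bcI ne])
      have leafB: "ch (Some B) = {}"
      proof (rule sibling_is_leaf[OF yV BC bc tot child_card[OF BC(1)]])
        fix d assume d: "d \<in> sub (Some B)"
        have "d \<in> I" by (rule in_I[OF child_V[OF BC(1)] d])
        moreover have "c \<noteq> d" using d disj bc_sub by blast
        ultimately show "rel c d \<or> rel d c" by (intro total bcI)
      next
        fix d assume "d \<in> I" "rel b d" "rel d b" then show "d = b" using asym bcI by blast
      qed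
      have leafC: "ch (Some C) = {}"
      proof (rule sibling_is_leaf[OF yV BC(2,1) BC(3)[symmetric] bc(2,1) _ child_card[OF BC(2)]])
        show "rel c b \<or> rel b c" using tot by blast
        fix d assume d: "d \<in> sub (Some C)"
        have "d \<in> I" by (rule in_I[OF child_V[OF BC(2)] d])
        moreover have "b \<noteq> d" using d disj bc_sub by blast
        ultimately show "rel b d \<or> rel d b" by (intro total bcI)
      next
        fix d assume "d \<in> I" "rel c d" "rel d c" then show "d = c" using asym bcI by blast
      qed
      from tot have "rel b c \<and> rel c b"
        using leaf_siblings_sym[OF yV BC leafB leafC bc]
          leaf_siblings_sym[OF yV BC(2,1) BC(3)[symmetric] leafC leafB bc(2,1)] by blast
      then show False using asym bcI ne by blast
    qed
    have rel_if: "rel i j" if ij: "i \<in> I" "j \<in> I" "(Some {i}, Some {j}) \<in> E\<^sup>*" for i j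
      by (rule dim_rel_descendant[OF sing[OF ij(1)]]) (use mem_sub[OF sing[OF ij(2)], of j "Some {i}"] ij(3) sing[OF ij(1)] in auto)
    have only_if: "(Some {i}, Some {j}) \<in> E\<^sup>*" if ij: "i \<in> I" "j \<in> I" "rel i j" for i j
    proof -
      have V: "Some {i} \<in> V" "Some {j} \<in> V" using sing ij by auto
      show ?thesis using chain_comparable[OF chain V] rel_if[OF ij(2,1)] asym[OF ij] by blast
    qed
    have VV: "V = V'" using P by (simp add: V'_def)
    have reach: "(v, w) \<in> E\<^sup>* \<longleftrightarrow> reach v w" if v: "v \<in> V" and w: "w \<in> V" for v w
    proof (cases v)
      case None
      then show ?thesis using root_reach[OF w] by (simp add: reach_def)
    next
      case (Some A)
      then obtain i where i: "i \<in> I" "v = Some {i}" using v P by (auto simp: vertices_def)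
      show ?thesis
      proof (cases w)
        case None
        then show ?thesis using i not_reach_root[of v] by (auto simp: reach_def)
      next
        case (Some D)
        then obtain j where j: "j \<in> I" "w = Some {j}" using w P by (auto simp: vertices_def)
        have "(v, w) \<in> E\<^sup>* \<longleftrightarrow> rel i j" using rel_if only_if i j by blast
        also have "\<dots> \<longleftrightarrow> reach v w" using i j by (simp add: reach_def)
        finally show ?thesis .
      qed
    qed
    have "(v, w) \<in> E \<longleftrightarrow> (v, w) \<in> E'" for v w
    proof -
      have "(v, w) \<in> E \<longleftrightarrow> v \<in> V \<and> w \<in> V \<and> v \<noteq> w \<and> reach v w \<and> (\<forall>z\<in>V. reach v z \<longrightarrow> reach z w \<longrightarrow> z = v \<or> z = w)"
        unfolding edge_iff[of v w] using reach by blast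
      then show ?thesis by (simp add: E'_def VV)
    qed
    then have "E = E'" by auto
    with P chain show ?thesis by blast
  qed
  obtain P E where T: "(P, E) \<in> smeu_rcts I X R" by (rule ex_rct)
  note uniq = main[THEN conjunct1] main[THEN conjunct2, THEN conjunct1]
  have c: "\<forall>v\<in>vertices P. card (children E v) \<le> 1" by (rule main[OF T, THEN conjunct2, THEN conjunct2])
  have "T' = (P, E)" if T': "T' \<in> smeu_rcts I X R" for T'
  proof (cases T')
    case (Pair P1 E1)
    then have "(P1, E1) \<in> smeu_rcts I X R" using T' by simp
    from uniq[OF this] uniq[OF T] have "P1 = P" "E1 = E" by (simp_all only:)
    with Pair show ?thesis by simp
  qed
  then have s: "smeu_rcts I X R = {(P, E)}" using T by blast
  show "has_recursive I X R" unfolding has_recursive_def by (rule exI, rule exI, rule conjI, rule s, rule c)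
qed

end

theorem theorem3:
  fixes N :: nat and lo hi :: "nat \<Rightarrow> real" and I :: "nat set" and X :: "nat \<Rightarrow> real set"
    and R :: "outcome pmf \<Rightarrow> outcome pmf \<Rightarrow> bool"
  assumes "N > 1" and "I = {1..N}"
    and "\<And>i. i \<in> I \<Longrightarrow> lo i < hi i" and "\<And>i. i \<in> I \<Longrightarrow> X i = {lo i..hi i}"
    and "has_smeu I X R"
  shows "(has_fate I X R \<longleftrightarrow> (\<forall>i\<in>I. \<forall>j\<in>I. dim_rel I X R i j)) \<and>
    (has_feta I X R \<longleftrightarrow> (\<forall>i\<in>I. \<forall>j\<in>I. dim_rel I X R i j \<longleftrightarrow> i = j)) \<and>
    (has_recursive I X R \<longleftrightarrow> linear_order_on I {(i, j). i \<in> I \<and> j \<in> I \<and> dim_rel I X R i j})"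
proof -
  interpret preference I lo hi X R
    by unfold_locales (use assms in auto)
  show ?thesis using fate_iff feta_iff recursive_iff by blast
qed

end
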